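(* Let $\mathscr{C}$ be a pointed $\infty$-category with (finite) limits and colimits. The functor $$\Xi^{\mathrm{rel}}:\ \mathrm{Fun}((\Delta^1\vee\Delta^1)^{\mathrm{op}},\mathscr{C})\to\mathrm{Fun}(\Delta^1\times\Delta^1\times\Delta^1,\mathscr{C}),$$ defined in the context, takes values in the full $\infty$-subcategory of $\mathrm{Fun}(\Delta^1\times\Delta^1\times\Delta^1,\mathscr{C})$ spanned by the Mather cubes. Consequently, if $\mathscr{C}$ satisfies the (second) Mather cube axiom, then for every diagram $X\to B\leftarrow Y$ in $\mathscr{C}$ there is an equivalence in $\mathscr{C}$ $$F_{X,Y}\ \cong\ F_X\ast F_Y,$$ where $F_X$ and $F_Y$ are the fibers of the morphisms $X\to B$ and $Y\to B$, respectively, and $F_{X,Y}$ is the fiber of the canonical morphism $X\ast_BY\to B$.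
   Context: $\infty$-category means quasi-category; pointed means having a zero object $0$. $\mathrm{Fun}((\Delta^1\vee\Delta^1)^{\mathrm{op}},\mathscr{C})$ is the $\infty$-category of cospans $X\to B\leftarrow Y$. The relative join is $X\ast_BY=\mathrm{colim}\{X\leftarrow X\times_BY\to Y\}$, with canonical morphism $\mathrm{Gan}^{\mathrm{rel}}(X\to B\leftarrow Y)=(X\ast_BY\to B)$ obtained from the counit of the adjunction (pushout cospan functor) $\dashv$ (pullback span functor) between spans and cospans. $F\ast F'=\mathrm{colim}\{F\leftarrow F\times F'\to F'\}$. The fiber of $p:X\to B$ is $\lim\{0\to B\leftarrow X\}$. Definition of $\Xi^{\mathrm{rel}}$: a cospan $X\to B\leftarrow Y$ determines the pushout square $\mathcal{F}^{\mathrm{rel}}$ with vertices $X\times_BY$, $X$, $Y$, $X\ast_BY$; the morphism $X\ast_BY\to B$ corresponds, by the adjunction between colimits of squares and constant squares, to a morphism from this square to the constant square at $B$, i.e. to a cube $\mathrm{Gan}^{\mathrm{rel},\natural}(X\to B\leftarrow Y)$ whose four "horizontal" edges are $X\times_BY\to B$, $X\to B$, $Y\to B$, $X\ast_BY\to B$. $\Xi^{\mathrm{rel}}$ is obtained by replacing each of these horizontal edges $Z\to B$ by its fiber inclusion $\mathrm{fib}(Z\to B)\to Z$ (functorially); thus $\Xi^{\mathrm{rel}}(X\to B\leftarrow Y)$ is the cube with one face $F_X\times F_Y, F_X, F_Y, F_{X,Y}$, opposite face the pushout square $X\times_BY, X, Y, X\ast_BY$, and connecting edges the fiber inclusions. A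 cube is a Mather cube if, up to rotation, its bottom face is a pushout square and its four side faces are pullback squares. $\mathscr{C}$ satisfies the (second) Mather cube axiom if the top face (opposite to the bottom one) of every Mather cube in $\mathscr{C}$ is also a pushout square. *)

theory Defs
  imports Main "HOL-Library.FuncSet" "HOL-Library.Product_Order"
begin

section \<open>Simplicial sets\<close>

text \<open>
  A monotone map from \<open>[m] = {0..m}\<close> to \<open>[n]\<close> is represented by the list of its \<open>m + 1\<close> values, so
  that \<open>comp_op \<alpha> \<beta>\<close> is the composite \<open>\<alpha> \<circ> \<beta>\<close> and \<open>id_op n\<close> the identity of \<open>[n]\<close>.
  The operator \<open>act X n \<alpha>\<close> maps the \<open>n\<close>-simplices of \<open>X\<close> to its \<open>m\<close>-simplices.
\<close>

record 'a sset =
  simplices :: "nat \<Rightarrow> 'a set"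
  act :: "nat \<Rightarrow> nat list \<Rightarrow> 'a \<Rightarrow> 'a"

abbreviation comp_op :: "'p list \<Rightarrow> nat list \<Rightarrow> 'p list" where
  "comp_op \<alpha> \<beta> \<equiv> map ((!) \<alpha>) \<beta>"

abbreviation id_op :: "nat \<Rightarrow> nat list" where
  "id_op n \<equiv> [0..<Suc n]"

text \<open>The nerve of a subset of a partial order.\<close>

definition nerve :: "'p::order set \<Rightarrow> 'p list sset" where
  "nerve A = \<lparr> simplices = (\<lambda>n. {xs. length xs = Suc n \<and> sorted_wrt (\<le>) xs \<and> set xs \<subseteq> A}),
               act = (\<lambda>n \<alpha> xs. comp_op xs \<alpha>) \<rparr>"

abbreviation Delta :: "nat \<Rightarrow> nat list sset" where
  "Delta n \<equiv> nerve {..n}"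

definition simplicial_set :: "'a sset \<Rightarrow> bool" where
  "simplicial_set X \<longleftrightarrow>
     (\<forall>n m. \<forall>\<alpha>\<in>simplices (Delta n) m. \<forall>x\<in>simplices X n. act X n \<alpha> x \<in> simplices X m) \<and>
     (\<forall>n. \<forall>x\<in>simplices X n. act X n (id_op n) x = x) \<and>
     (\<forall>n m k. \<forall>\<alpha>\<in>simplices (Delta n) m. \<forall>\<beta>\<in>simplices (Delta m) k. \<forall>x\<in>simplices X n.
        act X m \<beta> (act X n \<alpha> x) = act X n (comp_op \<alpha> \<beta>) x)"

text \<open>
  Simplicial maps are required to be \<open>undefined\<close> outside the simplices of the source, so that equality
  of simplicial maps is equality in HOL; \<open>sset_map X f\<close> truncates a family \<open>f\<close> accordingly.
\<close>

definition sset_hom :: "'a sset \<Rightarrow> 'b sset \<Rightarrow> (nat \<Rightarrow> 'a \<Rightarrow> 'b) set" where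
  "sset_hom X Y = {f. (\<forall>n. f n \<in> simplices X n \<rightarrow>\<^sub>E simplices Y n) \<and>
     (\<forall>n m. \<forall>\<alpha>\<in>simplices (Delta n) m. \<forall>x\<in>simplices X n.
        f m (act X n \<alpha> x) = act Y n \<alpha> (f n x))}"

definition sset_map :: "'a sset \<Rightarrow> (nat \<Rightarrow> 'a \<Rightarrow> 'b) \<Rightarrow> nat \<Rightarrow> 'a \<Rightarrow> 'b" where
  "sset_map X f = (\<lambda>n. restrict (f n) (simplices X n))"

definition sset_prod :: "'a sset \<Rightarrow> 'b sset \<Rightarrow> ('a \<times> 'b) sset" where
  "sset_prod X Y = \<lparr> simplices = (\<lambda>n. simplices X n \<times> simplices Y n),
                     act = (\<lambda>n \<alpha> (x, y). (act X n \<alpha> x, act Y n \<alpha> y)) \<rparr>"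

definition fun_sset :: "'k sset \<Rightarrow> 'a sset \<Rightarrow> (nat \<Rightarrow> nat list \<times> 'k \<Rightarrow> 'a) sset" where
  "fun_sset K X = \<lparr> simplices = (\<lambda>n. sset_hom (sset_prod (Delta n) K) X),
     act = (\<lambda>n \<alpha> f. sset_map (sset_prod (Delta (length \<alpha> - 1)) K)
                       (\<lambda>m (\<beta>, x). f m (comp_op \<alpha> \<beta>, x))) \<rparr>"

text \<open>The diagram \<open>K \<rightarrow> X\<close> given by a vertex of \<open>fun_sset K X\<close>, i.e. by a map \<open>\<Delta>\<^sup>0 \<times> K \<rightarrow> X\<close>.\<close>

definition underlying :: "'k sset \<Rightarrow> (nat \<Rightarrow> nat list \<times> 'k \<Rightarrow> 'a) \<Rightarrow> nat \<Rightarrow> 'k \<Rightarrow> 'a" where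
  "underlying K f = sset_map K (\<lambda>m x. f m (replicate (Suc m) 0, x))"

definition full_sub :: "'a sset \<Rightarrow> 'a set \<Rightarrow> 'a sset" where
  "full_sub X P = \<lparr> simplices = (\<lambda>n. {x\<in>simplices X n. \<forall>i\<le>n. act X n [i] x \<in> P}), act = act X \<rparr>"

definition horn :: "nat \<Rightarrow> nat \<Rightarrow> nat list sset" where
  "horn n i = \<lparr> simplices = (\<lambda>m. {\<alpha>\<in>simplices (Delta n) m. \<not> {..n} \<subseteq> insert i (set \<alpha>)}),
                act = act (Delta n) \<rparr>"

definition boundary :: "nat \<Rightarrow> nat list sset" where
  "boundary n = \<lparr> simplices = (\<lambda>m. {\<alpha>\<in>simplices (Delta n) m. \<not> {..n} \<subseteq> set \<alpha>}),
                  act = act (Delta n) \<rparr>"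

text \<open>
  For a simplicial subset \<open>S\<close> of \<open>\<Delta>\<^sup>n\<close>: the map \<open>f : S \<rightarrow> X\<close> is the restriction of the map
  \<open>\<Delta>\<^sup>n \<rightarrow> X\<close> classified by some \<open>n\<close>-simplex.
\<close>

definition fillable :: "'a sset \<Rightarrow> nat \<Rightarrow> nat list sset \<Rightarrow> (nat \<Rightarrow> nat list \<Rightarrow> 'a) \<Rightarrow> bool" where
  "fillable X n S f \<longleftrightarrow>
     (\<exists>s\<in>simplices X n. \<forall>m. \<forall>\<alpha>\<in>simplices S m. f m \<alpha> = act X n \<alpha> s)"

definition quasicategory :: "'a sset \<Rightarrow> bool" where
  "quasicategory X \<longleftrightarrow> simplicial_set X \<and>
     (\<forall>n i. 0 < i \<and> i < n \<longrightarrow> (\<forall>f\<in>sset_hom (horn n i) X. fillable X n (horn n i) f))"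

definition equivalence_edge :: "'a sset \<Rightarrow> 'a \<Rightarrow> bool" where
  "equivalence_edge X f \<longleftrightarrow> f \<in> simplices X 1 \<and> (\<exists>g\<in>simplices X 1. \<exists>s\<in>simplices X 2. \<exists>t\<in>simplices X 2.
     act X 2 [0,1] s = f \<and> act X 2 [1,2] s = g \<and> act X 2 [0,2] s = act X 1 [0,0] f \<and>
     act X 2 [0,1] t = g \<and> act X 2 [1,2] t = f \<and> act X 2 [0,2] t = act X 1 [1,1] f)"

definition equivalent_objects :: "'a sset \<Rightarrow> 'a \<Rightarrow> 'a \<Rightarrow> bool" where
  "equivalent_objects X x y \<longleftrightarrow>
     (\<exists>f. equivalence_edge X f \<and> act X 1 [0] f = x \<and> act X 1 [1] f = y)"

section \<open>Joins, slices, limits and colimits\<close>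

text \<open>
  An \<open>n\<close>-simplex of the join \<open>X \<star> Y\<close> is an \<open>n\<close>-simplex of \<open>X\<close>, an \<open>n\<close>-simplex of \<open>Y\<close>, or
  \<open>Mix i x y\<close> with \<open>x \<in> X\<^sub>i\<close> spanned by the vertices \<open>0..i\<close> and \<open>y \<in> Y\<^sub>j\<close> spanned by the remaining
  \<open>j + 1 = n - i\<close> vertices.
\<close>

datatype ('a, 'b) join_simplex = InL 'a | InR 'b | Mix nat 'a 'b

definition join :: "'a sset \<Rightarrow> 'b sset \<Rightarrow> ('a, 'b) join_simplex sset" where
  "join X Y = \<lparr> simplices = (\<lambda>n. InL ` simplices X n \<union> InR ` simplices Y n \<union>
        {Mix i x y | i x y. i < n \<and> x \<in> simplices X i \<and> y \<in> simplices Y (n - Suc i)}),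
     act = (\<lambda>n \<alpha> z. case z of
        InL x \<Rightarrow> InL (act X n \<alpha> x)
      | InR y \<Rightarrow> InR (act Y n \<alpha> y)
      | Mix i x y \<Rightarrow>
          (let \<beta> = filter (\<lambda>k. k \<le> i) \<alpha>; \<gamma> = map (\<lambda>k. k - Suc i) (filter (\<lambda>k. i < k) \<alpha>) in
           if \<gamma> = [] then InL (act X i \<beta> x)
           else if \<beta> = [] then InR (act Y (n - Suc i) \<gamma> y)
           else Mix (length \<beta> - 1) (act X i \<beta> x) (act Y (n - Suc i) \<gamma> y))) \<rparr>"

text \<open>The slice \<open>X\<^sub>/\<^sub>p\<close> and the coslice \<open>X\<^sub>p\<^sub>/\<close> of a diagram \<open>p : K \<rightarrow> X\<close>.\<close>

definition slice ::
  "'a sset \<Rightarrow> 'k sset \<Rightarrow> (nat \<Rightarrow> 'k \<Rightarrow> 'a) \<Rightarrow> (nat \<Rightarrow> (nat list, 'k) join_simplex \<Rightarrow> 'a) sset" where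
  "slice X K p = \<lparr> simplices = (\<lambda>n. {f\<in>sset_hom (join (Delta n) K) X.
                                        \<forall>m. \<forall>x\<in>simplices K m. f m (InR x) = p m x}),
     act = (\<lambda>n \<alpha> f. sset_map (join (Delta (length \<alpha> - 1)) K)
              (\<lambda>m z. f m (map_join_simplex (comp_op \<alpha>) id z))) \<rparr>"

definition coslice ::
  "'a sset \<Rightarrow> 'k sset \<Rightarrow> (nat \<Rightarrow> 'k \<Rightarrow> 'a) \<Rightarrow> (nat \<Rightarrow> ('k, nat list) join_simplex \<Rightarrow> 'a) sset" where
  "coslice X K p = \<lparr> simplices = (\<lambda>n. {f\<in>sset_hom (join K (Delta n)) X.
                                          \<forall>m. \<forall>x\<in>simplices K m. f m (InL x) = p m x}),
     act = (\<lambda>n \<alpha> f. sset_map (join K (Delta (length \<alpha> - 1)))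
              (\<lambda>m z. f m (map_join_simplex id (comp_op \<alpha>) z))) \<rparr>"

definition terminal :: "'a sset \<Rightarrow> 'a \<Rightarrow> bool" where
  "terminal X x \<longleftrightarrow> x \<in> simplices X 0 \<and>
     (\<forall>n\<ge>1. \<forall>f\<in>sset_hom (boundary n) X. f 0 [n] = x \<longrightarrow> fillable X n (boundary n) f)"

definition initial :: "'a sset \<Rightarrow> 'a \<Rightarrow> bool" where
  "initial X x \<longleftrightarrow> x \<in> simplices X 0 \<and>
     (\<forall>n\<ge>1. \<forall>f\<in>sset_hom (boundary n) X. f 0 [0] = x \<longrightarrow> fillable X n (boundary n) f)"

definition zero_object :: "'a sset \<Rightarrow> 'a \<Rightarrow> bool" where
  "zero_object X x \<longleftrightarrow> terminal X x \<and> initial X x"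

definition pointed :: "'a sset \<Rightarrow> bool" where
  "pointed X \<longleftrightarrow> (\<exists>x. zero_object X x)"

text \<open>
  A simplicial set is finite if it has finitely many nondegenerate simplices. Finite simplicial sets
  have countably many simplices, hence up to isomorphism their simplices are natural numbers.
\<close>

definition degenerate :: "'a sset \<Rightarrow> nat \<Rightarrow> 'a \<Rightarrow> bool" where
  "degenerate X n x \<longleftrightarrow>
     (\<exists>m<n. \<exists>\<alpha>\<in>simplices (Delta m) n. \<exists>y\<in>simplices X m. x = act X m \<alpha> y)"

definition finite_sset :: "'a sset \<Rightarrow> bool" where
  "finite_sset X \<longleftrightarrow>
     simplicial_set X \<and> finite {(n, x). x \<in> simplices X n \<and> \<not> degenerate X n x}"

definition has_finite_limits :: "'a sset \<Rightarrow> bool" where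
  "has_finite_limits X \<longleftrightarrow>
     (\<forall>K :: nat sset. finite_sset K \<longrightarrow> (\<forall>p\<in>sset_hom K X. \<exists>t. terminal (slice X K p) t))"

definition has_finite_colimits :: "'a sset \<Rightarrow> bool" where
  "has_finite_colimits X \<longleftrightarrow>
     (\<forall>K :: nat sset. finite_sset K \<longrightarrow> (\<forall>p\<in>sset_hom K X. \<exists>t. initial (coslice X K p) t))"

text \<open>
  If \<open>b\<close> lies below (above) every element of \<open>A\<close> and not in \<open>A\<close>, then the nerve of \<open>A \<union> {b}\<close> is the left
  (right) cone on the nerve of \<open>A\<close>. So a diagram on this nerve is a cone over (under) its restriction
  to the nerve of \<open>A\<close>, i.e. a vertex of the slice (coslice).
\<close>

definition is_limit_at :: "'a sset \<Rightarrow> 'p::order set \<Rightarrow> 'p \<Rightarrow> (nat \<Rightarrow> 'p list \<Rightarrow> 'a) \<Rightarrow> bool" where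
  "is_limit_at X A b D \<longleftrightarrow> terminal (slice X (nerve A) (sset_map (nerve A) D))
     (sset_map (join (Delta 0) (nerve A)) (\<lambda>m z. D m (case z of
          InL \<alpha> \<Rightarrow> map (\<lambda>_. b) \<alpha> | InR x \<Rightarrow> x | Mix i \<alpha> x \<Rightarrow> map (\<lambda>_. b) \<alpha> @ x)))"

definition is_colimit_at :: "'a sset \<Rightarrow> 'p::order set \<Rightarrow> 'p \<Rightarrow> (nat \<Rightarrow> 'p list \<Rightarrow> 'a) \<Rightarrow> bool" where
  "is_colimit_at X A b D \<longleftrightarrow> initial (coslice X (nerve A) (sset_map (nerve A) D))
     (sset_map (join (nerve A) (Delta 0)) (\<lambda>m z. D m (case z of
          InL x \<Rightarrow> x | InR \<alpha> \<Rightarrow> map (\<lambda>_. b) \<alpha> | Mix i x \<alpha> \<Rightarrow> x @ map (\<lambda>_. b) \<alpha>)))"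

section \<open>Squares and cubes\<close>

text \<open>
  \<open>\<Delta>\<^sup>1 \<times> \<Delta>\<^sup>1\<close> and \<open>\<Delta>\<^sup>1 \<times> \<Delta>\<^sup>1 \<times> \<Delta>\<^sup>1\<close> are the nerves of \<open>Sq\<close> and \<open>Cube\<close>. The nerve of \<open>Cosp\<close> is
  \<open>(\<Delta>\<^sup>1 \<or> \<Delta>\<^sup>1)\<^sup>o\<^sup>p\<close>: a cospan \<open>X \<rightarrow> B \<leftarrow> Y\<close> has \<open>X\<close> at \<open>(0,1)\<close>, \<open>Y\<close> at \<open>(1,0)\<close> and \<open>B\<close> at \<open>(1,1)\<close>.
\<close>

abbreviation Sq :: "(nat \<times> nat) set" where "Sq \<equiv> {..1} \<times> {..1}"
abbreviation Cosp :: "(nat \<times> nat) set" where "Cosp \<equiv> {(0,1), (1,0), (1,1)}"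
abbreviation Span :: "(nat \<times> nat) set" where "Span \<equiv> {(0,0), (0,1), (1,0)}"
abbreviation Cube :: "(nat \<times> nat \<times> nat) set" where "Cube \<equiv> {..1} \<times> {..1} \<times> {..1}"

definition reindex ::
  "'p::order set \<Rightarrow> ('p \<Rightarrow> 'q) \<Rightarrow> (nat \<Rightarrow> 'q list \<Rightarrow> 'a) \<Rightarrow> nat \<Rightarrow> 'p list \<Rightarrow> 'a" where
  "reindex A u D = sset_map (nerve A) (\<lambda>m xs. D m (map u xs))"

definition pullback_square :: "'a sset \<Rightarrow> (nat \<Rightarrow> (nat \<times> nat) list \<Rightarrow> 'a) \<Rightarrow> bool" where
  "pullback_square C D \<longleftrightarrow> D \<in> sset_hom (nerve Sq) C \<and> is_limit_at C Cosp (0,0) D"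

definition pushout_square :: "'a sset \<Rightarrow> (nat \<Rightarrow> (nat \<times> nat) list \<Rightarrow> 'a) \<Rightarrow> bool" where
  "pushout_square C D \<longleftrightarrow> D \<in> sset_hom (nerve Sq) C \<and> is_colimit_at C Span (1,1) D"

text \<open>
  A fiber square of an edge \<open>Z \<rightarrow> B\<close> has its fiber \<open>F\<close> at \<open>(0,0)\<close>, \<open>Z\<close> at \<open>(0,1)\<close>, a zero object at
  \<open>(1,0)\<close> and \<open>B\<close> at \<open>(1,1)\<close>.
\<close>

definition fiber_square :: "'a sset \<Rightarrow> (nat \<Rightarrow> (nat \<times> nat) list \<Rightarrow> 'a) \<Rightarrow> bool" where
  "fiber_square C D \<longleftrightarrow> pullback_square C D \<and> zero_object C (D 0 [(1,0)])"

definition is_fiber :: "'a sset \<Rightarrow> 'a \<Rightarrow> 'a \<Rightarrow> bool" where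
  "is_fiber C f F \<longleftrightarrow> (\<exists>D. fiber_square C D \<and> D 1 [(0,1), (1,1)] = f \<and> D 0 [(0,0)] = F)"

text \<open>\<open>J\<close> is a join \<open>F \<star> F'\<close>: a pushout of the two projections of a product of \<open>F\<close> and \<open>F'\<close>.\<close>

definition is_join_object :: "'a sset \<Rightarrow> 'a \<Rightarrow> 'a \<Rightarrow> 'a \<Rightarrow> bool" where
  "is_join_object C F F' J \<longleftrightarrow> (\<exists>D. pushout_square C D \<and> is_limit_at C {(0,1), (1,0)} (0,0) D \<and>
     D 0 [(0,1)] = F \<and> D 0 [(1,0)] = F' \<and> D 0 [(1,1)] = J)"

text \<open>
  Edges of a cube in the direction of the first coordinate are regarded as vertical, pointing from the
  top face (first coordinate 0) to the bottom face (first coordinate 1). The three possible vertical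
  directions are exchanged by the rotations of the cube about its main diagonal.
\<close>

definition top_face :: "(nat \<Rightarrow> (nat \<times> nat \<times> nat) list \<Rightarrow> 'a) \<Rightarrow> nat \<Rightarrow> (nat \<times> nat) list \<Rightarrow> 'a" where
  "top_face D = reindex Sq (\<lambda>v. (0, v)) D"

definition bottom_face :: "(nat \<Rightarrow> (nat \<times> nat \<times> nat) list \<Rightarrow> 'a) \<Rightarrow> nat \<Rightarrow> (nat \<times> nat) list \<Rightarrow> 'a" where
  "bottom_face D = reindex Sq (\<lambda>v. (1, v)) D"

definition upright_mather_cube :: "'a sset \<Rightarrow> (nat \<Rightarrow> (nat \<times> nat \<times> nat) list \<Rightarrow> 'a) \<Rightarrow> bool" where
  "upright_mather_cube C D \<longleftrightarrow> D \<in> sset_hom (nerve Cube) C \<and> pushout_square C (bottom_face D) \<and>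
     (\<forall>i\<le>1. pullback_square C (reindex Sq (\<lambda>(a, b). (a, i, b)) D) \<and>
            pullback_square C (reindex Sq (\<lambda>(a, b). (a, b, i)) D))"

definition rotate_cube ::
  "nat \<Rightarrow> (nat \<Rightarrow> (nat \<times> nat \<times> nat) list \<Rightarrow> 'a) \<Rightarrow> nat \<Rightarrow> (nat \<times> nat \<times> nat) list \<Rightarrow> 'a" where
  "rotate_cube k D = reindex Cube ((\<lambda>(a, b, c). (b, c, a)) ^^ k) D"

definition mather_cube :: "'a sset \<Rightarrow> (nat \<Rightarrow> (nat \<times> nat \<times> nat) list \<Rightarrow> 'a) \<Rightarrow> bool" where
  "mather_cube C D \<longleftrightarrow>
     D \<in> sset_hom (nerve Cube) C \<and> (\<exists>k<3. upright_mather_cube C (rotate_cube k D))"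

definition mather_cube_axiom :: "'a sset \<Rightarrow> bool" where
  "mather_cube_axiom C \<longleftrightarrow>
     (\<forall>D\<in>sset_hom (nerve Cube) C. \<forall>k<3. upright_mather_cube C (rotate_cube k D) \<longrightarrow>
        pushout_square C (top_face (rotate_cube k D)))"

section \<open>Natural transformations and adjunctions\<close>

text \<open>
  Natural transformations between functors \<open>S \<rightarrow> T\<close> are edges of \<open>fun_sset S T\<close>, i.e. maps
  \<open>\<Delta>\<^sup>1 \<times> S \<rightarrow> T\<close>. Precomposing with \<open>map Suc\<close> resp. \<open>map ((*) 2)\<close> takes the edge \<open>1 \<rightarrow> 2\<close> resp. \<open>0 \<rightarrow> 2\<close>
  of a 2-simplex of \<open>fun_sset S T\<close>.
\<close>

definition nat_trans :: "'a sset \<Rightarrow> 'b sset \<Rightarrow> (nat \<Rightarrow> 'a \<Rightarrow> 'b) \<Rightarrow> (nat \<Rightarrow> 'a \<Rightarrow> 'b) \<Rightarrow>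
    (nat \<Rightarrow> nat list \<times> 'a \<Rightarrow> 'b) \<Rightarrow> bool" where
  "nat_trans S T F F' \<tau> \<longleftrightarrow> \<tau> \<in> simplices (fun_sset S T) 1 \<and>
     (\<forall>m. \<forall>x\<in>simplices S m. \<tau> m (replicate (Suc m) 0, x) = F m x \<and>
                             \<tau> m (replicate (Suc m) 1, x) = F' m x)"

text \<open>\<open>\<rho>\<close> is a composite of \<open>\<sigma>\<close> followed by \<open>\<tau>\<close>.\<close>

definition nat_trans_composite :: "'a sset \<Rightarrow> 'b sset \<Rightarrow> (nat \<Rightarrow> nat list \<times> 'a \<Rightarrow> 'b) \<Rightarrow>
    (nat \<Rightarrow> nat list \<times> 'a \<Rightarrow> 'b) \<Rightarrow> (nat \<Rightarrow> nat list \<times> 'a \<Rightarrow> 'b) \<Rightarrow> bool" where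
  "nat_trans_composite S T \<sigma> \<tau> \<rho> \<longleftrightarrow> (\<exists>\<theta>\<in>simplices (fun_sset S T) 2.
     \<forall>m. \<forall>\<beta>\<in>simplices (Delta 1) m. \<forall>x\<in>simplices S m.
       \<theta> m (\<beta>, x) = \<sigma> m (\<beta>, x) \<and> \<theta> m (map Suc \<beta>, x) = \<tau> m (\<beta>, x) \<and>
       \<theta> m (map ((*) 2) \<beta>, x) = \<rho> m (\<beta>, x))"

definition adjunction :: "'a sset \<Rightarrow> 'b sset \<Rightarrow> (nat \<Rightarrow> 'a \<Rightarrow> 'b) \<Rightarrow> (nat \<Rightarrow> 'b \<Rightarrow> 'a) \<Rightarrow>
    (nat \<Rightarrow> nat list \<times> 'a \<Rightarrow> 'a) \<Rightarrow> (nat \<Rightarrow> nat list \<times> 'b \<Rightarrow> 'b) \<Rightarrow> bool" where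
  "adjunction S T F G \<eta> \<epsilon> \<longleftrightarrow> F \<in> sset_hom S T \<and> G \<in> sset_hom T S \<and>
     nat_trans S S (\<lambda>m x. x) (\<lambda>m x. G m (F m x)) \<eta> \<and>
     nat_trans T T (\<lambda>m y. F m (G m y)) (\<lambda>m y. y) \<epsilon> \<and>
     nat_trans_composite S T (\<lambda>m (\<beta>, x). F m (\<eta> m (\<beta>, x))) (\<lambda>m (\<beta>, x). \<epsilon> m (\<beta>, F m x))
       (\<lambda>m (\<beta>, x). F m x) \<and>
     nat_trans_composite T S (\<lambda>m (\<beta>, y). \<eta> m (\<beta>, G m y)) (\<lambda>m (\<beta>, y). G m (\<epsilon> m (\<beta>, y)))
       (\<lambda>m (\<beta>, y). G m y)"

section \<open>Functors between diagram categories\<close>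

abbreviation Diag :: "'p::order set \<Rightarrow> 'a sset \<Rightarrow> (nat \<Rightarrow> nat list \<times> 'p list \<Rightarrow> 'a) sset" where
  "Diag A C \<equiv> fun_sset (nerve A) C"

text \<open>
  The following functions are the actions on \<open>n\<close>-simplices of: restriction \<open>Diag B C \<rightarrow> Diag A C\<close>
  along a monotone map \<open>A \<rightarrow> B\<close>; evaluation \<open>Diag A C \<rightarrow> C\<close> at \<open>v\<close>; the constant diagram functor
  \<open>C \<rightarrow> Diag A C\<close>; and the isomorphisms between \<open>Diag (P \<times> Q) C\<close> and \<open>Diag Q (Diag P C)\<close>.
\<close>

definition pull :: "'p::order set \<Rightarrow> ('p \<Rightarrow> 'q) \<Rightarrow> nat \<Rightarrow> (nat \<Rightarrow> nat list \<times> 'q list \<Rightarrow> 'a) \<Rightarrow>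
    nat \<Rightarrow> nat list \<times> 'p list \<Rightarrow> 'a" where
  "pull A u n f = sset_map (sset_prod (Delta n) (nerve A)) (\<lambda>m (\<alpha>, x). f m (\<alpha>, map u x))"

definition ev_at :: "'p \<Rightarrow> nat \<Rightarrow> (nat \<Rightarrow> nat list \<times> 'p list \<Rightarrow> 'a) \<Rightarrow> 'a" where
  "ev_at v n f = f n (id_op n, replicate (Suc n) v)"

definition const_diag :: "'p::order set \<Rightarrow> 'a sset \<Rightarrow> nat \<Rightarrow> 'a \<Rightarrow> nat \<Rightarrow> nat list \<times> 'p list \<Rightarrow> 'a" where
  "const_diag A C n c = sset_map (sset_prod (Delta n) (nerve A)) (\<lambda>m (\<alpha>, x). act C n \<alpha> c)"

definition curry_diag :: "'p::order set \<Rightarrow> 'q::order set \<Rightarrow> nat \<Rightarrow>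
    (nat \<Rightarrow> nat list \<times> ('p \<times> 'q) list \<Rightarrow> 'a) \<Rightarrow>
    nat \<Rightarrow> nat list \<times> 'q list \<Rightarrow> nat \<Rightarrow> nat list \<times> 'p list \<Rightarrow> 'a" where
  "curry_diag P Q n f = sset_map (sset_prod (Delta n) (nerve Q)) (\<lambda>m (\<alpha>, y).
     sset_map (sset_prod (Delta m) (nerve P)) (\<lambda>k (\<beta>, x).
       f k (comp_op \<alpha> \<beta>, zip x (comp_op y \<beta>))))"

definition uncurry_diag :: "'p::order set \<Rightarrow> 'q::order set \<Rightarrow> nat \<Rightarrow>
    (nat \<Rightarrow> nat list \<times> 'q list \<Rightarrow> nat \<Rightarrow> nat list \<times> 'p list \<Rightarrow> 'a) \<Rightarrow>
    nat \<Rightarrow> nat list \<times> ('p \<times> 'q) list \<Rightarrow> 'a" where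
  "uncurry_diag P Q n g = sset_map (sset_prod (Delta n) (nerve (P \<times> Q)))
     (\<lambda>m (\<alpha>, z). g m (\<alpha>, map snd z) m (id_op m, map fst z))"

text \<open>The functor \<open>E \<rightarrow> Diag ({..1} \<times> Q) C\<close> given by a natural transformation of functors \<open>E \<rightarrow> Diag Q C\<close>.\<close>

definition trans_to_functor :: "'e sset \<Rightarrow> 'q::order set \<Rightarrow>
    (nat \<Rightarrow> nat list \<times> 'e \<Rightarrow> nat \<Rightarrow> nat list \<times> 'q list \<Rightarrow> 'a) \<Rightarrow>
    nat \<Rightarrow> 'e \<Rightarrow> nat \<Rightarrow> nat list \<times> (nat \<times> 'q) list \<Rightarrow> 'a" where
  "trans_to_functor E Q \<tau> n p = sset_map (sset_prod (Delta n) (nerve ({..1} \<times> Q)))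
     (\<lambda>m (\<alpha>, z). \<tau> m (map fst z, act E n \<alpha> p) m (id_op m, map snd z))"

text \<open>
  Functorial pullback squares, pushout squares and fiber squares: functors to squares whose values extend
  the given diagram and are pullbacks, pushouts or fiber squares. They are unique up to a contractible
  choice.
\<close>

definition pullback_functor where
  "pullback_functor C P \<longleftrightarrow> P \<in> sset_hom (Diag Cosp C) (Diag Sq C) \<and>
     (\<forall>n. \<forall>p\<in>simplices (Diag Cosp C) n. pull Cosp id n (P n p) = p) \<and>
     (\<forall>p\<in>simplices (Diag Cosp C) 0. pullback_square C (underlying (nerve Sq) (P 0 p)))"

definition pushout_functor where
  "pushout_functor C P \<longleftrightarrow> P \<in> sset_hom (Diag Span C) (Diag Sq C) \<and>
     (\<forall>n. \<forall>p\<in>simplices (Diag Span C) n. pull Span id n (P n p) = p) \<and>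
     (\<forall>p\<in>simplices (Diag Span C) 0. pushout_square C (underlying (nerve Sq) (P 0 p)))"

definition fiber_functor where
  "fiber_functor C P \<longleftrightarrow> P \<in> sset_hom (Diag {..1::nat} C) (Diag Sq C) \<and>
     (\<forall>n. \<forall>f\<in>simplices (Diag {..1} C) n. pull {..1} (\<lambda>i. (i, 1)) n (P n f) = f) \<and>
     (\<forall>f\<in>simplices (Diag {..1} C) 0. fiber_square C (underlying (nerve Sq) (P 0 f)))"

text \<open>The pullback span functor \<open>Cosp \<rightarrow> Span\<close> and the pushout cospan functor \<open>Span \<rightarrow> Cosp\<close>.\<close>

definition pullback_span where
  "pullback_span C P = sset_map (Diag Cosp C) (\<lambda>n p. pull Span id n (P n p))"

definition pushout_cospan where
  "pushout_cospan C Q = sset_map (Diag Span C) (\<lambda>n s. pull Cosp id n (Q n s))"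

section \<open>The relative Ganea construction\<close>

text \<open>The functor taking a cospan \<open>X \<rightarrow> B \<leftarrow> Y\<close> to the pushout square of \<open>X \<leftarrow> X \<times>\<^sub>B Y \<rightarrow> Y\<close>.\<close>

definition F_rel where
  "F_rel C P Q = sset_map (Diag Cosp C) (\<lambda>n p. Q n (pullback_span C P n p))"

text \<open>
  The pushout cospan functor is left adjoint to the pullback span functor, being the composite of the
  adjunctions (left Kan extension from spans to squares) \<open>\<stileturn>\<close> (restriction to spans) and (restriction to
  cospans) \<open>\<stileturn>\<close> (right Kan extension from cospans to squares). Accordingly its counit is the restriction to
  cospans of the transformation \<open>\<kappa>\<close> from the pushout square of \<open>X \<leftarrow> X \<times>\<^sub>B Y \<rightarrow> Y\<close> to the pullback square
  which is the adjunct of, i.e. which restricts on spans to, the identity. The condition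
  on \<open>\<kappa>\<close> distinguishes this adjunction from those obtained by twisting with automorphisms of the functors.
\<close>

definition counit_of where
  "counit_of C \<kappa> = sset_map (sset_prod (Delta 1) (Diag Cosp C))
     (\<lambda>m (\<beta>, p). pull Cosp id m (\<kappa> m (\<beta>, p)))"

definition relative_ganea where
  "relative_ganea C P Q \<kappa> \<longleftrightarrow> pullback_functor C P \<and> pushout_functor C Q \<and>
     nat_trans (Diag Cosp C) (Diag Sq C) (F_rel C P Q) P \<kappa> \<and>
     (\<forall>m. \<forall>\<beta>\<in>simplices (Delta 1) m. \<forall>p\<in>simplices (Diag Cosp C) m.
        pull Span id m (\<kappa> m (\<beta>, p)) = pull Span id m (P m p)) \<and>
     (\<exists>\<eta>. adjunction (Diag Span C) (Diag Cosp C) (pushout_cospan C Q) (pullback_span C P) \<eta>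
             (counit_of C \<kappa>))"

text \<open>
  The canonical morphism \<open>X \<star>\<^sub>B Y \<rightarrow> B\<close>, as a natural transformation of functors from cospans to \<open>C\<close>.
\<close>

definition Gan_rel where
  "Gan_rel C \<kappa> = sset_map (sset_prod (Delta 1) (Diag Cosp C))
     (\<lambda>m (\<beta>, p). ev_at (1,1) m (counit_of C \<kappa> m (\<beta>, p)))"

text \<open>
  Evaluation at the terminal vertex \<open>(1,1)\<close> is the colimit functor for squares, left adjoint to the
  constant square functor. The unit at a square \<open>f\<close> is the morphism from \<open>f\<close> to the constant square at \<open>f(1,1)\<close>
  given by the edges \<open>v \<rightarrow> (1,1)\<close>.
\<close>

definition colim_unit where
  "colim_unit C = sset_map (sset_prod (Delta 1) (Diag Sq C)) (\<lambda>m (\<beta>, f).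
     sset_map (sset_prod (Delta m) (nerve Sq)) (\<lambda>k (\<alpha>, x).
       f k (\<alpha>, map2 (\<lambda>i v. if i = 1 then (1,1) else v) (comp_op \<beta> \<alpha>) x)))"

text \<open>
  \<open>g\<close> is the adjunct, from \<open>F_rel\<close> to the constant square at \<open>B\<close>, of the canonical morphism.
\<close>

definition Gan_rel_nat where
  "Gan_rel_nat C P Q \<kappa> g \<longleftrightarrow> g \<in> simplices (fun_sset (Diag Cosp C) (Diag Sq C)) 1 \<and>
     nat_trans_composite (Diag Cosp C) (Diag Sq C)
       (\<lambda>m (\<beta>, p). colim_unit C m (\<beta>, F_rel C P Q m p))
       (\<lambda>m (\<beta>, p). const_diag Sq C m (Gan_rel C \<kappa> m (\<beta>, p)))
       g"

text \<open>
  \<open>trans_to_functor\<close> turns \<open>g\<close> into a functor from cospans to cubes whose horizontal edges \<open>Z \<rightarrow> B\<close> are in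
  the direction of the first coordinate. Viewing the cube as a square of edges, each edge is
  replaced by its fiber square, and of this only the fiber inclusion, the edge \<open>(0,0) \<rightarrow> (0,1)\<close>, is kept.
\<close>

definition replace_by_fiber_inclusion where
  "replace_by_fiber_inclusion \<Phi> n c =
     pull Cube (\<lambda>(a, v). ((0, a), v)) n (uncurry_diag Sq Sq n
       (sset_map (sset_prod (Delta n) (nerve Sq)) (\<lambda>m z. \<Phi> m (curry_diag {..1::nat} Sq n c m z))))"

text \<open>\<open>\<Xi>\<close> is (a choice of) the functor \<open>\<Xi>\<^sup>r\<^sup>e\<^sup>l\<close> from cospans to cubes.\<close>

definition is_Xi_rel :: "'a sset \<Rightarrow>
    (nat \<Rightarrow> (nat \<Rightarrow> nat list \<times> (nat \<times> nat) list \<Rightarrow> 'a) \<Rightarrow>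
       nat \<Rightarrow> nat list \<times> (nat \<times> nat \<times> nat) list \<Rightarrow> 'a) \<Rightarrow> bool" where
  "is_Xi_rel C \<Xi> \<longleftrightarrow> (\<exists>P Q \<kappa> g \<Phi>. relative_ganea C P Q \<kappa> \<and> Gan_rel_nat C P Q \<kappa> g \<and> fiber_functor C \<Phi> \<and>
     \<Xi> = sset_map (Diag Cosp C) (\<lambda>n p.
       replace_by_fiber_inclusion \<Phi> n (trans_to_functor (Diag Cosp C) Sq g n p)))"

text \<open>
  The values at a single cospan \<open>p = (X \<rightarrow> B \<leftarrow> Y)\<close> of the transformation \<open>\<kappa>\<close> above, for all choices of the
  pullback and the pushout: \<open>c\<close> is a morphism of squares from a pushout square to a pullback square extending \<open>p\<close>
  which is the identity on \<open>X \<leftarrow> X \<times>\<^sub>B Y \<rightarrow> Y\<close>. Its component at \<open>(1,1)\<close> is the canonical morphism \<open>X \<star>\<^sub>B Y \<rightarrow> B\<close>.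
\<close>

definition relative_ganea_at :: "'a sset \<Rightarrow> (nat \<Rightarrow> (nat \<times> nat) list \<Rightarrow> 'a) \<Rightarrow>
    (nat \<Rightarrow> (nat \<times> nat \<times> nat) list \<Rightarrow> 'a) \<Rightarrow> bool" where
  "relative_ganea_at C p c \<longleftrightarrow> c \<in> sset_hom (nerve Cube) C \<and>
     pushout_square C (reindex Sq (\<lambda>v. (0, v)) c) \<and>
     pullback_square C (reindex Sq (\<lambda>v. (1, v)) c) \<and>
     reindex Cosp (\<lambda>v. (1, v)) c = p \<and>
     reindex ({..1} \<times> Span) id c = reindex ({..1} \<times> Span) (\<lambda>(i, v). (1, v)) c"

definition is_canonical_morphism :: "'a sset \<Rightarrow> (nat \<Rightarrow> (nat \<times> nat) list \<Rightarrow> 'a) \<Rightarrow> 'a \<Rightarrow> bool" where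
  "is_canonical_morphism C p h \<longleftrightarrow>
     (\<exists>c. relative_ganea_at C p c \<and> h = c 1 [(0,1,1), (1,1,1)])"

end

theory Submission
  imports Defs
begin

text \<open>
  Simplicial maps out of nerves and joins are treated as maps out of ordered simplicial complexes and
  are extended one simplex at a time. The pieces that can be filled are inner horns, boundaries whose
  last vertex is terminal, boundaries below the apex of a limit cone, and outer horns whose critical
  edge is an equivalence.

  For the first claim, the cube \<open>\<Xi>\<^sup>r\<^sup>e\<^sup>l\<close> has a pushout as its bottom face, and each of its side faces,
  pasted with a fiber square, is again a fiber square; by the pasting lemma the side faces are
  pullbacks.

  For the second claim the functor \<open>\<Xi>\<^sup>r\<^sup>e\<^sup>l\<close> is not needed: all the fibers of one cospan are placed in a single
  diagram, whose cube is a Mather cube by the same pasting argument. Its top face exhibits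
  \<open>F\<^sub>X\<^sub>,\<^sub>Y\<close> as a pushout of the product span of \<open>F\<^sub>X\<close> and \<open>F\<^sub>Y\<close>, and pushouts of a
  span are unique up to equivalence.
\<close>

section \<open>Ordered complexes\<close>

text \<open>Limits are defined through slices, so every pasting step concerns boundaries of all
  dimensions, and the obstacle is to reduce it to a finite check. The vertices are split at 0: an
  unspecified simplex \<sigma> has the labels up to 0, a fixed finite diagram has positive labels.
  Whether a map can be enlarged then depends only on two families of faces of the finite diagram,
  one lying over the proper faces of \<sigma> and one over \<sigma> itself. Both are lists of
  integer chains, so the conditions are evaluated by \<open>code_simp\<close>. Integers serve as
  labels because they give each poset that occurs a fixed linear extension, in which all faces are
  sorted lists. A second obstacle is strictness. The fibers of one cospan come with unrelated zero
  objects, and the morphisms to \<open>B\<close> in the pushout square and in the pullback square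
  agree only up to homotopy. Before gluing, \<open>F_X\<close> and \<open>F_Y\<close> are therefore
  moved to the edge from zero to \<open>B\<close> that belongs to \<open>F_XY\<close>, while the
  fiber objects are kept.\<close>

text \<open>
  An ordered complex is given by the set of its faces. The \<open>n\<close>-simplices of the corresponding simplicial
  set are the sorted lists of \<open>n + 1\<close> vertices, repetitions allowed, that span a face, and \<open>dmap X K f\<close>
  says that \<open>f\<close> is a simplicial map from it to \<open>X\<close>.
\<close>

definition fin_complex :: "'v set set \<Rightarrow> bool" where
  "fin_complex K \<longleftrightarrow> (\<forall>S\<in>K. finite S \<and> Pow S \<subseteq> K)"

definition dmap :: "'a sset \<Rightarrow> 'v::linorder set set \<Rightarrow> ('v list \<Rightarrow> 'a) \<Rightarrow> bool" where
  "dmap X K f \<longleftrightarrow> (\<forall>n xs. length xs = Suc n \<and> sorted xs \<and> set xs \<in> K \<longrightarrow>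
     f xs \<in> simplices X n \<and>
     (\<forall>m. \<forall>\<alpha>\<in>simplices (Delta n) m. f (comp_op xs \<alpha>) = act X n \<alpha> (f xs)))"

text \<open>There is no simplex of dimension -1, and values off the faces are arbitrary. Hence maps
  are compared on nonempty sorted lists that span a face, rather than by \<open>=\<close>.\<close>

definition agree :: "'v::linorder set set \<Rightarrow> ('v list \<Rightarrow> 'a) \<Rightarrow> ('v list \<Rightarrow> 'a) \<Rightarrow> bool" where
  "agree K f g \<longleftrightarrow> (\<forall>xs. xs \<noteq> [] \<and> sorted xs \<and> set xs \<in> K \<longrightarrow> f xs = g xs)"

definition extensible :: "'a sset \<Rightarrow> 'v::linorder set set \<Rightarrow> ('v list \<Rightarrow> 'a) \<Rightarrow> 'v set set \<Rightarrow> bool" where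
  "extensible X K f K' \<longleftrightarrow> (\<exists>g. dmap X K' g \<and> agree K g f)"

section \<open>Monotone maps as lists\<close>

lemma in_Delta: "\<alpha> \<in> simplices (Delta n) m \<longleftrightarrow> length \<alpha> = Suc m \<and> sorted \<alpha> \<and> set \<alpha> \<subseteq> {..n}"
  by (auto simp: nerve_def)

lemma in_nerve: "\<alpha> \<in> simplices (nerve A) m \<longleftrightarrow> length \<alpha> = Suc m \<and> sorted_wrt (\<le>) \<alpha> \<and> set \<alpha> \<subseteq> A"
  by (auto simp: nerve_def)

lemma act_nerve [simp]: "act (nerve A) n \<alpha> xs = comp_op xs \<alpha>"
  by (simp add: nerve_def)

lemma sorted_wrt_comp_op:
  fixes xs :: "'p::order list"
  assumes "sorted_wrt (\<le>) xs" "sorted \<alpha>" "set \<alpha> \<subseteq> {..<length xs}"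
  shows "sorted_wrt (\<le>) (comp_op xs \<alpha>)"
proof -
  have "xs ! i \<le> xs ! j" if "i \<le> j" "j < length xs" for i j
    using assms(1) that by (cases "i = j") (auto simp: sorted_wrt_iff_nth_less)
  then show ?thesis
    using assms(2,3) by (auto simp: sorted_wrt_map intro!: sorted_wrt_mono_rel[of _ "(\<le>)" _])
qed

lemma set_comp_op: "set \<alpha> \<subseteq> {..<length xs} \<Longrightarrow> set (comp_op xs \<alpha>) \<subseteq> set xs"
  by auto

lemma comp_op_comp_op: "set \<beta> \<subseteq> {..<length \<alpha>} \<Longrightarrow> comp_op (comp_op xs \<alpha>) \<beta> = comp_op xs (comp_op \<alpha> \<beta>)"
  by (auto simp: subset_iff)

lemma map_comp_op: "set \<alpha> \<subseteq> {..<length xs} \<Longrightarrow> map h (comp_op xs \<alpha>) = comp_op (map h xs) \<alpha>"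
  by (auto simp: subset_iff)

lemma Delta_lessThan: "\<alpha> \<in> simplices (Delta n) m \<Longrightarrow> length xs = Suc n \<Longrightarrow> set \<alpha> \<subseteq> {..<length xs}"
  by (auto simp: in_Delta)

lemma comp_op_id: "length xs = Suc n \<Longrightarrow> comp_op xs (id_op n) = xs"
  using map_nth[of xs] by simp

lemma comp_op_Delta:
  "\<alpha> \<in> simplices (Delta n) m \<Longrightarrow> \<beta> \<in> simplices (Delta m) k \<Longrightarrow> comp_op \<alpha> \<beta> \<in> simplices (Delta n) k"
  using sorted_wrt_comp_op[of \<alpha> \<beta>] set_comp_op[of \<beta> \<alpha>] by (auto simp: in_Delta lessThan_Suc_atMost)

lemma fin_complexD: "fin_complex K \<Longrightarrow> S \<in> K \<Longrightarrow> T \<subseteq> S \<Longrightarrow> T \<in> K"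
  by (auto simp: fin_complex_def)

lemma agreeD: "agree K f g \<Longrightarrow> xs \<noteq> [] \<Longrightarrow> sorted xs \<Longrightarrow> set xs \<in> K \<Longrightarrow> f xs = g xs"
  by (simp add: agree_def)

lemma dmapD:
  assumes "dmap X K f" "length xs = Suc n" "sorted xs" "set xs \<in> K"
  shows "f xs \<in> simplices X n"
    and "\<alpha> \<in> simplices (Delta n) m \<Longrightarrow> f (comp_op xs \<alpha>) = act X n \<alpha> (f xs)"
  using assms unfolding dmap_def by blast+

lemma sset_act:
  assumes "simplicial_set X"
  shows "\<alpha> \<in> simplices (Delta n) m \<Longrightarrow> x \<in> simplices X n \<Longrightarrow> act X n \<alpha> x \<in> simplices X m"
    and "x \<in> simplices X n \<Longrightarrow> act X n (id_op n) x = x"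
    and "\<alpha> \<in> simplices (Delta n) m \<Longrightarrow> \<beta> \<in> simplices (Delta m) k \<Longrightarrow> x \<in> simplices X n \<Longrightarrow>
        act X m \<beta> (act X n \<alpha> x) = act X n (comp_op \<alpha> \<beta>) x"
  using assms unfolding simplicial_set_def by blast+

lemma dmap_subset: "dmap X K f \<Longrightarrow> K' \<subseteq> K \<Longrightarrow> dmap X K' f"
  unfolding dmap_def by blast

lemma dmap_agree:
  assumes "dmap X K f" "agree K g f" "fin_complex K"
  shows "dmap X K g"
  unfolding dmap_def
proof (intro allI impI conjI ballI; elim conjE)
  fix n xs m \<alpha> assume a: "length xs = Suc n" "sorted xs" "set xs \<in> K"
  have "xs \<noteq> []" using a(1) by auto
  then have g: "g xs = f xs" using a(2,3) assms(2) unfolding agree_def by blast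
  show "g xs \<in> simplices X n" using dmapD(1)[OF assms(1) a] g by simp
  assume al: "\<alpha> \<in> simplices (Delta n) m"
  have "set (comp_op xs \<alpha>) \<in> K"
    using a(3) assms(3) set_comp_op[OF Delta_lessThan[OF al a(1)]] unfolding fin_complex_def by blast
  moreover have "comp_op xs \<alpha> \<noteq> []" "sorted (comp_op xs \<alpha>)"
    using al sorted_wrt_comp_op[OF a(2) _ Delta_lessThan[OF al a(1)]] by (auto simp: in_Delta)
  ultimately have "g (comp_op xs \<alpha>) = f (comp_op xs \<alpha>)" using assms(2) unfolding agree_def by blast
  then show "g (comp_op xs \<alpha>) = act X n \<alpha> (g xs)" using dmapD(2)[OF assms(1) a al] g by simp
qed

lemma agree_refl: "agree K f f" by (simp add: agree_def)
lemma agree_sym: "agree K f g \<Longrightarrow> agree K g f" by (simp add: agree_def)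
lemma agree_trans: "agree K f g \<Longrightarrow> agree K g h \<Longrightarrow> agree K f h" by (simp add: agree_def)
lemma agree_subset: "agree K f g \<Longrightarrow> K' \<subseteq> K \<Longrightarrow> agree K' f g" by (auto simp: agree_def)

text \<open>A simplex of the union lies entirely in one of the two complexes, so a definition by
  cases respects all operators as soon as \<open>f\<close> and \<open>g\<close> agree on the
  overlap.\<close>

lemma dmap_Un:
  assumes "dmap X K f" "dmap X L g" "agree (K \<inter> L) f g" "fin_complex K" "fin_complex L"
  shows "\<exists>h. dmap X (K \<union> L) h \<and> agree K h f \<and> agree L h g"
proof -
  define h where "h xs = (if set xs \<in> K then f xs else g xs)" for xs
  have 1: "agree K h f" by (simp add: agree_def h_def)
  have 2: "agree L h g" using assms(3) by (simp add: agree_def h_def)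
  have "dmap X (K \<union> L) h"
    using dmap_agree[OF assms(1) 1 assms(4)] dmap_agree[OF assms(2) 2 assms(5)]
    unfolding dmap_def by blast
  with 1 2 show ?thesis by blast
qed

text \<open>Monotonicity is demanded on single faces only, because vertices without a common face
  may be reordered freely. The map \<open>u\<close> may identify vertices; this is how degenerate
  edges enter a diagram.\<close>

lemma dmap_reindex:
  assumes f: "dmap X K f" and u: "\<And>S. S \<in> L \<Longrightarrow> u ` S \<in> K \<and> mono_on S u"
  shows "dmap X L (\<lambda>xs. f (map u xs))"
  unfolding dmap_def
proof (intro allI impI conjI ballI; elim conjE)
  fix n xs m \<alpha> assume a: "length xs = Suc n" "sorted xs" "set xs \<in> L"
  have s: "length (map u xs) = Suc n" "sorted (map u xs)" "set (map u xs) \<in> K"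
    using a u[OF a(3)] by (auto simp: sorted_map mono_on_def intro: sorted_wrt_mono_rel[of _ "(\<le>)"])
  show "f (map u xs) \<in> simplices X n" by (rule dmapD(1)[OF f s])
  assume al: "\<alpha> \<in> simplices (Delta n) m"
  show "f (map u (comp_op xs \<alpha>)) = act X n \<alpha> (f (map u xs))"
    using dmapD(2)[OF f s al] map_comp_op[OF Delta_lessThan[OF al a(1)]] by metis
qed

text \<open>The inverse of the enumeration \<open>sorted_list_of_set \<sigma>\<close>, and so the
  identification of the simplex \<sigma> with a standard simplex. Counting makes it monotone on all
  vertices and computable on explicit sets.\<close>

definition pos :: "'v::linorder set \<Rightarrow> 'v \<Rightarrow> nat" where
  "pos \<sigma> x = card {y\<in>\<sigma>. y < x}"

lemma nth_sorted_list_strict: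
  assumes "finite \<sigma>" "i < j" "j < card \<sigma>"
  shows "sorted_list_of_set \<sigma> ! i < sorted_list_of_set \<sigma> ! j"
  using assms strict_sorted_list_of_set[of \<sigma>] by (simp add: sorted_wrt_iff_nth_less)

lemma pos_nth:
  assumes "finite \<sigma>" "i < card \<sigma>"
  shows "pos \<sigma> (sorted_list_of_set \<sigma> ! i) = i"
proof -
  let ?l = "sorted_list_of_set \<sigma>"
  have "{y\<in>\<sigma>. y < ?l ! i} = (!) ?l ` {..<i}"
  proof (intro equalityI subsetI)
    fix y assume "y \<in> {y\<in>\<sigma>. y < ?l ! i}"
    then have y: "y \<in> set ?l" "y < ?l ! i" using assms(1) by auto
    then obtain j where j: "j < card \<sigma>" "y = ?l ! j" by (metis in_set_conv_nth length_sorted_list_of_set)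
    with y nth_sorted_list_strict[OF assms(1), of i j] have "j < i"
      by (metis less_asym linorder_neqE_nat less_irrefl)
    with j show "y \<in> (!) ?l ` {..<i}" by auto
  next
    fix y assume "y \<in> (!) ?l ` {..<i}"
    then obtain j where "j < i" "y = ?l ! j" by auto
    then show "y \<in> {y\<in>\<sigma>. y < ?l ! i}"
      using nth_sorted_list_strict[OF assms(1), of j i] assms nth_mem[of j ?l] by auto
  qed
  moreover have "inj_on ((!) ?l) {..<i}"
    using assms by (auto intro!: inj_on_nth)
  ultimately show ?thesis unfolding pos_def by (simp add: card_image)
qed

lemma nth_pos:
  assumes "finite \<sigma>" "x \<in> \<sigma>"
  shows "pos \<sigma> x < card \<sigma>" "sorted_list_of_set \<sigma> ! pos \<sigma> x = x"
proof -
  obtain i where i: "i < card \<sigma>" "sorted_list_of_set \<sigma> ! i = x"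
    using assms by (metis in_set_conv_nth length_sorted_list_of_set set_sorted_list_of_set)
  with pos_nth[OF assms(1) i(1)] show "pos \<sigma> x < card \<sigma>" "sorted_list_of_set \<sigma> ! pos \<sigma> x = x" by auto
qed

lemma mono_pos: "finite \<sigma> \<Longrightarrow> x \<le> y \<Longrightarrow> pos \<sigma> x \<le> pos \<sigma> y"
  unfolding pos_def by (rule card_mono) auto

lemma pos_Delta:
  assumes "finite \<sigma>" "card \<sigma> = Suc n" "length xs = Suc m" "sorted xs" "set xs \<subseteq> \<sigma>"
  shows "map (pos \<sigma>) xs \<in> simplices (Delta n) m"
proof -
  have "pos \<sigma> x \<le> n" if "x \<in> set xs" for x using nth_pos(1)[OF assms(1)] that assms by force
  then show ?thesis using assms mono_pos[OF assms(1)]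
    by (auto simp: in_Delta sorted_map intro: sorted_wrt_mono_rel[of _ "(\<le>)"])
qed

lemma comp_op_pos:
  assumes "finite \<sigma>" "set xs \<subseteq> \<sigma>"
  shows "comp_op (sorted_list_of_set \<sigma>) (map (pos \<sigma>) xs) = xs"
  using nth_pos(2)[OF assms(1)] assms(2) by (auto intro!: map_idI simp: subset_iff)

lemma pos_comp_op:
  assumes "finite \<sigma>" "card \<sigma> = Suc n" "\<alpha> \<in> simplices (Delta n) m"
  shows "map (pos \<sigma>) (comp_op (sorted_list_of_set \<sigma>) \<alpha>) = \<alpha>"
  using assms by (auto simp: in_Delta pos_nth subset_iff intro!: map_idI)

lemma sorted_list_comp_op:
  assumes "finite \<sigma>" "card \<sigma> = Suc n" "\<alpha> \<in> simplices (Delta n) m"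
  shows "sorted (comp_op (sorted_list_of_set \<sigma>) \<alpha>)" "set (comp_op (sorted_list_of_set \<sigma>) \<alpha>) \<subseteq> \<sigma>"
    "length (comp_op (sorted_list_of_set \<sigma>) \<alpha>) = Suc m"
  using sorted_wrt_comp_op[of "sorted_list_of_set \<sigma>" \<alpha>] set_comp_op[of \<alpha> "sorted_list_of_set \<sigma>"] assms
  by (auto simp: in_Delta lessThan_Suc_atMost)

text \<open>A list with entries in \<sigma> is the image of its list of positions, so a single
  simplex \<open>s\<close> dictates all values on \<sigma>; condition \<open>c\<close> says that it
  dictates the old ones correctly.\<close>

lemma attach_simplex:
  assumes X: "simplicial_set X" and K: "fin_complex K" and f: "dmap X K f"
    and \<sigma>: "finite \<sigma>" "card \<sigma> = Suc n" and s: "s \<in> simplices X n"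
    and c: "\<And>xs. xs \<noteq> [] \<Longrightarrow> sorted xs \<Longrightarrow> set xs \<subseteq> \<sigma> \<Longrightarrow> set xs \<in> K \<Longrightarrow> f xs = act X n (map (pos \<sigma>) xs) s"
  shows "extensible X K f (K \<union> Pow \<sigma>)"
proof -
  define g where "g xs = (if set xs \<in> K then f xs else act X n (map (pos \<sigma>) xs) s)" for xs
  have ag: "agree K g f" by (simp add: agree_def g_def)
  have P: "g xs = act X n (map (pos \<sigma>) xs) s" if "xs \<noteq> []" "sorted xs" "set xs \<subseteq> \<sigma>" for xs
    using that c by (simp add: g_def)
  have "dmap X (Pow \<sigma>) g"
    unfolding dmap_def
  proof (intro allI impI conjI ballI; elim conjE)
    fix m xs k \<alpha> assume a: "length xs = Suc m" "sorted xs" "set xs \<in> Pow \<sigma>"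
    have q: "map (pos \<sigma>) xs \<in> simplices (Delta n) m" using pos_Delta[OF \<sigma> a(1,2)] a(3) by simp
    have gx: "g xs = act X n (map (pos \<sigma>) xs) s" using P[of xs] a by fastforce
    show "g xs \<in> simplices X m" using gx sset_act(1)[OF X q s] by simp
    assume al: "\<alpha> \<in> simplices (Delta m) k"
    note sub = Delta_lessThan[OF al a(1)]
    have "comp_op xs \<alpha> \<noteq> []" "sorted (comp_op xs \<alpha>)" "set (comp_op xs \<alpha>) \<subseteq> \<sigma>"
      using al sorted_wrt_comp_op[OF a(2) _ sub] set_comp_op[OF sub] a(3) by (auto simp: in_Delta)
    then have "g (comp_op xs \<alpha>) = act X n (map (pos \<sigma>) (comp_op xs \<alpha>)) s" by (rule P)
    also have "map (pos \<sigma>) (comp_op xs \<alpha>) = comp_op (map (pos \<sigma>) xs) \<alpha>" by (rule map_comp_op[OF sub])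
    also have "act X n \<dots> s = act X m \<alpha> (g xs)" using sset_act(3)[OF X q al s] gx by simp
    finally show "g (comp_op xs \<alpha>) = act X m \<alpha> (g xs)" .
  qed
  moreover have "dmap X K g" using dmap_agree[OF f ag K] .
  ultimately have "dmap X (K \<union> Pow \<sigma>) g" unfolding dmap_def by blast
  then show ?thesis using ag unfolding extensible_def by blast
qed

text \<open>\<open>S\<close> is the horn or boundary of \<open>\<Delta>\<^sup>n\<close>, with vertices renamed along the bijection of \<open>{..n}\<close> with \<open>\<sigma>\<close>.\<close>

lemma extend_along_fillable:
  assumes X: "simplicial_set X" and K: "fin_complex K" and f: "dmap X K f"
    and \<sigma>: "finite \<sigma>" "card \<sigma> = Suc n"
    and S: "simplices S = (\<lambda>m. {\<alpha> \<in> simplices (Delta n) m. set (comp_op (sorted_list_of_set \<sigma>) \<alpha>) \<in> K})"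
    and actS: "act S = act (Delta n)"
    and fill: "\<And>h. h \<in> sset_hom S X \<Longrightarrow>
       (\<And>m \<alpha>. \<alpha> \<in> simplices S m \<Longrightarrow> h m \<alpha> = f (comp_op (sorted_list_of_set \<sigma>) \<alpha>)) \<Longrightarrow> fillable X n S h"
  shows "extensible X K f (K \<union> Pow \<sigma>)"
proof -
  let ?l = "sorted_list_of_set \<sigma>"
  define h where "h = sset_map S (\<lambda>m \<alpha>. f (comp_op ?l \<alpha>))"
  have sub: "\<alpha> \<in> simplices (Delta n) m" "set (comp_op ?l \<alpha>) \<in> K" if "\<alpha> \<in> simplices S m" for \<alpha> m
    using that S by auto
  have "h \<in> sset_hom S X"
    unfolding sset_hom_def
  proof (intro CollectI conjI allI ballI)
    fix m
    show "h m \<in> simplices S m \<rightarrow>\<^sub>E simplices X m"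
      unfolding h_def sset_map_def
      using dmapD(1)[OF f _ _ sub(2)] sorted_list_comp_op[OF \<sigma> sub(1)] by fastforce
    fix k \<beta> \<alpha> assume b: "\<beta> \<in> simplices (Delta m) k" and a: "\<alpha> \<in> simplices S m"
    note l = sorted_list_comp_op[OF \<sigma> sub(1)[OF a]]
    have c: "comp_op ?l (comp_op \<alpha> \<beta>) = comp_op (comp_op ?l \<alpha>) \<beta>"
      using comp_op_comp_op[of \<beta> \<alpha> ?l] b sub(1)[OF a] by (fastforce simp: in_Delta)
    have "set (comp_op (comp_op ?l \<alpha>) \<beta>) \<subseteq> set (comp_op ?l \<alpha>)"
      by (rule set_comp_op) (rule Delta_lessThan[OF b l(3)])
    then have "set (comp_op ?l (comp_op \<alpha> \<beta>)) \<in> K"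
      using K sub(2)[OF a] unfolding c fin_complex_def by blast
    then have "comp_op \<alpha> \<beta> \<in> simplices S k"
      using comp_op_Delta[OF sub(1)[OF a] b] unfolding S by blast
    moreover have "f (comp_op ?l (comp_op \<alpha> \<beta>)) = act X m \<beta> (f (comp_op ?l \<alpha>))"
      unfolding c by (rule dmapD(2)[OF f l(3,1) sub(2)[OF a] b])
    ultimately show "h k (act S m \<beta> \<alpha>) = act X m \<beta> (h m \<alpha>)"
      using a by (simp add: h_def sset_map_def actS del: map_map)
  qed
  moreover have hh: "h m \<alpha> = f (comp_op ?l \<alpha>)" if "\<alpha> \<in> simplices S m" for m \<alpha>
    using that by (simp add: h_def sset_map_def)
  ultimately have "fillable X n S h" using fill by blast
  then obtain s where s: "s \<in> simplices X n" "\<And>m \<alpha>. \<alpha> \<in> simplices S m \<Longrightarrow> h m \<alpha> = act X n \<alpha> s"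
    unfolding fillable_def by blast
  show ?thesis
  proof (rule attach_simplex[OF X K f \<sigma> s(1)])
    fix xs assume a: "xs \<noteq> []" "sorted xs" "set xs \<subseteq> \<sigma>" "set xs \<in> K"
    then obtain m where m: "length xs = Suc m" by (cases xs) auto
    have p: "map (pos \<sigma>) xs \<in> simplices S m"
      using pos_Delta[OF \<sigma> m a(2,3)] a(4) unfolding S by (simp only: comp_op_pos[OF \<sigma>(1) a(3)] mem_Collect_eq)
    then show "f xs = act X n (map (pos \<sigma>) xs) s"
      using s(2)[OF p] hh[OF p] comp_op_pos[OF \<sigma>(1) a(3)] by simp
  qed
qed

lemma nth_image_sorted_list:
  assumes "finite \<sigma>" "card \<sigma> = Suc n"
  shows "inj_on ((!) (sorted_list_of_set \<sigma>)) {..n}" "(!) (sorted_list_of_set \<sigma>) ` {..n} = \<sigma>"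
proof -
  show "inj_on ((!) (sorted_list_of_set \<sigma>)) {..n}"
    using assms by (auto intro!: inj_on_nth)
  show "(!) (sorted_list_of_set \<sigma>) ` {..n} = \<sigma>"
    using map_nth[of "sorted_list_of_set \<sigma>"] assms
    by (metis atLeast_upt length_sorted_list_of_set lessThan_Suc_atMost list.set_map
        set_sorted_list_of_set)
qed

text \<open>By \<open>sub\<close>, the old complex meets \<sigma> exactly in the horn at
  \<open>v\<close>: the absent faces are \<sigma> and the one opposite \<open>v\<close>. The
  injective enumeration of \<sigma> turns them into the two vertex sets excluded from the standard
  horn.\<close>

lemma attach_horn:
  assumes X: "simplicial_set X" and K: "fin_complex K" and f: "dmap X K f"
    and \<sigma>: "finite \<sigma>" "card \<sigma> = Suc n" and v: "v \<in> \<sigma>"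
    and sub: "\<And>\<tau>. \<tau> \<subseteq> \<sigma> \<Longrightarrow> \<tau> \<in> K \<longleftrightarrow> \<tau> \<noteq> \<sigma> \<and> \<tau> \<noteq> \<sigma> - {v}"
    and fill: "\<And>h. h \<in> sset_hom (horn n (pos \<sigma> v)) X \<Longrightarrow>
       (\<And>m \<alpha>. \<alpha> \<in> simplices (horn n (pos \<sigma> v)) m \<Longrightarrow> h m \<alpha> = f (comp_op (sorted_list_of_set \<sigma>) \<alpha>)) \<Longrightarrow>
       fillable X n (horn n (pos \<sigma> v)) h"
  shows "extensible X K f (K \<union> Pow \<sigma>)"
proof (rule extend_along_fillable[OF X K f \<sigma>, where S = "horn n (pos \<sigma> v)"])
  let ?l = "sorted_list_of_set \<sigma>"
  note l = nth_image_sorted_list[OF \<sigma>]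
  have i: "pos \<sigma> v \<le> n" "?l ! pos \<sigma> v = v" using nth_pos[OF \<sigma>(1) v] \<sigma>(2) by auto
  have "set (comp_op ?l \<alpha>) \<in> K \<longleftrightarrow> \<not> {..n} \<subseteq> insert (pos \<sigma> v) (set \<alpha>)"
    if "\<alpha> \<in> simplices (Delta n) m" for m \<alpha>
  proof -
    have A: "set \<alpha> \<subseteq> {..n}" using that by (auto simp: in_Delta)
    have 1: "(!) ?l ` set \<alpha> = \<sigma> \<longleftrightarrow> set \<alpha> = {..n}"
      using inj_on_image_eq_iff[OF l(1) A, of "{..n}"] l(2) by simp
    have "(!) ?l ` ({..n} - {pos \<sigma> v}) = \<sigma> - {v}"
      using inj_on_image_set_diff[OF l(1), of "{..n}" "{pos \<sigma> v}"] i l(2) by auto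
    then have 2: "(!) ?l ` set \<alpha> = \<sigma> - {v} \<longleftrightarrow> set \<alpha> = {..n} - {pos \<sigma> v}"
      using inj_on_image_eq_iff[OF l(1) A, of "{..n} - {pos \<sigma> v}"] by auto
    have "set (comp_op ?l \<alpha>) \<subseteq> \<sigma>" using A l(2) by auto
    from sub[OF this] 1 2 have "set (comp_op ?l \<alpha>) \<in> K \<longleftrightarrow> set \<alpha> \<noteq> {..n} \<and> set \<alpha> \<noteq> {..n} - {pos \<sigma> v}"
      by (simp only: set_map)
    also have "\<dots> \<longleftrightarrow> \<not> {..n} \<subseteq> insert (pos \<sigma> v) (set \<alpha>)" using A i(1) by blast
    finally show ?thesis .
  qed
  then show "simplices (horn n (pos \<sigma> v)) = (\<lambda>m. {\<alpha> \<in> simplices (Delta n) m. set (comp_op ?l \<alpha>) \<in> K})"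
    by (auto simp: horn_def simp del: set_map)
  show "act (horn n (pos \<sigma> v)) = act (Delta n)" by (simp add: horn_def)
qed (rule fill)

text \<open>The vertices \<open>x\<close> and \<open>y\<close> on either side of \<open>v\<close>
  put its position strictly between \<open>0\<close> and \<open>n\<close>, which makes the horn
  inner.\<close>

lemma attach_inner_horn:
  assumes C: "quasicategory X" and K: "fin_complex K" and f: "dmap X K f"
    and \<sigma>: "finite \<sigma>" "{x, v, y} \<subseteq> \<sigma>" "x < v" "v < y"
    and sub: "\<And>\<tau>. \<tau> \<subseteq> \<sigma> \<Longrightarrow> \<tau> \<in> K \<longleftrightarrow> \<tau> \<noteq> \<sigma> \<and> \<tau> \<noteq> \<sigma> - {v}"
  shows "extensible X K f (K \<union> Pow \<sigma>)"
proof -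
  have "card \<sigma> \<noteq> 0" using \<sigma> by auto
  then obtain n where n: "card \<sigma> = Suc n" by (metis not0_implies_Suc)
  have v: "v \<in> \<sigma>" using \<sigma> by auto
  have "{z\<in>\<sigma>. z < v} \<subset> {z\<in>\<sigma>. z < y}" using \<sigma> by auto
  then have "pos \<sigma> v < pos \<sigma> y" unfolding pos_def using \<sigma>(1) by (simp add: psubset_card_mono)
  then have "pos \<sigma> v < n" using nth_pos(1)[OF \<sigma>(1), of y] \<sigma> n by auto
  moreover have "0 < pos \<sigma> v" unfolding pos_def using \<sigma> by (auto simp: card_gt_0_iff)
  ultimately show ?thesis
    using C attach_horn[OF _ K f \<sigma>(1) n v sub] unfolding quasicategory_def by blast
qed

text \<open>
  By a theorem of Joyal all equivalences have the following property. Only edges between terminal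
  objects and degenerate edges are needed here, for which there are direct proofs.
\<close>

definition rspecial :: "'a sset \<Rightarrow> 'a \<Rightarrow> bool" where
  "rspecial X e \<longleftrightarrow> (\<forall>n\<ge>2. \<forall>h\<in>sset_hom (horn n n) X. h 1 [n - 1, n] = e \<longrightarrow> fillable X n (horn n n) h)"

text \<open>Here \<open>v\<close> is the last vertex of \<sigma> and \<open>u\<close> the last but
  one, so \<open>[u, v]\<close> is the critical edge of the horn at \<open>v\<close>. The vertex
  \<open>x\<close> forces dimension at least 2; in dimension 1 the horn would not contain that
  edge.\<close>

lemma attach_outer_horn:
  assumes X: "simplicial_set X" and K: "fin_complex K" and f: "dmap X K f"
    and \<sigma>: "finite \<sigma>" "{x, u, v} \<subseteq> \<sigma>" "x < u" "u < v" and uv: "\<And>z. z \<in> \<sigma> \<Longrightarrow> z \<le> u \<or> z = v"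
    and e: "rspecial X (f [u, v])"
    and sub: "\<And>\<tau>. \<tau> \<subseteq> \<sigma> \<Longrightarrow> \<tau> \<in> K \<longleftrightarrow> \<tau> \<noteq> \<sigma> \<and> \<tau> \<noteq> \<sigma> - {v}"
  shows "extensible X K f (K \<union> Pow \<sigma>)"
proof -
  have "card \<sigma> \<noteq> 0" using \<sigma> by auto
  then obtain n where n: "card \<sigma> = Suc n" by (metis not0_implies_Suc)
  have v: "v \<in> \<sigma>" using \<sigma> by auto
  have "{z\<in>\<sigma>. z < v} = \<sigma> - {v}" using \<sigma> uv by fastforce
  then have pv: "pos \<sigma> v = n" unfolding pos_def using \<sigma> n v by simp
  have "{z\<in>\<sigma>. z < u} = \<sigma> - {u, v}" using \<sigma> uv by force
  then have "pos \<sigma> u = card (\<sigma> - {u, v})" unfolding pos_def by (simp only:)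
  also have "\<dots> = card \<sigma> - card {u, v}" using \<sigma> by (intro card_Diff_subset) auto
  also have "card {u, v} = 2" using \<sigma>(4) by simp
  finally have pu: "pos \<sigma> u = n - 1" using n by simp
  have "x \<in> {z\<in>\<sigma>. z < u}" using \<sigma> by auto
  then have "0 < pos \<sigma> u" unfolding pos_def using \<sigma>(1) card_gt_0_iff[of "{z\<in>\<sigma>. z < u}"] by auto
  then have n2: "2 \<le> n" using pu by simp
  let ?l = "sorted_list_of_set \<sigma>"
  have l: "?l ! (n - 1) = u" "?l ! n = v" using nth_pos(2)[OF \<sigma>(1), of u] nth_pos(2)[OF \<sigma>(1) v] \<sigma>(2)
    unfolding pu pv by auto
  have "\<not> {..n} \<subseteq> {n - 1, n}" using n2 by auto
  then have "[n - 1, n] \<in> simplices (horn n n) 1" by (auto simp: horn_def in_Delta)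
  then show ?thesis
    using attach_horn[OF X K f \<sigma>(1) n v sub] e n2 pv l
    unfolding rspecial_def by (metis (no_types, lifting) list.map)
qed

lemma attach_boundary:
  assumes X: "simplicial_set X" and K: "fin_complex K" and f: "dmap X K f"
    and \<sigma>: "finite \<sigma>" "card \<sigma> = Suc n"
    and sub: "\<And>\<tau>. \<tau> \<subseteq> \<sigma> \<Longrightarrow> \<tau> \<in> K \<longleftrightarrow> \<tau> \<noteq> \<sigma>"
    and fill: "\<And>h. h \<in> sset_hom (boundary n) X \<Longrightarrow>
       (\<And>m \<alpha>. \<alpha> \<in> simplices (boundary n) m \<Longrightarrow> h m \<alpha> = f (comp_op (sorted_list_of_set \<sigma>) \<alpha>)) \<Longrightarrow>
       fillable X n (boundary n) h"
  shows "extensible X K f (K \<union> Pow \<sigma>)"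
proof (rule extend_along_fillable[OF X K f \<sigma>, where S = "boundary n"])
  let ?l = "sorted_list_of_set \<sigma>"
  note l = nth_image_sorted_list[OF \<sigma>]
  have "set (comp_op ?l \<alpha>) \<in> K \<longleftrightarrow> \<not> {..n} \<subseteq> set \<alpha>"
    if "\<alpha> \<in> simplices (Delta n) m" for m \<alpha>
  proof -
    have A: "set \<alpha> \<subseteq> {..n}" using that by (auto simp: in_Delta)
    have 1: "(!) ?l ` set \<alpha> = \<sigma> \<longleftrightarrow> set \<alpha> = {..n}"
      using inj_on_image_eq_iff[OF l(1) A, of "{..n}"] l(2) by simp
    have "set (comp_op ?l \<alpha>) \<subseteq> \<sigma>" using A l(2) by auto
    from sub[OF this] 1 show ?thesis using A by auto
  qed
  then show "simplices (boundary n) = (\<lambda>m. {\<alpha> \<in> simplices (Delta n) m. set (comp_op ?l \<alpha>) \<in> K})"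
    by (auto simp: boundary_def simp del: set_map)
  show "act (boundary n) = act (Delta n)" by (simp add: boundary_def)
qed (rule fill)

lemma card_ge_2:
  assumes "finite \<sigma>" "{x, y} \<subseteq> \<sigma>" "x \<noteq> y"
  obtains n where "card \<sigma> = Suc n" "1 \<le> n"
proof -
  have "card {x, y} \<le> card \<sigma>" using assms by (intro card_mono)
  then show ?thesis using that[of "card \<sigma> - 1"] assms(3) by simp
qed

text \<open>The vertex \<open>x\<close> makes the dimension positive, as the definition of
  \<open>terminal\<close> speaks of boundaries from dimension 1 on.\<close>

lemma attach_terminal:
  assumes X: "simplicial_set X" and K: "fin_complex K" and f: "dmap X K f"
    and \<sigma>: "finite \<sigma>" "{x, v} \<subseteq> \<sigma>" "x < v" "\<And>z. z \<in> \<sigma> \<Longrightarrow> z \<le> v" and t: "terminal X (f [v])"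
    and sub: "\<And>\<tau>. \<tau> \<subseteq> \<sigma> \<Longrightarrow> \<tau> \<in> K \<longleftrightarrow> \<tau> \<noteq> \<sigma>"
  shows "extensible X K f (K \<union> Pow \<sigma>)"
proof -
  obtain n where n: "card \<sigma> = Suc n" "1 \<le> n" using card_ge_2[of \<sigma> x v] \<sigma> by auto
  have v: "v \<in> \<sigma>" using \<sigma> by auto
  have "{z\<in>\<sigma>. z < v} = \<sigma> - {v}" using \<sigma>(4) by fastforce
  then have "pos \<sigma> v = n" unfolding pos_def using \<sigma> n v by simp
  then have l: "sorted_list_of_set \<sigma> ! n = v" using nth_pos(2)[OF \<sigma>(1) v] by auto
  have "\<not> {..n} \<subseteq> {n}" using n(2) by auto
  then have "[n] \<in> simplices (boundary n) 0" by (auto simp: boundary_def in_Delta)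
  then show ?thesis
    using attach_boundary[OF X K f \<sigma>(1) n(1) sub] t n l
    unfolding terminal_def by (metis (no_types, lifting) list.map)
qed

lemma attach_initial:
  assumes X: "simplicial_set X" and K: "fin_complex K" and f: "dmap X K f"
    and \<sigma>: "finite \<sigma>" "{x, v} \<subseteq> \<sigma>" "v < x" "\<And>z. z \<in> \<sigma> \<Longrightarrow> v \<le> z" and t: "initial X (f [v])"
    and sub: "\<And>\<tau>. \<tau> \<subseteq> \<sigma> \<Longrightarrow> \<tau> \<in> K \<longleftrightarrow> \<tau> \<noteq> \<sigma>"
  shows "extensible X K f (K \<union> Pow \<sigma>)"
proof -
  obtain n where n: "card \<sigma> = Suc n" "1 \<le> n" using card_ge_2[of \<sigma> x v] \<sigma> by auto
  have v: "v \<in> \<sigma>" using \<sigma> by auto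
  have "{z\<in>\<sigma>. z < v} = {}" using \<sigma>(4) by fastforce
  then have "pos \<sigma> v = 0" unfolding pos_def by (simp only: card.empty)
  then have l: "sorted_list_of_set \<sigma> ! 0 = v" using nth_pos(2)[OF \<sigma>(1) v] by auto
  have "\<not> {..n} \<subseteq> {0}" using n(2) by auto
  then have "[0] \<in> simplices (boundary n) 0" by (auto simp: boundary_def in_Delta)
  then show ?thesis
    using attach_boundary[OF X K f \<sigma>(1) n(1) sub] t n l
    unfolding initial_def by (metis (no_types, lifting) list.map)
qed

section \<open>Attaching many simplices in a suitable order\<close>

lemma fin_complex_Un: "fin_complex K \<Longrightarrow> fin_complex L \<Longrightarrow> fin_complex (K \<union> L)"
  unfolding fin_complex_def by blast

lemma fin_complex_Pow: "finite S \<Longrightarrow> fin_complex (Pow S)"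
  unfolding fin_complex_def by (auto intro: finite_subset)

lemma extensible_refl: "dmap X K f \<Longrightarrow> extensible X K f K"
  unfolding extensible_def using agree_refl by blast

lemma extensible_trans:
  assumes "extensible X K f L" "K \<subseteq> L" "\<And>g. dmap X L g \<Longrightarrow> agree K g f \<Longrightarrow> extensible X L g M"
  shows "extensible X K f M"
  using assms unfolding extensible_def by (meson agree_subset agree_trans)

text \<open>The new simplices are attached in pairs \<open>\<sigma>\<close>, \<open>\<sigma> - {v}\<close>, i.e. along horns.\<close>

lemma extend_pairs:
  assumes K': "fin_complex K'" "finite K'"
    and tog: "\<And>S. S \<in> K' - K \<Longrightarrow> insert v S \<in> K' - K \<and> S - {v} \<in> K' - K"
    and step: "\<And>L f \<sigma>. fin_complex L \<Longrightarrow> K \<subseteq> L \<Longrightarrow> L \<subseteq> K' \<Longrightarrow> dmap X L f \<Longrightarrow> agree K f f0 \<Longrightarrow>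
       \<sigma> \<in> K' - K \<Longrightarrow> v \<in> \<sigma> \<Longrightarrow> (\<And>\<tau>. \<tau> \<subseteq> \<sigma> \<Longrightarrow> \<tau> \<in> L \<longleftrightarrow> \<tau> \<noteq> \<sigma> \<and> \<tau> \<noteq> \<sigma> - {v}) \<Longrightarrow>
       extensible X L f (L \<union> Pow \<sigma>)"
    and K: "fin_complex K" "K \<subseteq> K'" "dmap X K f0"
  shows "extensible X K f0 K'"
proof -
  have "extensible X L f K'" if "fin_complex L" "K \<subseteq> L" "L \<subseteq> K'" "dmap X L f" "agree K f f0"
    "\<And>S. S \<in> K' - L \<Longrightarrow> insert v S \<in> K' - L \<and> S - {v} \<in> K' - L" for L f
    using that
  proof (induction "card (K' - L)" arbitrary: L f rule: less_induct)
    case less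
    show ?case
    proof (cases "K' = L")
      case True then show ?thesis using less.prems extensible_refl by blast
    next
      case False
      \<comment> \<open>The next pair comes from a missing face without \<open>v\<close> of least
        cardinality. If some face of \<sigma> is missing, so is the one obtained by deleting
        \<open>v\<close>, and by minimality that is \<open>\<sigma>0\<close>; hence the old complex
        meets \<sigma> exactly in the horn at \<open>v\<close>.\<close>
      define P where "P S \<longleftrightarrow> S \<in> K' - L \<and> v \<notin> S" for S
      have "\<exists>S. P S" using False less.prems(3,6) unfolding P_def by blast
      then obtain \<sigma>0 where \<sigma>0: "P \<sigma>0" "\<And>S. P S \<Longrightarrow> card \<sigma>0 \<le> card S"
        using ex_has_least_nat[of P _ card] by blast
      define \<sigma> where "\<sigma> = insert v \<sigma>0"
      have s: "\<sigma> - {v} = \<sigma>0" "v \<in> \<sigma>" "\<sigma> \<in> K' - L" "\<sigma>0 \<in> K' - L"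
        using \<sigma>0(1) less.prems(6) unfolding \<sigma>_def P_def by auto
      have fin: "finite \<sigma>" "finite \<sigma>0" "Pow \<sigma> \<subseteq> K'" using s K' unfolding fin_complex_def by auto
      have sub: "\<tau> \<in> L \<longleftrightarrow> \<tau> \<noteq> \<sigma> \<and> \<tau> \<noteq> \<sigma> - {v}" if "\<tau> \<subseteq> \<sigma>" for \<tau>
      proof
        show "\<tau> \<in> L \<Longrightarrow> \<tau> \<noteq> \<sigma> \<and> \<tau> \<noteq> \<sigma> - {v}" using s by auto
        assume n: "\<tau> \<noteq> \<sigma> \<and> \<tau> \<noteq> \<sigma> - {v}"
        show "\<tau> \<in> L"
        proof (rule ccontr)
          assume "\<tau> \<notin> L"
          then have "\<tau> \<in> K' - L" using fin that by auto
          then have "P (\<tau> - {v})" using less.prems(6) unfolding P_def by auto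
          then have "card \<sigma>0 \<le> card (\<tau> - {v})" by (rule \<sigma>0(2))
          moreover have "\<tau> - {v} \<subseteq> \<sigma>0" using that s by auto
          ultimately have "\<tau> - {v} = \<sigma>0" using fin(2) by (metis card_seteq)
          then show False using n s by auto
        qed
      qed
      have ext: "extensible X L f (L \<union> Pow \<sigma>)"
        using step[OF less.prems(1-5) _ s(2) sub] s less.prems(2) by blast
      have eq: "K' - (L \<union> Pow \<sigma>) = K' - L - {\<sigma>, \<sigma>0}"
        using sub s fin by auto
      show ?thesis
      proof (rule extensible_trans[OF ext])
        fix g assume g: "dmap X (L \<union> Pow \<sigma>) g" "agree L g f"
        show "extensible X (L \<union> Pow \<sigma>) g K'"
        proof (rule less.hyps)
          have "finite (K' - L)" using K' by auto
          then show "card (K' - (L \<union> Pow \<sigma>)) < card (K' - L)"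
            unfolding eq using s by (intro psubset_card_mono) auto
          show "fin_complex (L \<union> Pow \<sigma>)"
            using less.prems(1) fin by (intro fin_complex_Un fin_complex_Pow)
          show "agree K g f0" using g less.prems(2,5) by (meson agree_subset agree_trans)
          fix S assume S: "S \<in> K' - (L \<union> Pow \<sigma>)"
          then have "insert v S \<in> K' - L" "S - {v} \<in> K' - L" using less.prems(6)[of S] by auto
          moreover have "insert v S \<noteq> \<sigma>0" "S - {v} \<noteq> \<sigma>" using s by auto
          moreover have "insert v S \<noteq> \<sigma>" "S - {v} \<noteq> \<sigma>0" using S unfolding eq \<sigma>_def by auto
          ultimately show "insert v S \<in> K' - (L \<union> Pow \<sigma>) \<and> S - {v} \<in> K' - (L \<union> Pow \<sigma>)"
            unfolding eq by auto
        qed (use less.prems fin g in auto)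
      qed auto
    qed
  qed
  then show ?thesis using K tog agree_refl by blast
qed

text \<open>Inserting and deleting \<open>v\<close> is a perfect matching of the new faces, as in
  discrete Morse theory. Since every new face has vertices on both sides of \<open>v\<close>, all
  horns that occur are inner.\<close>

lemma extend_toggle_inner:
  assumes "quasicategory X" "dmap X K f" "fin_complex K" "K \<subseteq> K'" "fin_complex K'" "finite K'"
    and "\<And>S. S \<in> K' - K \<Longrightarrow> insert v S \<in> K' - K \<and> S - {v} \<in> K' - K \<and> (\<exists>x\<in>S. x < v) \<and> (\<exists>y\<in>S. v < y)"
  shows "extensible X K f K'"
proof (rule extend_pairs[where v = v])
  fix L g \<sigma>
  assume a: "fin_complex L" "dmap X L g" "\<sigma> \<in> K' - K" "v \<in> \<sigma>"
    "\<And>\<tau>. \<tau> \<subseteq> \<sigma> \<Longrightarrow> \<tau> \<in> L \<longleftrightarrow> \<tau> \<noteq> \<sigma> \<and> \<tau> \<noteq> \<sigma> - {v}"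
  obtain x y where "x \<in> \<sigma>" "x < v" "y \<in> \<sigma>" "v < y" using assms(7)[OF a(3)] by blast
  moreover have "finite \<sigma>" using a(3) assms(5) unfolding fin_complex_def by auto
  ultimately show "extensible X L g (L \<union> Pow \<sigma>)"
    using attach_inner_horn[OF assms(1) a(1,2), of \<sigma> x v y] a by auto
qed (use assms in auto)

text \<open>The same matching at a last vertex \<open>v\<close>: every horn that occurs has the
  critical edge \<open>[u, v]\<close>, whose value is fixed because the edge lies in
  \<open>K\<close>.\<close>

lemma extend_toggle_outer:
  assumes "quasicategory X" "dmap X K f" "fin_complex K" "K \<subseteq> K'" "fin_complex K'" "finite K'"
    and e: "u < v" "{u, v} \<in> K" "rspecial X (f [u, v])"
    and tog: "\<And>S. S \<in> K' - K \<Longrightarrow> insert v S \<in> K' - K \<and> S - {v} \<in> K' - K \<and> u \<in> S \<and> (\<exists>x\<in>S. x < u) \<and>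
       (\<forall>y\<in>S. y \<le> u \<or> y = v)"
  shows "extensible X K f K'"
proof (rule extend_pairs[where v = v])
  fix L g \<sigma>
  assume a: "fin_complex L" "dmap X L g" "agree K g f" "\<sigma> \<in> K' - K" "v \<in> \<sigma>"
    "\<And>\<tau>. \<tau> \<subseteq> \<sigma> \<Longrightarrow> \<tau> \<in> L \<longleftrightarrow> \<tau> \<noteq> \<sigma> \<and> \<tau> \<noteq> \<sigma> - {v}"
  obtain x where "x \<in> \<sigma>" "x < u" using tog[OF a(4)] by blast
  moreover have "finite \<sigma>" using a(4) assms(5) unfolding fin_complex_def by auto
  moreover have "g [u, v] = f [u, v]" using a(3) e unfolding agree_def by auto
  moreover have "simplicial_set X" using assms(1) unfolding quasicategory_def by blast
  ultimately show "extensible X L g (L \<union> Pow \<sigma>)"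
    using attach_outer_horn[OF _ a(1,2), of \<sigma> x u v] a(5,6) e tog[OF a(4)] by auto
qed (use assms in auto)

text \<open>In order of cardinality, each new face finds its whole boundary already present.\<close>

lemma extend_cells:
  assumes K': "fin_complex K'" "finite K'"
    and step: "\<And>L f \<sigma>. fin_complex L \<Longrightarrow> K \<subseteq> L \<Longrightarrow> L \<subseteq> K' \<Longrightarrow> dmap X L f \<Longrightarrow> agree K f f0 \<Longrightarrow>
       \<sigma> \<in> K' - K \<Longrightarrow> (\<And>\<tau>. \<tau> \<subseteq> \<sigma> \<Longrightarrow> \<tau> \<in> L \<longleftrightarrow> \<tau> \<noteq> \<sigma>) \<Longrightarrow> extensible X L f (L \<union> Pow \<sigma>)"
    and K: "fin_complex K" "K \<subseteq> K'" "dmap X K f0"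
  shows "extensible X K f0 K'"
proof -
  have "extensible X L f K'" if "fin_complex L" "K \<subseteq> L" "L \<subseteq> K'" "dmap X L f" "agree K f f0" for L f
    using that
  proof (induction "card (K' - L)" arbitrary: L f rule: less_induct)
    case less
    show ?case
    proof (cases "K' = L")
      case True then show ?thesis using less.prems extensible_refl by blast
    next
      case False
      then have "\<exists>S. S \<in> K' - L" using less.prems(3) by blast
      then obtain \<sigma> where \<sigma>: "\<sigma> \<in> K' - L" "\<And>S. S \<in> K' - L \<Longrightarrow> card \<sigma> \<le> card S"
        using ex_has_least_nat[of "\<lambda>S. S \<in> K' - L" _ card] by blast
      have fin: "finite \<sigma>" "Pow \<sigma> \<subseteq> K'" using \<sigma>(1) K' unfolding fin_complex_def by auto
      have sub: "\<tau> \<in> L \<longleftrightarrow> \<tau> \<noteq> \<sigma>" if "\<tau> \<subseteq> \<sigma>" for \<tau>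
        using \<sigma> fin that by (metis DiffE DiffI PowI card_seteq subsetD)
      have ext: "extensible X L f (L \<union> Pow \<sigma>)"
        using step[OF less.prems(1-5) _ sub] \<sigma>(1) less.prems(2) by blast
      show ?thesis
      proof (rule extensible_trans[OF ext])
        fix g assume g: "dmap X (L \<union> Pow \<sigma>) g" "agree L g f"
        show "extensible X (L \<union> Pow \<sigma>) g K'"
        proof (rule less.hyps)
          have "finite (K' - L)" using K' by auto
          then show "card (K' - (L \<union> Pow \<sigma>)) < card (K' - L)"
            using \<sigma>(1) by (intro psubset_card_mono) auto
          show "fin_complex (L \<union> Pow \<sigma>)"
            using less.prems(1) fin by (intro fin_complex_Un fin_complex_Pow)
          show "agree K g f0" using g less.prems(2,5) by (meson agree_subset agree_trans)
        qed (use less.prems fin g in auto)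
      qed auto
    qed
  qed
  then show ?thesis using K agree_refl by blast
qed

lemma extend_terminal:
  assumes "simplicial_set X" "dmap X K f" "fin_complex K" "K \<subseteq> K'" "fin_complex K'" "finite K'"
    and e: "{v} \<in> K" "terminal X (f [v])"
    and tog: "\<And>S. S \<in> K' - K \<Longrightarrow> v \<in> S \<and> (\<exists>x\<in>S. x < v) \<and> (\<forall>y\<in>S. y \<le> v)"
  shows "extensible X K f K'"
proof (rule extend_cells)
  fix L g \<sigma>
  assume a: "fin_complex L" "dmap X L g" "agree K g f" "\<sigma> \<in> K' - K"
    "\<And>\<tau>. \<tau> \<subseteq> \<sigma> \<Longrightarrow> \<tau> \<in> L \<longleftrightarrow> \<tau> \<noteq> \<sigma>"
  obtain x where "x \<in> \<sigma>" "x < v" using tog[OF a(4)] by blast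
  moreover have "finite \<sigma>" using a(4) assms(5) unfolding fin_complex_def by auto
  moreover have "g [v] = f [v]" using a(3) e unfolding agree_def by auto
  ultimately show "extensible X L g (L \<union> Pow \<sigma>)"
    using attach_terminal[OF assms(1) a(1,2), of \<sigma> x v] a(5) e tog[OF a(4)] by auto
qed (use assms in auto)

lemma extend_initial:
  assumes "simplicial_set X" "dmap X K f" "fin_complex K" "K \<subseteq> K'" "fin_complex K'" "finite K'"
    and e: "{v} \<in> K" "initial X (f [v])"
    and tog: "\<And>S. S \<in> K' - K \<Longrightarrow> v \<in> S \<and> (\<exists>x\<in>S. v < x) \<and> (\<forall>y\<in>S. v \<le> y)"
  shows "extensible X K f K'"
proof (rule extend_cells)
  fix L g \<sigma>
  assume a: "fin_complex L" "dmap X L g" "agree K g f" "\<sigma> \<in> K' - K"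
    "\<And>\<tau>. \<tau> \<subseteq> \<sigma> \<Longrightarrow> \<tau> \<in> L \<longleftrightarrow> \<tau> \<noteq> \<sigma>"
  obtain x where "x \<in> \<sigma>" "v < x" using tog[OF a(4)] by blast
  moreover have "finite \<sigma>" using a(4) assms(5) unfolding fin_complex_def by auto
  moreover have "g [v] = f [v]" using a(3) e unfolding agree_def by auto
  ultimately show "extensible X L g (L \<union> Pow \<sigma>)"
    using attach_initial[OF assms(1) a(1,2), of \<sigma> x v] a(5) e tog[OF a(4)] by auto
qed (use assms in auto)

section \<open>Limit cones on ordered complexes\<close>

definition joinc :: "'v set set \<Rightarrow> 'v set set \<Rightarrow> 'v set set" where
  "joinc K L = {S \<union> T |S T. S \<in> K \<and> T \<in> L}"

text \<open>
  A boundary in the slice over \<open>A\<close> whose last vertex is the cone \<open>f\<close> with apex \<open>b\<close> is a map on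
  \<open>\<partial>\<Delta>\<^sup>n \<star> A\<close>, where \<open>\<Delta>\<^sup>n\<close> has the vertices \<open>\<rho> \<union> {b}\<close>: the following says that \<open>f\<close> is terminal.
\<close>

definition lim_cone :: "'a sset \<Rightarrow> 'v::linorder set set \<Rightarrow> 'v \<Rightarrow> ('v list \<Rightarrow> 'a) \<Rightarrow> bool" where
  "lim_cone X A b f \<longleftrightarrow> (\<forall>\<rho> g. finite \<rho> \<longrightarrow> \<rho> \<noteq> {} \<longrightarrow> (\<forall>x\<in>\<rho>. x < b) \<longrightarrow>
     dmap X (joinc (Pow (insert b \<rho>) - {insert b \<rho>}) A) g \<longrightarrow>
     agree (joinc (Pow {b}) A) g f \<longrightarrow>
     extensible X (joinc (Pow (insert b \<rho>) - {insert b \<rho>}) A) g (joinc (Pow (insert b \<rho>)) A))"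

lemma lim_coneD:
  assumes "lim_cone X A b f" "finite \<rho>" "\<rho> \<noteq> {}" "\<forall>x\<in>\<rho>. x < b"
    and "dmap X (joinc (Pow (insert b \<rho>) - {insert b \<rho>}) A) g" "agree (joinc (Pow {b}) A) g f"
  shows "extensible X (joinc (Pow (insert b \<rho>) - {insert b \<rho>}) A) g (joinc (Pow (insert b \<rho>)) A)"
  using assms unfolding lim_cone_def by blast

lemma joincI: "S \<in> K \<Longrightarrow> T \<in> L \<Longrightarrow> S \<union> T \<in> joinc K L"
  unfolding joinc_def by blast

lemma fin_complex_joinc: "fin_complex K \<Longrightarrow> fin_complex L \<Longrightarrow> fin_complex (joinc K L)"
  unfolding fin_complex_def joinc_def
proof (intro ballI conjI)
  assume a: "\<forall>S\<in>K. finite S \<and> Pow S \<subseteq> K" "\<forall>S\<in>L. finite S \<and> Pow S \<subseteq> L"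
  fix U assume "U \<in> {S \<union> T |S T. S \<in> K \<and> T \<in> L}"
  then obtain S T where U: "U = S \<union> T" "S \<in> K" "T \<in> L" by auto
  then show "finite U" using a by auto
  show "Pow U \<subseteq> {S \<union> T |S T. S \<in> K \<and> T \<in> L}"
  proof
    fix V assume "V \<in> Pow U"
    then have "V = (V \<inter> S) \<union> (V \<inter> T)" "V \<inter> S \<in> K" "V \<inter> T \<in> L" using U a by auto
    then show "V \<in> {S \<union> T |S T. S \<in> K \<and> T \<in> L}" by blast
  qed
qed

text \<open>The new faces split into blocks, each consisting of the unions of a fixed set
  \<open>insert b \<rho>\<close> with the faces of \<open>A\<close>; condition \<open>cl\<close>
  says that a block is new as a whole. For a block with \<rho> of least cardinality, the old part is
  the boundary of \<open>insert b \<rho>\<close> joined with \<open>A\<close>, and this is the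
  extension problem that \<open>lim_cone\<close> solves.\<close>

lemma extend_limit:
  assumes f0: "dmap X K f0" "fin_complex K" "K \<subseteq> K'" and K': "fin_complex K'" "finite K'"
    and A: "fin_complex A" "\<And>T x. T \<in> A \<Longrightarrow> x \<in> T \<Longrightarrow> b < x"
    and lim: "lim_cone X A b f0" and bA: "joinc (Pow {b}) A \<subseteq> K"
    and new: "\<And>S. S \<in> K' - K \<Longrightarrow> b \<in> S \<and> (\<exists>x\<in>S. x < b) \<and> {x\<in>S. b < x} \<in> A"
    and cl: "\<And>S T. S \<in> K' - K \<Longrightarrow> T \<in> A \<Longrightarrow> {x\<in>S. x \<le> b} \<union> T \<in> K' - K"
  shows "extensible X K f0 K'"
proof -
  have "extensible X L f K'" if "fin_complex L" "K \<subseteq> L" "L \<subseteq> K'" "dmap X L f" "agree K f f0"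
    "\<And>S T. S \<in> K' - L \<Longrightarrow> T \<in> A \<Longrightarrow> {x\<in>S. x \<le> b} \<union> T \<in> K' - L" for L f
    using that
  proof (induction "card (K' - L)" arbitrary: L f rule: less_induct)
    case less
    show ?case
    proof (cases "K' = L")
      case True then show ?thesis using less.prems extensible_refl by blast
    next
      case False
      then have "\<exists>S. S \<in> K' - L" using less.prems(3) by blast
      then obtain S where S: "S \<in> K' - L"
        and Smin: "\<And>T. T \<in> K' - L \<Longrightarrow> card {x\<in>S. x \<le> b} \<le> card {x\<in>T. x \<le> b}"
        using ex_has_least_nat[of "\<lambda>S. S \<in> K' - L" _ "\<lambda>S. card {x\<in>S. x \<le> b}"] by blast
      define \<rho> where "\<rho> = {x\<in>S. x < b}"
      have newL: "b \<in> S \<and> (\<exists>x\<in>S. x < b) \<and> {x\<in>S. b < x} \<in> A" if "S \<in> K' - L" for S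
        using new[of S] that less.prems(2) by auto
      have finS: "finite S" using S K' unfolding fin_complex_def by auto
      have br: "{x\<in>S. x \<le> b} = insert b \<rho>" using newL[OF S] unfolding \<rho>_def by auto
      have \<rho>: "finite \<rho>" "\<rho> \<noteq> {}" "\<forall>x\<in>\<rho>. x < b" using newL[OF S] finS unfolding \<rho>_def by auto
      let ?B = "joinc (Pow (insert b \<rho>) - {insert b \<rho>}) A"
      let ?F = "joinc (Pow (insert b \<rho>)) A"
      have notL: "insert b \<rho> \<union> T \<in> K' - L" if "T \<in> A" for T
        using less.prems(6)[OF S that] br by simp
      have fl: "fin_complex ?F" using A \<rho> by (intro fin_complex_joinc fin_complex_Pow) auto
      have FK: "?F \<subseteq> K'"
      proof
        fix U assume "U \<in> ?F"
        then obtain V T where "U = V \<union> T" "V \<subseteq> insert b \<rho>" "T \<in> A" unfolding joinc_def by auto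
        moreover from this have "insert b \<rho> \<union> T \<in> K'" using notL[of T] by blast
        ultimately show "U \<in> K'" using K'(1) unfolding fin_complex_def by (metis PowI Un_mono order_refl subsetD)
      qed
      have low: "{x\<in>V \<union> T. x \<le> b} = V" if "V \<subseteq> insert b \<rho>" "T \<in> A" for V T
        using that A(2) \<rho>(3) by fastforce
      have BL: "?B \<subseteq> L"
      proof
        fix U assume "U \<in> ?B"
        then obtain V T where U: "U = V \<union> T" "V \<subseteq> insert b \<rho>" "V \<noteq> insert b \<rho>" "T \<in> A"
          unfolding joinc_def by auto
        show "U \<in> L"
        proof (rule ccontr)
          assume "U \<notin> L"
          moreover have "U \<in> ?F" using U unfolding joinc_def by auto
          ultimately have "U \<in> K' - L" using FK by auto
          then have "card (insert b \<rho>) \<le> card V" using Smin[of U] low[OF U(2,4)] br U(1) by simp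
          then show False using U(2,3) \<rho>(1) card_seteq[of "insert b \<rho>" V] by auto
        qed
      qed
      have FL: "?F \<inter> L = ?B"
      proof
        show "?F \<inter> L \<subseteq> ?B"
        proof
          fix U assume U: "U \<in> ?F \<inter> L"
          then obtain V T where U': "U = V \<union> T" "V \<subseteq> insert b \<rho>" "T \<in> A" unfolding joinc_def by auto
          moreover have "V \<noteq> insert b \<rho>" using notL U U' by auto
          ultimately show "U \<in> ?B" unfolding joinc_def by blast
        qed
        show "?B \<subseteq> ?F \<inter> L" using BL unfolding joinc_def by blast
      qed
      have "dmap X ?B f" using less.prems(4) BL dmap_subset by blast
      moreover have "agree (joinc (Pow {b}) A) f f0" using less.prems(5) bA agree_subset by blast
      ultimately have "extensible X ?B f ?F" by (rule lim_coneD[OF lim \<rho>])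
      then obtain h where h: "dmap X ?F h" "agree ?B h f" unfolding extensible_def by blast
      have "agree (?F \<inter> L) h f" unfolding FL by (rule h(2))
      from dmap_Un[OF h(1) less.prems(4) this fl less.prems(1)]
      have ext: "extensible X L f (L \<union> ?F)" unfolding extensible_def by (metis Un_commute)
      show ?thesis
      proof (rule extensible_trans[OF ext])
        fix g assume g: "dmap X (L \<union> ?F) g" "agree L g f"
        show "extensible X (L \<union> ?F) g K'"
        proof (rule less.hyps)
          have "finite (K' - L)" using K' by auto
          moreover have "S = insert b \<rho> \<union> {x\<in>S. b < x}" using newL[OF S] unfolding \<rho>_def by auto
          then have "S \<in> ?F" using newL[OF S] joincI[of "insert b \<rho>" "Pow (insert b \<rho>)" _ A] by force
          ultimately show "card (K' - (L \<union> ?F)) < card (K' - L)"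
            using S by (intro psubset_card_mono) auto
          show "fin_complex (L \<union> ?F)" using less.prems(1) fl by (rule fin_complex_Un)
          show "agree K g f0" using g less.prems(2,5) by (meson agree_subset agree_trans)
          fix U T assume U: "U \<in> K' - (L \<union> ?F)" and T: "T \<in> A"
          have "{x\<in>U. x \<le> b} \<union> T \<notin> ?F"
          proof
            assume "{x\<in>U. x \<le> b} \<union> T \<in> ?F"
            then obtain V T' where e: "{x\<in>U. x \<le> b} \<union> T = V \<union> T'" and V: "V \<subseteq> insert b \<rho>" "T' \<in> A"
              unfolding joinc_def by auto
            have "{x\<in>U. x \<le> b} = {x\<in>{x\<in>U. x \<le> b} \<union> T. x \<le> b}" using A(2)[OF T] by fastforce
            also have "\<dots> = V" unfolding e by (rule low[OF V])
            finally have eq: "U = V \<union> {x\<in>U. b < x}" by auto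
            have "{x\<in>U. b < x} \<in> A" using newL[of U] U by auto
            then have "U \<in> ?F" using V(1) by (subst eq) (auto intro: joincI)
            then show False using U by auto
          qed
          then show "{x\<in>U. x \<le> b} \<union> T \<in> K' - (L \<union> ?F)" using less.prems(6)[of U T] U T by auto
        qed (use less.prems fl FK g in auto)
      qed auto
    qed
  qed
  then show ?thesis using f0 cl agree_refl by blast
qed

section \<open>Finite families of chains\<close>

text \<open>
  Complexes are described by lists of chains, so that the conditions under which a map can be extended
  from one complex to another are decided by evaluation.
\<close>

definition infam :: "int list list \<Rightarrow> int list \<Rightarrow> bool" where
  "infam cs xs \<longleftrightarrow> (\<exists>c\<in>set cs. set xs \<subseteq> set c)"

text \<open>\<open>fam []\<close> has no face at all, whereas \<open>fam [[]]\<close> has the empty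
  one. In the stages of the next section, an empty list for \<sigma> therefore means that \<sigma>
  itself is still absent.\<close>

definition fam :: "int list list \<Rightarrow> int set set" where
  "fam cs = {S. \<exists>c\<in>set cs. S \<subseteq> set c}"

definition sub_ok :: "int list list \<Rightarrow> int list list \<Rightarrow> bool" where
  "sub_ok cs cs' \<longleftrightarrow> (\<forall>c\<in>set cs. infam cs' c)"

text \<open>Running through \<open>subseqs\<close> covers all faces of the larger complex; the new
  ones must be matched by toggling \<open>v\<close>. Only the vertex above \<open>v\<close> is
  tested. The one below is provided by a simplex with labels \<open>\<le> 0\<close>, or tested
  separately by \<open>lower_ok\<close>.\<close>

definition toggle_ok :: "int \<Rightarrow> int list list \<Rightarrow> int list list \<Rightarrow> bool" where
  "toggle_ok v cs cs' \<longleftrightarrow> (\<forall>c\<in>set cs'. \<forall>xs\<in>set (subseqs c). infam cs xs \<or>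
     infam cs' (v # xs) \<and> \<not> infam cs (removeAll v xs) \<and> (\<exists>y\<in>set xs. v < y))"

definition outer_ok :: "int \<Rightarrow> int \<Rightarrow> int list list \<Rightarrow> int list list \<Rightarrow> bool" where
  "outer_ok u v cs cs' \<longleftrightarrow> (\<forall>c\<in>set cs'. \<forall>xs\<in>set (subseqs c). infam cs xs \<or>
     infam cs' (v # xs) \<and> \<not> infam cs (removeAll v xs) \<and> u \<in> set xs \<and> (\<forall>y\<in>set xs. y \<le> u \<or> y = v))"

definition terminal_ok :: "int \<Rightarrow> int list list \<Rightarrow> int list list \<Rightarrow> bool" where
  "terminal_ok v cs cs' \<longleftrightarrow> (\<forall>c\<in>set cs'. \<forall>xs\<in>set (subseqs c). infam cs xs \<or>
     v \<in> set xs \<and> (\<forall>y\<in>set xs. y \<le> v))"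

text \<open>The third conjunct tests only the part of a face up to \<open>b\<close>: if that part is
  absent from \<open>cs\<close>, so is every face containing it, and the whole block over it is
  new.\<close>

definition lim_ok :: "int list list \<Rightarrow> int \<Rightarrow> int list list \<Rightarrow> int list list \<Rightarrow> bool" where
  "lim_ok as b cs cs' \<longleftrightarrow> (\<forall>c\<in>set cs'. \<forall>xs\<in>set (subseqs c). infam cs xs \<or>
     b \<in> set xs \<and> infam as (filter (\<lambda>x. b < x) xs) \<and>
     \<not> infam cs (filter (\<lambda>x. x \<le> b) xs) \<and>
     (\<forall>a\<in>set as. infam cs' (filter (\<lambda>x. x \<le> b) xs @ a)))"

definition lower_ok :: "int \<Rightarrow> int list list \<Rightarrow> int list list \<Rightarrow> bool" where
  "lower_ok v cs cs' \<longleftrightarrow> (\<forall>c\<in>set cs'. \<forall>xs\<in>set (subseqs c). infam cs xs \<or> (\<exists>y\<in>set xs. y < v))"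

lemma infam_iff: "infam cs xs \<longleftrightarrow> set xs \<in> fam cs"
  by (simp add: infam_def fam_def)

lemma fin_complex_fam: "fin_complex (fam cs)"
  unfolding fin_complex_def fam_def by (auto intro: finite_subset)

lemma finite_fam: "finite (fam cs)"
proof -
  have "fam cs = (\<Union>c\<in>set cs. Pow (set c))" by (auto simp: fam_def)
  then show ?thesis by simp
qed

lemma fam_subset: "S \<in> fam cs \<Longrightarrow> T \<subseteq> S \<Longrightarrow> T \<in> fam cs"
  by (auto simp: fam_def)

lemma sub_okD: "sub_ok cs cs' \<Longrightarrow> fam cs \<subseteq> fam cs'"
  unfolding sub_ok_def infam_def fam_def by blast

lemma ball_fam:
  assumes "\<forall>c\<in>set cs'. \<forall>xs\<in>set (subseqs c). infam cs xs \<or> P xs" "S \<in> fam cs' - fam cs"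
  obtains xs where "set xs = S" "P xs"
proof -
  obtain c where c: "c \<in> set cs'" "S \<subseteq> set c" using assms(2) by (auto simp: fam_def)
  then obtain xs where xs: "xs \<in> set (subseqs c)" "set xs = S"
    by (metis (no_types, lifting) PowI image_iff subseqs_powset)
  then show ?thesis using assms c that by (auto simp: infam_iff)
qed

lemma toggle_okD:
  assumes "toggle_ok v cs cs'" "S \<in> fam cs' - fam cs"
  shows "insert v S \<in> fam cs' - fam cs \<and> S - {v} \<in> fam cs' - fam cs \<and> (\<exists>y\<in>S. v < y)"
proof -
  obtain xs where "set xs = S" "infam cs' (v # xs) \<and> \<not> infam cs (removeAll v xs) \<and> (\<exists>y\<in>set xs. v < y)"
    using ball_fam[OF assms(1)[unfolded toggle_ok_def] assms(2)] .
  then show ?thesis using assms(2) fam_subset[of S cs' "S - {v}"] fam_subset[of "insert v S" cs S]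
    by (auto simp: infam_iff)
qed

lemma outer_okD:
  assumes "outer_ok u v cs cs'" "S \<in> fam cs' - fam cs"
  shows "insert v S \<in> fam cs' - fam cs \<and> S - {v} \<in> fam cs' - fam cs \<and> u \<in> S \<and> (\<forall>y\<in>S. y \<le> u \<or> y = v)"
proof -
  obtain xs where "set xs = S" "infam cs' (v # xs) \<and> \<not> infam cs (removeAll v xs) \<and> u \<in> set xs \<and>
      (\<forall>y\<in>set xs. y \<le> u \<or> y = v)"
    using ball_fam[OF assms(1)[unfolded outer_ok_def] assms(2)] .
  then show ?thesis using assms(2) fam_subset[of S cs' "S - {v}"] fam_subset[of "insert v S" cs S]
    by (auto simp: infam_iff)
qed

lemma terminal_okD:
  assumes "terminal_ok v cs cs'" "S \<in> fam cs' - fam cs"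
  shows "v \<in> S \<and> (\<forall>y\<in>S. y \<le> v)"
proof -
  obtain xs where "set xs = S" "v \<in> set xs \<and> (\<forall>y\<in>set xs. y \<le> v)"
    by (rule ball_fam[OF assms(1)[unfolded terminal_ok_def] assms(2)])
  then show ?thesis by auto
qed

lemma lower_okD:
  assumes "lower_ok v cs cs'" "S \<in> fam cs' - fam cs"
  shows "\<exists>y\<in>S. y < v"
proof -
  obtain xs where "set xs = S" "\<exists>y\<in>set xs. y < v"
    by (rule ball_fam[OF assms(1)[unfolded lower_ok_def] assms(2)])
  then show ?thesis by auto
qed

lemma lim_okD:
  assumes "lim_ok as b cs cs'" "S \<in> fam cs' - fam cs"
  shows "b \<in> S \<and> {x\<in>S. b < x} \<in> fam as \<and> (\<forall>T\<in>fam as. {x\<in>S. x \<le> b} \<union> T \<in> fam cs' - fam cs)"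
proof -
  obtain xs where xs: "set xs = S" "b \<in> set xs \<and> infam as (filter (\<lambda>x. b < x) xs) \<and>
     \<not> infam cs (filter (\<lambda>x. x \<le> b) xs) \<and> (\<forall>a\<in>set as. infam cs' (filter (\<lambda>x. x \<le> b) xs @ a))"
    using ball_fam[OF assms(1)[unfolded lim_ok_def] assms(2)] .
  have "{x\<in>S. x \<le> b} \<union> T \<in> fam cs' - fam cs" if Ta: "T \<in> fam as" for T
  proof
    obtain a where a: "a \<in> set as" "T \<subseteq> set a" using Ta unfolding fam_def by blast
    then have "{x\<in>S. x \<le> b} \<union> set a \<in> fam cs'" using xs by (auto simp: infam_iff)
    then show "{x\<in>S. x \<le> b} \<union> T \<in> fam cs'" using a by (auto elim: fam_subset)
    show "{x\<in>S. x \<le> b} \<union> T \<notin> fam cs"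
      using xs fam_subset[of "{x\<in>S. x \<le> b} \<union> T" cs "{x\<in>S. x \<le> b}"] by (auto simp: infam_iff)
  qed
  then show ?thesis using xs by (auto simp: infam_iff)
qed

lemma toggle_fam:
  assumes "quasicategory X" "dmap X (fam cs) f" "sub_ok cs cs'" "toggle_ok v cs cs'" "lower_ok v cs cs'"
  shows "extensible X (fam cs) f (fam cs')"
  by (rule extend_toggle_inner[OF assms(1,2) fin_complex_fam sub_okD[OF assms(3)] fin_complex_fam finite_fam])
    (use toggle_okD[OF assms(4)] lower_okD[OF assms(5)] in blast)

lemma outer_fam:
  assumes "quasicategory X" "dmap X (fam cs) f" "sub_ok cs cs'" "outer_ok u v cs cs'" "lower_ok u cs cs'"
    and "u < v" "infam cs [u, v]" "rspecial X (f [u, v])"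
  shows "extensible X (fam cs) f (fam cs')"
  by (rule extend_toggle_outer[OF assms(1,2) fin_complex_fam sub_okD[OF assms(3)] fin_complex_fam finite_fam
        assms(6) _ assms(8)])
    (use assms(7) outer_okD[OF assms(4)] lower_okD[OF assms(5)] in \<open>auto simp: infam_iff\<close>)

lemma terminal_fam:
  assumes "simplicial_set X" "dmap X (fam cs) f" "sub_ok cs cs'" "terminal_ok v cs cs'" "lower_ok v cs cs'"
    and "infam cs [v]" "terminal X (f [v])"
  shows "extensible X (fam cs) f (fam cs')"
  by (rule extend_terminal[OF assms(1,2) fin_complex_fam sub_okD[OF assms(3)] fin_complex_fam finite_fam
        _ assms(7)])
    (use assms(6) terminal_okD[OF assms(4)] lower_okD[OF assms(5)] in \<open>auto simp: infam_iff\<close>)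

lemma joinc_fam:
  assumes "\<forall>a\<in>set as. infam cs (b # a)"
  shows "joinc (Pow {b}) (fam as) \<subseteq> fam cs"
  using assms by (fastforce simp: joinc_def fam_def infam_def)

lemma lim_fam:
  assumes "dmap X (fam cs) f" "sub_ok cs cs'" "lim_ok as b cs cs'" "lower_ok b cs cs'"
    and as: "\<forall>a\<in>set as. infam cs (b # a) \<and> (\<forall>x\<in>set a. b < x)" and l: "lim_cone X (fam as) b f"
  shows "extensible X (fam cs) f (fam cs')"
proof (rule extend_limit[OF assms(1) fin_complex_fam sub_okD[OF assms(2)] fin_complex_fam finite_fam
        fin_complex_fam _ l])
  show "joinc (Pow {b}) (fam as) \<subseteq> fam cs" using as by (intro joinc_fam) auto
  show "T \<in> fam as \<Longrightarrow> x \<in> T \<Longrightarrow> b < x" for T x using as by (auto simp: fam_def)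
qed (use lim_okD[OF assms(3)] lower_okD[OF assms(4)] in auto)

section \<open>Extension over joins\<close>

text \<open>
  Vertices \<open>\<le> 0\<close> belong to a simplex \<open>\<sigma>\<close> and positive ones to the base of a cone. At a stage \<open>jfam \<sigma> B vs ts us\<close>
  of an extension, the face \<open>B\<close> is joined to \<open>vs\<close>, the proper faces of \<open>\<sigma>\<close> to \<open>ts\<close>, and \<open>\<sigma>\<close> itself to \<open>us\<close>.
\<close>

definition low :: "int set \<Rightarrow> int set" where "low S = S \<inter> {..0}"
definition up :: "int set \<Rightarrow> int set" where "up S = S \<inter> {0<..}"

definition jfam :: "int set \<Rightarrow> int set \<Rightarrow> int list list \<Rightarrow> int list list \<Rightarrow> int list list \<Rightarrow> int set set" where
  "jfam \<sigma> B vs ts us = {S. low S \<subseteq> \<sigma> \<and>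
     (low S \<subseteq> B \<and> up S \<in> fam vs \<or> low S \<noteq> \<sigma> \<and> up S \<in> fam ts \<or> up S \<in> fam us)}"

text \<open>The map \<open>g\<close> varies, and only its restriction to the base is tied to
  \<open>f\<close>. Fillings obtained at one stage can thus be fed into the next, while properties
  of edges and cones are stated once, for \<open>f\<close>.\<close>

definition jext :: "'a sset \<Rightarrow> int set \<Rightarrow> int set \<Rightarrow> int list list \<Rightarrow> (int list \<Rightarrow> 'a) \<Rightarrow>
    int list list \<Rightarrow> int list list \<Rightarrow> int list list \<Rightarrow> int list list \<Rightarrow> bool" where
  "jext X \<sigma> B vs f ts us ts' us' \<longleftrightarrow>
     jfam \<sigma> B vs ts us \<subseteq> jfam \<sigma> B vs ts' us' \<and> sub_ok us' ts' \<and>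
     (\<forall>g. dmap X (jfam \<sigma> B vs ts us) g \<longrightarrow> agree (joinc (Pow B) (fam vs)) g f \<longrightarrow>
        extensible X (jfam \<sigma> B vs ts us) g (jfam \<sigma> B vs ts' us'))"

definition jbase :: "int set \<Rightarrow> int set \<Rightarrow> int list list \<Rightarrow> bool" where
  "jbase \<sigma> B vs \<longleftrightarrow> finite \<sigma> \<and> \<sigma> \<subseteq> {..0} \<and> B \<subset> \<sigma> \<and> (\<forall>v\<in>set vs. \<forall>x\<in>set v. 0 < x)"

definition stage_ok where
  "stage_ok vs ts us ts' us' \<longleftrightarrow>
     sub_ok us ts \<and> sub_ok us' ts' \<and> sub_ok ts ts' \<and> sub_ok us us' \<and> sub_ok ts' vs"

lemma low_up: "S = low S \<union> up S" "low S \<inter> up S = {}" "finite S \<longleftrightarrow> finite (low S) \<and> finite (up S)"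
proof -
  show a: "S = low S \<union> up S" "low S \<inter> up S = {}" by (auto simp: low_def up_def)
  show "finite S \<longleftrightarrow> finite (low S) \<and> finite (up S)" using a(1) by (metis finite_Un)
qed

lemma low_Un: "L \<subseteq> {..0} \<Longrightarrow> U \<subseteq> {0<..} \<Longrightarrow> low (L \<union> U) = L"
  and up_Un: "L \<subseteq> {..0} \<Longrightarrow> U \<subseteq> {0<..} \<Longrightarrow> up (L \<union> U) = U"
  by (auto simp: low_def up_def)

lemma fam_pos: "\<forall>v\<in>set vs. \<forall>x\<in>set v. 0 < x \<Longrightarrow> S \<in> fam vs \<Longrightarrow> S \<subseteq> {0<..}"
  by (fastforce simp: fam_def)

lemma joinc_base_subset:
  assumes "jbase \<sigma> B vs"
  shows "joinc (Pow B) (fam vs) \<subseteq> jfam \<sigma> B vs ts us"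
proof
  fix S assume "S \<in> joinc (Pow B) (fam vs)"
  then obtain L U where S: "S = L \<union> U" "L \<subseteq> B" "U \<in> fam vs" unfolding joinc_def by auto
  have "L \<subseteq> {..0}" "U \<subseteq> {0<..}" "B \<subset> \<sigma>" using S assms fam_pos[of vs U] unfolding jbase_def by auto
  then have "low S = L" "up S = U" unfolding S(1) by (simp_all add: low_Un up_Un)
  then show "S \<in> jfam \<sigma> B vs ts us" using S \<open>B \<subset> \<sigma>\<close> unfolding jfam_def by auto
qed

lemma fin_complex_jfam:
  assumes "finite \<sigma>"
  shows "fin_complex (jfam \<sigma> B vs ts us)" "finite (jfam \<sigma> B vs ts us)"
proof -
  show "fin_complex (jfam \<sigma> B vs ts us)"
    unfolding fin_complex_def
  proof (intro ballI conjI subsetI)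
    fix S assume S: "S \<in> jfam \<sigma> B vs ts us"
    then have f: "finite (up S)" using fin_complex_fam unfolding jfam_def fin_complex_def by blast
    then show "finite S" using low_up(3)[of S] S assms finite_subset unfolding jfam_def by blast
    fix T assume "T \<in> Pow S"
    then have "low T \<subseteq> low S" "up T \<subseteq> up S" by (auto simp: low_def up_def)
    then show "T \<in> jfam \<sigma> B vs ts us" using S fam_subset unfolding jfam_def by blast
  qed
  have "S \<in> joinc (Pow \<sigma>) (fam vs \<union> fam ts \<union> fam us)" if "S \<in> jfam \<sigma> B vs ts us" for S
    using that low_up(1)[of S] unfolding jfam_def joinc_def by blast
  moreover have "finite (joinc (Pow \<sigma>) (fam vs \<union> fam ts \<union> fam us))"
    unfolding joinc_def using assms finite_fam
    by (intro finite_image_set2) auto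
  ultimately show "finite (jfam \<sigma> B vs ts us)" using finite_subset by (metis subsetI)
qed

lemma jfam_mono:
  assumes "sub_ok ts ts'" "sub_ok us us'"
  shows "jfam \<sigma> B vs ts us \<subseteq> jfam \<sigma> B vs ts' us'"
  using sub_okD[OF assms(1)] sub_okD[OF assms(2)] unfolding jfam_def by blast

text \<open>The nesting of the families in \<open>stage_ok\<close> separates the clauses of
  \<open>jfam\<close>: faces over \<open>B\<close> are never new, the other proper faces of \<sigma>
  are governed by \<open>ts\<close>, and \<sigma> by \<open>us\<close>. This reduces a statement
  about \<sigma> of any dimension to two finite checks.\<close>

lemma jfam_new:
  assumes "B \<subset> \<sigma>" "stage_ok vs ts us ts' us'"
  shows "S \<in> jfam \<sigma> B vs ts' us' - jfam \<sigma> B vs ts us \<longleftrightarrow> low S \<subseteq> \<sigma> \<and> \<not> low S \<subseteq> B \<and>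
     (if low S = \<sigma> then up S \<in> fam us' - fam us else up S \<in> fam ts' - fam ts)"
proof -
  have "fam us \<subseteq> fam ts" "fam us' \<subseteq> fam ts'" "fam ts' \<subseteq> fam vs"
    using assms(2) sub_okD unfolding stage_ok_def by blast+
  then show ?thesis using assms(1) unfolding jfam_def by (cases "low S = \<sigma>"; cases "low S \<subseteq> B") auto
qed

lemma low_insert: "0 < v \<Longrightarrow> low (insert v S) = low S" "0 < v \<Longrightarrow> low (S - {v}) = low S"
  and up_insert: "0 < v \<Longrightarrow> up (insert v S) = insert v (up S)" "0 < v \<Longrightarrow> up (S - {v}) = up S - {v}"
  by (auto simp: low_def up_def)

lemma not_low: "\<not> low S \<subseteq> B \<Longrightarrow> \<exists>x\<in>S. x \<le> 0 \<and> x \<notin> B"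
  by (auto simp: low_def)

lemma jext_trans:
  assumes "jbase \<sigma> B vs" "jext X \<sigma> B vs f ts us ts' us'" "jext X \<sigma> B vs f ts' us' ts'' us''"
  shows "jext X \<sigma> B vs f ts us ts'' us''"
  unfolding jext_def
proof (intro conjI allI impI)
  show "jfam \<sigma> B vs ts us \<subseteq> jfam \<sigma> B vs ts'' us''" "sub_ok us'' ts''"
    using assms unfolding jext_def by auto
  fix g assume g: "dmap X (jfam \<sigma> B vs ts us) g" "agree (joinc (Pow B) (fam vs)) g f"
  show "extensible X (jfam \<sigma> B vs ts us) g (jfam \<sigma> B vs ts'' us'')"
  proof (rule extensible_trans)
    show "extensible X (jfam \<sigma> B vs ts us) g (jfam \<sigma> B vs ts' us')" "jfam \<sigma> B vs ts us \<subseteq> jfam \<sigma> B vs ts' us'"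
      using assms(2) g unfolding jext_def by auto
    fix h assume h: "dmap X (jfam \<sigma> B vs ts' us') h" "agree (jfam \<sigma> B vs ts us) h g"
    have "agree (joinc (Pow B) (fam vs)) h f"
      using agree_trans[OF agree_subset[OF h(2) joinc_base_subset[OF assms(1)]] g(2)] .
    then show "extensible X (jfam \<sigma> B vs ts' us') h (jfam \<sigma> B vs ts'' us'')"
      using assms(3) h unfolding jext_def by auto
  qed
qed

text \<open>A positive \<open>v\<close> leaves the part of a face in \<sigma> unchanged, and a new
  face has a vertex of \<sigma> outside \<open>B\<close>, which lies below \<open>v\<close>. So
  every horn is inner even if \<open>v\<close> is the least positive label.\<close>

lemma jext_toggle:
  assumes X: "quasicategory X" and b: "jbase \<sigma> B vs"
    and ok: "0 < v" "stage_ok vs ts us ts' us'" "toggle_ok v ts ts'" "toggle_ok v us us'"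
  shows "jext X \<sigma> B vs f ts us ts' us'"
  unfolding jext_def
proof (intro conjI allI impI)
  have B: "finite \<sigma>" "B \<subset> \<sigma>" using b unfolding jbase_def by auto
  have st: "sub_ok ts ts'" "sub_ok us us'" "sub_ok us' ts'" using ok(2) unfolding stage_ok_def by auto
  show m: "jfam \<sigma> B vs ts us \<subseteq> jfam \<sigma> B vs ts' us'" by (rule jfam_mono[OF st(1,2)])
  show "sub_ok us' ts'" by (rule st)
  note new = jfam_new[OF B(2) ok(2)]
  fix g assume g: "dmap X (jfam \<sigma> B vs ts us) g"
  show "extensible X (jfam \<sigma> B vs ts us) g (jfam \<sigma> B vs ts' us')"
  proof (rule extend_toggle_inner[OF X g fin_complex_jfam(1)[OF B(1)] m fin_complex_jfam[OF B(1)]])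
    fix S assume S: "S \<in> jfam \<sigma> B vs ts' us' - jfam \<sigma> B vs ts us"
    then have "\<exists>x\<in>S. x < v" using not_low[of S B] ok(1) unfolding new by force
    moreover have "\<exists>y\<in>up S. v < y"
      using S toggle_okD[OF ok(3)] toggle_okD[OF ok(4)] unfolding new by (auto split: if_splits)
    then have "\<exists>y\<in>S. v < y" by (auto simp: up_def)
    moreover have "insert v S \<in> jfam \<sigma> B vs ts' us' - jfam \<sigma> B vs ts us"
      "S - {v} \<in> jfam \<sigma> B vs ts' us' - jfam \<sigma> B vs ts us"
      using S toggle_okD[OF ok(3)] toggle_okD[OF ok(4)]
      unfolding new low_insert[OF ok(1)] up_insert[OF ok(1)] by presburger+
    ultimately show "insert v S \<in> jfam \<sigma> B vs ts' us' - jfam \<sigma> B vs ts us \<and>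
        S - {v} \<in> jfam \<sigma> B vs ts' us' - jfam \<sigma> B vs ts us \<and> (\<exists>x\<in>S. x < v) \<and> (\<exists>y\<in>S. v < y)"
      by blast
  qed
qed

lemma low_le: "x \<in> low S \<Longrightarrow> 0 < v \<Longrightarrow> x < v" by (auto simp: low_def)

lemma ball_low_up: "(\<forall>x\<in>S. P x) \<longleftrightarrow> (\<forall>x\<in>low S. P x) \<and> (\<forall>x\<in>up S. P x)"
  by (metis Un_iff low_up(1))

lemma fam_joinc_base: "infam vs xs \<Longrightarrow> set xs \<in> joinc (Pow B) (fam vs)"
  unfolding infam_iff joinc_def by blast

lemma agree_base: "agree (joinc (Pow B) (fam vs)) g f \<Longrightarrow> infam vs xs \<Longrightarrow> xs \<noteq> [] \<Longrightarrow> sorted xs \<Longrightarrow> g xs = f xs"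
  unfolding agree_def using fam_joinc_base by blast

lemma jext_outer:
  assumes X: "quasicategory X" and b: "jbase \<sigma> B vs"
    and ok: "0 < u" "u < v" "stage_ok vs ts us ts' us'"
      "outer_ok u v ts ts'" "outer_ok u v us us'"
    and sp: "infam vs [u, v]" "rspecial X (f [u, v])"
  shows "jext X \<sigma> B vs f ts us ts' us'"
  unfolding jext_def
proof (intro conjI allI impI)
  have B: "finite \<sigma>" "B \<subset> \<sigma>" using b unfolding jbase_def by auto
  have v: "0 < v" using ok by simp
  have st: "sub_ok ts ts'" "sub_ok us us'" "sub_ok us' ts'" using ok(3) unfolding stage_ok_def by auto
  show m: "jfam \<sigma> B vs ts us \<subseteq> jfam \<sigma> B vs ts' us'" by (rule jfam_mono[OF st(1,2)])
  show "sub_ok us' ts'" by (rule st)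
  note new = jfam_new[OF B(2) ok(3)]
  fix g assume g: "dmap X (jfam \<sigma> B vs ts us) g" "agree (joinc (Pow B) (fam vs)) g f"
  have uv: "{u, v} \<in> jfam \<sigma> B vs ts us"
    using joinc_base_subset[OF b] fam_joinc_base[OF sp(1), of B] by auto
  have e: "rspecial X (g [u, v])" using agree_base[OF g(2) sp(1)] sp(2) ok by simp
  show "extensible X (jfam \<sigma> B vs ts us) g (jfam \<sigma> B vs ts' us')"
  proof (rule extend_toggle_outer[OF X g(1) fin_complex_jfam(1)[OF B(1)] m fin_complex_jfam[OF B(1)] ok(2) uv e])
    fix S assume S: "S \<in> jfam \<sigma> B vs ts' us' - jfam \<sigma> B vs ts us"
    then have "\<exists>x\<in>S. x < u" using not_low[of S B] ok(1) unfolding new by force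
    moreover have q: "u \<in> up S \<and> (\<forall>y\<in>up S. y \<le> u \<or> y = v)"
      using S outer_okD[OF ok(4)] outer_okD[OF ok(5)] unfolding new by (auto split: if_splits)
    then have "\<forall>y\<in>S. y \<le> u \<or> y = v" using low_le[OF _ ok(1)] by (auto simp: ball_low_up[of S] less_imp_le)
    moreover have "u \<in> S" using q by (auto simp: up_def)
    moreover have "insert v S \<in> jfam \<sigma> B vs ts' us' - jfam \<sigma> B vs ts us"
      "S - {v} \<in> jfam \<sigma> B vs ts' us' - jfam \<sigma> B vs ts us"
      using S outer_okD[OF ok(4)] outer_okD[OF ok(5)]
      unfolding new low_insert[OF v] up_insert[OF v] by presburger+
    ultimately show "insert v S \<in> jfam \<sigma> B vs ts' us' - jfam \<sigma> B vs ts us \<and>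
        S - {v} \<in> jfam \<sigma> B vs ts' us' - jfam \<sigma> B vs ts us \<and> u \<in> S \<and> (\<exists>x\<in>S. x < u) \<and>
        (\<forall>y\<in>S. y \<le> u \<or> y = v)"
      by blast
  qed
qed

lemma jext_terminal:
  assumes X: "simplicial_set X" and b: "jbase \<sigma> B vs"
    and ok: "0 < v" "stage_ok vs ts us ts' us'"
      "terminal_ok v ts ts'" "terminal_ok v us us'"
    and sp: "infam vs [v]" "terminal X (f [v])"
  shows "jext X \<sigma> B vs f ts us ts' us'"
  unfolding jext_def
proof (intro conjI allI impI)
  have B: "finite \<sigma>" "B \<subset> \<sigma>" using b unfolding jbase_def by auto
  have st: "sub_ok ts ts'" "sub_ok us us'" "sub_ok us' ts'" using ok(2) unfolding stage_ok_def by auto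
  show m: "jfam \<sigma> B vs ts us \<subseteq> jfam \<sigma> B vs ts' us'" by (rule jfam_mono[OF st(1,2)])
  show "sub_ok us' ts'" by (rule st)
  note new = jfam_new[OF B(2) ok(2)]
  fix g assume g: "dmap X (jfam \<sigma> B vs ts us) g" "agree (joinc (Pow B) (fam vs)) g f"
  have uv: "{v} \<in> jfam \<sigma> B vs ts us"
    using joinc_base_subset[OF b] fam_joinc_base[OF sp(1), of B] by auto
  have e: "terminal X (g [v])" using agree_base[OF g(2) sp(1)] sp(2) ok by simp
  show "extensible X (jfam \<sigma> B vs ts us) g (jfam \<sigma> B vs ts' us')"
  proof (rule extend_terminal[OF X g(1) fin_complex_jfam(1)[OF B(1)] m fin_complex_jfam[OF B(1)] uv e])
    fix S assume S: "S \<in> jfam \<sigma> B vs ts' us' - jfam \<sigma> B vs ts us"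
    then have "\<exists>x\<in>S. x < v" using not_low[of S B] ok(1) unfolding new by force
    moreover have q: "v \<in> up S \<and> (\<forall>y\<in>up S. y \<le> v)"
      using S terminal_okD[OF ok(3)] terminal_okD[OF ok(4)] unfolding new by (auto split: if_splits)
    then have "\<forall>y\<in>S. y \<le> v" using low_le[OF _ ok(1)] by (auto simp: ball_low_up[of S] less_imp_le)
    moreover have "v \<in> S" using q by (auto simp: up_def)
    ultimately show "v \<in> S \<and> (\<exists>x\<in>S. x < v) \<and> (\<forall>y\<in>S. y \<le> v)" by blast
  qed
qed

lemma lim_cone_agree: "lim_cone X A b f \<Longrightarrow> agree (joinc (Pow {b}) A) g f \<Longrightarrow> lim_cone X A b g"
  unfolding lim_cone_def using agree_trans by blast

lemma jext_lim:
  assumes b: "jbase \<sigma> B vs"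
    and ok: "0 < v" "stage_ok vs ts us ts' us'"
      "lim_ok as v ts ts'" "lim_ok as v us us'" "\<forall>a\<in>set as. infam vs (v # a) \<and> (\<forall>x\<in>set a. v < x)"
    and l: "lim_cone X (fam as) v f"
  shows "jext X \<sigma> B vs f ts us ts' us'"
  unfolding jext_def
proof (intro conjI allI impI)
  have B: "finite \<sigma>" "B \<subset> \<sigma>" using b unfolding jbase_def by auto
  have st: "sub_ok ts ts'" "sub_ok us us'" "sub_ok us' ts'" using ok(2) unfolding stage_ok_def by auto
  show m: "jfam \<sigma> B vs ts us \<subseteq> jfam \<sigma> B vs ts' us'" by (rule jfam_mono[OF st(1,2)])
  show "sub_ok us' ts'" by (rule st)
  note new = jfam_new[OF B(2) ok(2)]
  have j: "joinc (Pow {v}) (fam as) \<subseteq> fam vs" using ok(5) by (intro joinc_fam) auto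
  have j2: "fam vs \<subseteq> joinc (Pow B) (fam vs)" unfolding joinc_def by blast
  fix g assume g: "dmap X (jfam \<sigma> B vs ts us) g" "agree (joinc (Pow B) (fam vs)) g f"
  have e: "lim_cone X (fam as) v g" using lim_cone_agree[OF l] agree_subset[OF g(2)] j j2 by blast
  have up_le: "low {x\<in>S. x \<le> v} = low S" "up {x\<in>S. x \<le> v} = {x\<in>up S. x \<le> v}" "{x\<in>S. v < x} = {x\<in>up S. v < x}" for S
    using ok(1) by (auto simp: low_def up_def)
  show "extensible X (jfam \<sigma> B vs ts us) g (jfam \<sigma> B vs ts' us')"
  proof (rule extend_limit[OF g(1) fin_complex_jfam(1)[OF B(1)] m fin_complex_jfam[OF B(1)] fin_complex_fam _ e])
    show "T \<in> fam as \<Longrightarrow> x \<in> T \<Longrightarrow> v < x" for T x using ok(5) by (auto simp: fam_def)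
    show "joinc (Pow {v}) (fam as) \<subseteq> jfam \<sigma> B vs ts us" using j j2 joinc_base_subset[OF b] by blast
    fix S assume S: "S \<in> jfam \<sigma> B vs ts' us' - jfam \<sigma> B vs ts us"
    then have "\<exists>x\<in>S. x < v" using not_low[of S B] ok(1) unfolding new by force
    moreover have q: "v \<in> up S \<and> {x\<in>up S. v < x} \<in> fam as"
      using S lim_okD[OF ok(3)] lim_okD[OF ok(4)] unfolding new by (auto split: if_splits)
    moreover have "v \<in> S" using q by (auto simp: up_def)
    ultimately show "v \<in> S \<and> (\<exists>x\<in>S. x < v) \<and> {x\<in>S. v < x} \<in> fam as" unfolding up_le(3)[of S] by blast
    fix T assume T: "T \<in> fam as"
    then have "\<forall>x\<in>T. 0 < x" using ok(1,5) by (fastforce simp: fam_def)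
    then have "low ({x\<in>S. x \<le> v} \<union> T) = low S" "up ({x\<in>S. x \<le> v} \<union> T) = {x\<in>up S. x \<le> v} \<union> T"
      using ok(1) by (auto simp: low_def up_def)
    then show "{x\<in>S. x \<le> v} \<union> T \<in> jfam \<sigma> B vs ts' us' - jfam \<sigma> B vs ts us"
      using S T lim_okD[OF ok(3), of "up S"] lim_okD[OF ok(4), of "up S"] unfolding new by (simp split: if_splits)
  qed
qed

text \<open>Here the apex is the last vertex \<open>0\<close> of \<sigma>. The proper faces of
  \<sigma> joined with \<open>as\<close> form exactly the boundary problem of
  \<open>lim_cone\<close>, whose solution adds the faces that contain all of \<sigma>.\<close>

lemma jext_lim0:
  assumes b: "jbase \<sigma> {0} vs" and ok: "sub_ok as ts" "sub_ok ts vs" and l: "lim_cone X (fam as) 0 f"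
  shows "jext X \<sigma> {0} vs f ts [] ts as"
  unfolding jext_def
proof (intro conjI allI impI)
  have B: "finite \<sigma>" "{0} \<subset> \<sigma>" using b unfolding jbase_def by auto
  have e: "sub_ok ts ts" "sub_ok [] as" "sub_ok [] ts" by (auto simp: sub_ok_def infam_def)
  have av: "fam as \<subseteq> fam vs" using ok sub_okD by blast
  show m: "jfam \<sigma> {0} vs ts [] \<subseteq> jfam \<sigma> {0} vs ts as" by (rule jfam_mono[OF e(1,2)])
  show "sub_ok as ts" by (rule ok)
  have "stage_ok vs ts [] ts as" unfolding stage_ok_def using e ok by blast
  note new = jfam_new[OF B(2) this]
  fix g assume g: "dmap X (jfam \<sigma> {0} vs ts []) g" "agree (joinc (Pow {0}) (fam vs)) g f"
  have j: "joinc (Pow {0}) (fam as) \<subseteq> joinc (Pow {0}) (fam vs)"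
    using av unfolding joinc_def by blast
  have l': "lim_cone X (fam as) 0 g" using lim_cone_agree[OF l agree_subset[OF g(2) j]] .
  have pos: "0 < x" if "x \<in> T" "T \<in> fam as" for x T
    using fam_pos[of vs T] b that av unfolding jbase_def by auto
  have newS: "low S = \<sigma> \<and> up S \<in> fam as" if "S \<in> jfam \<sigma> {0} vs ts as - jfam \<sigma> {0} vs ts []" for S
    using that unfolding new by (auto split: if_splits)
  show "extensible X (jfam \<sigma> {0} vs ts []) g (jfam \<sigma> {0} vs ts as)"
  proof (rule extend_limit[OF g(1) fin_complex_jfam(1)[OF B(1)] m fin_complex_jfam[OF B(1)] fin_complex_fam _ l'])
    show "T \<in> fam as \<Longrightarrow> x \<in> T \<Longrightarrow> 0 < x" for T x using pos .
    show "joinc (Pow {0}) (fam as) \<subseteq> jfam \<sigma> {0} vs ts []" using j joinc_base_subset[OF b] by blast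
    fix S assume S: "S \<in> jfam \<sigma> {0} vs ts as - jfam \<sigma> {0} vs ts []"
    obtain x where x: "x \<in> \<sigma>" "x \<noteq> 0" using B(2) by blast
    then have "x \<in> S" "x < 0" "0 \<in> S" using newS[OF S] B(2) by (auto simp: low_def)
    moreover have "{x\<in>S. 0 < x} = up S" by (auto simp: up_def)
    ultimately show "0 \<in> S \<and> (\<exists>x\<in>S. x < 0) \<and> {x\<in>S. 0 < x} \<in> fam as" using newS[OF S] by auto
    fix T assume T: "T \<in> fam as"
    then have "\<forall>x\<in>T. 0 < x" using pos by blast
    then have "low ({x\<in>S. x \<le> 0} \<union> T) = low S" "up ({x\<in>S. x \<le> 0} \<union> T) = T"
      by (auto simp: low_def up_def)
    then show "{x\<in>S. x \<le> 0} \<union> T \<in> jfam \<sigma> {0} vs ts as - jfam \<sigma> {0} vs ts []"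
      using newS[OF S] T B(2) unfolding new by (auto simp: fam_def)
  qed
qed

text \<open>The boundary problem over \<open>as\<close> is glued to \<open>f\<close> on
  \<open>0\<close> joined with the larger diagram \<open>vs\<close>, so that the other objects of
  \<open>vs\<close> become available during the extension. The outcome is restricted to \<sigma>
  joined with \<open>as\<close>.\<close>

lemma lim_cone_by_jext:
  assumes f: "dmap X (joinc (Pow {0}) (fam vs)) f" and vs: "\<forall>v\<in>set vs. \<forall>x\<in>set v. 0 < x" and av: "sub_ok as vs"
    and au: "sub_ok as us"
    and ext: "\<And>\<sigma>. jbase \<sigma> {0} vs \<Longrightarrow> jext X \<sigma> {0} vs f as [] ts us"
  shows "lim_cone X (fam as) 0 f"
  unfolding lim_cone_def
proof (intro allI impI)
  fix \<rho> :: "int set" and g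
  let ?\<sigma> = "insert 0 \<rho>" let ?P = "joinc (Pow ?\<sigma> - {?\<sigma>}) (fam as)" let ?V = "joinc (Pow {0}) (fam vs)"
  assume r: "finite \<rho>" "\<rho> \<noteq> {}" "\<forall>x\<in>\<rho>. x < 0" and g: "dmap X ?P g" "agree (joinc (Pow {0}) (fam as)) g f"
  have b: "jbase ?\<sigma> {0} vs" using r vs unfolding jbase_def by force
  have pos: "T \<subseteq> {0<..}" if "T \<in> fam vs" for T using fam_pos[OF vs that] .
  have le: "L \<subseteq> {..0}" if "L \<subseteq> ?\<sigma>" for L using that r(3) by force
  have P: "S \<in> ?P \<longleftrightarrow> low S \<subseteq> ?\<sigma> \<and> low S \<noteq> ?\<sigma> \<and> up S \<in> fam as" for S
  proof
    assume "S \<in> ?P"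
    then obtain L U where S: "S = L \<union> U" "L \<subseteq> ?\<sigma>" "L \<noteq> ?\<sigma>" "U \<in> fam as" unfolding joinc_def by auto
    have "U \<in> fam vs" using S sub_okD[OF av] by auto
    then have "low S = L" "up S = U" unfolding S(1) using le[OF S(2)] pos by (simp_all add: low_Un up_Un)
    then show "low S \<subseteq> ?\<sigma> \<and> low S \<noteq> ?\<sigma> \<and> up S \<in> fam as" using S by simp
  next
    assume "low S \<subseteq> ?\<sigma> \<and> low S \<noteq> ?\<sigma> \<and> up S \<in> fam as"
    then show "S \<in> ?P" using low_up(1)[of S] unfolding joinc_def by blast
  qed
  have V: "S \<in> ?V \<longleftrightarrow> low S \<subseteq> {0} \<and> up S \<in> fam vs" for S
  proof
    assume "S \<in> ?V"
    then obtain L U where S: "S = L \<union> U" "L \<subseteq> {0}" "U \<in> fam vs" unfolding joinc_def by auto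
    have "L \<subseteq> ?\<sigma>" using S(2) by auto
    then have "low S = L" "up S = U" unfolding S(1) using le[of L] pos[OF S(3)] by (simp_all add: low_Un up_Un)
    then show "low S \<subseteq> {0} \<and> up S \<in> fam vs" using S by simp
  next
    assume "low S \<subseteq> {0} \<and> up S \<in> fam vs"
    then show "S \<in> ?V" using low_up(1)[of S] unfolding joinc_def by blast
  qed
  have fP: "fin_complex ?P"
    using r(1) by (intro fin_complex_joinc fin_complex_fam) (auto simp: fin_complex_def intro: finite_subset)
  have fV: "fin_complex ?V"
    by (intro fin_complex_joinc fin_complex_fam) (auto simp: fin_complex_def intro: finite_subset)
  have "agree (?P \<inter> ?V) g f"
  proof (rule agree_subset[OF g(2)])
    show "?P \<inter> ?V \<subseteq> joinc (Pow {0}) (fam as)"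
    proof
      fix S assume "S \<in> ?P \<inter> ?V"
      then have "low S \<subseteq> {0}" "up S \<in> fam as" using P V by auto
      then show "S \<in> joinc (Pow {0}) (fam as)" using low_up(1)[of S] unfolding joinc_def by blast
    qed
  qed
  from dmap_Un[OF g(1) f this fP fV] obtain h where h: "dmap X (?P \<union> ?V) h" "agree ?P h g" "agree ?V h f" by blast
  \<comment> \<open>With \<open>[]\<close> as the family over \<sigma>, the starting stage is
    precisely the glued complex.\<close>
  have J: "jfam ?\<sigma> {0} vs as [] = ?P \<union> ?V"
    using P V b unfolding jfam_def jbase_def by (auto simp: fam_def[of "[]"])
  have "extensible X (?P \<union> ?V) h (jfam ?\<sigma> {0} vs ts us)"
    using ext[OF b] h unfolding jext_def J by blast
  then obtain k where k: "dmap X (jfam ?\<sigma> {0} vs ts us) k" "agree (?P \<union> ?V) k h" unfolding extensible_def by blast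
  have "joinc (Pow ?\<sigma>) (fam as) \<subseteq> jfam ?\<sigma> {0} vs ts us"
  proof
    fix S assume "S \<in> joinc (Pow ?\<sigma>) (fam as)"
    then obtain L U where S: "S = L \<union> U" "L \<subseteq> ?\<sigma>" "U \<in> fam as" unfolding joinc_def by auto
    have "U \<in> fam vs" using S sub_okD[OF av] by auto
    then have "low S = L" "up S = U" unfolding S(1) using le[OF S(2)] pos by (simp_all add: low_Un up_Un)
    then show "S \<in> jfam ?\<sigma> {0} vs ts us" using S sub_okD[OF au] unfolding jfam_def by auto
  qed
  then have "dmap X (joinc (Pow ?\<sigma>) (fam as)) k" using k(1) dmap_subset by blast
  moreover have "agree ?P k g" using k(2) h(2) agree_trans agree_subset by (metis Un_upper1)
  ultimately show "extensible X ?P g (joinc (Pow ?\<sigma>) (fam as))" unfolding extensible_def by blast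
qed

section \<open>Edges along which outer horns can be filled\<close>

text \<open>Passes from a graded simplicial map to a function on lists; the degree is recovered as
  \<open>length xs - 1\<close>.\<close>

lemma dmap_of_subcomplex:
  assumes S: "simplices S = (\<lambda>m. {\<alpha> \<in> simplices (Delta n) m. set \<alpha> \<in> K})" and a: "act S = act (Delta n)"
    and K: "fin_complex K" "K \<subseteq> Pow {..n}" and h: "h \<in> sset_hom S X"
  shows "dmap X K (\<lambda>xs. h (length xs - 1) xs)"
  unfolding dmap_def
proof (intro allI impI conjI ballI; elim conjE)
  fix m xs k \<alpha> assume x: "length xs = Suc m" "sorted xs" "set xs \<in> K"
  have xS: "xs \<in> simplices S m" using x K(2) unfolding S by (auto simp: in_Delta)
  show "h (length xs - 1) xs \<in> simplices X m" using h xS x(1) unfolding sset_hom_def by auto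
  assume al: "\<alpha> \<in> simplices (Delta m) k"
  have "h k (act S m \<alpha> xs) = act X m \<alpha> (h m xs)" using h al xS unfolding sset_hom_def by blast
  then show "h (length (comp_op xs \<alpha>) - 1) (comp_op xs \<alpha>) = act X m \<alpha> (h (length xs - 1) xs)"
    using al x(1) unfolding a by (simp add: in_Delta)
qed

lemma fillable_of_extensible:
  assumes S: "simplices S = (\<lambda>m. {\<alpha> \<in> simplices (Delta n) m. set \<alpha> \<in> K})"
    and e: "extensible X K (\<lambda>xs. h (length xs - 1) xs) (Pow {..n})"
  shows "fillable X n S h"
proof -
  obtain g where g: "dmap X (Pow {..n}) g" "agree K g (\<lambda>xs. h (length xs - 1) xs)"
    using e unfolding extensible_def by blast
  have i: "length (id_op n) = Suc n" "sorted (id_op n)" "set (id_op n) \<in> Pow {..n}" by (auto simp del: upt_Suc)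
  show ?thesis
    unfolding fillable_def
  proof (intro bexI allI ballI)
    show "g (id_op n) \<in> simplices X n" by (rule dmapD(1)[OF g(1) i])
    fix m \<alpha> assume "\<alpha> \<in> simplices S m"
    then have al: "\<alpha> \<in> simplices (Delta n) m" "set \<alpha> \<in> K" unfolding S by auto
    have "comp_op (id_op n) \<alpha> = \<alpha>" using al(1) by (intro map_idI) (auto simp: in_Delta simp del: upt_Suc)
    then have "g \<alpha> = act X n \<alpha> (g (id_op n))" using dmapD(2)[OF g(1) i al(1)] by simp
    moreover have l: "length \<alpha> = Suc m" "sorted \<alpha>" using al(1) unfolding in_Delta by auto
    moreover have "g \<alpha> = h m \<alpha>" using agreeD[OF g(2) _ l(2) al(2)] l(1) by fastforce
    ultimately show "h m \<alpha> = act X n \<alpha> (g (id_op n))" by simp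
  qed
qed

definition hornc :: "nat \<Rightarrow> nat set set" where
  "hornc n = {S. S \<subseteq> {..n} \<and> \<not> {..n} \<subseteq> insert n S}"

lemma horn_hornc:
  "simplices (horn n n) = (\<lambda>m. {\<alpha> \<in> simplices (Delta n) m. set \<alpha> \<in> hornc n})"
  "act (horn n n) = act (Delta n)" "fin_complex (hornc n)" "hornc n \<subseteq> Pow {..n}"
  by (auto simp: horn_def hornc_def in_Delta fin_complex_def intro: finite_subset)

text \<open>The face opposite \<open>n\<close> is filled because its last vertex
  \<open>n - 1\<close> is terminal; the simplex itself is then filled because \<open>n\<close> is
  terminal.\<close>

lemma rspecial_terminal:
  assumes X: "simplicial_set X" and t: "terminal X (act X 1 [0] e)" "terminal X (act X 1 [1] e)"
  shows "rspecial X e"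
  unfolding rspecial_def
proof (intro allI impI ballI)
  fix n h assume n: "2 \<le> n" and h: "h \<in> sset_hom (horn n n) X" "h 1 [n - 1, n] = e"
  define f where "f xs = h (length xs - 1) xs" for xs
  have f: "dmap X (hornc n) f"
    unfolding f_def by (rule dmap_of_subcomplex[OF horn_hornc h(1)])
  have "0 \<in> {..n}" "0 \<notin> insert n {n - 1, n}" "{n - 1, n} \<subseteq> {..n}" using n by auto
  then have nn: "{n - 1, n} \<in> hornc n" unfolding hornc_def by blast
  then have s: "length [n - 1, n] = Suc 1" "sorted [n - 1, n]" "set [n - 1, n] \<in> hornc n" by auto
  have f1: "f [n - 1] = act X 1 [0] e" "f [n] = act X 1 [1] e"
    using dmapD(2)[OF f s, of "[0]" 0] dmapD(2)[OF f s, of "[1]" 0] h(2) unfolding f_def by (simp_all add: in_Delta)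
  define K where "K = {S. S \<subset> {..n}}"
  have K: "fin_complex K" "finite K"
    unfolding K_def fin_complex_def by (auto intro: finite_subset)
  have sg: "{n - 1} \<in> hornc n" "{n} \<in> hornc n"
    by (rule fin_complexD[OF horn_hornc(3) nn], simp)+
  have HK: "hornc n \<subseteq> K" unfolding hornc_def K_def by blast
  have 1: "extensible X (hornc n) f K"
  proof (rule extend_terminal[OF X f horn_hornc(3) HK K sg(1)])
    show "terminal X (f [n - 1])" using f1 t by simp
    fix S assume "S \<in> K - hornc n"
    then have "S = {..n} - {n}" unfolding K_def hornc_def by auto
    also have "\<dots> = {..<n}" by auto
    finally show "n - 1 \<in> S \<and> (\<exists>x\<in>S. x < n - 1) \<and> (\<forall>y\<in>S. y \<le> n - 1)" using n by (auto intro!: bexI[of _ 0])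
  qed
  have "extensible X (hornc n) f (Pow {..n})"
  proof (rule extensible_trans[OF 1 HK])
    fix g assume g: "dmap X K g" "agree (hornc n) g f"
    have "g [n] = f [n]" using g(2) sg unfolding agree_def by simp
    then have t': "terminal X (g [n])" using f1 t by simp
    show "extensible X K g (Pow {..n})"
    proof (rule extend_terminal[OF X g(1) K(1) _ _ _ _ t'])
      show "{n} \<in> K" using HK sg by auto
      fix S assume "S \<in> Pow {..n} - K"
      then have "S = {..n}" unfolding K_def by auto
      then show "n \<in> S \<and> (\<exists>x\<in>S. x < n) \<and> (\<forall>y\<in>S. y \<le> n)" using n by (auto intro!: bexI[of _ 0])
    qed (auto simp: K_def fin_complex_def intro: finite_subset)
  qed
  then show "fillable X n (horn n n) h"
    unfolding f_def by (rule fillable_of_extensible[OF horn_hornc(1)])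
qed

section \<open>Relabelling of vertices\<close>

definition relabel :: "(int \<times> int) list \<Rightarrow> int \<Rightarrow> int" where
  "relabel ps x = (case map_of ps x of None \<Rightarrow> x | Some y \<Rightarrow> y)"

definition relabel_ok :: "(int \<times> int) list \<Rightarrow> int list list \<Rightarrow> int list list \<Rightarrow> bool" where
  "relabel_ok ps cs cs' \<longleftrightarrow> (\<forall>c\<in>set cs. infam cs' (map (relabel ps) c) \<and>
     (\<forall>x\<in>set c. \<forall>y\<in>set c. x \<le> y \<longrightarrow> relabel ps x \<le> relabel ps y))"

lemma relabel_okD:
  assumes "relabel_ok ps cs cs'" "S \<in> fam cs"
  shows "relabel ps ` S \<in> fam cs'" "mono_on S (relabel ps)"
proof -
  obtain c where c: "c \<in> set cs" "S \<subseteq> set c" using assms(2) unfolding fam_def by blast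
  then have "relabel ps ` set c \<in> fam cs'" using assms(1) unfolding relabel_ok_def infam_iff by simp
  then show "relabel ps ` S \<in> fam cs'" by (rule fam_subset) (use c(2) in auto)
  show "mono_on S (relabel ps)" using c assms(1) unfolding relabel_ok_def mono_on_def by blast
qed

lemma dmap_relabel:
  assumes "dmap X (fam cs') f" "relabel_ok ps cs cs'"
  shows "dmap X (fam cs) (\<lambda>xs. f (map (relabel ps) xs))"
  by (rule dmap_reindex[OF assms(1)]) (use relabel_okD[OF assms(2)] in blast)

lemma relabel_low_up:
  assumes "\<forall>p\<in>set ps. 0 < fst p \<and> 0 < snd p"
  shows "low (relabel ps ` S) = low S" "up (relabel ps ` S) = relabel ps ` up S"
    "x \<le> 0 \<Longrightarrow> relabel ps x = x" "0 < x \<Longrightarrow> 0 < relabel ps x"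
proof -
  show 1: "relabel ps x = x" if "x \<le> 0" for x
  proof (cases "map_of ps x")
    case (Some y)
    then have "0 < x" using map_of_SomeD[OF Some] assms by fastforce
    then show ?thesis using that by simp
  qed (simp add: relabel_def)
  show 2: "0 < relabel ps x" if "0 < x" for x
  proof (cases "map_of ps x")
    case (Some y)
    then have "0 < y" using map_of_SomeD[OF Some] assms by fastforce
    then show ?thesis using Some by (simp add: relabel_def)
  qed (use that in \<open>simp add: relabel_def\<close>)
  show "low (relabel ps ` S) = low S"
  proof (intro equalityI subsetI)
    fix y assume "y \<in> low (relabel ps ` S)"
    then obtain x where "x \<in> S" "y = relabel ps x" "y \<le> 0" by (auto simp: low_def)
    then show "y \<in> low S" using 1[of x] 2[of x] by (cases "x \<le> 0") (auto simp: low_def)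
  next
    fix y assume "y \<in> low S"
    then show "y \<in> low (relabel ps ` S)" using 1[of y] by (force simp: low_def image_iff)
  qed
  show "up (relabel ps ` S) = relabel ps ` up S"
  proof (intro equalityI subsetI)
    fix y assume "y \<in> up (relabel ps ` S)"
    then obtain x where "x \<in> S" "y = relabel ps x" "0 < y" by (auto simp: up_def)
    then show "y \<in> relabel ps ` up S" using 1[of x] by (cases "x \<le> 0") (auto simp: up_def)
  next
    fix y assume "y \<in> relabel ps ` up S"
    then show "y \<in> up (relabel ps ` S)" using 2 by (auto simp: up_def)
  qed
qed

text \<open>A relabelling of this kind fixes the labels up to \<open>0\<close> and keeps positive
  labels positive, so it acts on the three families separately and leaves \<sigma> alone.\<close>

lemma dmap_jfam_relabel:
  assumes f: "dmap X (jfam \<sigma> B vs' ts' us') f" and ps: "\<forall>p\<in>set ps. 0 < fst p \<and> 0 < snd p"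
    and ok: "relabel_ok ps vs vs'" "relabel_ok ps ts ts'" "relabel_ok ps us us'"
  shows "dmap X (jfam \<sigma> B vs ts us) (\<lambda>xs. f (map (relabel ps) xs))"
proof (rule dmap_reindex[OF f])
  note r = relabel_low_up[OF ps]
  fix S assume S: "S \<in> jfam \<sigma> B vs ts us"
  have "mono_on (up S) (relabel ps)"
    using S relabel_okD(2)[OF ok(1)] relabel_okD(2)[OF ok(2)] relabel_okD(2)[OF ok(3)] unfolding jfam_def by blast
  have "relabel ps x \<le> relabel ps y" if "x \<in> S" "y \<in> S" "x \<le> y" for x y
  proof (cases "0 < x")
    case True
    then show ?thesis using that \<open>mono_on (up S) (relabel ps)\<close> by (auto simp: mono_on_def up_def)
  next
    case False
    then show ?thesis using that r(3)[of x] r(3)[of y] r(4)[of y] by (cases "0 < y") auto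
  qed
  then have "mono_on S (relabel ps)" by (auto simp: mono_on_def)
  then show "relabel ps ` S \<in> jfam \<sigma> B vs' ts' us' \<and> mono_on S (relabel ps)"
    using S relabel_okD(1)[OF ok(1)] relabel_okD(1)[OF ok(2)] relabel_okD(1)[OF ok(3)]
    unfolding jfam_def r(1,2) mem_Collect_eq by blast
qed

lemma const_dmap:
  assumes X: "simplicial_set X" and y: "y \<in> simplices X 0"
  shows "dmap X K (\<lambda>xs. act X 0 (map (\<lambda>_. 0) xs) y)"
  unfolding dmap_def
proof (intro allI impI conjI ballI; elim conjE)
  fix n xs m \<alpha> assume a: "length xs = Suc n"
  have r: "map (\<lambda>_. 0) xs \<in> simplices (Delta 0) n" using a by (auto simp: in_nerve sorted_wrt_map intro: sorted_wrt_mono_rel[of _ "\<lambda>_ _. True"])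
  show "act X 0 (map (\<lambda>_. 0) xs) y \<in> simplices X n" by (rule sset_act(1)[OF X r y])
  assume al: "\<alpha> \<in> simplices (Delta n) m"
  show "act X 0 (map (\<lambda>_. 0) (comp_op xs \<alpha>)) y = act X n \<alpha> (act X 0 (map (\<lambda>_. 0) xs) y)"
    unfolding sset_act(3)[OF X r al y] by (simp only: map_comp_op[OF Delta_lessThan[OF al a]])
qed

definition proper :: "int set \<Rightarrow> int list list \<Rightarrow> int list \<Rightarrow> bool" where
  "proper \<sigma> cs xs \<longleftrightarrow> xs \<noteq> [] \<and> sorted xs \<and> low (set xs) \<subset> \<sigma> \<and> up (set xs) \<in> fam cs"

lemma sorted_relabel:
  assumes "sorted xs" "up (set xs) \<in> fam cs" "relabel_ok ps cs cs'" "\<forall>p\<in>set ps. 0 < fst p \<and> 0 < snd p"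
  shows "sorted (map (relabel ps) xs)"
proof -
  note r = relabel_low_up[OF assms(4)]
  have "mono_on (up (set xs)) (relabel ps)" using relabel_okD(2)[OF assms(3,2)] .
  then have "relabel ps x \<le> relabel ps y" if "x \<in> set xs" "y \<in> set xs" "x \<le> y" for x y
    using that r(3)[of x] r(3)[of y] r(4)[of y]
    by (cases "0 < x"; cases "0 < y") (auto simp: mono_on_def up_def)
  then show ?thesis using assms(1) by (auto simp: sorted_map intro: sorted_wrt_mono_rel[of _ "(\<le>)"])
qed

lemma proper_relabel:
  assumes "proper \<sigma> cs xs" "relabel_ok ps cs cs'" "\<forall>p\<in>set ps. 0 < fst p \<and> 0 < snd p"
  shows "proper \<sigma> cs' (map (relabel ps) xs)"
  using assms sorted_relabel[OF _ _ assms(2,3)] relabel_okD(1)[OF assms(2)]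
  unfolding proper_def set_map relabel_low_up(1,2)[OF assms(3)] by simp

lemma proper_jfam: "proper \<sigma> cs xs \<Longrightarrow> sub_ok cs ts \<Longrightarrow> set xs \<in> jfam \<sigma> B vs ts us"
  using sub_okD unfolding proper_def jfam_def by blast

lemma map_eq_on_fam:
  assumes "up (set xs) \<in> fam cs" "\<And>x. x \<le> 0 \<Longrightarrow> f x = g x" "\<forall>c\<in>set cs. \<forall>x\<in>set c. f x = g x"
  shows "map f xs = map g xs"
proof (rule map_cong[OF refl])
  fix x assume x: "x \<in> set xs"
  show "f x = g x"
  proof (cases "0 < x")
    case True
    then have "x \<in> up (set xs)" using x by (simp add: up_def)
    then show ?thesis using assms(1,3) unfolding fam_def by blast
  qed (use assms(2) in simp)
qed

text \<open>
  On the proper faces of \<open>\<sigma>\<close> joined to \<open>{1, 2}\<close>, \<open>f\<close> is an edge \<open>a \<rightarrow> b\<close> in the slices of \<open>X\<close>. Filling inner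
  horns gives a left inverse \<open>b \<rightarrow> a\<close> (in \<open>G\<close>) and then a triangle \<open>b \<rightarrow> a \<rightarrow> b\<close> with second edge \<open>f\<close> and
  degenerate composite (in \<open>H\<close>). In this triangle the cone over \<open>\<sigma>\<close>, given at the last vertex, extends to
  the other vertices along inner horns only.
\<close>

lemma degenerate_outer:
  assumes X: "quasicategory X" and \<sigma>: "finite \<sigma>" "\<sigma> \<noteq> {}" "\<sigma> \<subseteq> {..0}"
    and f: "dmap X (jfam \<sigma> {} [[1,2]] [[1,2]] [[2]]) f"
    and y: "y \<in> simplices X 0"
    and deg: "\<And>xs. xs \<noteq> [] \<Longrightarrow> sorted xs \<Longrightarrow> set xs \<subseteq> {1,2} \<Longrightarrow> f xs = act X 0 (map (\<lambda>_. 0) xs) y"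
  shows "extensible X (jfam \<sigma> {} [[1,2]] [[1,2]] [[2]]) f (jfam \<sigma> {} [[1,2]] [[1,2]] [[1,2]])"
proof -
  let ?J = "jfam \<sigma> {}"
  define c where "c = (\<lambda>xs::int list. act X 0 (map (\<lambda>_. 0) xs) y)"
  have ss: "simplicial_set X" using X unfolding quasicategory_def by blast
  have cd: "dmap X K c" for K unfolding c_def by (rule const_dmap[OF ss y])
  have cm: "c (map u xs) = c xs" for u xs unfolding c_def by (simp add: comp_def)
  note jc = fin_complex_jfam(1)[OF \<sigma>(1)]
  have b: "jbase \<sigma> {} [[1,2,3,4]]" using \<sigma> unfolding jbase_def by auto
  have fc: "f xs = c xs" if "xs \<noteq> []" "sorted xs" "set xs \<subseteq> {1,2}" for xs using deg that unfolding c_def by auto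
  have sub: "set xs \<in> fam cs" if "low (set xs) = {}" "up (set xs) \<in> fam cs" for xs :: "int list" and cs
    using low_up(1)[of "set xs"] that by simp
  have prp: "proper \<sigma> cs xs" if "set xs \<in> jfam \<sigma> {} cs cs []" "xs \<noteq> []" "sorted xs" for xs cs
    using that \<sigma>(2) unfolding jfam_def proper_def by (auto simp: fam_def[of "[]"])

  \<comment> \<open>Over the proper faces of \<sigma> the labels \<open>1, 2, 3, 4\<close> carry
    \<open>a, b, a, b\<close>: by \<open>?u\<close> the edges \<open>1 -> 2\<close> and
    \<open>1 -> 4\<close> are \<open>f\<close>, while \<open>1 -> 3\<close> and
    \<open>2 -> 4\<close> are degenerate. Filling at \<open>1\<close> gives the left inverse
    \<open>2 -> 3\<close>; filling at \<open>2\<close> gives an edge \<open>3 -> 4\<close> homotopic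
    to \<open>f\<close>.\<close>
  let ?C = "[[1,2,4],[1,3]]" and ?u = "relabel [(3,1),(4,2)]"
  have f1: "dmap X (?J ?C ?C []) (\<lambda>xs. f (map ?u xs))"
    by (rule dmap_jfam_relabel[OF f]; code_simp)
  \<comment> \<open>Disjointly from \<sigma> everything can be kept constant at \<open>y\<close>,
    because there \<open>f\<close> is degenerate by \<open>deg\<close>.\<close>
  have "agree (?J ?C ?C [] \<inter> ?J [[1,2,3,4]] [] []) (\<lambda>xs. f (map ?u xs)) c"
    unfolding agree_def
  proof (intro allI impI)
    fix xs assume a: "xs \<noteq> [] \<and> sorted xs \<and> set xs \<in> ?J ?C ?C [] \<inter> ?J [[1,2,3,4]] [] []"
    then have p: "proper \<sigma> ?C xs" using prp by blast
    have "proper \<sigma> [[1,2]] (map ?u xs)" by (rule proper_relabel[OF p]; code_simp)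
    moreover have "low (set xs) = {}" using a unfolding jfam_def fam_def[of "[]"] by simp
    then have "low (set (map ?u xs)) = {}" using relabel_low_up(1)[of "[(3,1),(4,2)]" "set xs"] by simp
    ultimately have "set (map ?u xs) \<in> fam [[1,2]]" using sub unfolding proper_def by blast
    then have "set (map ?u xs) \<subseteq> {1,2}" by (simp add: fam_def)
    then show "f (map ?u xs) = c xs"
      using fc[of "map ?u xs"] cm[of ?u xs] \<open>proper \<sigma> [[1,2]] (map ?u xs)\<close> unfolding proper_def by simp
  qed
  from dmap_Un[OF f1 cd this jc jc] obtain G0 where
    G0: "dmap X (?J ?C ?C [] \<union> ?J [[1,2,3,4]] [] []) G0" "agree (?J ?C ?C []) G0 (\<lambda>xs. f (map ?u xs))"
      "agree (?J [[1,2,3,4]] [] []) G0 c" by blast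
  have e: "?J ?C ?C [] \<union> ?J [[1,2,3,4]] [] [] = ?J [[1,2,3,4]] ?C []"
    unfolding jfam_def fam_def by auto
  have "jext X \<sigma> {} [[1,2,3,4]] G0 ?C [] [[1,2,3,4]] []"
    by (rule jext_trans[OF b jext_toggle[OF X b, where v = 1 and ts' = "[[1,2,4],[1,2,3]]" and us' = "[]"]
          jext_toggle[OF X b, where v = 2]]; code_simp)
  then have "extensible X (?J [[1,2,3,4]] ?C []) G0 (?J [[1,2,3,4]] [[1,2,3,4]] [])"
    using G0(1) agree_refl unfolding e jext_def by blast
  then obtain G where G: "dmap X (?J [[1,2,3,4]] [[1,2,3,4]] []) G" "agree (?J [[1,2,3,4]] ?C []) G G0"
    unfolding extensible_def by blast
  have G1: "G xs = f (map ?u xs)" if "proper \<sigma> ?C xs" for xs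
  proof -
    have "set xs \<in> ?J [[1,2,3,4]] ?C []" "set xs \<in> ?J ?C ?C []" using proper_jfam[OF that] by (auto simp: sub_ok_def infam_def)
    then show ?thesis using agreeD[OF G(2)] agreeD[OF G0(2)] that unfolding proper_def by auto
  qed
  have Gc: "G xs = c xs" if "xs \<noteq> []" "sorted xs" "set xs \<in> ?J [[1,2,3,4]] [] []" for xs
  proof -
    have "set xs \<in> ?J [[1,2,3,4]] ?C []" using that(3) e by blast
    then show ?thesis using agreeD[OF G(2)] agreeD[OF G0(3)] that by auto
  qed

  \<comment> \<open>The edge \<open>3 -> 4\<close> of \<open>G\<close> must be replaced by
    \<open>f\<close> itself. Now the labels carry \<open>b, a, a, b\<close>: the faces in
    \<open>?D\<close> come from the triangle \<open>2, 3, 4\<close> of \<open>G\<close> and its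
    degeneracies, the face in \<open>?E\<close> from the triangle \<open>1, 3, 4\<close>. Filling at
    \<open>3\<close> yields the triangle \<open>1, 2, 4\<close>, in which \<open>2 -> 4\<close> is
    \<open>f\<close> and \<open>1 -> 4\<close> is degenerate.\<close>
  let ?D = "[[1,3,4],[1,2,3]]" and ?E = "[[2,3,4]]" and ?w1 = "relabel [(1,2),(2,3)]" and ?w2 = "relabel [(2,1)]"
  have h1: "dmap X (?J ?D ?D []) (\<lambda>xs. G (map ?w1 xs))"
    by (rule dmap_jfam_relabel[OF G(1)]; code_simp)
  have h2: "dmap X (?J ?E ?E []) (\<lambda>xs. G (map ?w2 xs))"
    by (rule dmap_jfam_relabel[OF G(1)]; code_simp)
  have "agree (?J ?D ?D [] \<inter> ?J ?E ?E []) (\<lambda>xs. G (map ?w1 xs)) (\<lambda>xs. G (map ?w2 xs))"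
    unfolding agree_def
  proof (intro allI impI)
    fix xs assume a: "xs \<noteq> [] \<and> sorted xs \<and> set xs \<in> ?J ?D ?D [] \<inter> ?J ?E ?E []"
    then have "proper \<sigma> ?D xs" "proper \<sigma> ?E xs" using prp by blast+
    then have "proper \<sigma> [[3,4]] xs \<or> proper \<sigma> [[2,3]] xs" unfolding proper_def fam_def by auto
    then show "G (map ?w1 xs) = G (map ?w2 xs)"
    proof
      assume p: "proper \<sigma> [[3,4]] xs"
      have "map ?w1 xs = map ?w2 xs"
        by (rule map_eq_on_fam[where cs = "[[3,4]]"]) (use p in \<open>auto simp: proper_def relabel_def\<close>)
      then show ?thesis by (rule arg_cong)
    next
      assume p: "proper \<sigma> [[2,3]] xs"
      have 1: "proper \<sigma> ?C (map ?w1 xs)" by (rule proper_relabel[OF p]; code_simp)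
      have 2: "proper \<sigma> ?C (map ?w2 xs)" by (rule proper_relabel[OF p]; code_simp)
      have "map (?u \<circ> ?w1) xs = map (?u \<circ> ?w2) xs"
        by (rule map_eq_on_fam[where cs = "[[2,3]]"]) (use p in \<open>auto simp: proper_def relabel_def\<close>)
      then have "f (map (?u \<circ> ?w1) xs) = f (map (?u \<circ> ?w2) xs)" by (rule arg_cong)
      then show ?thesis using G1[OF 1] G1[OF 2] by simp
    qed
  qed
  from dmap_Un[OF h1 h2 this jc jc] obtain H0 where
    H0: "dmap X (?J ?D ?D [] \<union> ?J ?E ?E []) H0" "agree (?J ?D ?D []) H0 (\<lambda>xs. G (map ?w1 xs))"
      "agree (?J ?E ?E []) H0 (\<lambda>xs. G (map ?w2 xs))" by blast
  have "agree ((?J ?D ?D [] \<union> ?J ?E ?E []) \<inter> ?J [[1,2,3,4]] [] []) H0 c"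
    unfolding agree_def
  proof (intro allI impI)
    fix xs assume a: "xs \<noteq> [] \<and> sorted xs \<and> set xs \<in> (?J ?D ?D [] \<union> ?J ?E ?E []) \<inter> ?J [[1,2,3,4]] [] []"
    then have l: "low (set xs) = {}" unfolding jfam_def fam_def[of "[]"] by simp
    have mem: "set xs \<in> ?J [[1,2,3,4]] [] []" if "proper \<sigma> [[1,2,3,4]] xs" "low (set xs) = {}" for xs
      using that unfolding proper_def jfam_def by auto
    from a consider "set xs \<in> ?J ?D ?D []" | "set xs \<in> ?J ?E ?E []" by blast
    then show "H0 xs = c xs"
    proof cases
      case 1
      then have p: "proper \<sigma> ?D xs" using a prp by blast
      have q: "proper \<sigma> [[1,2,3,4]] (map ?w1 xs)" by (rule proper_relabel[OF p]; code_simp)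
      have "low (set (map ?w1 xs)) = {}" using relabel_low_up(1)[of "[(1,2),(2,3)]" "set xs"] l by simp
      then have "G (map ?w1 xs) = c xs" using Gc[OF _ _ mem[OF q]] q cm unfolding proper_def by auto
      then show ?thesis using agreeD[OF H0(2)] a 1 by simp
    next
      case 2
      then have p: "proper \<sigma> ?E xs" using a prp by blast
      have q: "proper \<sigma> [[1,2,3,4]] (map ?w2 xs)" by (rule proper_relabel[OF p]; code_simp)
      have "low (set (map ?w2 xs)) = {}" using relabel_low_up(1)[of "[(2,1)]" "set xs"] l by simp
      then have "G (map ?w2 xs) = c xs" using Gc[OF _ _ mem[OF q]] q cm unfolding proper_def by auto
      then show ?thesis using agreeD[OF H0(3)] a 2 by simp
    qed
  qed
  from dmap_Un[OF H0(1) cd this fin_complex_Un[OF jc jc] jc] obtain H1 where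
    H1: "dmap X (?J ?D ?D [] \<union> ?J ?E ?E [] \<union> ?J [[1,2,3,4]] [] []) H1" "agree (?J ?D ?D [] \<union> ?J ?E ?E []) H1 H0"
    by blast
  have e: "?J ?D ?D [] \<union> ?J ?E ?E [] \<union> ?J [[1,2,3,4]] [] [] = ?J [[1,2,3,4]] (?D @ ?E) []"
    unfolding jfam_def fam_def by auto
  have "jext X \<sigma> {} [[1,2,3,4]] H1 (?D @ ?E) [] [[1,2,3,4]] []"
    by (rule jext_toggle[OF X b, where v = 3]; code_simp)
  then have "extensible X (?J [[1,2,3,4]] (?D @ ?E) []) H1 (?J [[1,2,3,4]] [[1,2,3,4]] [])"
    using H1(1) agree_refl unfolding e jext_def by blast
  then obtain H where H: "dmap X (?J [[1,2,3,4]] [[1,2,3,4]] []) H" "agree (?J [[1,2,3,4]] (?D @ ?E) []) H H1"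
    unfolding extensible_def by blast
  have HD: "H xs = G (map ?w1 xs)" if "proper \<sigma> ?D xs" for xs
  proof -
    have 1: "set xs \<in> ?J ?D ?D []" using proper_jfam[OF that] by (auto simp: sub_ok_def infam_def)
    then have "set xs \<in> ?J [[1,2,3,4]] (?D @ ?E) []" using e by blast
    then show ?thesis using agreeD[OF H(2)] agreeD[OF H1(2)] agreeD[OF H0(2)] 1 that unfolding proper_def by auto
  qed
  have HE: "H xs = G (map ?w2 xs)" if "proper \<sigma> ?E xs" for xs
  proof -
    have 1: "set xs \<in> ?J ?E ?E []" using proper_jfam[OF that] by (auto simp: sub_ok_def infam_def)
    then have "set xs \<in> ?J [[1,2,3,4]] (?D @ ?E) []" using e by blast
    then show ?thesis using agreeD[OF H(2)] agreeD[OF H1(2)] agreeD[OF H0(3)] 1 that unfolding proper_def by auto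
  qed

  \<comment> \<open>The triangle \<open>1, 2, 4\<close> of \<open>H\<close> becomes
    \<open>1, 2, 3\<close>, and the cone over \<sigma>, known at \<open>b\<close>, is pulled back to
    its degenerate edge \<open>1 -> 3\<close>. The missing faces over \<sigma> all contain
    \<open>2\<close> and are matched by toggling \<open>1\<close>.\<close>
  let ?z = "relabel [(3,4)]" and ?t = "relabel [(1,2),(3,2)]"
  have l1: "dmap X (?J [[1,2,3]] [[1,2,3]] []) (\<lambda>xs. H (map ?z xs))"
    by (rule dmap_jfam_relabel[OF H(1)]; code_simp)
  have l2: "dmap X (?J [[1,3]] [[1,3]] [[1,3]]) (\<lambda>xs. f (map ?t xs))"
    by (rule dmap_jfam_relabel[OF f]; code_simp)
  have "agree (?J [[1,2,3]] [[1,2,3]] [] \<inter> ?J [[1,3]] [[1,3]] [[1,3]]) (\<lambda>xs. H (map ?z xs)) (\<lambda>xs. f (map ?t xs))"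
    unfolding agree_def
  proof (intro allI impI)
    fix xs assume a: "xs \<noteq> [] \<and> sorted xs \<and> set xs \<in> ?J [[1,2,3]] [[1,2,3]] [] \<inter> ?J [[1,3]] [[1,3]] [[1,3]]"
    then have "proper \<sigma> [[1,2,3]] xs" using prp by blast
    moreover have "up (set xs) \<in> fam [[1,3]]" using a unfolding jfam_def by blast
    ultimately have p: "proper \<sigma> [[1,3]] xs" unfolding proper_def by blast
    have 1: "proper \<sigma> ?D (map ?z xs)" by (rule proper_relabel[OF p]; code_simp)
    have p': "proper \<sigma> [[1,4]] (map ?z xs)" by (rule proper_relabel[OF p]; code_simp)
    have 2: "proper \<sigma> ?C (map ?w1 (map ?z xs))" by (rule proper_relabel[OF p']; code_simp)
    have "map (?u \<circ> ?w1 \<circ> ?z) xs = map ?t xs"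
      by (rule map_eq_on_fam[where cs = "[[1,3]]"]) (use p in \<open>auto simp: proper_def relabel_def\<close>)
    then have "f (map (?u \<circ> ?w1 \<circ> ?z) xs) = f (map ?t xs)" by (rule arg_cong)
    then show "H (map ?z xs) = f (map ?t xs)" using HD[OF 1] G1[OF 2] by (simp add: comp_assoc)
  qed
  from dmap_Un[OF l1 l2 this jc jc] obtain L where
    L: "dmap X (?J [[1,2,3]] [[1,2,3]] [] \<union> ?J [[1,3]] [[1,3]] [[1,3]]) L"
      "agree (?J [[1,2,3]] [[1,2,3]] []) L (\<lambda>xs. H (map ?z xs))"
      "agree (?J [[1,3]] [[1,3]] [[1,3]]) L (\<lambda>xs. f (map ?t xs))" by blast
  have e: "?J [[1,2,3]] [[1,2,3]] [] \<union> ?J [[1,3]] [[1,3]] [[1,3]] = ?J [[1,2,3]] [[1,2,3]] [[1,3]]"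
    unfolding jfam_def fam_def by auto
  have b3: "jbase \<sigma> {} [[1,2,3]]" using \<sigma> unfolding jbase_def by auto
  have "jext X \<sigma> {} [[1,2,3]] L [[1,2,3]] [[1,3]] [[1,2,3]] [[1,2,3]]"
    by (rule jext_toggle[OF X b3, where v = 1]; code_simp)
  then have "extensible X (?J [[1,2,3]] [[1,2,3]] [[1,3]]) L (?J [[1,2,3]] [[1,2,3]] [[1,2,3]])"
    using L(1) agree_refl unfolding e jext_def by blast
  then obtain M where M: "dmap X (?J [[1,2,3]] [[1,2,3]] [[1,2,3]]) M" "agree (?J [[1,2,3]] [[1,2,3]] [[1,3]]) M L"
    unfolding extensible_def by blast

  \<comment> \<open>The edge \<open>2 -> 3\<close> of the triangle is \<open>f\<close>, so
    restricting to it solves the original problem.\<close>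
  let ?q = "relabel [(1,2),(2,3)]"
  have q: "dmap X (?J [[1,2]] [[1,2]] [[1,2]]) (\<lambda>xs. M (map ?q xs))"
    by (rule dmap_jfam_relabel[OF M(1)]; code_simp)
  have "agree (?J [[1,2]] [[1,2]] [[2]]) (\<lambda>xs. M (map ?q xs)) f"
    unfolding agree_def
  proof (intro allI impI)
    fix xs assume a: "xs \<noteq> [] \<and> sorted xs \<and> set xs \<in> ?J [[1,2]] [[1,2]] [[2]]"
    show "M (map ?q xs) = f xs"
    proof (cases "low (set xs) = \<sigma>")
      case True
      then have up: "up (set xs) \<in> fam [[2]]" using a \<sigma>(2) unfolding jfam_def by auto
      have s: "sorted (map ?q xs)" by (rule sorted_relabel[OF _ up, where cs' = "[[3]]"]) (use a in simp, code_simp+)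
      have "up (set (map ?q xs)) \<in> fam [[1,3]]" "low (set (map ?q xs)) = \<sigma>"
        using relabel_low_up(1,2)[of "[(1,2),(2,3)]" "set xs"] up True by (auto simp: fam_def relabel_def)
      then have m: "set (map ?q xs) \<in> ?J [[1,3]] [[1,3]] [[1,3]]" unfolding jfam_def by blast
      then have m2: "set (map ?q xs) \<in> ?J [[1,2,3]] [[1,2,3]] [[1,3]]" using e by blast
      have "map ?q xs \<noteq> []" using a by simp
      then have "M (map ?q xs) = f (map ?t (map ?q xs))"
        using agreeD[OF M(2) _ s m2] agreeD[OF L(3) _ s m] by simp
      also have "map ?t (map ?q xs) = map (?t \<circ> ?q) xs" by simp
      also have "\<dots> = map id xs"
        by (rule map_eq_on_fam[OF up]) (auto simp: relabel_def)
      finally show ?thesis by simp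
    next
      case False
      then have p: "proper \<sigma> [[1,2]] xs"
        using a sub_okD[of "[[2]]" "[[1,2]]"] unfolding jfam_def proper_def by (auto simp: sub_ok_def infam_def)
      have 1: "proper \<sigma> [[2,3]] (map ?q xs)" by (rule proper_relabel[OF p]; code_simp)
      have 2: "proper \<sigma> ?E (map ?z (map ?q xs))" by (rule proper_relabel[OF 1]; code_simp)
      have 4: "proper \<sigma> [[2,4]] (map ?z (map ?q xs))" by (rule proper_relabel[OF 1]; code_simp)
      have 3: "proper \<sigma> ?C (map ?w2 (map ?z (map ?q xs)))" by (rule proper_relabel[OF 4]; code_simp)
      have m: "set (map ?q xs) \<in> ?J [[1,2,3]] [[1,2,3]] []" by (rule proper_jfam[OF 1]; code_simp)
      then have m2: "set (map ?q xs) \<in> ?J [[1,2,3]] [[1,2,3]] [[1,3]]" using e by blast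
      have "map ?q xs \<noteq> []" "sorted (map ?q xs)" using 1 unfolding proper_def by auto
      then have "M (map ?q xs) = H (map ?z (map ?q xs))"
        using agreeD[OF M(2) _ _ m2] agreeD[OF L(2) _ _ m] by simp
      also have "\<dots> = f (map ?u (map ?w2 (map ?z (map ?q xs))))" using HE[OF 2] G1[OF 3] by simp
      also have "map ?u (map ?w2 (map ?z (map ?q xs))) = map (?u \<circ> ?w2 \<circ> ?z \<circ> ?q) xs" by simp
      also have "\<dots> = map id xs"
        by (rule map_eq_on_fam[where cs = "[[1,2]]"]) (use p in \<open>auto simp: proper_def relabel_def\<close>)
      finally show ?thesis by simp
    qed
  qed
  with q show ?thesis unfolding extensible_def by blast
qed

lemma rspecial_degenerate:
  assumes X: "quasicategory X" and y: "y \<in> simplices X 0"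
  shows "rspecial X (act X 0 [0, 0] y)"
  unfolding rspecial_def
proof (intro allI impI ballI)
  fix n h assume n: "2 \<le> n" and h: "h \<in> sset_hom (horn n n) X" "h 1 [n - 1, n] = act X 0 [0, 0] y"
  have ss: "simplicial_set X" using X unfolding quasicategory_def by blast
  define f where "f xs = h (length xs - 1) xs" for xs
  have f: "dmap X (hornc n) f"
    unfolding f_def by (rule dmap_of_subcomplex[OF horn_hornc h(1)])
  \<comment> \<open>This shift sends the last two vertices \<open>n - 1\<close> and \<open>n\<close>
    to \<open>1\<close> and \<open>2\<close>, and the others onto the labels from
    \<open>2 - n\<close> to \<open>0\<close> that make up \<sigma>.\<close>
  define r where "r i = int i - int n + 2" for i
  define r' where "r' x = nat (x + int n - 2)" for x
  define \<sigma> where "\<sigma> = {2 - int n..0}"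
  have \<sigma>: "finite \<sigma>" "\<sigma> \<noteq> {}" "\<sigma> \<subseteq> {..0}" using n by (auto simp: \<sigma>_def)
  have r'r: "r' (r i) = i" for i by (simp add: r_def r'_def)
  have mr': "mono_on S r'" for S by (auto simp: mono_on_def r'_def)
  have fr: "dmap X (jfam \<sigma> {} [[1,2]] [[1,2]] [[2]]) (\<lambda>xs. f (map r' xs))"
  proof (rule dmap_reindex[OF f conjI[OF _ mr']])
    fix S assume S: "S \<in> jfam \<sigma> {} [[1,2]] [[1,2]] [[2]]"
    have S1: "low S \<subseteq> \<sigma>" "up S \<subseteq> {1,2}" "low S = \<sigma> \<longrightarrow> 1 \<notin> up S"
      using S \<sigma>(2) unfolding jfam_def fam_def by auto
    have "low S \<union> up S \<subseteq> {2 - int n..2}"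
      using n by (intro Un_least subset_trans[OF S1(1)] subset_trans[OF S1(2)]) (auto simp: \<sigma>_def)
    then have S2: "S \<subseteq> {2 - int n..2}" using low_up(1)[of S] by simp
    \<comment> \<open>A label other than \<open>2\<close> that is missing from the face; it shows
      that the shifted face belongs to the horn.\<close>
    obtain z where z: "z \<in> {2 - int n..1}" "z \<notin> S"
    proof (cases "low S = \<sigma>")
      case True
      then show ?thesis using S1(3) that[of 1] n by (auto simp: up_def)
    next
      case False
      then obtain z where "z \<in> \<sigma>" "z \<notin> low S" using S1(1) by blast
      then show ?thesis using that[of z] unfolding \<sigma>_def by (auto simp: low_def)
    qed
    have "r' z \<notin> insert n (r' ` S)" "r' z \<in> {..n}"
      using z S2 by (auto simp: r'_def nat_eq_iff subset_iff eq_nat_nat_iff)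
    moreover have "r' ` S \<subseteq> {..n}" using S2 by (fastforce simp: r'_def)
    ultimately show "r' ` S \<in> hornc n" unfolding hornc_def by blast
  qed
  have "0 \<in> {..n}" "0 \<notin> insert n {n - 1, n}" "{n - 1, n} \<subseteq> {..n}" using n by auto
  then have "{n - 1, n} \<in> hornc n" unfolding hornc_def by blast
  then have s: "length [n - 1, n] = Suc 1" "sorted [n - 1, n]" "set [n - 1, n] \<in> hornc n" by auto
  have deg: "f (map r' xs) = act X 0 (map (\<lambda>_. 0) xs) y" if xs: "xs \<noteq> []" "sorted xs" "set xs \<subseteq> {1,2}" for xs
  proof -
    obtain m where m: "length xs = Suc m" using xs(1) by (cases xs) auto
    define \<alpha> where "\<alpha> = map (\<lambda>x. nat (x - 1)) xs"
    have al: "\<alpha> \<in> simplices (Delta 1) m"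
      using xs m by (auto simp: in_Delta \<alpha>_def sorted_map intro: sorted_wrt_mono_rel[of _ "(\<le>)"])
    have "comp_op [n - 1, n] \<alpha> = map r' xs"
      using xs(3) n by (auto simp: \<alpha>_def r'_def nat_diff_distrib)
    then have "f (map r' xs) = act X 1 \<alpha> (act X 0 [0, 0] y)"
      using dmapD(2)[OF f s al] h(2) by (simp add: f_def)
    also have "\<dots> = act X 0 (comp_op [0, 0] \<alpha>) y"
      by (rule sset_act(3)[OF ss _ al y]) (auto simp: in_nerve)
    also have "comp_op [0, 0] \<alpha> = map (\<lambda>_. 0) xs"
      using xs(3) by (auto simp: \<alpha>_def)
    finally show ?thesis .
  qed
  obtain g where g: "dmap X (jfam \<sigma> {} [[1,2]] [[1,2]] [[1,2]]) g"
    "agree (jfam \<sigma> {} [[1,2]] [[1,2]] [[2]]) g (\<lambda>xs. f (map r' xs))"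
    using degenerate_outer[OF X \<sigma> fr y deg] unfolding extensible_def by blast
  have mr: "mono_on S r" for S by (auto simp: mono_on_def r_def)
  have low_r: "low (r ` S) = r ` (S \<inter> {..n - 2})" "up (r ` S) = r ` (S \<inter> {n - 1..})" for S
    using n by (auto simp: low_def up_def r_def)
  have rP: "r ` S \<in> jfam \<sigma> {} [[1,2]] [[1,2]] [[1,2]]" if "S \<subseteq> {..n}" for S
  proof -
    have "low (r ` S) \<subseteq> \<sigma>" unfolding low_r \<sigma>_def using n by (auto simp: r_def)
    moreover have "up (r ` S) \<subseteq> {1,2}" unfolding low_r using n that by (auto simp: r_def)
    ultimately show ?thesis unfolding jfam_def fam_def by auto
  qed
  have rH: "r ` S \<in> jfam \<sigma> {} [[1,2]] [[1,2]] [[2]]" if "S \<in> hornc n" for S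
  proof -
    have S: "S \<subseteq> {..n}" "\<not> {..n} \<subseteq> insert n S" using that unfolding hornc_def by auto
    have "low (r ` S) \<noteq> \<sigma> \<or> up (r ` S) \<subseteq> {2}"
    proof (rule ccontr)
      assume "\<not> ?thesis"
      then have a: "low (r ` S) = \<sigma>" "\<not> up (r ` S) \<subseteq> {2}" by auto
      have "i \<in> insert n S" if "i \<le> n" for i
      proof -
        consider "i \<le> n - 2" | "i = n - 1" | "i = n" using \<open>i \<le> n\<close> by linarith
        then show ?thesis
        proof cases
          case 1
          then have "r i \<in> \<sigma>" using n by (auto simp: r_def \<sigma>_def)
          then have "r i \<in> r ` S" using a(1) by (auto simp: low_def)
          then show ?thesis using r'r by (metis imageE insertI2)
        next
          case 2
          obtain x where "x \<in> S" "n - 1 \<le> x" "r x \<noteq> 2" using a(2) unfolding low_r by auto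
          moreover have "x \<noteq> n" using \<open>r x \<noteq> 2\<close> by (auto simp: r_def)
          ultimately show ?thesis using S(1) 2 by (metis atMost_iff insertI2 le_antisym less_Suc_eq_le
              linorder_not_le nat_less_le subsetD Suc_pred' not_less_eq_eq diff_Suc_1 le_zero_eq gr0I)
        qed simp
      qed
      then show False using S(2) by auto
    qed
    then show ?thesis using rP[OF S(1)] unfolding jfam_def fam_def by auto
  qed
  have "dmap X (Pow {..n}) (\<lambda>xs. g (map r xs))"
    by (rule dmap_reindex[OF g(1)]) (use rP mr in auto)
  moreover have "agree (hornc n) (\<lambda>xs. g (map r xs)) f"
    unfolding agree_def
  proof (intro allI impI)
    fix xs assume a: "xs \<noteq> [] \<and> sorted xs \<and> set xs \<in> hornc n"
    have "sorted (map r xs)" using a mr by (auto simp: sorted_map r_def intro: sorted_wrt_mono_rel[of _ "(\<le>)"])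
    then have "g (map r xs) = f (map r' (map r xs))" using agreeD[OF g(2), of "map r xs"] rH[of "set xs"] a by simp
    then show "g (map r xs) = f xs" by (simp add: r'r comp_def)
  qed
  ultimately have "extensible X (hornc n) f (Pow {..n})" unfolding extensible_def by blast
  then show "fillable X n (horn n n) h"
    unfolding f_def by (rule fillable_of_extensible[OF horn_hornc(1)])
qed

section \<open>Limits of diagrams and limit cones on ordered complexes\<close>

text \<open>With empty parts allowed, the three constructors of \<open>join\<close> become one
  concatenation of a left and a right list. The index of \<open>Mix\<close> is the dimension of the
  left part, one less than its length.\<close>

definition jn :: "'a list \<Rightarrow> 'b list \<Rightarrow> ('a list, 'b list) join_simplex" where
  "jn ys zs = (if zs = [] then InL ys else if ys = [] then InR zs else Mix (length ys - 1) ys zs)"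

definition lp :: "('a list, 'b list) join_simplex \<Rightarrow> 'a list" where
  "lp z = (case z of InL y \<Rightarrow> y | InR _ \<Rightarrow> [] | Mix _ y _ \<Rightarrow> y)"

definition rp :: "('a list, 'b list) join_simplex \<Rightarrow> 'b list" where
  "rp z = (case z of InL _ \<Rightarrow> [] | InR x \<Rightarrow> x | Mix _ _ x \<Rightarrow> x)"

lemma lp_jn [simp]: "lp (jn ys zs) = ys" and rp_jn [simp]: "rp (jn ys zs) = zs"
  by (auto simp: jn_def lp_def rp_def)

lemma in_join:
  "z \<in> simplices (join (nerve P) (nerve A)) k \<longleftrightarrow> (\<exists>ys zs. z = jn ys zs \<and> length ys + length zs = Suc k \<and>
     sorted_wrt (\<le>) ys \<and> set ys \<subseteq> P \<and> sorted_wrt (\<le>) zs \<and> set zs \<subseteq> A)"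
proof
  assume "z \<in> simplices (join (nerve P) (nerve A)) k"
  then consider (L) x where "z = InL x" "x \<in> simplices (nerve P) k"
    | (R) x where "z = InR x" "x \<in> simplices (nerve A) k"
    | (M) i x y where "z = Mix i x y" "i < k" "x \<in> simplices (nerve P) i" "y \<in> simplices (nerve A) (k - Suc i)"
    unfolding join_def by auto
  then show "\<exists>ys zs. z = jn ys zs \<and> length ys + length zs = Suc k \<and>
     sorted_wrt (\<le>) ys \<and> set ys \<subseteq> P \<and> sorted_wrt (\<le>) zs \<and> set zs \<subseteq> A"
  proof cases
    case L then show ?thesis by (intro exI[of _ x] exI[of _ "[]"]) (auto simp: jn_def in_nerve)
  next
    case R then show ?thesis by (intro exI[of _ "[]"] exI[of _ x]) (auto simp: jn_def in_nerve)
  next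
    case M
    then have "x \<noteq> []" "y \<noteq> []" "length x = Suc i" "length y = k - i" by (auto simp: in_nerve)
    then show ?thesis using M by (intro exI[of _ x] exI[of _ y]) (auto simp: jn_def in_nerve)
  qed
next
  assume "\<exists>ys zs. z = jn ys zs \<and> length ys + length zs = Suc k \<and>
     sorted_wrt (\<le>) ys \<and> set ys \<subseteq> P \<and> sorted_wrt (\<le>) zs \<and> set zs \<subseteq> A"
  then obtain ys zs where z: "z = jn ys zs" "length ys + length zs = Suc k"
    "sorted_wrt (\<le>) ys" "set ys \<subseteq> P" "sorted_wrt (\<le>) zs" "set zs \<subseteq> A" by blast
  show "z \<in> simplices (join (nerve P) (nerve A)) k"
  proof (cases "zs = [] \<or> ys = []")
    case True then show ?thesis using z by (auto simp: jn_def join_def in_nerve)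
  next
    case False
    then obtain i where i: "length ys = Suc i" by (metis length_0_conv not0_implies_Suc)
    have "length zs > 0" using False by simp
    then have "i < k" "length zs = Suc (k - Suc i)" using z(2) i by linarith+
    then show ?thesis using z False i by (auto simp: jn_def join_def in_nerve)
  qed
qed

text \<open>Cutting an operator at the length of the left part, not at its dimension, keeps the
  formulas valid when the left part is empty.\<close>

abbreviation cutl :: "nat \<Rightarrow> nat list \<Rightarrow> nat list" where "cutl n \<alpha> \<equiv> filter (\<lambda>k. k < n) \<alpha>"
abbreviation cutr :: "nat \<Rightarrow> nat list \<Rightarrow> nat list" where "cutr n \<alpha> \<equiv> map (\<lambda>k. k - n) (filter (\<lambda>k. n \<le> k) \<alpha>)"

lemma sorted_cut: "sorted \<alpha> \<Longrightarrow> filter (\<lambda>k. k < n) \<alpha> @ filter (\<lambda>k. n \<le> k) \<alpha> = (\<alpha> :: nat list)"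
proof (induction \<alpha>)
  case (Cons a \<alpha>)
  then show ?case
  proof (cases "a < n")
    case False
    then have "filter (\<lambda>k. k < n) \<alpha> = []" "filter (\<lambda>k. n \<le> k) \<alpha> = \<alpha>"
      using Cons.prems by (auto simp: filter_empty_conv intro!: filter_True)
    then show ?thesis using False by simp
  qed auto
qed simp

lemma comp_op_append:
  assumes "sorted \<alpha>"
  shows "comp_op (ys @ zs) \<alpha> = comp_op ys (cutl (length ys) \<alpha>) @ comp_op zs (cutr (length ys) \<alpha>)"
proof -
  have "comp_op (ys @ zs) \<alpha> = comp_op (ys @ zs) (cutl (length ys) \<alpha>) @ comp_op (ys @ zs) (filter (\<lambda>k. length ys \<le> k) \<alpha>)"
    by (metis map_append sorted_cut[OF assms])
  then show ?thesis by (simp add: nth_append)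
qed

lemma cut_props:
  assumes "sorted \<alpha>" "set \<alpha> \<subseteq> {..<n + m}"
  shows "sorted (cutl n \<alpha>)" "sorted (cutr n \<alpha>)" "set (cutl n \<alpha>) \<subseteq> {..<n}" "set (cutr n \<alpha>) \<subseteq> {..<m}"
    "length (cutl n \<alpha>) + length (cutr n \<alpha>) = length \<alpha>"
proof -
  show "sorted (cutl n \<alpha>)" using sorted_wrt_filter assms(1) by blast
  have "sorted (filter (\<lambda>k. n \<le> k) \<alpha>)" using sorted_wrt_filter assms(1) by blast
  then show "sorted (cutr n \<alpha>)" by (auto simp: sorted_map intro: sorted_wrt_mono_rel[of _ "(\<le>)"] diff_le_mono)
  show "length (cutl n \<alpha>) + length (cutr n \<alpha>) = length \<alpha>"
    using arg_cong[OF sorted_cut[OF assms(1), of n], of length] by simp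
qed (use assms in auto)

lemma act_jn:
  assumes l: "length ys + length zs = Suc k" and al: "\<alpha> \<in> simplices (Delta k) m"
  shows "act (join (nerve P) (nerve A)) k \<alpha> (jn ys zs) =
    jn (comp_op ys (cutl (length ys) \<alpha>)) (comp_op zs (cutr (length ys) \<alpha>))"
proof -
  have a: "set \<alpha> \<subseteq> {..<length ys + length zs}" "\<alpha> \<noteq> []" using al l by (auto simp: in_Delta)
  consider "zs = []" | "ys = []" "zs \<noteq> []" | "ys \<noteq> []" "zs \<noteq> []" by blast
  then show ?thesis
  proof cases
    case 1
    then have "cutl (length ys) \<alpha> = \<alpha>" "filter (\<lambda>k. length ys \<le> k) \<alpha> = []"
      using a by (auto simp: filter_empty_conv intro!: filter_True)
    then show ?thesis using 1 by (simp add: jn_def join_def)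
  next
    case 2
    then have "cutr (length ys) \<alpha> = \<alpha>" "cutl (length ys) \<alpha> = []" by (auto simp: filter_empty_conv)
    then show ?thesis using 2 a by (simp add: jn_def join_def)
  next
    case 3
    then obtain i where i: "length ys = Suc i" by (metis length_0_conv not0_implies_Suc)
    have "cutl (Suc i) \<alpha> = filter (\<lambda>k. k \<le> i) \<alpha>" "filter (\<lambda>k. Suc i \<le> k) \<alpha> = filter (\<lambda>k. i < k) \<alpha>"
      by (simp_all add: less_Suc_eq_le Suc_le_eq)
    then show ?thesis using 3 i by (simp add: jn_def join_def Let_def)
  qed
qed

lemma map_join_comp_op:
  "map_join_simplex (comp_op \<alpha>) id (jn ys zs) = jn (comp_op \<alpha> ys) zs"
  by (auto simp: jn_def)

section \<open>Simplicial maps, nerves and labelled posets\<close>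

lemma sset_homD:
  assumes "f \<in> sset_hom S T"
  shows "x \<in> simplices S n \<Longrightarrow> f n x \<in> simplices T n" "x \<notin> simplices S n \<Longrightarrow> f n x = undefined"
    "\<alpha> \<in> simplices (Delta n) m \<Longrightarrow> x \<in> simplices S n \<Longrightarrow> f m (act S n \<alpha> x) = act T n \<alpha> (f n x)"
  using assms unfolding sset_hom_def PiE_def extensional_def Pi_def by blast+

lemma sset_homI:
  assumes "\<And>n x. x \<in> simplices S n \<Longrightarrow> f n x \<in> simplices T n" "\<And>n x. x \<notin> simplices S n \<Longrightarrow> f n x = undefined"
    "\<And>n m \<alpha> x. \<alpha> \<in> simplices (Delta n) m \<Longrightarrow> x \<in> simplices S n \<Longrightarrow> f m (act S n \<alpha> x) = act T n \<alpha> (f n x)"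
  shows "f \<in> sset_hom S T"
  unfolding sset_hom_def using assms by auto

lemma sset_map_in [simp]: "x \<in> simplices S n \<Longrightarrow> sset_map S f n x = f n x"
  and sset_map_out: "x \<notin> simplices S n \<Longrightarrow> sset_map S f n x = undefined"
  by (simp_all add: sset_map_def)

lemma sset_mapI:
  assumes "\<And>n x. x \<in> simplices S n \<Longrightarrow> f n x \<in> simplices T n"
    "\<And>n m \<alpha> x. \<alpha> \<in> simplices (Delta n) m \<Longrightarrow> x \<in> simplices S n \<Longrightarrow>
       act S n \<alpha> x \<in> simplices S m \<and> f m (act S n \<alpha> x) = act T n \<alpha> (f n x)"
  shows "sset_map S f \<in> sset_hom S T"
  using assms by (intro sset_homI) (auto simp: sset_map_out)

lemma simplicial_set_nerve: "simplicial_set (nerve A)"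
  unfolding simplicial_set_def
proof (intro conjI allI ballI)
  fix n m \<alpha> xs assume a: "\<alpha> \<in> simplices (Delta n) m" "xs \<in> simplices (nerve A) n"
  then have s: "set \<alpha> \<subseteq> {..<length xs}" by (auto simp: in_nerve)
  show "act (nerve A) n \<alpha> xs \<in> simplices (nerve A) m"
    using sorted_wrt_comp_op[OF _ _ s] set_comp_op[OF s] a by (auto simp: in_nerve)
  fix k \<beta> assume b: "\<beta> \<in> simplices (Delta m) k"
  have "set \<beta> \<subseteq> {..<length \<alpha>}" using a(1) b by (auto simp: in_nerve)
  then show "act (nerve A) m \<beta> (act (nerve A) n \<alpha> xs) = act (nerve A) n (comp_op \<alpha> \<beta>) xs"
    using comp_op_comp_op by auto
next
  fix n and xs :: "'a list" assume "xs \<in> simplices (nerve A) n"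
  then show "act (nerve A) n (id_op n) xs = xs" using comp_op_id[of xs n] by (simp add: in_nerve)
qed

lemma join_jnI:
  "length ys + length zs = Suc k \<Longrightarrow> sorted_wrt (\<le>) ys \<Longrightarrow> set ys \<subseteq> P \<Longrightarrow> sorted_wrt (\<le>) zs \<Longrightarrow> set zs \<subseteq> A \<Longrightarrow>
   jn ys zs \<in> simplices (join (nerve P) (nerve A)) k"
  unfolding in_join by blast

lemma act_join_closed:
  assumes "\<alpha> \<in> simplices (Delta k) m" "z \<in> simplices (join (nerve P) (nerve A)) k"
  shows "act (join (nerve P) (nerve A)) k \<alpha> z \<in> simplices (join (nerve P) (nerve A)) m"
proof -
  obtain ys zs where z: "z = jn ys zs" "length ys + length zs = Suc k"
    "sorted_wrt (\<le>) ys" "set ys \<subseteq> P" "sorted_wrt (\<le>) zs" "set zs \<subseteq> A" using assms(2) unfolding in_join by blast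
  have al: "sorted \<alpha>" "set \<alpha> \<subseteq> {..<length ys + length zs}" using assms(1) z(2) by (auto simp: in_Delta)
  note c = cut_props[OF al]
  show ?thesis
    unfolding z(1) act_jn[OF z(2) assms(1)]
  proof (rule join_jnI)
    show "length (comp_op ys (cutl (length ys) \<alpha>)) + length (comp_op zs (cutr (length ys) \<alpha>)) = Suc m"
      using c(5) assms(1) by (simp add: in_Delta)
    show "sorted_wrt (\<le>) (comp_op ys (cutl (length ys) \<alpha>))" by (rule sorted_wrt_comp_op[OF z(3) c(1,3)])
    show "sorted_wrt (\<le>) (comp_op zs (cutr (length ys) \<alpha>))" by (rule sorted_wrt_comp_op[OF z(5) c(2,4)])
    show "set (comp_op ys (cutl (length ys) \<alpha>)) \<subseteq> P" using set_comp_op[OF c(3)] z(4) by blast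
    show "set (comp_op zs (cutr (length ys) \<alpha>)) \<subseteq> A" using set_comp_op[OF c(4)] z(6) by blast
  qed
qed

text \<open>A linear extension \<open>e\<close> of the poset \<open>A\<close> by integers above the
  apex \<open>b\<close>, under which the chains of \<open>A\<close> become faces in
  \<open>F\<close>. The inverse \<open>u\<close> is monotone on faces only, as incomparable elements
  receive comparable labels.\<close>

definition chain_enum :: "'p::order set \<Rightarrow> int set set \<Rightarrow> ('p \<Rightarrow> int) \<Rightarrow> (int \<Rightarrow> 'p) \<Rightarrow> int \<Rightarrow> bool" where
  "chain_enum A F e u b \<longleftrightarrow> fin_complex F \<and> (\<forall>a\<in>A. u (e a) = a \<and> b < e a) \<and> mono_on A e \<and>
     (\<forall>T\<in>F. u ` T \<subseteq> A \<and> mono_on T u \<and> (\<forall>x\<in>T. e (u x) = x)) \<and>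
     (\<forall>xs. sorted_wrt (\<le>) xs \<longrightarrow> set xs \<subseteq> A \<longrightarrow> e ` set xs \<in> F)"

lemma chain_enumD:
  assumes "chain_enum A F e u b"
  shows "fin_complex F" "a \<in> A \<Longrightarrow> u (e a) = a" "a \<in> A \<Longrightarrow> b < e a"
    "T \<in> F \<Longrightarrow> u ` T \<subseteq> A" "T \<in> F \<Longrightarrow> x \<in> T \<Longrightarrow> e (u x) = x" "T \<in> F \<Longrightarrow> x \<in> T \<Longrightarrow> b < x"
    "sorted_wrt (\<le>) xs \<Longrightarrow> set xs \<subseteq> A \<Longrightarrow> e ` set xs \<in> F"
    "sorted_wrt (\<le>) xs \<Longrightarrow> set xs \<subseteq> A \<Longrightarrow> sorted (map e xs)"
    "sorted ys \<Longrightarrow> set ys \<in> F \<Longrightarrow> sorted_wrt (\<le>) (map u ys)"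
    "set ys \<in> F \<Longrightarrow> map e (map u ys) = ys"
    "set xs \<subseteq> A \<Longrightarrow> map u (map e xs) = xs"
proof -
  note d = assms[unfolded chain_enum_def]
  show "fin_complex F" "a \<in> A \<Longrightarrow> u (e a) = a" "a \<in> A \<Longrightarrow> b < e a"
    "T \<in> F \<Longrightarrow> u ` T \<subseteq> A" "T \<in> F \<Longrightarrow> x \<in> T \<Longrightarrow> e (u x) = x"
    "sorted_wrt (\<le>) xs \<Longrightarrow> set xs \<subseteq> A \<Longrightarrow> e ` set xs \<in> F" using d by blast+
  show "T \<in> F \<Longrightarrow> x \<in> T \<Longrightarrow> b < x" using d by (metis image_subset_iff)
  show "sorted (map e xs)" if "sorted_wrt (\<le>) xs" "set xs \<subseteq> A"
    unfolding sorted_map by (rule sorted_wrt_mono_rel[OF _ that(1)]) (meson d mono_onD that(2) subsetD)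
  show "sorted_wrt (\<le>) (map u ys)" if "sorted ys" "set ys \<in> F"
    unfolding sorted_wrt_map by (rule sorted_wrt_mono_rel[OF _ that(1)]) (use d that(2) in \<open>auto simp: mono_on_def\<close>)
  show "set ys \<in> F \<Longrightarrow> map e (map u ys) = ys" using d by (auto intro!: map_idI)
  show "set xs \<subseteq> A \<Longrightarrow> map u (map e xs) = xs" using d by (auto intro!: map_idI)
qed

text \<open>The restriction of \<open>g\<close> to the vertices in \<open>l\<close> joined with the
  base, read as a simplex of the slice: the left part of a join simplex selects entries of
  \<open>l\<close>, the right part is labelled by \<open>e\<close>.\<close>

definition slice_simplex :: "'p::order set \<Rightarrow> ('p \<Rightarrow> int) \<Rightarrow> (int list \<Rightarrow> 'a) \<Rightarrow> int list \<Rightarrow>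
    nat \<Rightarrow> (nat list, 'p list) join_simplex \<Rightarrow> 'a" where
  "slice_simplex A e g l = sset_map (join (Delta (length l - 1)) (nerve A))
     (\<lambda>k z. g (comp_op l (lp z) @ map e (rp z)))"

lemma comp_op_Delta': "\<alpha> \<in> simplices (Delta n) m \<Longrightarrow> sorted ys \<Longrightarrow> set ys \<subseteq> {..m} \<Longrightarrow>
  sorted (comp_op \<alpha> ys) \<and> set (comp_op \<alpha> ys) \<subseteq> {..n}"
  using sorted_wrt_comp_op[of \<alpha> ys] set_comp_op[of ys \<alpha>] by (auto simp: in_Delta lessThan_Suc_atMost)

lemma slice_simplex_in:
  assumes ce: "chain_enum A F e u b" and g: "dmap X K g" and l: "length l = Suc n" "sorted l" "\<And>x. x \<in> set l \<Longrightarrow> x \<le> b"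
    and K: "joinc (Pow (set l)) F \<subseteq> K" and p: "\<And>m x. x \<in> simplices (nerve A) m \<Longrightarrow> g (map e x) = p m x"
  shows "slice_simplex A e g l \<in> simplices (slice X (nerve A) p) n"
proof -
  have *: "sorted (comp_op l ys @ map e zs)" "set (comp_op l ys @ map e zs) \<in> K"
    if "sorted ys" "set ys \<subseteq> {..n}" "sorted_wrt (\<le>) zs" "set zs \<subseteq> A" for ys zs
  proof -
    have y: "set ys \<subseteq> {..<length l}" using that(2) l(1) by auto
    have 1: "sorted (comp_op l ys)" by (rule sorted_wrt_comp_op[OF l(2) that(1) y])
    have 2: "set (comp_op l ys) \<subseteq> set l" by (rule set_comp_op[OF y])
    have 3: "sorted (map e zs)" by (rule chain_enumD(8)[OF ce that(3,4)])
    have 4: "set (map e zs) \<in> F" using chain_enumD(7)[OF ce that(3,4)] by simp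
    have "x \<le> z" if "x \<in> set (comp_op l ys)" "z \<in> set (map e zs)" for x z
      using l(3) 2 chain_enumD(6)[OF ce 4 that(2)] that(1) by fastforce
    then show "sorted (comp_op l ys @ map e zs)" using 1 3 unfolding sorted_append by blast
    show "set (comp_op l ys @ map e zs) \<in> K"
      using joincI[of "set (comp_op l ys)" "Pow (set l)" "set (map e zs)" F] 2 4 K by auto
  qed
  have "slice_simplex A e g l \<in> sset_hom (join (Delta n) (nerve A)) X"
    unfolding slice_simplex_def l(1) diff_Suc_1
  proof (rule sset_mapI)
    fix k z assume "z \<in> simplices (join (Delta n) (nerve A)) k"
    then obtain ys zs where z: "z = jn ys zs" "length ys + length zs = Suc k"
      "sorted ys" "set ys \<subseteq> {..n}" "sorted_wrt (\<le>) zs" "set zs \<subseteq> A" unfolding in_join by blast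
    have len: "length (comp_op l ys @ map e zs) = Suc k" using z by simp
    note s = *[OF z(3-6)]
    show "g (comp_op l (lp z) @ map e (rp z)) \<in> simplices X k"
      unfolding z(1) lp_jn rp_jn by (rule dmapD(1)[OF g len s])
  next
    fix k m \<alpha> z assume al: "\<alpha> \<in> simplices (Delta k) m" and zj: "z \<in> simplices (join (Delta n) (nerve A)) k"
    then obtain ys zs where z: "z = jn ys zs" "length ys + length zs = Suc k"
      "sorted ys" "set ys \<subseteq> {..n}" "sorted_wrt (\<le>) zs" "set zs \<subseteq> A" unfolding in_join by blast
    have len: "length (comp_op l ys @ map e zs) = Suc k" using z by simp
    have al': "sorted \<alpha>" "set \<alpha> \<subseteq> {..<length ys + length zs}" using al z(2) by (auto simp: in_Delta)
    note s = *[OF z(3-6)] and c = cut_props[OF al']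
    have "g (comp_op l (lp (act (join (Delta n) (nerve A)) k \<alpha> z)) @ map e (rp (act (join (Delta n) (nerve A)) k \<alpha> z)))
      = g (comp_op (comp_op l ys @ map e zs) \<alpha>)"
      unfolding z(1) act_jn[OF z(2) al] lp_jn rp_jn comp_op_append[OF al'(1)]
        map_comp_op[OF c(3)] map_comp_op[OF c(4)] length_map ..
    also have "\<dots> = act X k \<alpha> (g (comp_op l ys @ map e zs))" by (rule dmapD(2)[OF g len s al])
    finally show "act (join (Delta n) (nerve A)) k \<alpha> z \<in> simplices (join (Delta n) (nerve A)) m \<and>
      g (comp_op l (lp (act (join (Delta n) (nerve A)) k \<alpha> z)) @ map e (rp (act (join (Delta n) (nerve A)) k \<alpha> z)))
      = act X k \<alpha> (g (comp_op l (lp z) @ map e (rp z)))"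
      using act_join_closed[OF al zj] by (simp add: z(1))
  qed
  moreover have "slice_simplex A e g l m (InR x) = p m x" if x: "x \<in> simplices (nerve A) m" for m x
  proof -
    have "InR x \<in> simplices (join (Delta n) (nerve A)) m" using x by (simp add: join_def)
    then show ?thesis using p[OF x] unfolding slice_simplex_def l(1) diff_Suc_1 by (simp add: lp_def rp_def)
  qed
  ultimately show ?thesis unfolding slice_def by simp
qed

lemma slice_act:
  assumes "z \<in> simplices (join (Delta m) K) k" "length \<alpha> = Suc m"
  shows "act (slice X K p) n \<alpha> f k z = f k (map_join_simplex (comp_op \<alpha>) id z)"
  using assms by (simp add: slice_def)

lemma slice_simplex_act:
  assumes l: "length l = Suc n" and al: "\<alpha> \<in> simplices (Delta n) m"
  shows "act (slice X (nerve A) p) n \<alpha> (slice_simplex A e g l) = slice_simplex A e g (comp_op l \<alpha>)"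
proof -
  have len: "length \<alpha> = Suc m" using al by (simp add: in_Delta)
  have "act (slice X (nerve A) p) n \<alpha> (slice_simplex A e g l) k z = slice_simplex A e g (comp_op l \<alpha>) k z" for k z
  proof (cases "z \<in> simplices (join (Delta m) (nerve A)) k")
    case True
    then obtain ys zs where z: "z = jn ys zs" "length ys + length zs = Suc k"
      "sorted ys" "set ys \<subseteq> {..m}" "sorted_wrt (\<le>) zs" "set zs \<subseteq> A" unfolding in_join by blast
    have "jn (comp_op \<alpha> ys) zs \<in> simplices (join (Delta n) (nerve A)) k"
      using comp_op_Delta'[OF al z(3,4)] z by (intro join_jnI) auto
    moreover have "comp_op (comp_op l \<alpha>) ys = comp_op l (comp_op \<alpha> ys)"
      by (rule comp_op_comp_op) (use z(4) len in auto)
    ultimately have "slice_simplex A e g l k (jn (comp_op \<alpha> ys) zs) = slice_simplex A e g (comp_op l \<alpha>) k z"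
      using True len l unfolding slice_simplex_def z(1) by (simp del: map_map)
    then show ?thesis using slice_act[OF True len, of X p n] unfolding z(1) map_join_comp_op by simp
  next
    case False
    then show ?thesis using len by (simp add: slice_def slice_simplex_def sset_map_out)
  qed
  then show ?thesis by blast
qed

definition cone_of :: "(nat \<Rightarrow> 'p list \<Rightarrow> 'a) \<Rightarrow> (int \<Rightarrow> 'p) \<Rightarrow> int list \<Rightarrow> 'a" where
  "cone_of D u xs = D (length xs - 1) (map u xs)"

lemma dmap_cone_of:
  assumes D: "D \<in> sset_hom (nerve A) X" and K: "\<And>S. S \<in> K \<Longrightarrow> u ` S \<subseteq> A \<and> mono_on S u"
  shows "dmap X K (cone_of D u)"
  unfolding dmap_def
proof (intro allI impI conjI ballI; elim conjE)
  fix n xs m \<alpha> assume a: "length xs = Suc n" "sorted xs" "set xs \<in> K"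
  have "sorted_wrt (\<le>) (map u xs)"
    unfolding sorted_wrt_map by (rule sorted_wrt_mono_rel[OF _ a(2)]) (meson K[OF a(3)] mono_onD)
  then have x: "map u xs \<in> simplices (nerve A) n" using a K[OF a(3)] by (auto simp: in_nerve)
  show "cone_of D u xs \<in> simplices X n" using sset_homD(1)[OF D x] a(1) by (simp add: cone_of_def)
  assume al: "\<alpha> \<in> simplices (Delta n) m"
  have "map u (comp_op xs \<alpha>) = comp_op (map u xs) \<alpha>" by (rule map_comp_op[OF Delta_lessThan[OF al a(1)]])
  moreover have "length \<alpha> = Suc m" using al by (simp add: in_Delta)
  ultimately show "cone_of D u (comp_op xs \<alpha>) = act X n \<alpha> (cone_of D u xs)"
    using sset_homD(3)[OF D al x] a(1) unfolding cone_of_def by (simp del: map_map)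
qed

text \<open>The vertex of the slice that occurs in \<open>is_limit_at\<close>;
  \<open>slice_simplex_cone\<close> identifies it with the apex \<open>b\<close> of a labelled
  cone.\<close>

definition cone_pt :: "'p::order set \<Rightarrow> 'p \<Rightarrow> (nat \<Rightarrow> 'p list \<Rightarrow> 'a) \<Rightarrow> nat \<Rightarrow> (nat list, 'p list) join_simplex \<Rightarrow> 'a" where
  "cone_pt A b D = sset_map (join (Delta 0) (nerve A)) (\<lambda>m z. D m (case z of
          InL \<alpha> \<Rightarrow> map (\<lambda>_. b) \<alpha> | InR x \<Rightarrow> x | Mix i \<alpha> x \<Rightarrow> map (\<lambda>_. b) \<alpha> @ x))"

lemma case_join: "(case z of InL \<alpha> \<Rightarrow> map f \<alpha> | InR x \<Rightarrow> x | Mix i \<alpha> x \<Rightarrow> map f \<alpha> @ x) = map f (lp z) @ rp z"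
  by (cases z) (auto simp: lp_def rp_def)

lemma slice_simplex_cone:
  assumes ce: "chain_enum A F e u b"
    and g: "agree (joinc (Pow {b}) F) g (cone_of D (u(b := b0)))"
  shows "slice_simplex A e g [b] = cone_pt A b0 D"
proof -
  have "slice_simplex A e g [b] k z = cone_pt A b0 D k z" for k z
  proof (cases "z \<in> simplices (join (Delta 0) (nerve A)) k")
    case True
    then obtain ys zs where z: "z = jn ys zs" "length ys + length zs = Suc k"
      "sorted ys" "set ys \<subseteq> {..0}" "sorted_wrt (\<le>) zs" "set zs \<subseteq> A" unfolding in_join by blast
    let ?l = "comp_op [b] ys @ map e zs"
    have y: "set (comp_op [b] ys) \<subseteq> {b}" using z(4) by auto
    have F: "set (map e zs) \<in> F" using chain_enumD(7)[OF ce z(5,6)] by simp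
    have "x \<le> z" if "x \<in> set (comp_op [b] ys)" "z \<in> set (map e zs)" for x z
      using y chain_enumD(6)[OF ce F that(2)] that(1) by fastforce
    moreover have "sorted (comp_op [b] ys)" by (rule sorted_wrt_comp_op) (use z in auto)
    ultimately have s: "sorted ?l" using chain_enumD(8)[OF ce z(5,6)] unfolding sorted_append by blast
    have m: "set ?l \<in> joinc (Pow {b}) F" using joincI[of "set (comp_op [b] ys)" "Pow {b}" _ F] y F by auto
    have ne: "?l \<noteq> []" using z(2) by auto
    have e1: "map (u(b := b0)) (map e zs) = zs"
    proof -
      have "map (u(b := b0)) (map e zs) = map u (map e zs)"
        using chain_enumD(6)[OF ce F] by (intro map_cong) auto
      then show ?thesis using chain_enumD(11)[OF ce z(6)] by (rule trans)
    qed
    have e2: "map (u(b := b0)) (comp_op [b] ys) = map (\<lambda>_. b0) ys" using z(4) by auto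
    have "g ?l = D k (map (\<lambda>_. b0) ys @ zs)"
      unfolding agreeD[OF g ne s m] cone_of_def map_append e1 e2 using z(2) by simp
    then show ?thesis
      using True unfolding slice_simplex_def cone_pt_def case_join by (simp add: z(1))
  next
    case False
    then show ?thesis by (simp add: slice_simplex_def cone_pt_def sset_map_out)
  qed
  then show ?thesis by blast
qed

lemma agree_chain_part:
  assumes ce: "chain_enum A F e u b" and g: "agree (joinc (Pow {b}) F) g (cone_of D (u(b := b0)))"
    and x: "x \<in> simplices (nerve A) m"
  shows "g (map e x) = sset_map (nerve A) D m x"
proof -
  have x': "sorted_wrt (\<le>) x" "set x \<subseteq> A" "length x = Suc m" using x by (auto simp: in_nerve)
  have F: "set (map e x) \<in> F" using chain_enumD(7)[OF ce x'(1,2)] by simp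
  have m: "set (map e x) \<in> joinc (Pow {b}) F" using joincI[of "{}" "Pow {b}" _ F] F by auto
  have "map (u(b := b0)) (map e x) = map u (map e x)"
    using chain_enumD(6)[OF ce F] by (intro map_cong) auto
  then have e1: "map (u(b := b0)) (map e x) = x" using chain_enumD(11)[OF ce x'(2)] by (rule trans)
  have "map e x \<noteq> []" using x' by auto
  then have "g (map e x) = cone_of D (u(b := b0)) (map e x)"
    using agreeD[OF g _ chain_enumD(8)[OF ce x'(1,2)] m] by simp
  then show ?thesis using x'(3) x unfolding cone_of_def e1 by simp
qed

lemma filter_split:
  assumes "\<And>x. x \<in> set ys \<Longrightarrow> x \<le> b" "\<And>x. x \<in> set zs \<Longrightarrow> b < (x::int)"
  shows "filter (\<lambda>x. x \<le> b) (ys @ zs) = ys" "filter (\<lambda>x. b < x) (ys @ zs) = zs"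
proof -
  have "filter (\<lambda>x. x \<le> b) ys = ys" "filter (\<lambda>x. x \<le> b) zs = []" "filter (\<lambda>x. b < x) ys = []" "filter (\<lambda>x. b < x) zs = zs"
    using assms by (fastforce simp: filter_empty_conv intro!: filter_True)+
  then show "filter (\<lambda>x. x \<le> b) (ys @ zs) = ys" "filter (\<lambda>x. b < x) (ys @ zs) = zs" by auto
qed

lemma sorted_split:
  "sorted xs \<Longrightarrow> filter (\<lambda>x. x \<le> b) xs @ filter (\<lambda>x. b < x) xs = (xs :: int list)"
proof (induction xs)
  case (Cons a xs)
  show ?case
  proof (cases "a \<le> b")
    case False
    then have "filter (\<lambda>x. x \<le> b) xs = []" "filter (\<lambda>x. b < x) xs = xs"
      using Cons.prems by (fastforce simp: filter_empty_conv intro!: filter_True)+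
    then show ?thesis using False by simp
  qed (use Cons in auto)
qed simp

lemma joinc_split:
  assumes K: "\<And>S x. S \<in> K \<Longrightarrow> x \<in> S \<Longrightarrow> x \<le> b" and F: "\<And>S x. S \<in> F \<Longrightarrow> x \<in> S \<Longrightarrow> b < (x::int)"
    and xs: "sorted xs" "set xs \<in> joinc K F"
  obtains ys zs where "xs = ys @ zs" "sorted ys" "sorted zs" "set ys \<in> K" "set zs \<in> F"
    "filter (\<lambda>x. x \<le> b) xs = ys" "filter (\<lambda>x. b < x) xs = zs"
proof -
  obtain S T where S: "set xs = S \<union> T" "S \<in> K" "T \<in> F" using xs(2) unfolding joinc_def by auto
  have "{x\<in>S \<union> T. x \<le> b} = S" "{x\<in>S \<union> T. b < x} = T" using K[OF S(2)] F[OF S(3)] by force+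
  then have "set (filter (\<lambda>x. x \<le> b) xs) = S" "set (filter (\<lambda>x. b < x) xs) = T"
    unfolding set_filter S(1) by blast+
  then show ?thesis
    using that[of "filter (\<lambda>x. x \<le> b) xs" "filter (\<lambda>x. b < x) xs"] sorted_split[OF xs(1), of b] S
      sorted_wrt_filter[OF xs(1)] by simp
qed

lemma in_boundary:
  "\<alpha> \<in> simplices (boundary n) m \<longleftrightarrow> \<alpha> \<in> simplices (Delta n) m \<and> set \<alpha> \<noteq> {..n}"
  by (auto simp: boundary_def in_Delta)

lemma boundary_act:
  assumes "\<alpha> \<in> simplices (boundary n) m" "\<beta> \<in> simplices (Delta m) k"
  shows "comp_op \<alpha> \<beta> \<in> simplices (boundary n) k" "act (boundary n) m \<beta> \<alpha> = comp_op \<alpha> \<beta>"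
proof -
  have a: "\<alpha> \<in> simplices (Delta n) m" "set \<alpha> \<noteq> {..n}" using assms(1) by (auto simp: in_boundary)
  have "set (comp_op \<alpha> \<beta>) \<subseteq> set \<alpha>" by (rule set_comp_op) (use a assms(2) in \<open>auto simp: in_Delta\<close>)
  then show "comp_op \<alpha> \<beta> \<in> simplices (boundary n) k"
    using a comp_op_Delta[OF a(1) assms(2)] unfolding in_boundary by (auto simp: in_Delta)
  show "act (boundary n) m \<beta> \<alpha> = comp_op \<alpha> \<beta>" by (simp add: boundary_def)
qed

text \<open>A map on the boundary of a simplex joined with \<open>F\<close> amounts to a boundary in
  the slice. Its last vertex is the cone by \<open>ag\<close>, so terminality gives a filler, which
  is read back as a map on the full join.\<close>

lemma is_limit_at_imp_lim_cone:
  assumes ce: "chain_enum A F e u b" and lim: "is_limit_at X A b0 D"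
  shows "lim_cone X F b (cone_of D (u(b := b0)))"
  unfolding lim_cone_def
proof (intro allI impI)
  fix \<rho> :: "int set" and g
  let ?\<sigma> = "insert b \<rho>" let ?B = "joinc (Pow ?\<sigma> - {?\<sigma>}) F" and ?p = "sset_map (nerve A) D"
  let ?l = "sorted_list_of_set ?\<sigma>"
  assume \<rho>: "finite \<rho>" "\<rho> \<noteq> {}" "\<forall>x\<in>\<rho>. x < b" and g: "dmap X ?B g"
    and ag: "agree (joinc (Pow {b}) F) g (cone_of D (u(b := b0)))"
  have nb: "b \<notin> \<rho>" using \<rho>(3) by auto
  obtain n where n: "card \<rho> = n" "1 \<le> n" using \<rho> by (metis One_nat_def Suc_leI card_gt_0_iff)
  have \<sigma>: "finite ?\<sigma>" "card ?\<sigma> = Suc n" using \<rho> n nb by auto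
  have b1: "x \<le> b" if "x \<in> ?\<sigma>" for x using that \<rho>(3) by auto
  note bF = chain_enumD(6)[OF ce]
  have "{z\<in>?\<sigma>. z < b} = \<rho>" using \<rho>(3) by auto
  then have pb: "pos ?\<sigma> b = n" using n unfolding pos_def by simp
  then have ln: "?l ! n = b" using nth_pos(2)[OF \<sigma>(1), of b] by simp
  define f where "f = sset_map (boundary n) (\<lambda>m \<alpha>. slice_simplex A e g (comp_op ?l \<alpha>))"
  have pg: "g (map e x) = ?p m x" if "x \<in> simplices (nerve A) m" for m x
    using agree_chain_part[OF ce ag that] .
  have sb: "set (comp_op ?l \<alpha>) \<noteq> ?\<sigma>" if "\<alpha> \<in> simplices (boundary n) m" for \<alpha> m
  proof
    assume "set (comp_op ?l \<alpha>) = ?\<sigma>"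
    then have "(!) ?l ` set \<alpha> = (!) ?l ` {..n}" using nth_image_sorted_list(2)[OF \<sigma>] by simp
    moreover have "set \<alpha> \<subseteq> {..n}" using that by (auto simp: in_boundary in_Delta)
    ultimately have "set \<alpha> = {..n}"
      using inj_on_image_eq_iff[OF nth_image_sorted_list(1)[OF \<sigma>], of "set \<alpha>" "{..n}"] by simp
    then show False using that by (simp add: in_boundary)
  qed
  have fin: "slice_simplex A e g (comp_op ?l \<alpha>) \<in> simplices (slice X (nerve A) ?p) m"
    if al: "\<alpha> \<in> simplices (boundary n) m" for m \<alpha>
  proof -
    have ad: "\<alpha> \<in> simplices (Delta n) m" using al by (simp add: in_boundary)
    note s = sorted_list_comp_op[OF \<sigma> ad]
    have "joinc (Pow (set (comp_op ?l \<alpha>))) F \<subseteq> ?B" using s(2) sb[OF al] unfolding joinc_def by blast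
    then show ?thesis using b1 s(2) by (intro slice_simplex_in[OF ce g s(3,1) _ _ pg]) auto
  qed
  have fh: "f \<in> sset_hom (boundary n) (slice X (nerve A) ?p)"
    unfolding f_def
  proof (rule sset_mapI[OF fin])
    fix m k \<beta> \<alpha> assume be: "\<beta> \<in> simplices (Delta m) k" and al: "\<alpha> \<in> simplices (boundary n) m"
    have ad: "\<alpha> \<in> simplices (Delta n) m" using al by (simp add: in_boundary)
    have "comp_op (comp_op ?l \<alpha>) \<beta> = comp_op ?l (comp_op \<alpha> \<beta>)"
      by (rule comp_op_comp_op) (use ad be in \<open>auto simp: in_Delta\<close>)
    then show "act (boundary n) m \<beta> \<alpha> \<in> simplices (boundary n) k \<and>
      slice_simplex A e g (comp_op ?l (act (boundary n) m \<beta> \<alpha>)) =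
      act (slice X (nerve A) ?p) m \<beta> (slice_simplex A e g (comp_op ?l \<alpha>))"
      using boundary_act[OF al be] slice_simplex_act[OF sorted_list_comp_op(3)[OF \<sigma> ad] be]
      by metis
  qed
  have "0 \<in> {..n}" "0 \<notin> {n}" using n(2) by auto
  then have "set [n] \<noteq> {..n}" by auto
  then have "[n] \<in> simplices (boundary n) 0" by (simp add: in_boundary in_Delta)
  then have "f 0 [n] = slice_simplex A e g [b]" using ln unfolding f_def by simp
  then have "f 0 [n] = cone_pt A b0 D" using slice_simplex_cone[OF ce ag] by simp
  then have "fillable (slice X (nerve A) ?p) n (boundary n) f"
    using lim fh n(2) unfolding is_limit_at_def terminal_def cone_pt_def by blast
  then obtain s where s: "s \<in> simplices (slice X (nerve A) ?p) n"
    "\<And>m \<alpha>. \<alpha> \<in> simplices (boundary n) m \<Longrightarrow> f m \<alpha> = act (slice X (nerve A) ?p) n \<alpha> s"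
    unfolding fillable_def by blast
  have sh: "s \<in> sset_hom (join (Delta n) (nerve A)) X" and sp: "\<And>m x. x \<in> simplices (nerve A) m \<Longrightarrow> s m (InR x) = ?p m x"
    using s(1) unfolding slice_def by auto
  define h where "h xs = s (length xs - 1) (jn (map (pos ?\<sigma>) (filter (\<lambda>x. x \<le> b) xs)) (map u (filter (\<lambda>x. b < x) xs)))" for xs
  have K: "x \<le> b" if "S \<in> Pow ?\<sigma>" "x \<in> S" for S x using that b1 by auto
  have jin: "jn (map (pos ?\<sigma>) ys) (map u zs) \<in> simplices (join (Delta n) (nerve A)) k"
    if "sorted ys" "sorted zs" "set ys \<subseteq> ?\<sigma>" "set zs \<in> F" "length ys + length zs = Suc k" for ys zs k
  proof (rule join_jnI)
    show "sorted (map (pos ?\<sigma>) ys)" "set (map (pos ?\<sigma>) ys) \<subseteq> {..n}"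
    proof -
      show "sorted (map (pos ?\<sigma>) ys)"
        using that(1) mono_pos[OF \<sigma>(1)] by (auto simp: sorted_map intro: sorted_wrt_mono_rel[of _ "(\<le>)"])
      show "set (map (pos ?\<sigma>) ys) \<subseteq> {..n}" using nth_pos(1)[OF \<sigma>(1)] that(3) \<sigma>(2) by (fastforce simp: less_Suc_eq_le)
    qed
    show "sorted_wrt (\<le>) (map u zs)" by (rule chain_enumD(9)[OF ce that(2,4)])
    show "set (map u zs) \<subseteq> A" using chain_enumD(4)[OF ce that(4)] by simp
  qed (use that in simp)
  have "dmap X (joinc (Pow ?\<sigma>) F) h"
    unfolding dmap_def
  proof (intro allI impI conjI ballI; elim conjE)
    fix k xs m \<alpha> assume a: "length xs = Suc k" "sorted xs" "set xs \<in> joinc (Pow ?\<sigma>) F"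
    obtain ys zs where yz: "xs = ys @ zs" "sorted ys" "sorted zs" "set ys \<in> Pow ?\<sigma>" "set zs \<in> F"
      "filter (\<lambda>x. x \<le> b) xs = ys" "filter (\<lambda>x. b < x) xs = zs"
      by (rule joinc_split[OF K bF a(2,3)])
    have len: "length ys + length zs = Suc k" using a(1) yz(1) by simp
    have hx: "h xs = s k (jn (map (pos ?\<sigma>) ys) (map u zs))" using a(1) yz(6,7) by (simp add: h_def)
    note J = jin[OF yz(2,3) _ yz(5) len]
    show "h xs \<in> simplices X k" unfolding hx using sset_homD(1)[OF sh J] yz(4) by simp
    assume al: "\<alpha> \<in> simplices (Delta k) m"
    have al': "sorted \<alpha>" "set \<alpha> \<subseteq> {..<length ys + length zs}" "length \<alpha> = Suc m" using al len by (auto simp: in_Delta)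
    note c = cut_props[OF al'(1,2)]
    let ?y = "comp_op ys (cutl (length ys) \<alpha>)" and ?z = "comp_op zs (cutr (length ys) \<alpha>)"
    have cx: "comp_op xs \<alpha> = ?y @ ?z" unfolding yz(1) by (rule comp_op_append[OF al'(1)])
    have yy: "\<And>x. x \<in> set ?y \<Longrightarrow> x \<le> b" using set_comp_op[OF c(3)] K[OF yz(4)] by blast
    have zz: "\<And>x. x \<in> set ?z \<Longrightarrow> b < x" using set_comp_op[OF c(4)] bF[OF yz(5)] by blast
    have "filter (\<lambda>x. x \<le> b) (?y @ ?z) = ?y" "filter (\<lambda>x. b < x) (?y @ ?z) = ?z"
      by (rule filter_split[OF yy zz]; assumption)+
    moreover have "length (?y @ ?z) - 1 = m" using c(5) al'(3) by simp
    ultimately have "h (comp_op xs \<alpha>) = s m (jn (map (pos ?\<sigma>) ?y) (map u ?z))"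
      unfolding h_def cx by (simp only:)
    also have "\<dots> = s m (act (join (Delta n) (nerve A)) k \<alpha> (jn (map (pos ?\<sigma>) ys) (map u zs)))"
      using act_jn[of "map (pos ?\<sigma>) ys" "map u zs" k \<alpha> m "{..n}" A] len al
      by (simp add: map_comp_op[OF c(3)] map_comp_op[OF c(4)] del: map_map)
    also have "\<dots> = act X k \<alpha> (h xs)" unfolding hx using sset_homD(3)[OF sh al J] yz(4) by simp
    finally show "h (comp_op xs \<alpha>) = act X k \<alpha> (h xs)" .
  qed
  moreover have "agree ?B h g"
    unfolding agree_def
  proof (intro allI impI; elim conjE)
    fix xs assume a: "xs \<noteq> []" "sorted xs" "set xs \<in> ?B"
    have K': "x \<le> b" if "S \<in> Pow ?\<sigma> - {?\<sigma>}" "x \<in> S" for S x using that b1 by auto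
    obtain ys zs where yz: "xs = ys @ zs" "sorted ys" "sorted zs" "set ys \<in> Pow ?\<sigma> - {?\<sigma>}" "set zs \<in> F"
      "filter (\<lambda>x. x \<le> b) xs = ys" "filter (\<lambda>x. b < x) xs = zs"
      by (rule joinc_split[OF K' bF a(2,3)])
    obtain k where k: "length xs = Suc k" using a(1) by (cases xs) auto
    have len: "length ys + length zs = Suc k" using k yz(1) by simp
    have ys\<sigma>: "set ys \<subseteq> ?\<sigma>" "set ys \<noteq> ?\<sigma>" using yz(4) by auto
    have hx: "h xs = s k (jn (map (pos ?\<sigma>) ys) (map u zs))" using k yz(6,7) by (simp add: h_def)
    have ez: "map e (map u zs) = zs" by (rule chain_enumD(10)[OF ce yz(5)])
    have nz: "sorted_wrt (\<le>) (map u zs)" "set (map u zs) \<subseteq> A"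
      using chain_enumD(9)[OF ce yz(3,5)] chain_enumD(4)[OF ce yz(5)] by auto
    show "h xs = g xs"
    proof (cases "ys = []")
      case True
      have nx: "map u zs \<in> simplices (nerve A) k" using nz len True by (simp add: in_nerve)
      have "zs \<noteq> []" using len True by auto
      then have "h xs = ?p k (map u zs)" unfolding hx using True sp[OF nx] by (simp add: jn_def)
      then show ?thesis using pg[OF nx] ez True yz(1) by simp
    next
      case False
      then obtain m where m: "length ys = Suc m" by (cases ys) auto
      let ?\<alpha> = "map (pos ?\<sigma>) ys"
      have ad: "?\<alpha> \<in> simplices (Delta n) m" by (rule pos_Delta[OF \<sigma> m yz(2) ys\<sigma>(1)])
      have cy: "comp_op ?l ?\<alpha> = ys" by (rule comp_op_pos[OF \<sigma>(1) ys\<sigma>(1)])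
      have "set ?\<alpha> \<noteq> {..n}"
      proof
        assume "set ?\<alpha> = {..n}"
        then have "set (comp_op ?l ?\<alpha>) = ?\<sigma>" using nth_image_sorted_list(2)[OF \<sigma>] by (metis list.set_map)
        then show False unfolding cy using ys\<sigma>(2) by blast
      qed
      then have ab: "?\<alpha> \<in> simplices (boundary n) m" using ad by (simp add: in_boundary)
      \<comment> \<open>The left part is the generic simplex: evaluating a face of \<open>s\<close>
        there amounts to evaluating \<open>s\<close> on that face.\<close>
      let ?z = "jn (id_op m) (map u zs)"
      have zj: "?z \<in> simplices (join (Delta m) (nerve A)) k"
        using nz len m by (intro join_jnI) (auto simp del: upt_Suc)
      have i1: "comp_op ?\<alpha> (id_op m) = ?\<alpha>" using comp_op_id[of ?\<alpha> m] m by simp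
      have i2: "comp_op ys (id_op m) = ys" using comp_op_id[of ys m] m by simp
      have "f m ?\<alpha> k ?z = s k (jn ?\<alpha> (map u zs))"
        using s(2)[OF ab] slice_act[OF zj, of ?\<alpha> X ?p n s] m unfolding map_join_comp_op i1 by simp
      moreover have "f m ?\<alpha> k ?z = g (ys @ zs)"
        using ab zj m i2 cy ez unfolding f_def by (simp add: slice_simplex_def del: map_map upt_Suc)
      ultimately have "s k (jn ?\<alpha> (map u zs)) = g xs" unfolding yz(1) by (simp only:)
      then show ?thesis unfolding hx .
    qed
  qed
  ultimately show "extensible X ?B g (joinc (Pow ?\<sigma>) F)" unfolding extensible_def by blast
qed

text \<open>The same correspondence in the other direction: a boundary in the slice is unfolded to a
  map on a join, extended there by \<open>lim_cone\<close>, and folded again.\<close>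

lemma lim_cone_imp_is_limit_at:
  assumes ce: "chain_enum A F e u b" and lim: "lim_cone X F b (cone_of D (u(b := b0)))"
    and D: "D \<in> sset_hom (nerve (insert b0 A)) X" and b0: "\<And>a. a \<in> A \<Longrightarrow> b0 \<le> a"
  shows "is_limit_at X A b0 D"
proof -
  let ?p = "sset_map (nerve A) D" and ?D = "cone_of D (u(b := b0))" and ?S = "slice X (nerve A) (sset_map (nerve A) D)"
  note bF = chain_enumD(6)[OF ce]
  have dD: "dmap X (joinc (Pow {b}) F) ?D"
  proof (rule dmap_cone_of[OF D])
    fix S assume "S \<in> joinc (Pow {b}) F"
    then obtain B T where S: "S = B \<union> T" "B \<subseteq> {b}" "T \<in> F" unfolding joinc_def by auto
    have T: "u ` T \<subseteq> A" "mono_on T u" using ce S(3) unfolding chain_enum_def by blast+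
    have v: "(u(b := b0)) x = (if x \<in> T then u x else b0)" if "x \<in> S" for x
      using that S bF[OF S(3)] by auto
    have "(u(b := b0)) ` S \<subseteq> insert b0 A" using v T(1) by fastforce
    moreover have "mono_on S (u(b := b0))"
    proof (rule mono_onI)
      fix x y assume xy: "x \<in> S" "y \<in> S" "x \<le> y"
      have "y \<in> T" if "x \<in> T" using bF[OF S(3) that] xy S by auto
      then show "(u(b := b0)) x \<le> (u(b := b0)) y"
        using v[OF xy(1)] v[OF xy(2)] T xy b0 by (cases "x \<in> T"; cases "y \<in> T") (auto simp: mono_on_def)
    qed
    ultimately show "(u(b := b0)) ` S \<subseteq> insert b0 A \<and> mono_on S (u(b := b0))" by blast
  qed
  have cp: "slice_simplex A e ?D [b] = cone_pt A b0 D" by (rule slice_simplex_cone[OF ce agree_refl])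
  have t: "cone_pt A b0 D \<in> simplices ?S 0"
    unfolding cp[symmetric]
    by (rule slice_simplex_in[OF ce dD _ _ _ _ agree_chain_part[OF ce agree_refl]]) auto
  have "fillable ?S n (boundary n) f"
    if n: "1 \<le> n" and f: "f \<in> sset_hom (boundary n) ?S" and fn: "f 0 [n] = cone_pt A b0 D" for n f
  proof -
    \<comment> \<open>Together with \<open>b\<close>, any \<open>n\<close> labels below it can serve
      as the vertices of the \<open>n\<close>-simplex.\<close>
    define \<rho> where "\<rho> = {b - int n..<b}"
    let ?\<sigma> = "insert b \<rho>" let ?B = "joinc (Pow ?\<sigma> - {?\<sigma>}) F" and ?l = "sorted_list_of_set (insert b \<rho>)"
    have \<rho>: "finite \<rho>" "\<rho> \<noteq> {}" "\<forall>x\<in>\<rho>. x < b" "card \<rho> = n" "b \<notin> \<rho>" using n by (auto simp: \<rho>_def)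
    have \<sigma>: "finite ?\<sigma>" "card ?\<sigma> = Suc n" using \<rho> by auto
    have b1: "x \<le> b" if "x \<in> ?\<sigma>" for x using that \<rho>(3) by auto
    have "{z\<in>?\<sigma>. z < b} = \<rho>" using \<rho>(3) by auto
    then have pb: "pos ?\<sigma> b = n" using \<rho> unfolding pos_def by simp
    have K: "x \<le> b" if "S \<in> Pow ?\<sigma>" "x \<in> S" for S x using that b1 by auto
    have K': "x \<le> b" if "S \<in> Pow ?\<sigma> - {?\<sigma>}" "x \<in> S" for S x using that b1 by auto
    have fs: "f m \<alpha> \<in> sset_hom (join (Delta m) (nerve A)) X"
      and fp: "x \<in> simplices (nerve A) k \<Longrightarrow> f m \<alpha> k (InR x) = ?p k x"
      if "\<alpha> \<in> simplices (boundary n) m" for m \<alpha> k x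
      using sset_homD(1)[OF f that] unfolding slice_def by auto
    have fact: "f k (comp_op \<alpha> \<beta>) = act ?S m \<beta> (f m \<alpha>)"
      if "\<alpha> \<in> simplices (boundary n) m" "\<beta> \<in> simplices (Delta m) k" for \<alpha> \<beta> m k
      using sset_homD(3)[OF f that(2,1)] boundary_act(2)[OF that] by simp
    \<comment> \<open>Naturality of \<open>f\<close>: a face of \<open>f m \<alpha>\<close>,
      evaluated with a generic left part, is \<open>f m \<alpha>\<close> evaluated on that face.
      This makes the map \<open>g\<close> below compatible with operators.\<close>
    have eval: "f i (comp_op \<alpha> \<beta>) k (jn (id_op i) zs) = f m \<alpha> k (jn \<beta> zs)"
      if a: "\<alpha> \<in> simplices (boundary n) m" "\<beta> \<in> simplices (Delta m) i"
        "Suc i + length zs = Suc k" "sorted_wrt (\<le>) zs" "set zs \<subseteq> A" for \<alpha> \<beta> m i k zs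
    proof -
      have z: "jn (id_op i) zs \<in> simplices (join (Delta i) (nerve A)) k"
        using a(3-5) by (intro join_jnI) (auto simp del: upt_Suc)
      have l: "length \<beta> = Suc i" using a(2) by (simp add: in_Delta)
      have i1: "comp_op \<beta> (id_op i) = \<beta>" using comp_op_id[OF l] .
      show ?thesis
        unfolding fact[OF a(1,2)] slice_act[OF z l] map_join_comp_op i1 ..
    qed
    \<comment> \<open>The part of a list up to \<open>b\<close> selects a simplex of the boundary
      and hence, by \<open>f\<close>, one of the slice, which is evaluated on the generic simplex
      joined with the rest. A list without such a part sees only the base diagram.\<close>
    define g where "g xs = (let ys = filter (\<lambda>x. x \<le> b) xs; zs = map u (filter (\<lambda>x. b < x) xs); k = length xs - 1 in
        if ys = [] then ?p k zs else f (length ys - 1) (map (pos ?\<sigma>) ys) k (jn (id_op (length ys - 1)) zs))" for xs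
    have gI: "g (ys @ zs) = (if ys = [] then ?p k (map u zs)
        else f (length ys - 1) (map (pos ?\<sigma>) ys) k (jn (id_op (length ys - 1)) (map u zs)))"
      if "\<And>x. x \<in> set ys \<Longrightarrow> x \<le> b" "\<And>x. x \<in> set zs \<Longrightarrow> b < x" "length ys + length zs = Suc k" for ys zs k
    proof -
      have "length (ys @ zs) - 1 = k" using that(3) by simp
      moreover have "filter (\<lambda>x. x \<le> b) (ys @ zs) = ys" "filter (\<lambda>x. b < x) (ys @ zs) = zs"
        by (rule filter_split[OF that(1,2)]; assumption)+
      ultimately show ?thesis unfolding g_def Let_def by (simp only:)
    qed
    have bd: "map (pos ?\<sigma>) ys \<in> simplices (boundary n) m"
      if ys: "length ys = Suc m" "sorted ys" "set ys \<in> Pow ?\<sigma> - {?\<sigma>}" for ys m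
    proof -
      have ad: "map (pos ?\<sigma>) ys \<in> simplices (Delta n) m" using pos_Delta[OF \<sigma> ys(1,2)] ys(3) by simp
      have cy: "comp_op ?l (map (pos ?\<sigma>) ys) = ys" using comp_op_pos[OF \<sigma>(1)] ys(3) by blast
      have "set (map (pos ?\<sigma>) ys) \<noteq> {..n}"
      proof
        assume "set (map (pos ?\<sigma>) ys) = {..n}"
        then have "set (comp_op ?l (map (pos ?\<sigma>) ys)) = ?\<sigma>" using nth_image_sorted_list(2)[OF \<sigma>] by (metis list.set_map)
        then show False unfolding cy using ys(3) by blast
      qed
      then show ?thesis using ad by (simp add: in_boundary)
    qed
    have nz: "sorted_wrt (\<le>) (map u zs)" "set (map u zs) \<subseteq> A" if "sorted zs" "set zs \<in> F" for zs
      using chain_enumD(9)[OF ce that] chain_enumD(4)[OF ce that(2)] by auto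
    have ph: "?p k (map u zs) \<in> simplices X k" "\<alpha> \<in> simplices (Delta k) m \<Longrightarrow>
        ?p m (comp_op (map u zs) \<alpha>) = act X k \<alpha> (?p k (map u zs))"
      if "sorted zs" "set zs \<in> F" "length zs = Suc k" for zs k m \<alpha>
    proof -
      have x: "map u zs \<in> simplices (nerve A) k" using nz[OF that(1,2)] that(3) by (simp add: in_nerve)
      then have x': "map u zs \<in> simplices (nerve (insert b0 A)) k" by (auto simp: in_nerve)
      show "?p k (map u zs) \<in> simplices X k" using x sset_homD(1)[OF D x'] by simp
      assume al: "\<alpha> \<in> simplices (Delta k) m"
      have "comp_op (map u zs) \<alpha> \<in> simplices (nerve A) m"
        using simplicial_set_nerve[of A] al x unfolding simplicial_set_def by (metis act_nerve)
      then show "?p m (comp_op (map u zs) \<alpha>) = act X k \<alpha> (?p k (map u zs))"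
        using sset_homD(3)[OF D al x'] x by (simp del: map_map)
    qed
    have dg: "dmap X ?B g"
      unfolding dmap_def
    proof (intro allI impI conjI ballI; elim conjE)
      fix k xs m \<alpha> assume a: "length xs = Suc k" "sorted xs" "set xs \<in> ?B"
      obtain ys zs where yz: "xs = ys @ zs" "sorted ys" "sorted zs" "set ys \<in> Pow ?\<sigma> - {?\<sigma>}" "set zs \<in> F"
        "filter (\<lambda>x. x \<le> b) xs = ys" "filter (\<lambda>x. b < x) xs = zs"
        by (rule joinc_split[OF K' bF a(2,3)])
      have len: "length ys + length zs = Suc k" using a(1) yz(1) by simp
      have gx: "g xs = (if ys = [] then ?p k (map u zs)
          else f (length ys - 1) (map (pos ?\<sigma>) ys) k (jn (id_op (length ys - 1)) (map u zs)))"
        unfolding yz(1) by (rule gI[OF K'[OF yz(4)] bF[OF yz(5)] len])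
      have J: "jn (id_op i) (map u zs) \<in> simplices (join (Delta i) (nerve A)) k" if "length ys = Suc i" for i
        using nz[OF yz(3,5)] len that by (intro join_jnI) (auto simp del: upt_Suc)
      show "g xs \<in> simplices X k"
      proof (cases "ys = []")
        case True then show ?thesis using gx ph(1)[OF yz(3,5)] len by simp
      next
        case False
        then obtain i where i: "length ys = Suc i" by (cases ys) auto
        show ?thesis using gx False i sset_homD(1)[OF fs[OF bd[OF i yz(2,4)]] J[OF i]] by simp
      qed
      assume al: "\<alpha> \<in> simplices (Delta k) m"
      have al': "sorted \<alpha>" "set \<alpha> \<subseteq> {..<length ys + length zs}" "length \<alpha> = Suc m" using al len by (auto simp: in_Delta)
      note c = cut_props[OF al'(1,2)]
      let ?b = "cutl (length ys) \<alpha>" let ?y = "comp_op ys ?b" and ?z = "comp_op zs (cutr (length ys) \<alpha>)"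
      have cx: "comp_op xs \<alpha> = ?y @ ?z" unfolding yz(1) by (rule comp_op_append[OF al'(1)])
      have yy: "\<And>x. x \<in> set ?y \<Longrightarrow> x \<le> b" using set_comp_op[OF c(3)] K'[OF yz(4)] by blast
      have zz: "\<And>x. x \<in> set ?z \<Longrightarrow> b < x" using set_comp_op[OF c(4)] bF[OF yz(5)] by blast
      have leny: "length ?y + length ?z = Suc m" using c(5) al'(3) by simp
      have zF: "set ?z \<in> F" using chain_enumD(1)[OF ce] yz(5) set_comp_op[OF c(4)] by (rule fin_complexD)
      have zs: "sorted ?z" by (rule sorted_wrt_comp_op[OF yz(3) c(2,4)])
      have gy: "g (comp_op xs \<alpha>) = (if ?y = [] then ?p m (map u ?z)
          else f (length ?y - 1) (map (pos ?\<sigma>) ?y) m (jn (id_op (length ?y - 1)) (map u ?z)))"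
        unfolding cx by (rule gI[OF yy zz leny])
      have mz: "map u ?z = comp_op (map u zs) (cutr (length ys) \<alpha>)" by (rule map_comp_op[OF c(4)])
      show "g (comp_op xs \<alpha>) = act X k \<alpha> (g xs)"
      proof (cases "ys = []")
        case True
        have "cutr (length ys) \<alpha> = \<alpha>" using True by simp
        then have "g (comp_op xs \<alpha>) = ?p m (comp_op (map u zs) \<alpha>)" using gy True mz by (simp del: map_map)
        then show ?thesis using ph(2)[OF yz(3,5) _ al] len True gx by simp
      next
        case False
        then obtain i where i: "length ys = Suc i" by (cases ys) auto
        note B = bd[OF i yz(2,4)]
        have zA: "sorted_wrt (\<le>) (map u ?z)" "set (map u ?z) \<subseteq> A" using nz[OF zs zF] by auto
        have "act X k \<alpha> (g xs) = f i (map (pos ?\<sigma>) ys) m (act (join (Delta i) (nerve A)) k \<alpha> (jn (id_op i) (map u zs)))"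
          using gx False i sset_homD(3)[OF fs[OF B] al J[OF i]] by simp
        also have "act (join (Delta i) (nerve A)) k \<alpha> (jn (id_op i) (map u zs)) = jn (comp_op (id_op i) ?b) (map u ?z)"
          using act_jn[of "id_op i" "map u zs" k \<alpha> m "{..i}" A] len i al mz by (simp del: map_map upt_Suc)
        also have ib: "comp_op (id_op i) ?b = ?b" using c(3) i by (intro map_idI) (auto simp del: upt_Suc)
        finally have 1: "act X k \<alpha> (g xs) = f i (map (pos ?\<sigma>) ys) m (jn ?b (map u ?z))" .
        show ?thesis
        proof (cases "?b = []")
          \<comment> \<open>An operator may discard the left part altogether; the value is then that
            of the base diagram, by \<open>fp\<close>.\<close>
          case True
          then have "?z \<noteq> []" "length ?z = Suc m" using leny by auto
          then have "map u ?z \<in> simplices (nerve A) m" using zA by (simp add: in_nerve)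
          then have "f i (map (pos ?\<sigma>) ys) m (jn ?b (map u ?z)) = ?p m (map u ?z)"
            using fp[OF B] True \<open>?z \<noteq> []\<close> by (simp add: jn_def del: map_map)
          then show ?thesis using gy True 1 by simp
        next
          case False
          then obtain j where j: "length ?b = Suc j" by (cases ?b) auto
          have bD: "?b \<in> simplices (Delta i) j" using c(1,3) i j by (auto simp: in_Delta)
          have pm: "map (pos ?\<sigma>) ?y = comp_op (map (pos ?\<sigma>) ys) ?b" by (rule map_comp_op[OF c(3)])
          have "Suc j + length (map u ?z) = Suc m" using leny j by simp
          from eval[OF B bD this zA]
          have "f j (map (pos ?\<sigma>) ?y) m (jn (id_op j) (map u ?z)) = f i (map (pos ?\<sigma>) ys) m (jn ?b (map u ?z))"
            unfolding pm .
          then show ?thesis using gy j False 1 by (simp del: map_map upt_Suc)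
        qed
      qed
    qed
    have ag: "agree (joinc (Pow {b}) F) g ?D"
      unfolding agree_def
    proof (intro allI impI; elim conjE)
      fix xs assume a: "xs \<noteq> []" "sorted xs" "set xs \<in> joinc (Pow {b}) F"
      have K0: "x \<le> b" if "S \<in> Pow {b}" "x \<in> S" for S x using that by auto
      obtain ys zs where yz: "xs = ys @ zs" "sorted ys" "sorted zs" "set ys \<in> Pow {b}" "set zs \<in> F"
        "filter (\<lambda>x. x \<le> b) xs = ys" "filter (\<lambda>x. b < x) xs = zs"
        by (rule joinc_split[OF K0 bF a(2,3)])
      obtain k where k: "length xs = Suc k" using a(1) by (cases xs) auto
      have len: "length ys + length zs = Suc k" using k yz(1) by simp
      have gx: "g xs = (if ys = [] then ?p k (map u zs)
          else f (length ys - 1) (map (pos ?\<sigma>) ys) k (jn (id_op (length ys - 1)) (map u zs)))"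
        unfolding yz(1) by (rule gI[OF K0[OF yz(4)] bF[OF yz(5)] len])
      have uz: "map (u(b := b0)) zs = map u zs" using bF[OF yz(5)] by (intro map_cong) auto
      have uy: "map (u(b := b0)) ys = map (\<lambda>_. b0) ys" using yz(4) by auto
      show "g xs = ?D xs"
      proof (cases "ys = []")
        case True
        then have "map u zs \<in> simplices (nerve A) k" using nz[OF yz(3,5)] len by (simp add: in_nerve)
        then show ?thesis using gx True k yz(1) unfolding cone_of_def by (simp add: uz)
      next
        case False
        then obtain i where i: "length ys = Suc i" by (cases ys) auto
        have yp: "map (pos ?\<sigma>) ys = comp_op [n] (replicate (Suc i) 0)"
          using i yz(4) pb by (intro nth_equalityI) (auto simp: subset_singleton_iff nth_Cons' all_set_conv_all_nth)
        have "0 \<in> {..n}" "0 \<notin> {n}" using n by auto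
        then have "set [n] \<noteq> {..n}" by auto
        then have nb: "[n] \<in> simplices (boundary n) 0" by (simp add: in_boundary in_Delta)
        have rD: "replicate (Suc i) 0 \<in> simplices (Delta 0) i" by (auto simp: in_nerve simp del: replicate_Suc)
        have sl: "Suc i + length (map u zs) = Suc k" using len i by simp
        have "g xs = f 0 [n] k (jn (replicate (Suc i) 0) (map u zs))"
          using gx False i eval[OF nb rD sl nz[OF yz(3,5)]] yp by (simp del: replicate_Suc upt_Suc)
        also have "\<dots> = D k (map (\<lambda>_. b0) (replicate (Suc i) 0) @ map u zs)"
        proof -
          have "jn (replicate (Suc i) 0) (map u zs) \<in> simplices (join (Delta 0) (nerve A)) k"
            using sl nz[OF yz(3,5)] by (intro join_jnI) auto
          then show ?thesis unfolding fn cone_pt_def case_join by (simp del: replicate_Suc)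
        qed
        also have "map (\<lambda>_. b0) (replicate (Suc i) 0) = map (\<lambda>_. b0) ys"
          using i by (simp add: map_replicate_const)
        finally show ?thesis using k unfolding cone_of_def yz(1) map_append uz uy by simp
      qed
    qed
    from lim_coneD[OF lim \<rho>(1-3) dg ag] obtain h where h: "dmap X (joinc (Pow ?\<sigma>) F) h" "agree ?B h g"
      unfolding extensible_def by blast
    have hp: "h (map e x) = ?p m x" if "x \<in> simplices (nerve A) m" for x m
    proof -
      have x': "sorted_wrt (\<le>) x" "set x \<subseteq> A" "length x = Suc m" using that by (auto simp: in_nerve)
      have F: "set (map e x) \<in> F" using chain_enumD(7)[OF ce x'(1,2)] by simp
      have "set (map e x) \<in> ?B" using joincI[of "{}" "Pow ?\<sigma> - {?\<sigma>}" _ F] F by auto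
      moreover have "map e x \<noteq> []" using x' by auto
      ultimately have "h (map e x) = g (map e x)" using agreeD[OF h(2)] chain_enumD(8)[OF ce x'(1,2)] by blast
      then show ?thesis using agree_chain_part[OF ce ag that] by simp
    qed
    have sl: "length ?l = Suc n" "sorted ?l" "set ?l = ?\<sigma>"
      using \<sigma> sorted_sorted_list_of_set[of ?\<sigma>] set_sorted_list_of_set[OF \<sigma>(1)] length_sorted_list_of_set[of ?\<sigma>]
      by (simp_all only:)
    have s: "slice_simplex A e h ?l \<in> simplices ?S n"
      by (rule slice_simplex_in[OF ce h(1) sl(1,2) _ _ hp]) (use sl(3) b1 in auto)
    have "f m \<alpha> = act ?S n \<alpha> (slice_simplex A e h ?l)" if al: "\<alpha> \<in> simplices (boundary n) m" for m \<alpha>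
    proof -
      have ad: "\<alpha> \<in> simplices (Delta n) m" using al by (simp add: in_boundary)
      note la = sorted_list_comp_op[OF \<sigma> ad]
      have "f m \<alpha> k z = slice_simplex A e h (comp_op ?l \<alpha>) k z" for k z
      proof (cases "z \<in> simplices (join (Delta m) (nerve A)) k")
        case True
        then obtain ys zs where z: "z = jn ys zs" "length ys + length zs = Suc k"
          "sorted ys" "set ys \<subseteq> {..m}" "sorted_wrt (\<le>) zs" "set zs \<subseteq> A" unfolding in_join by blast
        let ?y = "comp_op (comp_op ?l \<alpha>) ys"
        have y: "set ys \<subseteq> {..<length (comp_op ?l \<alpha>)}" using z(4) la(3) by auto
        have F: "set (map e zs) \<in> F" using chain_enumD(7)[OF ce z(5,6)] by simp
        have ysub: "set ?y \<subseteq> set (comp_op ?l \<alpha>)" by (rule set_comp_op[OF y])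
        have lne: "set (comp_op ?l \<alpha>) \<noteq> ?\<sigma>"
        proof
          assume "set (comp_op ?l \<alpha>) = ?\<sigma>"
          then have "(!) ?l ` set \<alpha> = (!) ?l ` {..n}" using nth_image_sorted_list(2)[OF \<sigma>] by simp
          moreover have "set \<alpha> \<subseteq> {..n}" using ad by (auto simp: in_Delta)
          ultimately have "set \<alpha> = {..n}"
            using inj_on_image_eq_iff[OF nth_image_sorted_list(1)[OF \<sigma>], of "set \<alpha>" "{..n}"] by simp
          then show False using al by (simp add: in_boundary)
        qed
        have yK: "set ?y \<in> Pow ?\<sigma> - {?\<sigma>}" using ysub la(2) lne by blast
        have sy: "sorted ?y" by (rule sorted_wrt_comp_op[OF la(1) z(3) y])
        have "x \<le> w" if "x \<in> set ?y" "w \<in> set (map e zs)" for x w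
          using K'[OF yK that(1)] bF[OF F that(2)] by simp
        then have srt: "sorted (?y @ map e zs)" using sy chain_enumD(8)[OF ce z(5,6)] unfolding sorted_append by blast
        have mem: "set (?y @ map e zs) \<in> ?B" using joincI[OF yK F] by simp
        have ne: "?y @ map e zs \<noteq> []" using z(2) by auto
        have lk: "length ?y + length (map e zs) = Suc k" unfolding length_map by (rule z(2))
        have "slice_simplex A e h (comp_op ?l \<alpha>) k z = h (?y @ map e zs)"
          using True la(3) unfolding slice_simplex_def z(1) by (simp del: map_map)
        also have "\<dots> = g (?y @ map e zs)" by (rule agreeD[OF h(2) ne srt mem])
        also have "\<dots> = (if ?y = [] then ?p k (map u (map e zs))
          else f (length ?y - 1) (map (pos ?\<sigma>) ?y) k (jn (id_op (length ?y - 1)) (map u (map e zs))))"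
          by (rule gI[OF K'[OF yK] bF[OF F] lk])
        also have "map u (map e zs) = zs" by (rule chain_enumD(11)[OF ce z(6)])
        also have "(if ?y = [] then ?p k zs
          else f (length ?y - 1) (map (pos ?\<sigma>) ?y) k (jn (id_op (length ?y - 1)) zs)) = f m \<alpha> k z"
        proof (cases "ys = []")
          case True
          then have "zs \<in> simplices (nerve A) k" "zs \<noteq> []" using z by (auto simp: in_nerve)
          then show ?thesis using True fp[OF al] by (simp add: z(1) jn_def)
        next
          case False
          then obtain i where i: "length ys = Suc i" by (cases ys) auto
          have yD: "ys \<in> simplices (Delta m) i" using z i by (simp add: in_Delta)
          have "?y = comp_op ?l (comp_op \<alpha> ys)"
            by (rule comp_op_comp_op) (use z(4) ad in \<open>auto simp: in_Delta\<close>)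
          then have "map (pos ?\<sigma>) ?y = comp_op \<alpha> ys"
            using pos_comp_op[OF \<sigma> comp_op_Delta[OF ad yD]] by simp
          moreover have "Suc i + length zs = Suc k" using z(2) i by simp
          ultimately show ?thesis
            using False i eval[OF al yD _ z(5,6)] by (simp add: z(1) del: map_map upt_Suc)
        qed
        finally show ?thesis ..
      next
        case False
        then show ?thesis using sset_homD(2)[OF fs[OF al]] la(3) by (simp add: slice_simplex_def sset_map_out)
      qed
      then have "f m \<alpha> = slice_simplex A e h (comp_op ?l \<alpha>)" by blast
      then show ?thesis using slice_simplex_act[OF sl(1) ad] by metis
    qed
    then show ?thesis unfolding fillable_def using s by blast
  qed
  then show ?thesis using t unfolding is_limit_at_def terminal_def cone_pt_def by blast
qed

section \<open>Squares\<close>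

text \<open>The critical edge starts in \<sigma>, at its last vertex \<open>0\<close>, a case that
  \<open>jext_outer\<close> excludes by \<open>0 < u\<close>. The new faces are \<sigma> and
  \<sigma> with \<open>v\<close> added, so this is a single outer horn.\<close>

lemma jext_outer0:
  assumes X: "quasicategory X" and b: "jbase \<sigma> {0} vs"
    and ok: "0 < v" "sub_ok [[v]] ts" "sub_ok ts vs"
    and sp: "rspecial X (f [0, v])"
  shows "jext X \<sigma> {0} vs f ts [] ts [[v]]"
  unfolding jext_def
proof (intro conjI allI impI)
  have B: "finite \<sigma>" "{0} \<subset> \<sigma>" using b unfolding jbase_def by auto
  have e: "sub_ok ts ts" "sub_ok [] [[v]]" "sub_ok [] ts" by (auto simp: sub_ok_def infam_def)
  show m: "jfam \<sigma> {0} vs ts [] \<subseteq> jfam \<sigma> {0} vs ts [[v]]" by (rule jfam_mono[OF e(1,2)])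
  show "sub_ok [[v]] ts" by (rule ok)
  have "stage_ok vs ts [] ts [[v]]" unfolding stage_ok_def using e ok by blast
  note new = jfam_new[OF B(2) this]
  fix g assume g: "dmap X (jfam \<sigma> {0} vs ts []) g" "agree (joinc (Pow {0}) (fam vs)) g f"
  have "{v} \<in> fam vs" using ok sub_okD[of "[[v]]" ts] sub_okD[of ts vs] by (auto simp: fam_def[of "[[v]]"])
  then have m0: "{0} \<union> {v} \<in> joinc (Pow {0}) (fam vs)" by (intro joincI) auto
  have g0: "g [0, v] = f [0, v]" using agreeD[OF g(2), of "[0, v]"] m0 ok(1) by (simp add: insert_commute)
  have m1: "{0, v} \<in> jfam \<sigma> {0} vs ts []" using subsetD[OF joinc_base_subset[OF b] m0] by (simp add: insert_commute)
  have newS: "S \<in> jfam \<sigma> {0} vs ts [[v]] - jfam \<sigma> {0} vs ts [] \<longleftrightarrow> low S = \<sigma> \<and> up S \<subseteq> {v}" for S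
    unfolding new using B(2) by (auto simp: fam_def)
  show "extensible X (jfam \<sigma> {0} vs ts []) g (jfam \<sigma> {0} vs ts [[v]])"
  proof (rule extend_toggle_outer[OF X g(1) fin_complex_jfam(1)[OF B(1)] m fin_complex_jfam[OF B(1)] ok(1) m1])
    show "rspecial X (g [0, v])" using g0 sp by simp
    fix S assume S: "S \<in> jfam \<sigma> {0} vs ts [[v]] - jfam \<sigma> {0} vs ts []"
    then have S': "low S = \<sigma>" "up S \<subseteq> {v}" using newS by auto
    obtain x where x: "x \<in> \<sigma>" "x \<noteq> 0" using B(2) by blast
    then have "x \<in> S" "x < 0" "0 \<in> S" using S' B(2) by (auto simp: low_def)
    moreover have "\<forall>y\<in>S. y \<le> 0 \<or> y = v" unfolding ball_low_up[of S] using S' by (auto simp: low_def)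
    moreover have "insert v S \<in> jfam \<sigma> {0} vs ts [[v]] - jfam \<sigma> {0} vs ts []"
      "S - {v} \<in> jfam \<sigma> {0} vs ts [[v]] - jfam \<sigma> {0} vs ts []"
      unfolding newS low_insert[OF ok(1)] up_insert[OF ok(1)] using S' by auto
    ultimately show "insert v S \<in> jfam \<sigma> {0} vs ts [[v]] - jfam \<sigma> {0} vs ts [] \<and>
        S - {v} \<in> jfam \<sigma> {0} vs ts [[v]] - jfam \<sigma> {0} vs ts [] \<and> 0 \<in> S \<and> (\<exists>x\<in>S. x < 0) \<and>
        (\<forall>y\<in>S. y \<le> 0 \<or> y = v)"
      by blast
  qed
qed

lemma joinc_fam_eq: "joinc (Pow {0}) (fam vs) = fam (map ((#) 0) vs)"
proof (intro equalityI subsetI)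
  fix S assume "S \<in> joinc (Pow {0}) (fam vs)"
  then obtain B T where S: "S = B \<union> T" "B \<subseteq> {0}" "T \<in> fam vs" unfolding joinc_def by blast
  then obtain c where "c \<in> set vs" "T \<subseteq> set c" unfolding fam_def by blast
  then have "0 # c \<in> set (map ((#) 0) vs)" "S \<subseteq> set (0 # c)" using S by auto
  then show "S \<in> fam (map ((#) 0) vs)" unfolding fam_def by blast
next
  fix S assume "S \<in> fam (map ((#) 0) vs)"
  then obtain c where c: "c \<in> set vs" "S \<subseteq> insert 0 (set c)" by (auto simp: fam_def)
  then have "S \<inter> {0} \<union> (S - {0}) \<in> joinc (Pow {0}) (fam vs)" by (intro joincI) (auto simp: fam_def)
  moreover have "S \<inter> {0} \<union> (S - {0}) = S" by auto
  ultimately show "S \<in> joinc (Pow {0}) (fam vs)" by simp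
qed

text \<open>With \<open>0\<close> in front, these are the six maximal chains of the cube with
  vertices numbered in binary; as they stand, the cube without its initial vertex. The even and the
  odd labels form two squares, connected by \<open>0 -> 1\<close>, \<open>2 -> 3\<close>,
  \<open>4 -> 5\<close> and \<open>6 -> 7\<close>.\<close>

abbreviation (input) prism :: "int list list" where
  "prism \<equiv> [[1,3,7],[1,5,7],[2,3,7],[2,6,7],[4,5,7],[4,6,7]]"

text \<open>Being cartesian is invariant under equivalence of squares. Over the proper faces of
  \<sigma>, a cone on the even square is composed to the odd one and then factored through the limit
  \<open>1\<close>.\<close>

lemma limit_along_equivalence:
  assumes X: "quasicategory X" and f: "dmap X (fam (map ((#) 0) prism)) f"
    and sp: "rspecial X (f [0,1])" "rspecial X (f [2,3])" "rspecial X (f [4,5])" "rspecial X (f [6,7])"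
    and lim: "lim_cone X (fam [[3,7],[5,7]]) 1 f"
  shows "lim_cone X (fam [[2,6],[4,6]]) 0 f"
proof (rule lim_cone_by_jext[where vs = prism])
  show "dmap X (joinc (Pow {0}) (fam prism)) f" unfolding joinc_fam_eq by (rule f)
  fix \<sigma> assume b: "jbase \<sigma> {0} prism"
  note t = jext_trans[OF b]
  have 1: "jext X \<sigma> {0} prism f [[2,6],[4,6]] [] [[2,6],[4,6],[2,3]] []"
    by (rule jext_toggle[OF X b, where v = 2]; code_simp)
  have 2: "jext X \<sigma> {0} prism f [[2,6],[4,6],[2,3]] [] [[2,6],[4,6],[2,3],[4,5]] []"
    by (rule jext_toggle[OF X b, where v = 4]; code_simp)
  have 3: "jext X \<sigma> {0} prism f [[2,6],[4,6],[2,3],[4,5]] [] [[2,6,7],[4,6,7],[2,3],[4,5]] []"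
    by (rule jext_toggle[OF X b, where v = 6]; code_simp)
  have 4: "jext X \<sigma> {0} prism f [[2,6,7],[4,6,7],[2,3],[4,5]] [] [[2,6,7],[4,6,7],[2,3,7],[4,5]] []"
    by (rule jext_toggle[OF X b, where v = 2]; code_simp)
  have 5: "jext X \<sigma> {0} prism f [[2,6,7],[4,6,7],[2,3,7],[4,5]] [] [[2,6,7],[4,6,7],[2,3,7],[4,5,7]] []"
    by (rule jext_toggle[OF X b, where v = 4]; code_simp)
  have 6: "jext X \<sigma> {0} prism f [[2,6,7],[4,6,7],[2,3,7],[4,5,7]] [] prism []"
    by (rule jext_lim[OF b _ _ _ _ _ lim]; code_simp)
  \<comment> \<open>From here on the faces contain all of \<sigma>. The special edge
    \<open>0 -> 1\<close> provides \<sigma> itself together with its cone at \<open>1\<close>;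
    composition leads to the odd labels, and the other special edges lead back to the even
    ones.\<close>
  have 7: "jext X \<sigma> {0} prism f prism [] prism [[1]]"
    by (rule jext_outer0[OF X b, where v = 1 and f = f, OF _ _ _ sp(1)]; code_simp)
  have 8: "jext X \<sigma> {0} prism f prism [[1]] prism [[1,3,7],[1,5,7]]"
    by (rule jext_toggle[OF X b, where v = 1]; code_simp)
  have 9: "jext X \<sigma> {0} prism f prism [[1,3,7],[1,5,7]] prism [[1,3,7],[1,5,7],[2,3]]"
    by (rule jext_outer[OF X b, where u = 2 and v = 3 and f = f, OF _ _ _ _ _ _ sp(2)]; code_simp)
  have 10: "jext X \<sigma> {0} prism f prism [[1,3,7],[1,5,7],[2,3]] prism [[1,3,7],[1,5,7],[2,3],[4,5]]"
    by (rule jext_outer[OF X b, where u = 4 and v = 5 and f = f, OF _ _ _ _ _ _ sp(3)]; code_simp)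
  have 11: "jext X \<sigma> {0} prism f prism [[1,3,7],[1,5,7],[2,3],[4,5]] prism [[1,3,7],[1,5,7],[2,3],[4,5],[6,7]]"
    by (rule jext_outer[OF X b, where u = 6 and v = 7 and f = f, OF _ _ _ _ _ _ sp(4)]; code_simp)
  have 12: "jext X \<sigma> {0} prism f prism [[1,3,7],[1,5,7],[2,3],[4,5],[6,7]] prism [[1,3,7],[1,5,7],[2,3,7],[4,5],[6,7]]"
    by (rule jext_toggle[OF X b, where v = 3]; code_simp)
  have 13: "jext X \<sigma> {0} prism f prism [[1,3,7],[1,5,7],[2,3,7],[4,5],[6,7]] prism [[1,3,7],[1,5,7],[2,3,7],[4,5,7],[6,7]]"
    by (rule jext_toggle[OF X b, where v = 5]; code_simp)
  have 14: "jext X \<sigma> {0} prism f prism [[1,3,7],[1,5,7],[2,3,7],[4,5,7],[6,7]] prism prism"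
    by (rule jext_outer[OF X b, where u = 6 and v = 7 and f = f, OF _ _ _ _ _ _ sp(4)]; code_simp)
  show "jext X \<sigma> {0} prism f [[2,6],[4,6]] [] prism prism"
    by (rule t[OF 1 t[OF 2 t[OF 3 t[OF 4 t[OF 5 t[OF 6 t[OF 7 t[OF 8 t[OF 9 t[OF 10 t[OF 11 t[OF 12 t[OF 13 14]]]]]]]]]]]]])
qed (code_simp | simp)+

text \<open>
  Labelling the vertices of two fiber squares \<open>F\<^sub>u, Z\<^sub>u, z\<^sub>u, B\<^sub>u\<close> and \<open>F\<^sub>v, Z\<^sub>v, z\<^sub>v, B\<^sub>v\<close> by \<open>0, 2, 4, 6\<close> and
  \<open>1, 3, 5, 7\<close>, the square \<open>F\<^sub>u, F\<^sub>v, Z\<^sub>u, Z\<^sub>v\<close> is cartesian.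
\<close>

lemma limit_of_fibers:
  assumes X: "quasicategory X" and f: "dmap X (fam (map ((#) 0) prism)) f"
    and sp: "rspecial X (f [6,7])" and te: "terminal X (f [4])" "terminal X (f [5])"
    and lim: "lim_cone X (fam [[2,6],[4,6]]) 0 f" "lim_cone X (fam [[3,7],[5,7]]) 1 f"
  shows "lim_cone X (fam [[1,3],[2,3]]) 0 f"
proof (rule lim_cone_by_jext[where vs = prism])
  show "dmap X (joinc (Pow {0}) (fam prism)) f" unfolding joinc_fam_eq by (rule f)
  fix \<sigma> assume b: "jbase \<sigma> {0} prism"
  note t = jext_trans[OF b]
  have ss: "simplicial_set X" using X unfolding quasicategory_def by blast
  \<comment> \<open>Over the proper faces of \<sigma>, the given cone on \<open>1, 2, 3\<close> is
    enlarged to all labels: \<open>4\<close> and \<open>5\<close> are terminal, and \<open>6\<close>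
    is reached by lifting along \<open>6 -> 7\<close>.\<close>
  have 1: "jext X \<sigma> {0} prism f [[1,3],[2,3]] [] [[1,3,7],[2,3,7]] []"
    by (rule jext_toggle[OF X b, where v = 3]; code_simp)
  have 2: "jext X \<sigma> {0} prism f [[1,3,7],[2,3,7]] [] [[1,3,7],[2,3,7],[1,5,7]] []"
    by (rule jext_toggle[OF X b, where v = 1]; code_simp)
  have 3: "jext X \<sigma> {0} prism f [[1,3,7],[2,3,7],[1,5,7]] [] [[1,3,7],[2,3,7],[1,5,7],[4]] []"
    by (rule jext_terminal[OF ss b, where v = 4 and f = f, OF _ _ _ _ _ te(1)]; code_simp)
  have 4: "jext X \<sigma> {0} prism f [[1,3,7],[2,3,7],[1,5,7],[4]] [] [[1,3,7],[2,3,7],[1,5,7],[4,5]] []"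
    by (rule jext_terminal[OF ss b, where v = 5 and f = f, OF _ _ _ _ _ te(2)]; code_simp)
  have 5: "jext X \<sigma> {0} prism f [[1,3,7],[2,3,7],[1,5,7],[4,5]] [] [[1,3,7],[2,3,7],[1,5,7],[4,5,7]] []"
    by (rule jext_toggle[OF X b, where v = 5]; code_simp)
  have 6: "jext X \<sigma> {0} prism f [[1,3,7],[2,3,7],[1,5,7],[4,5,7]] [] [[1,3,7],[2,3,7],[1,5,7],[4,5,7],[2,6,7]] []"
    by (rule jext_toggle[OF X b, where v = 2]; code_simp)
  have 7: "jext X \<sigma> {0} prism f [[1,3,7],[2,3,7],[1,5,7],[4,5,7],[2,6,7]] [] prism []"
    by (rule jext_outer[OF X b, where u = 6 and v = 7 and f = f, OF _ _ _ _ _ _ sp]; code_simp)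
  \<comment> \<open>The first fiber square now provides \<sigma> over \<open>2, 4, 6\<close>.
    Composition and terminality of \<open>5\<close> give the odd labels except \<open>1\<close>, and
    the second fiber square gives \<open>1\<close>.\<close>
  have 8: "jext X \<sigma> {0} prism f prism [] prism [[2,6],[4,6]]"
    by (rule jext_lim0[OF b _ _ lim(1)]; code_simp)
  have 9: "jext X \<sigma> {0} prism f prism [[2,6],[4,6]] prism [[2,6,7],[4,6,7]]"
    by (rule jext_toggle[OF X b, where v = 6]; code_simp)
  have 10: "jext X \<sigma> {0} prism f prism [[2,6,7],[4,6,7]] prism [[2,6,7],[4,6,7],[4,5]]"
    by (rule jext_terminal[OF ss b, where v = 5 and f = f, OF _ _ _ _ _ te(2)]; code_simp)
  have 11: "jext X \<sigma> {0} prism f prism [[2,6,7],[4,6,7],[4,5]] prism [[2,6,7],[4,6,7],[4,5,7]]"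
    by (rule jext_toggle[OF X b, where v = 4]; code_simp)
  have 12: "jext X \<sigma> {0} prism f prism [[2,6,7],[4,6,7],[4,5,7]] prism [[2,6,7],[4,6,7],[4,5,7],[2,3,7]]"
    by (rule jext_toggle[OF X b, where v = 2]; code_simp)
  have 13: "jext X \<sigma> {0} prism f prism [[2,6,7],[4,6,7],[4,5,7],[2,3,7]] prism prism"
    by (rule jext_lim[OF b _ _ _ _ _ lim(2)]; code_simp)
  show "jext X \<sigma> {0} prism f [[1,3],[2,3]] [] prism prism"
    by (rule t[OF 1 t[OF 2 t[OF 3 t[OF 4 t[OF 5 t[OF 6 t[OF 7 t[OF 8 t[OF 9 t[OF 10 t[OF 11 t[OF 12 13]]]]]]]]]]]])
qed (code_simp | simp)+

section \<open>Squares with integer labels\<close>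

definition sq_label :: "int \<Rightarrow> int \<Rightarrow> int \<Rightarrow> int \<Rightarrow> nat \<times> nat \<Rightarrow> int" where
  "sq_label b x y w v = (if v = (0,0) then b else if v = (0,1) then x else if v = (1,0) then y else w)"

definition sq_vertex :: "int \<Rightarrow> int \<Rightarrow> int \<Rightarrow> int \<Rightarrow> nat \<times> nat" where
  "sq_vertex b x y j = (if j = b then (0,0) else if j = x then (0,1) else if j = y then (1,0) else (1,1))"

definition sq_of :: "(int list \<Rightarrow> 'a) \<Rightarrow> int \<Rightarrow> int \<Rightarrow> int \<Rightarrow> int \<Rightarrow> nat \<Rightarrow> (nat \<times> nat) list \<Rightarrow> 'a" where
  "sq_of f b x y w = sset_map (nerve Sq) (\<lambda>m xs. f (map (sq_label b x y w) xs))"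

lemma in_Sq: "v \<in> Sq \<longleftrightarrow> v = (0,0) \<or> v = (0,1) \<or> v = (1,0) \<or> v = (1,1)"
  by (cases v) auto

lemma chain_enum_Cosp:
  assumes l: "b < x" "b < y" "x < w" "y < w" "x \<noteq> y"
  shows "chain_enum Cosp (fam [[x,w],[y,w]]) (sq_label b x y w) (sq_vertex b x y) b"
  unfolding chain_enum_def
proof (intro conjI allI ballI impI fin_complex_fam)
  fix a :: "nat \<times> nat" assume "a \<in> Cosp"
  then show "sq_vertex b x y (sq_label b x y w a) = a" "b < sq_label b x y w a"
    using l by (auto simp: sq_label_def sq_vertex_def)
next
  show "mono_on Cosp (sq_label b x y w)" using l by (auto simp: mono_on_def sq_label_def)
next
  fix T assume T: "T \<in> fam [[x,w],[y,w]]"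
  then show "sq_vertex b x y ` T \<subseteq> Cosp" using l by (auto simp: fam_def sq_vertex_def subset_iff)
  have "T \<subseteq> {x,w} \<or> T \<subseteq> {y,w}" using T by (auto simp: fam_def)
  then show "mono_on T (sq_vertex b x y)"
    using l by (auto simp: mono_on_def sq_vertex_def subset_iff)
  fix j assume "j \<in> T"
  then show "sq_label b x y w (sq_vertex b x y j) = j"
    using T l by (auto simp: fam_def sq_vertex_def sq_label_def subset_iff)
next
  fix xs :: "(nat \<times> nat) list" assume xs: "sorted_wrt (\<le>) xs" "set xs \<subseteq> Cosp"
  have "\<not> ((0,1) \<in> set xs \<and> (1,0) \<in> set xs)"
  proof
    assume "(0,1) \<in> set xs \<and> (1,0) \<in> set xs"
    then obtain i j where "i < length xs" "xs ! i = (0,1)" "j < length xs" "xs ! j = (1,0)"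
      by (metis in_set_conv_nth)
    then show False using xs(1) unfolding sorted_wrt_iff_nth_less
      by (cases i j rule: linorder_cases) force+
  qed
  then have "set xs \<subseteq> {(0,1),(1,1)} \<or> set xs \<subseteq> {(1,0),(1,1)}" using xs(2) by blast
  then show "sq_label b x y w ` set xs \<in> fam [[x,w],[y,w]]"
    by (auto simp: fam_def sq_label_def subset_iff image_subset_iff)
qed

lemma sq_label_chain:
  assumes "b < x" "b < y" "x < w" "y < w" and xs: "xs \<in> simplices (nerve Sq) m"
  shows "sorted (map (sq_label b x y w) xs)" "set (map (sq_label b x y w) xs) \<in> fam [[b,x,w],[b,y,w]]"
proof -
  have xs': "sorted_wrt (\<le>) xs" "set xs \<subseteq> Sq" using xs by (auto simp: in_nerve)
  have "mono_on Sq (sq_label b x y w)" using assms by (auto simp: mono_on_def sq_label_def)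
  then have "sq_label b x y w u \<le> sq_label b x y w v" if "u \<in> set xs" "v \<in> set xs" "u \<le> v" for u v
    using subsetD[OF xs'(2) that(1)] subsetD[OF xs'(2) that(2)] that(3) by (rule mono_onD)
  then show "sorted (map (sq_label b x y w) xs)"
    unfolding sorted_map by (intro sorted_wrt_mono_rel[OF _ xs'(1)])
  have "\<not> ((0,1) \<in> set xs \<and> (1,0) \<in> set xs)"
  proof
    assume "(0,1) \<in> set xs \<and> (1,0) \<in> set xs"
    then obtain i j where "i < length xs" "xs ! i = (0,1)" "j < length xs" "xs ! j = (1,0)"
      by (metis in_set_conv_nth)
    then show False using xs'(1) unfolding sorted_wrt_iff_nth_less
      by (cases i j rule: linorder_cases) force+
  qed
  moreover have "v \<in> {(0,0),(0,1),(1,0),(1,1)}" if "v \<in> set xs" for v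
    using subsetD[OF xs'(2) that] unfolding in_Sq by simp
  then have "set xs \<subseteq> {(0,0),(0,1),(1,0),(1,1)}" by (rule subsetI)
  ultimately have "set xs \<subseteq> {(0,0),(0,1),(1,1)} \<or> set xs \<subseteq> {(0,0),(1,0),(1,1)}" by blast
  then show "set (map (sq_label b x y w) xs) \<in> fam [[b,x,w],[b,y,w]]"
    by (auto simp: fam_def sq_label_def subset_iff image_subset_iff)
qed

lemma sq_of_hom:
  assumes l: "b < x" "b < y" "x < w" "y < w" and f: "dmap X (fam [[b,x,w],[b,y,w]]) f"
  shows "sq_of f b x y w \<in> sset_hom (nerve Sq) X"
  unfolding sq_of_def
proof (rule sset_mapI)
  fix n xs assume xs: "xs \<in> simplices (nerve Sq) n"
  then have len: "length (map (sq_label b x y w) xs) = Suc n" by (simp add: in_nerve)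
  note c = sq_label_chain[OF l xs]
  show "f (map (sq_label b x y w) xs) \<in> simplices X n" by (rule dmapD(1)[OF f len c])
  fix m \<alpha> assume al: "\<alpha> \<in> simplices (Delta n) m"
  have "map (sq_label b x y w) (comp_op xs \<alpha>) = comp_op (map (sq_label b x y w) xs) \<alpha>"
    by (rule map_comp_op) (use al len in \<open>auto simp: in_Delta\<close>)
  moreover have "act (nerve Sq) n \<alpha> xs \<in> simplices (nerve Sq) m"
    using simplicial_set_nerve[of Sq] al xs unfolding simplicial_set_def by blast
  ultimately show "act (nerve Sq) n \<alpha> xs \<in> simplices (nerve Sq) m \<and>
      f (map (sq_label b x y w) (act (nerve Sq) n \<alpha> xs)) = act X n \<alpha> (f (map (sq_label b x y w) xs))"
    using dmapD(2)[OF f len c al] by (simp del: map_map)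
qed

lemma fun_upd_sq_vertex: "(sq_vertex b x y)(b := (0,0)) = sq_vertex b x y"
  by (auto simp: sq_vertex_def)

text \<open>The bridge that allows pasting arguments about pullback squares to be carried out on
  labels alone.\<close>

lemma pullback_iff:
  assumes l: "b < x" "b < y" "x < w" "y < w" "x \<noteq> y" and f: "dmap X (fam [[b,x,w],[b,y,w]]) f"
  shows "pullback_square X (sq_of f b x y w) \<longleftrightarrow> lim_cone X (fam [[x,w],[y,w]]) b f"
proof -
  let ?D = "sq_of f b x y w" and ?F = "fam [[x,w],[y,w]]"
  have h: "?D \<in> sset_hom (nerve Sq) X" by (rule sq_of_hom[OF l(1-4) f])
  have e: "insert (0,0) Cosp = Sq" by (auto simp: in_Sq)
  note ce = chain_enum_Cosp[OF l]
  have ag: "agree (joinc (Pow {b}) ?F) (cone_of ?D (sq_vertex b x y)) f"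
    unfolding agree_def
  proof (intro allI impI; elim conjE)
    fix xs assume a: "xs \<noteq> []" "sorted xs" "set xs \<in> joinc (Pow {b}) ?F"
    then have s: "set xs \<subseteq> {b,x,w} \<or> set xs \<subseteq> {b,y,w}" unfolding joinc_def fam_def by fastforce
    have i: "map (sq_label b x y w) (map (sq_vertex b x y) xs) = xs"
      unfolding map_map by (rule map_idI) (use s l in \<open>auto simp: sq_label_def sq_vertex_def\<close>)
    have "mono_on (set xs) (sq_vertex b x y)"
      using s l by (auto simp: mono_on_def sq_vertex_def subset_iff)
    then have "sorted_wrt (\<le>) (map (sq_vertex b x y) xs)"
      unfolding sorted_wrt_map by (intro sorted_wrt_mono_rel[OF _ a(2)]) (meson mono_onD)
    moreover have "set (map (sq_vertex b x y) xs) \<subseteq> Sq" by (auto simp: sq_vertex_def)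
    ultimately have "map (sq_vertex b x y) xs \<in> simplices (nerve Sq) (length xs - 1)"
      using a(1) by (simp add: in_nerve)
    then show "cone_of ?D (sq_vertex b x y) xs = f xs" unfolding cone_of_def sq_of_def using i by (simp del: map_map)
  qed
  show ?thesis
  proof
    assume "pullback_square X ?D"
    then have "is_limit_at X Cosp (0,0) ?D" unfolding pullback_square_def by blast
    from is_limit_at_imp_lim_cone[OF ce this] have "lim_cone X ?F b (cone_of ?D (sq_vertex b x y))"
      unfolding fun_upd_sq_vertex .
    then show "lim_cone X ?F b f" using lim_cone_agree ag agree_sym by blast
  next
    assume "lim_cone X ?F b f"
    then have "lim_cone X ?F b (cone_of ?D ((sq_vertex b x y)(b := (0,0))))"
      unfolding fun_upd_sq_vertex using lim_cone_agree ag by blast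
    then have "is_limit_at X Cosp (0,0) ?D"
    proof (rule lim_cone_imp_is_limit_at[OF ce])
      show "?D \<in> sset_hom (nerve (insert (0,0) Cosp)) X" unfolding e by (rule h)
    qed auto
    then show "pullback_square X ?D" unfolding pullback_square_def using h by blast
  qed
qed

lemma initial_fam:
  assumes "simplicial_set X" "dmap X (fam cs) f" "sub_ok cs cs'"
    and ok: "\<forall>c\<in>set cs'. \<forall>xs\<in>set (subseqs c). infam cs xs \<or> v \<in> set xs \<and> (\<forall>y\<in>set xs. v \<le> y) \<and> (\<exists>y\<in>set xs. v < y)"
    and "infam cs [v]" "initial X (f [v])"
  shows "extensible X (fam cs) f (fam cs')"
proof (rule extend_initial[OF assms(1,2) fin_complex_fam sub_okD[OF assms(3)] fin_complex_fam finite_fam _ assms(6)])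
  show "{v} \<in> fam cs" using assms(5) by (simp add: infam_iff)
  fix S assume S: "S \<in> fam cs' - fam cs"
  obtain xs where "set xs = S" "v \<in> set xs \<and> (\<forall>y\<in>set xs. v \<le> y) \<and> (\<exists>y\<in>set xs. v < y)"
    using ball_fam[OF ok S] .
  then show "v \<in> S \<and> (\<exists>x\<in>S. v < x) \<and> (\<forall>y\<in>S. v \<le> y)" by auto
qed

text \<open>The lists in \<open>ls\<close> span the overlap of the two complexes. For complexes
  without a common vertex \<open>ls\<close> is \<open>[[]]\<close>, on which nothing has to be
  compared.\<close>

definition glue_ok :: "int list list \<Rightarrow> int list list \<Rightarrow> int list list \<Rightarrow> bool" where
  "glue_ok cs ds ls \<longleftrightarrow> (\<forall>c\<in>set cs. \<forall>d\<in>set ds. infam ls (filter (\<lambda>x. x \<in> set d) c)) \<and>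
     (\<forall>l\<in>set ls. infam cs l \<and> infam ds l \<and> sorted l \<and> distinct l)"

text \<open>All simplices in a face arise by operators from the one spanned by its full vertex list,
  so agreement on one list for each common face suffices.\<close>

lemma glue_fam:
  assumes f: "dmap X (fam cs) f" and g: "dmap X (fam ds) g" and ok: "glue_ok cs ds ls"
    and eq: "\<forall>l\<in>set ls. l = [] \<or> f l = g l"
  shows "\<exists>h. dmap X (fam (cs @ ds)) h \<and> agree (fam cs) h f \<and> agree (fam ds) h g"
proof -
  have "agree (fam cs \<inter> fam ds) f g"
    unfolding agree_def
  proof (intro allI impI; elim conjE)
    fix xs assume a: "xs \<noteq> []" "sorted xs" "set xs \<in> fam cs \<inter> fam ds"
    then obtain c d where cd: "c \<in> set cs" "d \<in> set ds" "set xs \<subseteq> set c" "set xs \<subseteq> set d" unfolding fam_def by blast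
    then have "infam ls (filter (\<lambda>x. x \<in> set d) c)" using ok unfolding glue_ok_def by blast
    then obtain l where l: "l \<in> set ls" "set xs \<subseteq> set l" using cd unfolding infam_def by auto
    then have l': "set l \<in> fam cs" "set l \<in> fam ds" "sorted l" "distinct l"
      using ok unfolding glue_ok_def infam_iff by auto
    have sl: "sorted_list_of_set (set l) = l" using l' by (simp add: sorted_list_of_set_sort_remdups sorted_sort_id distinct_remdups_id)
    have "l \<noteq> []" using l(2) a(1) by auto
    then obtain n where n: "length l = Suc n" by (cases l) auto
    obtain m where m: "length xs = Suc m" using a(1) by (cases xs) auto
    have card: "card (set l) = Suc n" using l'(4) n by (simp add: distinct_card)
    have p: "map (pos (set l)) xs \<in> simplices (Delta n) m" by (rule pos_Delta[OF _ card m a(2) l(2)]) simp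
    have x: "comp_op l (map (pos (set l)) xs) = xs" using comp_op_pos[of "set l" xs] l(2) unfolding sl by simp
    show "f xs = g xs"
      using dmapD(2)[OF f n l'(3,1) p] dmapD(2)[OF g n l'(3,2) p] eq l(1) \<open>l \<noteq> []\<close> unfolding x by fastforce
  qed
  from dmap_Un[OF f g this fin_complex_fam fin_complex_fam]
  moreover have "fam (cs @ ds) = fam cs \<union> fam ds" by (auto simp: fam_def)
  ultimately show ?thesis by simp
qed

lemma agree_fam: "agree (fam cs) f g \<Longrightarrow> infam cs xs \<Longrightarrow> sorted xs \<Longrightarrow> xs \<noteq> [] \<Longrightarrow> f xs = g xs"
  unfolding agree_def infam_iff by blast

lemma agree_sub: "agree (fam cs') f g \<Longrightarrow> sub_ok cs cs' \<Longrightarrow> agree (fam cs) f g"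
  using agree_subset sub_okD by blast

lemma dmap_sub: "dmap X (fam cs') f \<Longrightarrow> sub_ok cs cs' \<Longrightarrow> dmap X (fam cs) f"
  using dmap_subset sub_okD by blast

text \<open>The map from the full simplex with vertices \<open>l\<close> that is classified by
  \<open>s\<close>.\<close>

definition spx :: "'a sset \<Rightarrow> int list \<Rightarrow> 'a \<Rightarrow> int list \<Rightarrow> 'a" where
  "spx X l s xs = act X (length l - 1) (map (pos (set l)) xs) s"

lemma dmap_spx:
  assumes X: "simplicial_set X" and l: "distinct l" "length l = Suc n" and s: "s \<in> simplices X n"
  shows "dmap X (fam [l]) (spx X l s)"
  unfolding dmap_def
proof (intro allI impI conjI ballI; elim conjE)
  fix m xs k \<alpha> assume a: "length xs = Suc m" "sorted xs" "set xs \<in> fam [l]"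
  have card: "card (set l) = Suc n" using l by (simp add: distinct_card)
  have q: "map (pos (set l)) xs \<in> simplices (Delta n) m"
    by (rule pos_Delta[OF _ card a(1,2)]) (use a(3) in \<open>auto simp: fam_def\<close>)
  show "spx X l s xs \<in> simplices X m" using sset_act(1)[OF X q s] l(2) by (simp add: spx_def)
  assume al: "\<alpha> \<in> simplices (Delta m) k"
  have "map (pos (set l)) (comp_op xs \<alpha>) = comp_op (map (pos (set l)) xs) \<alpha>"
    by (rule map_comp_op[OF Delta_lessThan[OF al a(1)]])
  then show "spx X l s (comp_op xs \<alpha>) = act X m \<alpha> (spx X l s xs)"
    using sset_act(3)[OF X q al s] l(2) by (simp add: spx_def del: map_map)
qed

lemma pos_eval [simp]:
  "pos {} x = 0"
  "pos (insert a S) x = (if a \<in> S then pos S x else if finite S then (if a < x then Suc (pos S x) else pos S x) else pos (insert a S) x)"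
proof -
  show "pos {} x = 0" by (simp add: pos_def)
  show "pos (insert a S) x = (if a \<in> S then pos S x else if finite S then (if a < x then Suc (pos S x) else pos S x) else pos (insert a S) x)"
  proof (cases "a \<in> S \<or> infinite S")
    case True then show ?thesis by (auto simp: insert_absorb)
  next
    case False
    have "{y \<in> insert a S. y < x} = (if a < x then insert a {y\<in>S. y < x} else {y\<in>S. y < x})" by auto
    then show ?thesis using False unfolding pos_def by simp
  qed
qed

lemma sq_of_relabel:
  "sq_of (\<lambda>xs. f (map r xs)) b x y w = sq_of f (r b) (r x) (r y) (r w)"
proof -
  have "r \<circ> sq_label b x y w = sq_label (r b) (r x) (r y) (r w)" by (auto simp: sq_label_def)
  then show ?thesis unfolding sq_of_def by simp
qed

lemma sq_of_cong:
  assumes "agree (fam [[b,x,w],[b,y,w]]) f g" "b < x" "b < y" "x < w" "y < w"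
  shows "sq_of f b x y w = sq_of g b x y w"
proof -
  have "sq_of f b x y w m xs = sq_of g b x y w m xs" for m xs
  proof (cases "xs \<in> simplices (nerve Sq) m")
    case True
    then have "map (sq_label b x y w) xs \<noteq> []" by (auto simp: in_nerve)
    with sq_label_chain[OF assms(2-5) True] assms(1) have "f (map (sq_label b x y w) xs) = g (map (sq_label b x y w) xs)"
      unfolding agree_def by blast
    then show ?thesis using True by (simp add: sq_of_def)
  qed (simp add: sq_of_def sset_map_out)
  then show ?thesis by blast
qed

lemma sq_eqI:
  assumes "\<And>m xs. xs \<in> simplices (nerve Sq) m \<Longrightarrow> D m xs = D' m xs"
  shows "sset_map (nerve Sq) D = sset_map (nerve Sq) D'"
  using assms by (intro ext) (simp add: sset_map_def restrict_def)

lemma sq_of_cone_of: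
  assumes "\<And>v. v \<in> Sq \<Longrightarrow> u (sq_label b x y w v) = h v"
  shows "sq_of (cone_of D u) b x y w = reindex Sq h D"
  unfolding sq_of_def reindex_def
proof (rule sq_eqI)
  fix m xs assume "xs \<in> simplices (nerve Sq) m"
  then have xs: "set xs \<subseteq> Sq" "length xs = Suc m" by (auto simp: in_nerve)
  have "map u (map (sq_label b x y w) xs) = map h xs"
    unfolding map_map by (rule map_cong[OF refl]) (use assms xs in \<open>auto simp del: split_paired_All\<close>)
  then show "cone_of D u (map (sq_label b x y w) xs) = D m (map h xs)"
    unfolding cone_of_def using xs(2) by (simp only: length_map diff_Suc_1)
qed

lemma reindex_id:
  assumes "D \<in> sset_hom (nerve A) X" shows "reindex A id D = D"
proof -
  have "reindex A id D m xs = D m xs" for m xs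
    using sset_homD(2)[OF assms] by (cases "xs \<in> simplices (nerve A) m") (auto simp: reindex_def sset_map_out)
  then show ?thesis by blast
qed

lemma dmap_cone_fam:
  assumes D: "D \<in> sset_hom (nerve A) X" and u: "\<forall>c\<in>set cs. \<forall>x\<in>set c. u x \<in> A \<and> (\<forall>y\<in>set c. x \<le> y \<longrightarrow> u x \<le> u y)"
  shows "dmap X (fam cs) (cone_of D u)"
proof (rule dmap_cone_of[OF D])
  fix S assume "S \<in> fam cs"
  then obtain c where "c \<in> set cs" "S \<subseteq> set c" unfolding fam_def by blast
  then show "u ` S \<subseteq> A \<and> mono_on S u" using u by (auto simp: mono_on_def)
qed

lemma degenerate_edge:
  assumes f: "dmap X (fam cs) f" and c: "infam cs [v]"
  shows "f [v, v] = act X 0 [0, 0] (f [v])" "f [v] \<in> simplices X 0"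
proof -
  have s: "length [v] = Suc 0" "sorted [v]" "set [v] \<in> fam cs" using c by (auto simp: infam_iff)
  show "f [v] \<in> simplices X 0" by (rule dmapD(1)[OF f s])
  have "[0,0] \<in> simplices (Delta 0) 1" by (simp add: in_nerve)
  from dmapD(2)[OF f s this] show "f [v, v] = act X 0 [0, 0] (f [v])" by simp
qed

lemma dmap_faces:
  assumes f: "dmap X (fam cs) f" and c: "infam cs [u, v]" "u < v"
  shows "f [u, v] \<in> simplices X 1" "act X 1 [0] (f [u, v]) = f [u]" "act X 1 [1] (f [u, v]) = f [v]"
proof -
  have s: "length [u, v] = Suc 1" "sorted [u, v]" "set [u, v] \<in> fam cs" using c by (auto simp: infam_iff)
  show "f [u, v] \<in> simplices X 1" by (rule dmapD(1)[OF f s])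
  show "act X 1 [0] (f [u, v]) = f [u]" "act X 1 [1] (f [u, v]) = f [v]"
    using dmapD(2)[OF f s, of "[0]" 0] dmapD(2)[OF f s, of "[1]" 0] by (simp_all add: in_Delta)
qed

lemma rspecial_terminal_edge:
  assumes "simplicial_set X" "dmap X (fam cs) f" "infam cs [u, v]" "u < v" "terminal X (f [u])" "terminal X (f [v])"
  shows "rspecial X (f [u, v])"
  using rspecial_terminal[OF assms(1), of "f [u, v]"] dmap_faces[OF assms(2-4)] assms(5,6) by simp

lemma rspecial_degenerate_edge:
  assumes "quasicategory X" "dmap X (fam cs) f" "infam cs [v]"
  shows "rspecial X (f [v, v])"
  using rspecial_degenerate[OF assms(1)] degenerate_edge[OF assms(2,3)] by simp

text \<open>The counterpart of \<open>jext\<close> without a variable simplex: \<open>f\<close> is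
  pinned down on \<open>bs\<close>, which carries the special edges, terminal vertices and limit
  cones that are used.\<close>

definition fext :: "'a sset \<Rightarrow> int list list \<Rightarrow> (int list \<Rightarrow> 'a) \<Rightarrow> int list list \<Rightarrow> int list list \<Rightarrow> bool" where
  "fext X bs f cs cs' \<longleftrightarrow> sub_ok bs cs \<and> sub_ok cs cs' \<and>
     (\<forall>g. dmap X (fam cs) g \<longrightarrow> agree (fam bs) g f \<longrightarrow> extensible X (fam cs) g (fam cs'))"

lemma fextI:
  assumes "sub_ok bs cs" "sub_ok cs cs'"
    "\<And>g. dmap X (fam cs) g \<Longrightarrow> agree (fam bs) g f \<Longrightarrow> extensible X (fam cs) g (fam cs')"
  shows "fext X bs f cs cs'"
  using assms unfolding fext_def by blast

lemma fext_trans: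
  assumes "fext X bs f cs cs'" "fext X bs f cs' cs''"
  shows "fext X bs f cs cs''"
proof (rule fextI)
  have s: "fam cs \<subseteq> fam cs'" "fam bs \<subseteq> fam cs" "fam cs' \<subseteq> fam cs''"
    using assms sub_okD unfolding fext_def by blast+
  show "sub_ok bs cs" using assms(1) unfolding fext_def by blast
  have "set c \<in> fam cs''" if "c \<in> set cs" for c using s that unfolding fam_def by blast
  then show "sub_ok cs cs''" unfolding sub_ok_def infam_iff by blast
  fix g assume g: "dmap X (fam cs) g" "agree (fam bs) g f"
  show "extensible X (fam cs) g (fam cs'')"
  proof (rule extensible_trans[OF _ s(1)])
    show "extensible X (fam cs) g (fam cs')" using assms(1) g unfolding fext_def by blast
    fix h assume h: "dmap X (fam cs') h" "agree (fam cs) h g"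
    have "agree (fam bs) h f" using agree_trans[OF agree_subset[OF h(2) s(2)] g(2)] .
    then show "extensible X (fam cs') h (fam cs'')" using assms(2) h(1) unfolding fext_def by blast
  qed
qed

lemma fext_toggle:
  assumes "quasicategory X" "sub_ok bs cs" "sub_ok cs cs'" "toggle_ok v cs cs'" "lower_ok v cs cs'"
  shows "fext X bs f cs cs'"
  by (rule fextI[OF assms(2,3)]) (rule toggle_fam[OF assms(1) _ assms(3-5)])

lemma fext_outer:
  assumes "quasicategory X" "sub_ok bs cs" "sub_ok cs cs'" "outer_ok u v cs cs'" "lower_ok u cs cs'"
    "u < v" "infam bs [u, v]" "rspecial X (f [u, v])"
  shows "fext X bs f cs cs'"
proof (rule fextI[OF assms(2,3)])
  fix g assume g: "dmap X (fam cs) g" "agree (fam bs) g f"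
  have "g [u, v] = f [u, v]" using agree_fam[OF g(2) assms(7)] assms(6) by simp
  moreover have "infam cs [u, v]" using assms(7) sub_okD[OF assms(2)] unfolding infam_iff by blast
  ultimately show "extensible X (fam cs) g (fam cs')"
    using outer_fam[OF assms(1) g(1) assms(3-6)] assms(8) by simp
qed

lemma fext_terminal:
  assumes "simplicial_set X" "sub_ok bs cs" "sub_ok cs cs'" "terminal_ok v cs cs'" "lower_ok v cs cs'"
    "infam bs [v]" "terminal X (f [v])"
  shows "fext X bs f cs cs'"
proof (rule fextI[OF assms(2,3)])
  fix g assume g: "dmap X (fam cs) g" "agree (fam bs) g f"
  have "g [v] = f [v]" using agree_fam[OF g(2) assms(6)] by simp
  moreover have "infam cs [v]" using assms(6) sub_okD[OF assms(2)] unfolding infam_iff by blast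
  ultimately show "extensible X (fam cs) g (fam cs')"
    using terminal_fam[OF assms(1) g(1) assms(3-5)] assms(7) by simp
qed

definition initial_ok :: "int \<Rightarrow> int list list \<Rightarrow> int list list \<Rightarrow> bool" where
  "initial_ok v cs cs' \<longleftrightarrow> (\<forall>c\<in>set cs'. \<forall>xs\<in>set (subseqs c). infam cs xs \<or>
     v \<in> set xs \<and> (\<forall>y\<in>set xs. v \<le> y) \<and> (\<exists>y\<in>set xs. v < y))"

lemma fext_initial:
  assumes "simplicial_set X" "sub_ok bs cs" "sub_ok cs cs'" "initial_ok v cs cs'"
    "infam bs [v]" "initial X (f [v])"
  shows "fext X bs f cs cs'"
proof (rule fextI[OF assms(2,3)])
  fix g assume g: "dmap X (fam cs) g" "agree (fam bs) g f"
  have "g [v] = f [v]" using agree_fam[OF g(2) assms(5)] by simp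
  moreover have "infam cs [v]" using assms(5) sub_okD[OF assms(2)] unfolding infam_iff by blast
  ultimately show "extensible X (fam cs) g (fam cs')"
    using initial_fam[OF assms(1) g(1) assms(3) assms(4)[unfolded initial_ok_def]] assms(6) by simp
qed

lemma fext_lim:
  assumes "sub_ok bs cs" "sub_ok cs cs'" "lim_ok as b cs cs'" "lower_ok b cs cs'"
    "\<forall>a\<in>set as. infam bs (b # a) \<and> (\<forall>x\<in>set a. b < x)" "lim_cone X (fam as) b f"
  shows "fext X bs f cs cs'"
proof (rule fextI[OF assms(1,2)])
  fix g assume g: "dmap X (fam cs) g" "agree (fam bs) g f"
  have s: "fam bs \<subseteq> fam cs" by (rule sub_okD[OF assms(1)])
  have "joinc (Pow {b}) (fam as) \<subseteq> fam bs" using assms(5) by (intro joinc_fam) auto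
  then have "lim_cone X (fam as) b g" using lim_cone_agree[OF assms(6)] agree_subset[OF g(2)] by blast
  moreover have "\<forall>a\<in>set as. infam cs (b # a) \<and> (\<forall>x\<in>set a. b < x)" using assms(5) s unfolding infam_iff by blast
  ultimately show "extensible X (fam cs) g (fam cs')" using lim_fam[OF g(1) assms(2-4)] by blast
qed

lemma fextE:
  assumes "fext X cs f cs cs'" "dmap X (fam cs) f"
  shows "\<exists>g. dmap X (fam cs') g \<and> agree (fam cs) g f"
  using assms agree_refl unfolding fext_def extensible_def by blast

text \<open>Both sides say that one and the same square is cartesian, since \<open>sq_of\<close>
  forgets the labels.\<close>

lemma lim_relabel:
  assumes f: "dmap X (fam [[b',x',w'],[b',y',w']]) f"
    and l': "b' < x'" "b' < y'" "x' < w'" "y' < w'" "x' \<noteq> y'"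
    and l: "b < x" "b < y" "x < w" "y < w" "x \<noteq> y"
    and r: "r b = b'" "r x = x'" "r y = y'" "r w = w'"
  shows "lim_cone X (fam [[x,w],[y,w]]) b (\<lambda>xs. f (map r xs)) \<longleftrightarrow> lim_cone X (fam [[x',w'],[y',w']]) b' f"
proof -
  have d: "dmap X (fam [[b,x,w],[b,y,w]]) (\<lambda>xs. f (map r xs))"
  proof (rule dmap_reindex[OF f])
    fix S assume S: "S \<in> fam [[b,x,w],[b,y,w]]"
    then have S': "S \<subseteq> {b,x,w} \<or> S \<subseteq> {b,y,w}" by (auto simp: fam_def)
    then have "r ` S \<subseteq> {b',x',w'} \<or> r ` S \<subseteq> {b',y',w'}" using r by auto
    moreover have "mono_on S r"
    proof (rule mono_onI)
      fix i j assume ij: "i \<in> S" "j \<in> S" "i \<le> j"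
      then have "i \<in> {b,x,w} \<and> j \<in> {b,x,w} \<or> i \<in> {b,y,w} \<and> j \<in> {b,y,w}" using S' by blast
      then show "r i \<le> r j" using l l' r ij(3) by auto
    qed
    ultimately show "r ` S \<in> fam [[b',x',w'],[b',y',w']] \<and> mono_on S r" by (auto simp: fam_def)
  qed
  show ?thesis
    unfolding pullback_iff[OF l' f, symmetric] pullback_iff[OF l d, symmetric] sq_of_relabel r ..
qed

text \<open>The edge to \<open>B\<close> is replaced by a composite whose first edge is special, and
  the zero object by a prescribed one with a prescribed edge to \<open>B\<close>, while the fiber
  object stays the same. In this way several fiber squares over \<open>B\<close> can be given a
  common edge from zero.\<close>

lemma fiber_along_homotopy:
  assumes X: "quasicategory X" and S: "fiber_square X S"
    and t: "t \<in> simplices X 2" "act X 2 [1,2] t = S 1 [(0,1),(1,1)]" "rspecial X (act X 2 [0,1] t)"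
    and z: "zero_object X z" and e: "e \<in> simplices X 1" "act X 1 [0] e = z" "act X 1 [1] e = S 0 [(1,1)]"
  shows "\<exists>g. dmap X (fam [[0,1,3],[0,2,3]]) g \<and> lim_cone X (fam [[1,3],[2,3]]) 0 g \<and>
    g [1,3] = act X 2 [0,2] t \<and> g [2,3] = e \<and> g [0] = S 0 [(0,0)]"
proof -
  have ss: "simplicial_set X" using X unfolding quasicategory_def by blast
  have Sh: "S \<in> sset_hom (nerve Sq) X" and Sp: "pullback_square X S" and Sz: "zero_object X (S 0 [(1,0)])"
    using S unfolding fiber_square_def pullback_square_def by auto
  \<comment> \<open>Label \<open>0\<close> is the fiber, \<open>2 -> 5\<close> the edge of
    \<open>S\<close> and \<open>4\<close> its zero object; \<open>1\<close> will be the new source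
    and \<open>3\<close> the new zero object.\<close>
  let ?u = "sq_vertex 0 2 4" let ?c0 = "[[0,2,5],[0,4,5]]"
  have f0: "dmap X (fam ?c0) (cone_of S ?u)"
    by (rule dmap_cone_fam[OF Sh]) (simp add: sq_vertex_def)
  have f1: "dmap X (fam [[1,2,5]]) (spx X [1,2,5] t)" by (rule dmap_spx[OF ss _ _ t(1)]) auto
  have "glue_ok ?c0 [[1,2,5]] [[2,5]]" by code_simp
  moreover have "\<forall>l\<in>set [[2,5]]. cone_of S ?u l = spx X [1,2,5] t l"
    using t(2) by (simp add: cone_of_def spx_def sq_vertex_def numeral_2_eq_2)
  ultimately obtain h1 where h1: "dmap X (fam (?c0 @ [[1,2,5]])) h1" "agree (fam ?c0) h1 (cone_of S ?u)"
    "agree (fam [[1,2,5]]) h1 (spx X [1,2,5] t)" using glue_fam[OF f0 f1] by blast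
  let ?c1 = "[[0,2,5],[0,4,5],[1,2,5]]"
  have h1d: "dmap X (fam ?c1) h1" using h1(1) by simp
  have f2: "dmap X (fam [[3,5]]) (spx X [3,5] e)" by (rule dmap_spx[OF ss _ _ e(1)]) auto
  have "glue_ok ?c1 [[3,5]] [[5]]" by code_simp
  moreover have "h1 [5] = cone_of S ?u [5]" by (rule agree_fam[OF h1(2)]; code_simp)
  then have "\<forall>l\<in>set [[5]]. h1 l = spx X [3,5] e l"
    using e(3) by (simp add: cone_of_def spx_def sq_vertex_def)
  ultimately obtain h2 where h2: "dmap X (fam (?c1 @ [[3,5]])) h2" "agree (fam ?c1) h2 h1" "agree (fam [[3,5]]) h2 (spx X [3,5] e)"
    using glue_fam[OF h1d f2] by blast
  let ?c2 = "[[0,2,5],[0,4,5],[1,2,5],[3,5]]"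
  have h2d: "dmap X (fam ?c2) h2" using h2(1) by simp
  have ag2: "agree (fam ?c0) h2 (cone_of S ?u)"
    by (rule agree_trans[OF agree_sub[OF h2(2)] h1(2)]; code_simp)
  have v: "h2 [3] = z" "h2 [3,5] = e" "h2 [1,2] = act X 2 [0,1] t" "h2 [1,5] = act X 2 [0,2] t"
    "h2 [4] = S 0 [(1,0)]" "h2 [0] = S 0 [(0,0)]"
  proof -
    have "h2 [3] = spx X [3,5] e [3]" "h2 [3,5] = spx X [3,5] e [3,5]"
      by (rule agree_fam[OF h2(3)]; code_simp)+
    then show "h2 [3] = z" "h2 [3,5] = e"
      using e(2) sset_act(2)[OF ss e(1)] by (simp_all add: spx_def)
    have "h2 [1,2] = h1 [1,2]" "h2 [1,5] = h1 [1,5]"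
      by (rule agree_fam[OF h2(2)]; code_simp)+
    moreover have "h1 [1,2] = spx X [1,2,5] t [1,2]" "h1 [1,5] = spx X [1,2,5] t [1,5]"
      by (rule agree_fam[OF h1(3)]; code_simp)+
    ultimately show "h2 [1,2] = act X 2 [0,1] t" "h2 [1,5] = act X 2 [0,2] t"
      by (simp_all add: spx_def numeral_2_eq_2)
    have "h2 [4] = cone_of S ?u [4]" "h2 [0] = cone_of S ?u [0]"
      by (rule agree_fam[OF ag2]; code_simp)+
    then show "h2 [4] = S 0 [(1,0)]" "h2 [0] = S 0 [(0,0)]"
      by (simp_all add: cone_of_def sq_vertex_def)
  qed
  have z3: "terminal X (h2 [3])" "initial X (h2 [3])" and z4: "terminal X (h2 [4])"
    and sp: "rspecial X (h2 [1,2])"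
    using v z Sz t(3) unfolding zero_object_def by auto
  note t = fext_trans
  have 1: "fext X ?c2 h2 ?c2 [[0,2,5],[0,4,5],[1,2,5],[3,5],[0,3]]"
    by (rule fext_terminal[OF ss, where v = 3 and f = h2, OF _ _ _ _ _ z3(1)]; code_simp)
  have 2: "fext X ?c2 h2 [[0,2,5],[0,4,5],[1,2,5],[3,5],[0,3]] [[0,2,5],[0,4,5],[1,2,5],[3,5],[0,3,4]]"
    by (rule fext_terminal[OF ss, where v = 4 and f = h2, OF _ _ _ _ _ z4]; code_simp)
  \<comment> \<open>Initiality of the new zero object makes the prescribed edge
    \<open>3 -> 5\<close> homotopic to the composite through \<open>4\<close>.\<close>
  have 3: "fext X ?c2 h2 [[0,2,5],[0,4,5],[1,2,5],[3,5],[0,3,4]] [[0,2,5],[0,4,5],[1,2,5],[3,4,5],[0,3,4]]"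
    by (rule fext_initial[OF ss, where v = 3 and f = h2, OF _ _ _ _ z3(2)]; code_simp)
  have 4: "fext X ?c2 h2 [[0,2,5],[0,4,5],[1,2,5],[3,4,5],[0,3,4]] [[0,2,5],[1,2,5],[0,3,4,5]]"
    by (rule fext_toggle[OF X, where v = 4]; code_simp)
  \<comment> \<open>The fiber is mapped to the new source by lifting \<open>0 -> 2\<close> along the
    special edge \<open>1 -> 2\<close>.\<close>
  have 5: "fext X ?c2 h2 [[0,2,5],[1,2,5],[0,3,4,5]] [[0,2,5],[1,2,5],[0,3,4,5],[0,1,2]]"
    by (rule fext_outer[OF X, where u = 1 and v = 2 and f = h2, OF _ _ _ _ _ _ sp]; code_simp)
  have 6: "fext X ?c2 h2 [[0,2,5],[1,2,5],[0,3,4,5],[0,1,2]] [[0,1,2,5],[0,3,4,5]]"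
    by (rule fext_toggle[OF X, where v = 2]; code_simp)
  obtain h where h: "dmap X (fam [[0,1,2,5],[0,3,4,5]]) h" "agree (fam ?c2) h h2"
    using fextE[OF t[OF 1 t[OF 2 t[OF 3 t[OF 4 t[OF 5 6]]]]] h2d] by blast
  have hv: "h [l] = h2 [l]" if "infam ?c2 [l]" for l by (rule agree_fam[OF h(2) that]) auto
  \<comment> \<open>The new square \<open>0, 1, 3, 5\<close> is placed on the even labels of the
    prism and the old square \<open>0, 2, 4, 5\<close> on the odd ones. The repeated values
    \<open>0\<close> and \<open>5\<close> make the edges \<open>0 -> 1\<close> and
    \<open>6 -> 7\<close> of the prism degenerate.\<close>
  let ?ps = "[(0,0),(1,0),(2,1),(3,2),(4,3),(5,4),(6,5),(7,5)] :: (int \<times> int) list"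
  let ?r = "relabel ?ps"
  have rl: "?r 0 = 0" "?r 1 = 0" "?r 2 = 1" "?r 3 = 2" "?r 4 = 3" "?r 5 = 4" "?r 6 = 5" "?r 7 = 5"
    by (simp_all add: relabel_def)
  have hr: "dmap X (fam (map ((#) 0) prism)) (\<lambda>xs. h (map ?r xs))"
    by (rule dmap_relabel[OF h(1)]; code_simp)
  have r1: "rspecial X (h (map ?r [0,1]))" "rspecial X (h (map ?r [6,7]))"
    unfolding list.map rl by (rule rspecial_degenerate_edge[OF X h(1)]; code_simp)+
  have "h [1,2] = h2 [1,2]" by (rule agree_fam[OF h(2)]; code_simp)
  then have r2: "rspecial X (h (map ?r [2,3]))" unfolding list.map rl using sp by simp
  have "h [3] = h2 [3]" "h [4] = h2 [4]" by (rule hv; code_simp)+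
  then have t34: "terminal X (h [3])" "terminal X (h [4])" using z3 z4 by simp_all
  have r3: "rspecial X (h (map ?r [4,5]))" unfolding list.map rl
    by (rule rspecial_terminal_edge[OF ss h(1) _ _ t34]; code_simp)
  have d0: "dmap X (fam ?c0) h" by (rule dmap_sub[OF h(1)]; code_simp)
  have agh: "agree (fam ?c0) h (cone_of S ?u)"
    by (rule agree_trans[OF agree_sub[OF h(2)] ag2]; code_simp)
  have "sq_of h 0 2 4 5 = sq_of (cone_of S ?u) 0 2 4 5" by (rule sq_of_cong[OF agh]) auto
  also have "\<dots> = reindex Sq id S" by (rule sq_of_cone_of) (auto simp: in_Sq sq_label_def sq_vertex_def)
  also have "\<dots> = S" by (rule reindex_id[OF Sh])
  finally have "lim_cone X (fam [[2,5],[4,5]]) 0 h" using Sp pullback_iff[of 0 2 4 5 X h] d0 by simp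
  then have l1: "lim_cone X (fam [[3,7],[5,7]]) 1 (\<lambda>xs. h (map ?r xs))"
    using lim_relabel[OF d0, where b = 1 and x = 3 and y = 5 and w = 7 and r = ?r] rl by simp
  have "lim_cone X (fam [[2,6],[4,6]]) 0 (\<lambda>xs. h (map ?r xs))"
    by (rule limit_along_equivalence[OF X hr r1(1) r2 r3 r1(2) l1])
  let ?q = "relabel [(0,0),(1,1),(2,3),(3,5)]"
  have ql: "?q 0 = 0" "?q 1 = 1" "?q 2 = 3" "?q 3 = 5" by (simp_all add: relabel_def)
  have d1: "dmap X (fam [[0,1,5],[0,3,5]]) h" by (rule dmap_sub[OF h(1)]; code_simp)
  have "lim_cone X (fam [[1,5],[3,5]]) 0 h"
    using \<open>lim_cone X (fam [[2,6],[4,6]]) 0 (\<lambda>xs. h (map ?r xs))\<close>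
      lim_relabel[OF d1, where b = 0 and x = 2 and y = 4 and w = 6 and r = ?r] rl by simp
  then have "lim_cone X (fam [[1,3],[2,3]]) 0 (\<lambda>xs. h (map ?q xs))"
    using lim_relabel[OF d1, where b = 0 and x = 1 and y = 2 and w = 3 and r = ?q] ql by simp
  moreover have "dmap X (fam [[0,1,3],[0,2,3]]) (\<lambda>xs. h (map ?q xs))"
    by (rule dmap_relabel[OF h(1)]; code_simp)
  moreover have "h [1,5] = h2 [1,5]" "h [3,5] = h2 [3,5]" "h [0] = h2 [0]"
    by (rule agree_fam[OF h(2)]; code_simp)+
  ultimately show ?thesis
    by (intro exI[of _ "\<lambda>xs. h (map ?q xs)"]) (simp add: ql v)
qed

section \<open>Uniqueness of pushouts\<close>

text \<open>Edges and triangles that start at an initial vertex are fillings of boundaries, so the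
  usual argument works in every simplicial set, without composing edges.\<close>

lemma equivalent_initial:
  assumes Y: "simplicial_set Y" and t: "initial Y t" "initial Y t'"
  shows "\<exists>f. equivalence_edge Y f \<and> act Y 1 [0] f = t \<and> act Y 1 [1] f = t'"
proof -
  have edge: "\<exists>f\<in>simplices Y 1. act Y 1 [0] f = t \<and> act Y 1 [1] f = t'" if i: "initial Y t" "initial Y t'" for t t'
  proof -
    have s: "t \<in> simplices Y 0" "t' \<in> simplices Y 0" using i unfolding initial_def by auto
    have d: "dmap Y (fam [[0]]) (spx Y [0] t)" "dmap Y (fam [[1]]) (spx Y [1] t')"
      using s by (auto intro!: dmap_spx[OF Y])
    have "glue_ok [[0]] [[1]] [[]]" by code_simp
    then obtain h where h: "dmap Y (fam ([[0]] @ [[1]])) h" "agree (fam [[0]]) h (spx Y [0] t)" "agree (fam [[1]]) h (spx Y [1] t')"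
      using glue_fam[OF d, of "[[]]"] by auto
    have h1: "dmap Y (fam [[0],[1]]) h" using h(1) by simp
    have "h [0] = spx Y [0] t [0]" by (rule agree_fam[OF h(2)]; code_simp)
    moreover have "h [1] = spx Y [1] t' [1]" by (rule agree_fam[OF h(3)]; code_simp)
    ultimately have v: "h [0] = t" "h [1] = t'"
      using sset_act(2)[OF Y s(1)] sset_act(2)[OF Y s(2)] by (simp_all add: spx_def)
    have i0: "initial Y (h [0])" using v i by simp
    have "fext Y [[0],[1]] h [[0],[1]] [[0,1]]"
      by (rule fext_initial[OF Y, where v = 0 and f = h, OF _ _ _ _ i0]; code_simp)
    from fextE[OF this h1] obtain g where g: "dmap Y (fam [[0,1]]) g" "agree (fam [[0],[1]]) g h" by blast
    have "g [0] = h [0]" "g [1] = h [1]" by (rule agree_fam[OF g(2)]; code_simp)+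
    moreover have "infam [[0,1]] [0,1]" by code_simp
    ultimately show ?thesis using dmap_faces[OF g(1), of 0 1] v by (intro bexI[of _ "g [0,1]"]) auto
  qed
  obtain f where f: "f \<in> simplices Y 1" "act Y 1 [0] f = t" "act Y 1 [1] f = t'" using edge[OF t] by blast
  obtain g where g: "g \<in> simplices Y 1" "act Y 1 [0] g = t'" "act Y 1 [1] g = t" using edge[OF t(2,1)] by blast
  have tri: "\<exists>s\<in>simplices Y 2. act Y 2 [0,1] s = f \<and> act Y 2 [1,2] s = g \<and> act Y 2 [0,2] s = act Y 1 [0,0] f"
    if t: "initial Y t" and f: "f \<in> simplices Y 1" "act Y 1 [0] f = t" "act Y 1 [1] f = t'"
      and g: "g \<in> simplices Y 1" "act Y 1 [0] g = t'" "act Y 1 [1] g = t" for t t' f g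
  proof -
    let ?d = "act Y 1 [0,0] f"
    have D: "[0,0] \<in> simplices (Delta 1) 1" "[0] \<in> simplices (Delta 1) 0" "[1] \<in> simplices (Delta 1) 0" by (simp_all add: in_Delta)
    have d: "?d \<in> simplices Y 1" by (rule sset_act(1)[OF Y D(1) f(1)])
    have d01: "act Y 1 [0] ?d = t" "act Y 1 [1] ?d = t"
      using sset_act(3)[OF Y D(1) D(2) f(1)] sset_act(3)[OF Y D(1) D(3) f(1)] f(2) by simp_all
    have q: "dmap Y (fam [[0,1]]) (spx Y [0,1] f)" "dmap Y (fam [[1,2]]) (spx Y [1,2] g)" "dmap Y (fam [[0,2]]) (spx Y [0,2] ?d)"
      using f(1) g(1) d by (auto intro!: dmap_spx[OF Y])
    have "glue_ok [[0,1]] [[1,2]] [[1]]" by code_simp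
    moreover have "\<forall>l\<in>set [[1]]. spx Y [0,1] f l = spx Y [1,2] g l" using f g by (simp add: spx_def)
    ultimately obtain h where h: "dmap Y (fam ([[0,1]] @ [[1,2]])) h" "agree (fam [[0,1]]) h (spx Y [0,1] f)"
      "agree (fam [[1,2]]) h (spx Y [1,2] g)" using glue_fam[OF q(1,2)] by blast
    have h1: "dmap Y (fam [[0,1],[1,2]]) h" using h(1) by simp
    have "glue_ok [[0,1],[1,2]] [[0,2]] [[0],[2]]" by code_simp
    moreover have "h [0] = spx Y [0,1] f [0]" by (rule agree_fam[OF h(2)]; code_simp)
    moreover have "h [2] = spx Y [1,2] g [2]" by (rule agree_fam[OF h(3)]; code_simp)
    ultimately obtain k where k: "dmap Y (fam ([[0,1],[1,2]] @ [[0,2]])) k" "agree (fam [[0,1],[1,2]]) k h"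
      "agree (fam [[0,2]]) k (spx Y [0,2] ?d)"
      using glue_fam[OF h1 q(3), of "[[0],[2]]"] f g d01 by (auto simp: spx_def)
    have k1: "dmap Y (fam [[0,1],[1,2],[0,2]]) k" using k(1) by simp
    have kv: "k [0] = h [0]" "k [0,1] = h [0,1]" "k [1,2] = h [1,2]" by (rule agree_fam[OF k(2)]; code_simp)+
    have "k [0,2] = spx Y [0,2] ?d [0,2]" by (rule agree_fam[OF k(3)]; code_simp)
    moreover have "h [0,1] = spx Y [0,1] f [0,1]" by (rule agree_fam[OF h(2)]; code_simp)
    moreover have "h [1,2] = spx Y [1,2] g [1,2]" by (rule agree_fam[OF h(3)]; code_simp)
    ultimately have ke: "k [0,1] = f" "k [1,2] = g" "k [0,2] = ?d"
      using kv sset_act(2)[OF Y f(1)] sset_act(2)[OF Y g(1)] sset_act(2)[OF Y d] by (simp_all add: spx_def)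
    have "k [0] = t" using kv \<open>h [0] = spx Y [0,1] f [0]\<close> f by (simp add: spx_def)
    then have i0: "initial Y (k [0])" using t by simp
    have "fext Y [[0,1],[1,2],[0,2]] k [[0,1],[1,2],[0,2]] [[0,1,2]]"
      by (rule fext_initial[OF Y, where v = 0 and f = k, OF _ _ _ _ i0]; code_simp)
    from fextE[OF this k1] obtain m where m: "dmap Y (fam [[0,1,2]]) m" "agree (fam [[0,1],[1,2],[0,2]]) m k" by blast
    have s: "length [0,1,2::int] = Suc 2" "sorted [0,1,2::int]" "set [0,1,2] \<in> fam [[0,1,2]]" by (auto simp: fam_def)
    have "m [0,1] = k [0,1]" "m [1,2] = k [1,2]" "m [0,2] = k [0,2]" by (rule agree_fam[OF m(2)]; code_simp)+
    moreover have "m [0,1] = act Y 2 [0,1] (m [0,1,2])" "m [1,2] = act Y 2 [1,2] (m [0,1,2])" "m [0,2] = act Y 2 [0,2] (m [0,1,2])"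
      using dmapD(2)[OF m(1) s, of "[0,1]" 1] dmapD(2)[OF m(1) s, of "[1,2]" 1] dmapD(2)[OF m(1) s, of "[0,2]" 1]
      by (simp_all add: in_Delta numeral_2_eq_2)
    ultimately show ?thesis using dmapD(1)[OF m(1) s] ke by (intro bexI[of _ "m [0,1,2]"]) auto
  qed
  obtain s where s: "s \<in> simplices Y 2" "act Y 2 [0,1] s = f" "act Y 2 [1,2] s = g" "act Y 2 [0,2] s = act Y 1 [0,0] f"
    using tri[OF t(1) f g] by blast
  obtain r where r: "r \<in> simplices Y 2" "act Y 2 [0,1] r = g" "act Y 2 [1,2] r = f" "act Y 2 [0,2] r = act Y 1 [0,0] g"
    using tri[OF t(2) g f] by blast
  have D: "[0] \<in> simplices (Delta 1) 0" "[1] \<in> simplices (Delta 1) 0" "[0,0] \<in> simplices (Delta 0) 1" by (simp_all add: in_nerve)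
  have "act Y 1 [0,0] g = act Y 0 [0,0] t'" "act Y 1 [1,1] f = act Y 0 [0,0] t'"
    using sset_act(3)[OF Y D(1,3) g(1)] sset_act(3)[OF Y D(2,3) f(1)] f(3) g(2) by simp_all
  then have "equivalence_edge Y f"
    unfolding equivalence_edge_def using f(1) g(1) s r by auto
  then show ?thesis using f by blast
qed

section \<open>Coslices\<close>

lemma map_join_jn2: "map_join_simplex id (comp_op \<alpha>) (jn xs ys) = jn xs (comp_op \<alpha> ys)"
  by (auto simp: jn_def)

lemma coslice_act:
  assumes "z \<in> simplices (join K (Delta m)) k" "length \<alpha> = Suc m"
  shows "act (coslice X K p) n \<alpha> f k z = f k (map_join_simplex id (comp_op \<alpha>) z)"
  using assms by (simp add: coslice_def)

lemma coslice_actI: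
  assumes "length \<alpha> = Suc m"
  shows "act (coslice X K p) n \<alpha> f = sset_map (join K (Delta m)) (\<lambda>k z. f k (map_join_simplex id (comp_op \<alpha>) z))"
  using assms by (simp add: coslice_def)

lemma coslice_jnI:
  assumes "\<alpha> \<in> simplices (Delta n) m" "length xs + length ys = Suc k" "sorted_wrt (\<le>) xs" "set xs \<subseteq> A"
    "sorted ys" "set ys \<subseteq> {..m}"
  shows "jn xs (comp_op \<alpha> ys) \<in> simplices (join (nerve A) (Delta n)) k"
  using comp_op_Delta'[OF assms(1,5,6)] assms by (intro join_jnI) auto

lemma simplicial_coslice:
  assumes X: "simplicial_set X"
  shows "simplicial_set (coslice X (nerve A) p)"
  unfolding simplicial_set_def
proof (intro conjI allI ballI)
  fix n m \<alpha> f assume al: "\<alpha> \<in> simplices (Delta n) m" and f: "f \<in> simplices (coslice X (nerve A) p) n"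
  have len: "length \<alpha> = Suc m" using al by (simp add: in_Delta)
  have fh: "f \<in> sset_hom (join (nerve A) (Delta n)) X" and fp: "\<And>m x. x \<in> simplices (nerve A) m \<Longrightarrow> f m (InL x) = p m x"
    using f unfolding coslice_def by auto
  have "act (coslice X (nerve A) p) n \<alpha> f \<in> sset_hom (join (nerve A) (Delta m)) X"
    unfolding coslice_actI[OF len]
  proof (rule sset_mapI)
    fix k z assume "z \<in> simplices (join (nerve A) (Delta m)) k"
    then obtain xs ys where z: "z = jn xs ys" "length xs + length ys = Suc k"
      "sorted_wrt (\<le>) xs" "set xs \<subseteq> A" "sorted ys" "set ys \<subseteq> {..m}" unfolding in_join by blast
    show "f k (map_join_simplex id (comp_op \<alpha>) z) \<in> simplices X k"
      unfolding z(1) map_join_jn2 by (rule sset_homD(1)[OF fh coslice_jnI[OF al z(2-6)]])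
  next
    fix k l \<beta> z assume be: "\<beta> \<in> simplices (Delta k) l" and zj: "z \<in> simplices (join (nerve A) (Delta m)) k"
    then obtain xs ys where z: "z = jn xs ys" "length xs + length ys = Suc k"
      "sorted_wrt (\<le>) xs" "set xs \<subseteq> A" "sorted ys" "set ys \<subseteq> {..m}" unfolding in_join by blast
    have b: "sorted \<beta>" "set \<beta> \<subseteq> {..<length xs + length ys}" using be z(2) by (auto simp: in_Delta)
    note c = cut_props[OF b]
    have e: "comp_op \<alpha> (comp_op ys (cutr (length xs) \<beta>)) = comp_op (comp_op \<alpha> ys) (cutr (length xs) \<beta>)"
      by (rule map_comp_op[OF c(4)])
    have "f l (map_join_simplex id (comp_op \<alpha>) (act (join (nerve A) (Delta m)) k \<beta> z))
      = f l (act (join (nerve A) (Delta n)) k \<beta> (jn xs (comp_op \<alpha> ys)))"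
      unfolding z(1) act_jn[OF z(2) be] map_join_jn2 e using act_jn[of xs "comp_op \<alpha> ys" k \<beta> l A "{..n}"] z(2) be
      by (simp del: map_map)
    also have "\<dots> = act X k \<beta> (f k (map_join_simplex id (comp_op \<alpha>) z))"
      unfolding z(1) map_join_jn2 by (rule sset_homD(3)[OF fh be coslice_jnI[OF al z(2-6)]])
    finally show "act (join (nerve A) (Delta m)) k \<beta> z \<in> simplices (join (nerve A) (Delta m)) l \<and>
      f l (map_join_simplex id (comp_op \<alpha>) (act (join (nerve A) (Delta m)) k \<beta> z)) =
      act X k \<beta> (f k (map_join_simplex id (comp_op \<alpha>) z))"
      using act_join_closed[OF be zj] by blast
  qed
  moreover have "act (coslice X (nerve A) p) n \<alpha> f k (InL x) = p k x" if "x \<in> simplices (nerve A) k" for k x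
    using that fp[OF that] unfolding coslice_actI[OF len] by (simp add: join_def)
  ultimately show "act (coslice X (nerve A) p) n \<alpha> f \<in> simplices (coslice X (nerve A) p) m"
    unfolding coslice_def by simp
next
  fix n f assume f: "f \<in> simplices (coslice X (nerve A) p) n"
  have fh: "f \<in> sset_hom (join (nerve A) (Delta n)) X" using f unfolding coslice_def by auto
  have len: "length (id_op n) = Suc n" by simp
  have "act (coslice X (nerve A) p) n (id_op n) f k z = f k z" for k z
  proof (cases "z \<in> simplices (join (nerve A) (Delta n)) k")
    case True
    then obtain xs ys where z: "z = jn xs ys" "set ys \<subseteq> {..n}" unfolding in_join by blast
    have "comp_op (id_op n) ys = ys" using z(2) by (intro map_idI) (auto simp del: upt_Suc)
    then show ?thesis using coslice_act[OF True len] unfolding z(1) map_join_jn2 by simp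
  next
    case False
    then show ?thesis unfolding coslice_actI[OF len] using sset_homD(2)[OF fh False] by (simp add: sset_map_out)
  qed
  then show "act (coslice X (nerve A) p) n (id_op n) f = f" by blast
next
  fix n m k \<alpha> \<beta> f assume al: "\<alpha> \<in> simplices (Delta n) m" and be: "\<beta> \<in> simplices (Delta m) k"
  have la: "length \<alpha> = Suc m" and lb: "length \<beta> = Suc k" "length (comp_op \<alpha> \<beta>) = Suc k" using al be by (simp_all add: in_Delta)
  have "act (coslice X (nerve A) p) m \<beta> (act (coslice X (nerve A) p) n \<alpha> f) i z =
    act (coslice X (nerve A) p) n (comp_op \<alpha> \<beta>) f i z" for i z
  proof (cases "z \<in> simplices (join (nerve A) (Delta k)) i")
    case True
    then obtain xs ys where z: "z = jn xs ys" "length xs + length ys = Suc i"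
      "sorted_wrt (\<le>) xs" "set xs \<subseteq> A" "sorted ys" "set ys \<subseteq> {..k}" unfolding in_join by blast
    have c: "comp_op \<alpha> (comp_op \<beta> ys) = comp_op (comp_op \<alpha> \<beta>) ys"
      by (rule comp_op_comp_op[symmetric]) (use z(6) lb in auto)
    have "act (coslice X (nerve A) p) m \<beta> (act (coslice X (nerve A) p) n \<alpha> f) i z
      = act (coslice X (nerve A) p) n \<alpha> f i (jn xs (comp_op \<beta> ys))"
      unfolding coslice_act[OF True lb(1)] unfolding z(1) map_join_jn2 ..
    also have "\<dots> = f i (jn xs (comp_op \<alpha> (comp_op \<beta> ys)))"
      unfolding coslice_act[OF coslice_jnI[OF be z(2-6)] la] map_join_jn2 ..
    also have "\<dots> = act (coslice X (nerve A) p) n (comp_op \<alpha> \<beta>) f i z"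
      unfolding coslice_act[OF True lb(2)] unfolding z(1) map_join_jn2 c ..
    finally show ?thesis .
  next
    case False
    then show ?thesis unfolding coslice_actI[OF lb(1)] coslice_actI[OF lb(2)] by (simp add: sset_map_out)
  qed
  then show "act (coslice X (nerve A) p) m \<beta> (act (coslice X (nerve A) p) n \<alpha> f) =
    act (coslice X (nerve A) p) n (comp_op \<alpha> \<beta>) f" by blast
qed

text \<open>By \<open>eq\<close> both cones are initial in the same coslice, hence equivalent there.
  Evaluation at the cone point, \<open>V\<close>, commutes with operators and therefore carries the
  equivalence to \<open>X\<close>.\<close>

lemma pushout_unique:
  assumes X: "simplicial_set X" and D: "is_colimit_at X A b D" "is_colimit_at X A b D'"
    and eq: "sset_map (nerve A) D = sset_map (nerve A) D'"
  shows "equivalent_objects X (D 0 [b]) (D' 0 [b])"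
proof -
  let ?Y = "coslice X (nerve A) (sset_map (nerve A) D)"
  define t where "t E = sset_map (join (nerve A) (Delta 0)) (\<lambda>m z. E m (case z of
          InL x \<Rightarrow> x | InR \<alpha> \<Rightarrow> map (\<lambda>_. b) \<alpha> | Mix i x \<alpha> \<Rightarrow> x @ map (\<lambda>_. b) \<alpha>))" for E :: "nat \<Rightarrow> 'b list \<Rightarrow> 'a"
  have i: "initial ?Y (t D)" "initial ?Y (t D')" using D eq unfolding is_colimit_at_def t_def by auto
  define V where "V n s = s n (InR (id_op n))" for n and s :: "nat \<Rightarrow> ('b list, nat list) join_simplex \<Rightarrow> 'a"
  have inj: "InR y \<in> simplices (join (nerve A) (Delta n)) m" if "y \<in> simplices (Delta n) m" for y n m
    using that by (simp add: join_def)
  have idD: "id_op n \<in> simplices (Delta n) n" for n by (auto simp: in_Delta simp del: upt_Suc)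
  have sh: "s \<in> sset_hom (join (nerve A) (Delta n)) X" if "s \<in> simplices ?Y n" for s n
    using that unfolding coslice_def by auto
  have V1: "V n s \<in> simplices X n" if "s \<in> simplices ?Y n" for n s
    unfolding V_def by (rule sset_homD(1)[OF sh[OF that] inj[OF idD]])
  have V2: "V m (act ?Y n \<alpha> s) = act X n \<alpha> (V n s)" if s: "s \<in> simplices ?Y n" and al: "\<alpha> \<in> simplices (Delta n) m" for n m \<alpha> s
  proof -
    have la: "length \<alpha> = Suc m" using al by (simp add: in_Delta)
    have "V m (act ?Y n \<alpha> s) = s m (InR \<alpha>)"
      unfolding V_def coslice_act[OF inj[OF idD] la] using comp_op_id[OF la] by simp
    moreover have "comp_op (id_op n) \<alpha> = \<alpha>" using al by (intro map_idI) (auto simp: in_Delta simp del: upt_Suc)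
    then have "act (join (nerve A) (Delta n)) n \<alpha> (InR (id_op n)) = InR \<alpha>" by (simp add: join_def del: upt_Suc)
    ultimately show ?thesis using sset_homD(3)[OF sh[OF s] al inj[OF idD]] unfolding V_def by simp
  qed
  have Vt: "V 0 (t E) = E 0 [b]" for E using inj[OF idD[of 0]] unfolding V_def t_def by simp
  obtain f where f: "equivalence_edge ?Y f" "act ?Y 1 [0] f = t D" "act ?Y 1 [1] f = t D'"
    using equivalent_initial[OF simplicial_coslice[OF X] i] by blast
  obtain g s r where e: "f \<in> simplices ?Y 1" "g \<in> simplices ?Y 1" "s \<in> simplices ?Y 2" "r \<in> simplices ?Y 2"
    "act ?Y 2 [0,1] s = f" "act ?Y 2 [1,2] s = g" "act ?Y 2 [0,2] s = act ?Y 1 [0,0] f"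
    "act ?Y 2 [0,1] r = g" "act ?Y 2 [1,2] r = f" "act ?Y 2 [0,2] r = act ?Y 1 [1,1] f"
    using f(1) unfolding equivalence_edge_def by auto
  have D2: "[0,1] \<in> simplices (Delta 2) 1" "[1,2] \<in> simplices (Delta 2) 1" "[0,2] \<in> simplices (Delta 2) 1"
    "[0,0] \<in> simplices (Delta 1) 1" "[1,1] \<in> simplices (Delta 1) 1" "[0] \<in> simplices (Delta 1) 0" "[1] \<in> simplices (Delta 1) 0"
    by (simp_all add: in_Delta)
  have "equivalence_edge X (V 1 f)"
    unfolding equivalence_edge_def
  proof (intro conjI bexI)
    show "act X 2 [0,1] (V 2 s) = V 1 f" "act X 2 [1,2] (V 2 s) = V 1 g" "act X 2 [0,2] (V 2 s) = act X 1 [0,0] (V 1 f)"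
      using V2[OF e(3) D2(1)] V2[OF e(3) D2(2)] V2[OF e(3) D2(3)] V2[OF e(1) D2(4)] e by simp_all
    show "act X 2 [0,1] (V 2 r) = V 1 g" "act X 2 [1,2] (V 2 r) = V 1 f" "act X 2 [0,2] (V 2 r) = act X 1 [1,1] (V 1 f)"
      using V2[OF e(4) D2(1)] V2[OF e(4) D2(2)] V2[OF e(4) D2(3)] V2[OF e(1) D2(5)] e by simp_all
  qed (use V1 e in auto)
  moreover have "act X 1 [0] (V 1 f) = D 0 [b]" "act X 1 [1] (V 1 f) = D' 0 [b]"
    using V2[OF e(1) D2(6)] V2[OF e(1) D2(7)] f Vt by simp_all
  ultimately show ?thesis unfolding equivalent_objects_def by blast
qed

section \<open>Cubes\<close>

lemma comparable:
  assumes "sorted_wrt (\<le>) xs" "x \<in> set xs" "y \<in> set (xs :: 'p::order list)"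
  shows "x \<le> y \<or> y \<le> x"
proof -
  obtain i j where "i < length xs" "xs ! i = x" "j < length xs" "xs ! j = y"
    using assms(2,3) by (metis in_set_conv_nth)
  then show ?thesis using assms(1) unfolding sorted_wrt_iff_nth_less
    by (cases i j rule: linorder_cases) auto
qed

lemma hom_of_dmap:
  assumes f: "dmap X K f" and e: "mono_on A e"
    and K: "\<And>xs. sorted_wrt (\<le>) xs \<Longrightarrow> set xs \<subseteq> A \<Longrightarrow> e ` set xs \<in> K"
  shows "sset_map (nerve A) (\<lambda>m xs. f (map e xs)) \<in> sset_hom (nerve A) X"
proof (rule sset_mapI)
  fix n xs assume xs: "xs \<in> simplices (nerve A) n"
  then have xs': "sorted_wrt (\<le>) xs" "set xs \<subseteq> A" "length xs = Suc n" by (auto simp: in_nerve)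
  have len: "length (map e xs) = Suc n" using xs' by simp
  have "e u \<le> e v" if "u \<in> set xs" "v \<in> set xs" "u \<le> v" for u v
    using subsetD[OF xs'(2) that(1)] subsetD[OF xs'(2) that(2)] that(3) by (rule mono_onD[OF e])
  then have s: "sorted (map e xs)" unfolding sorted_map by (intro sorted_wrt_mono_rel[OF _ xs'(1)])
  have k: "set (map e xs) \<in> K" using K[OF xs'(1,2)] by simp
  show "f (map e xs) \<in> simplices X n" by (rule dmapD(1)[OF f len s k])
  fix m \<alpha> assume al: "\<alpha> \<in> simplices (Delta n) m"
  have "map e (comp_op xs \<alpha>) = comp_op (map e xs) \<alpha>"
    by (rule map_comp_op[OF Delta_lessThan[OF al xs'(3)]])
  moreover have "act (nerve A) n \<alpha> xs \<in> simplices (nerve A) m"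
    using simplicial_set_nerve[of A] al xs unfolding simplicial_set_def by blast
  ultimately show "act (nerve A) n \<alpha> xs \<in> simplices (nerve A) m \<and>
      f (map e (act (nerve A) n \<alpha> xs)) = act X n \<alpha> (f (map e xs))"
    using dmapD(2)[OF f len s k al] by (simp del: map_map)
qed

text \<open>Binary numbering with the vertical coordinate as leading digit: the top face has the
  labels \<open>0\<close> to \<open>3\<close>, the bottom face \<open>4\<close> to
  \<open>7\<close>.\<close>

definition cube_label :: "nat \<times> nat \<times> nat \<Rightarrow> int" where
  "cube_label = (\<lambda>(i, j, k). 4 * int i + 2 * int j + int k)"

definition cube_of :: "(int list \<Rightarrow> 'a) \<Rightarrow> nat \<Rightarrow> (nat \<times> nat \<times> nat) list \<Rightarrow> 'a" where
  "cube_of f = sset_map (nerve Cube) (\<lambda>m xs. f (map cube_label xs))"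

abbreviation (input) cube_chains :: "int list list" where
  "cube_chains \<equiv> [[0,1,3,7],[0,1,5,7],[0,2,3,7],[0,2,6,7],[0,4,5,7],[0,4,6,7]]"

lemma in_Cube: "v \<in> Cube \<longleftrightarrow> v = (0,0,0) \<or> v = (0,0,1) \<or> v = (0,1,0) \<or> v = (0,1,1) \<or>
  v = (1,0,0) \<or> v = (1,0,1) \<or> v = (1,1,0) \<or> v = (1,1,1)"
proof -
  have "x \<le> 1 \<longleftrightarrow> x = 0 \<or> x = 1" for x :: nat by auto
  then show ?thesis by (cases v) (simp only: mem_Times_iff atMost_iff fst_conv snd_conv prod.inject, blast)
qed

lemma cube_label_chain:
  assumes xs: "sorted_wrt (\<le>) xs" "set xs \<subseteq> Cube"
  shows "cube_label ` set xs \<in> fam cube_chains"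
proof -
  let ?S = "set xs"
  have cmp: "x \<le> y \<or> y \<le> x" if "x \<in> ?S" "y \<in> ?S" for x y using comparable[OF xs(1) that] .
  \<comment> \<open>Of the fifteen pairs of vertices other than the two extreme ones, six are
    comparable; these are the other nine.\<close>
  have n: "\<not> ((0,0,1) \<in> ?S \<and> (0,1,0) \<in> ?S)" "\<not> ((0,0,1) \<in> ?S \<and> (1,0,0) \<in> ?S)" "\<not> ((0,0,1) \<in> ?S \<and> (1,1,0) \<in> ?S)"
    "\<not> ((0,1,0) \<in> ?S \<and> (1,0,0) \<in> ?S)" "\<not> ((0,1,0) \<in> ?S \<and> (1,0,1) \<in> ?S)" "\<not> ((1,0,0) \<in> ?S \<and> (0,1,1) \<in> ?S)"
    "\<not> ((0,1,1) \<in> ?S \<and> (1,0,1) \<in> ?S)" "\<not> ((0,1,1) \<in> ?S \<and> (1,1,0) \<in> ?S)" "\<not> ((1,0,1) \<in> ?S \<and> (1,1,0) \<in> ?S)"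
    using cmp by fastforce+
  have l: "cube_label (0,0,0) = 0" "cube_label (0,0,1) = 1" "cube_label (0,1,0) = 2" "cube_label (0,1,1) = 3"
    "cube_label (1,0,0) = 4" "cube_label (1,0,1) = 5" "cube_label (1,1,0) = 6" "cube_label (1,1,1) = 7"
    by (simp_all add: cube_label_def)
  have im: "cube_label ` ?S \<subseteq> set c"
    if "\<And>v. v \<in> ?S \<Longrightarrow> v = (0,0,0) \<or> v = u \<or> v = w \<or> v = (1,1,1)" "set c = {0, cube_label u, cube_label w, 7}" for c u w
    using that l by (auto simp: image_subset_iff)
  have v: "v = (0,0,0) \<or> v = (0,0,1) \<or> v = (0,1,0) \<or> v = (0,1,1) \<or>
    v = (1,0,0) \<or> v = (1,0,1) \<or> v = (1,1,0) \<or> v = (1,1,1)" if "v \<in> ?S" for v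
    using subsetD[OF xs(2) that] unfolding in_Cube .
  consider "(0,0,1) \<in> ?S" | "(0,1,0) \<in> ?S" | "(1,0,0) \<in> ?S"
    | "(0,0,1) \<notin> ?S" "(0,1,0) \<notin> ?S" "(1,0,0) \<notin> ?S" by blast
  then have "(\<forall>v\<in>?S. v = (0,0,0) \<or> v = (0,0,1) \<or> v = (0,1,1) \<or> v = (1,1,1)) \<or>
    (\<forall>v\<in>?S. v = (0,0,0) \<or> v = (0,0,1) \<or> v = (1,0,1) \<or> v = (1,1,1)) \<or>
    (\<forall>v\<in>?S. v = (0,0,0) \<or> v = (0,1,0) \<or> v = (0,1,1) \<or> v = (1,1,1)) \<or>
    (\<forall>v\<in>?S. v = (0,0,0) \<or> v = (0,1,0) \<or> v = (1,1,0) \<or> v = (1,1,1)) \<or>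
    (\<forall>v\<in>?S. v = (0,0,0) \<or> v = (1,0,0) \<or> v = (1,0,1) \<or> v = (1,1,1)) \<or>
    (\<forall>v\<in>?S. v = (0,0,0) \<or> v = (1,0,0) \<or> v = (1,1,0) \<or> v = (1,1,1))"
    by cases (use v n in \<open>metis+\<close>)
  then show ?thesis
    unfolding fam_def using l by (elim disjE) (fastforce simp: image_subset_iff)+
qed

lemma mono_cube_label: "mono_on A cube_label"
  by (auto simp: mono_on_def cube_label_def intro!: add_mono mult_left_mono)

lemma cube_of_hom:
  assumes "dmap X (fam cube_chains) f"
  shows "cube_of f \<in> sset_hom (nerve Cube) X"
  unfolding cube_of_def by (rule hom_of_dmap[OF assms mono_cube_label cube_label_chain])

lemma nerve_map:
  assumes "xs \<in> simplices (nerve A) m" "\<And>v. v \<in> A \<Longrightarrow> h v \<in> B" "mono_on A h"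
  shows "map h xs \<in> simplices (nerve B) m"
proof -
  have xs: "sorted_wrt (\<le>) xs" "set xs \<subseteq> A" "length xs = Suc m" using assms(1) by (auto simp: in_nerve)
  have "h u \<le> h v" if "u \<in> set xs" "v \<in> set xs" "u \<le> v" for u v
    using subsetD[OF xs(2) that(1)] subsetD[OF xs(2) that(2)] that(3) by (rule mono_onD[OF assms(3)])
  then have "sorted_wrt (\<le>) (map h xs)" unfolding sorted_wrt_map by (intro sorted_wrt_mono_rel[OF _ xs(1)])
  then show ?thesis using xs assms(2) by (auto simp: in_nerve)
qed

lemma face_cube_of:
  assumes "\<And>v. v \<in> Sq \<Longrightarrow> h v \<in> Cube" "mono_on Sq h"
  shows "reindex Sq h (cube_of f) = sq_of f (cube_label (h (0,0))) (cube_label (h (0,1))) (cube_label (h (1,0))) (cube_label (h (1,1)))"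
  unfolding reindex_def sq_of_def
proof (rule sq_eqI)
  fix m xs assume x: "xs \<in> simplices (nerve Sq) m"
  have "map h xs \<in> simplices (nerve Cube) m" by (rule nerve_map[OF x assms])
  then have "cube_of f m (map h xs) = f (map cube_label (map h xs))" by (simp add: cube_of_def)
  also have "map cube_label (map h xs) = map (sq_label (cube_label (h (0,0))) (cube_label (h (0,1))) (cube_label (h (1,0))) (cube_label (h (1,1)))) xs"
    unfolding map_map
  proof (rule map_cong[OF refl])
    fix v assume "v \<in> set xs"
    then have "v \<in> Sq" using x by (auto simp: in_nerve)
    then show "(cube_label \<circ> h) v = sq_label (cube_label (h (0,0))) (cube_label (h (0,1))) (cube_label (h (1,0))) (cube_label (h (1,1))) v"
      unfolding in_Sq by (auto simp: sq_label_def)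
  qed
  finally show "cube_of f m (map h xs) = f (map (sq_label (cube_label (h (0,0))) (cube_label (h (0,1))) (cube_label (h (1,0))) (cube_label (h (1,1)))) xs)" .
qed

text \<open>\<open>limit_of_fibers\<close> with freely chosen labels, some of which may coincide:
  for two fiber squares over the same edge from zero, \<open>z = z'\<close> and
  \<open>w = w'\<close>, and the critical edge \<open>[w, w']\<close> is degenerate.\<close>

lemma pullback_of_fibers:
  assumes X: "quasicategory X" and f: "dmap X (fam cs) f"
    and ok: "relabel_ok [(0,a),(1,a'),(2,x),(3,x'),(4,z),(5,z'),(6,w),(7,w')] (map ((#) 0) prism) cs"
    and lt: "a < x" "a < z" "x < w" "z < w" "x \<noteq> z" "a' < x'" "a' < z'" "x' < w'" "z' < w'" "x' \<noteq> z'"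
      "a < a'" "x < x'" "a' \<noteq> x"
    and sp: "rspecial X (f [w, w'])" and te: "terminal X (f [z])" "terminal X (f [z'])"
    and lim: "lim_cone X (fam [[x,w],[z,w]]) a f" "lim_cone X (fam [[x',w'],[z',w']]) a' f"
  shows "pullback_square X (sq_of f a a' x x')"
proof -
  let ?r = "relabel [(0,a),(1,a'),(2,x),(3,x'),(4,z),(5,z'),(6,w),(7,w')]"
  have rl: "?r 0 = a" "?r 1 = a'" "?r 2 = x" "?r 3 = x'" "?r 4 = z" "?r 5 = z'" "?r 6 = w" "?r 7 = w'"
    by (simp_all add: relabel_def)
  have g: "dmap X (fam (map ((#) 0) prism)) (\<lambda>xs. f (map ?r xs))" by (rule dmap_relabel[OF f ok])
  have d: "sub_ok [[a,x,w],[a,z,w]] cs" "sub_ok [[a',x',w'],[a',z',w']] cs" "sub_ok [[a,a',x'],[a,x,x']] cs"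
  proof -
    have o: "infam cs (map ?r c)" if "infam (map ((#) 0) prism) c" for c
      using relabel_okD(1)[OF ok, of "set c"] that unfolding infam_iff by simp
    have "infam cs (map ?r [0,2,6])" "infam cs (map ?r [0,4,6])" "infam cs (map ?r [1,3,7])" "infam cs (map ?r [1,5,7])"
      "infam cs (map ?r [0,1,3])" "infam cs (map ?r [0,2,3])"
      by (rule o; code_simp)+
    then show "sub_ok [[a,x,w],[a,z,w]] cs" "sub_ok [[a',x',w'],[a',z',w']] cs" "sub_ok [[a,a',x'],[a,x,x']] cs"
      unfolding sub_ok_def list.map rl by simp_all
  qed
  have l1: "lim_cone X (fam [[2,6],[4,6]]) 0 (\<lambda>xs. f (map ?r xs))"
    using lim_relabel[OF dmap_sub[OF f d(1)], where b = 0 and x = 2 and y = 4 and w = 6 and r = ?r] lt lim(1) rl by simp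
  have l2: "lim_cone X (fam [[3,7],[5,7]]) 1 (\<lambda>xs. f (map ?r xs))"
    using lim_relabel[OF dmap_sub[OF f d(2)], where b = 1 and x = 3 and y = 5 and w = 7 and r = ?r] lt lim(2) rl by simp
  have "lim_cone X (fam [[1,3],[2,3]]) 0 (\<lambda>xs. f (map ?r xs))"
    by (rule limit_of_fibers[OF X g _ _ _ l1 l2]) (use sp te rl in simp_all)
  moreover have "dmap X (fam [[0,1,3],[0,2,3]]) (\<lambda>xs. f (map ?r xs))" by (rule dmap_sub[OF g]; code_simp)
  ultimately have "pullback_square X (sq_of (\<lambda>xs. f (map ?r xs)) 0 1 2 3)"
    using pullback_iff[of 0 1 2 3 X "\<lambda>xs. f (map ?r xs)"] by simp
  then show ?thesis unfolding sq_of_relabel rl .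
qed

text \<open>The indexing poset of a product has two incomparable elements, so its chains are the
  single labels \<open>1\<close> and \<open>2\<close>.\<close>

lemma chain_enum_two: "chain_enum {(0,1),(1,0)} (fam [[1],[2]]) (sq_label 0 1 2 3) (sq_vertex 0 1 2) 0"
  unfolding chain_enum_def
proof (intro conjI allI ballI impI fin_complex_fam)
  fix a :: "nat \<times> nat" assume "a \<in> {(0,1),(1,0)}"
  then show "sq_vertex 0 1 2 (sq_label 0 1 2 3 a) = a" "0 < sq_label 0 1 2 3 a"
    by (auto simp: sq_label_def sq_vertex_def)
next
  show "mono_on {(0,1),(1,0)} (sq_label 0 1 2 3)" by (auto simp: mono_on_def sq_label_def)
next
  fix T assume T: "T \<in> fam [[1],[2]]"
  then have T': "T \<subseteq> {1} \<or> T \<subseteq> {2}" by (auto simp: fam_def)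
  then show "sq_vertex 0 1 2 ` T \<subseteq> {(0,1),(1,0)}" "mono_on T (sq_vertex 0 1 2)"
    by (auto simp: sq_vertex_def mono_on_def subset_iff)
  fix j assume "j \<in> T"
  then show "sq_label 0 1 2 3 (sq_vertex 0 1 2 j) = j"
    using T' by (auto simp: sq_vertex_def sq_label_def)
next
  fix xs :: "(nat \<times> nat) list" assume xs: "sorted_wrt (\<le>) xs" "set xs \<subseteq> {(0,1),(1,0)}"
  have "\<not> ((0,1) \<in> set xs \<and> (1,0) \<in> set xs)" using comparable[OF xs(1), of "(0,1)" "(1,0)"] by auto
  then have "set xs \<subseteq> {(0,1)} \<or> set xs \<subseteq> {(1,0)}" using xs(2) by blast
  then show "sq_label 0 1 2 3 ` set xs \<in> fam [[1],[2]]"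
    by (auto simp: fam_def sq_label_def image_subset_iff)
qed

section \<open>The fiber of the canonical morphism\<close>

lemma sset_map_eqD: "sset_map S f = sset_map S g \<Longrightarrow> x \<in> simplices S m \<Longrightarrow> f m x = g m x"
  by (metis sset_map_in)

lemma cone_of_eval: "length xs = Suc m \<Longrightarrow> cone_of D u xs = D m (map u xs)"
  by (simp add: cone_of_def)

text \<open>Labels \<open>4\<close> to \<open>7\<close> form the pushout square; the default value
  serves label \<open>9\<close>, the object \<open>B\<close>.\<close>

definition ganea_vertex :: "int \<Rightarrow> nat \<times> nat \<times> nat" where
  "ganea_vertex x = (if x = 4 then (0,0,0) else if x = 5 then (0,0,1) else if x = 6 then (0,1,0)
     else if x = 7 then (0,1,1) else (1,1,1))"

text \<open>The odd labels form the pullback square. The even ones are the span of the pushout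
  square completed by \<open>B\<close>, which is thus the image of both \<open>6\<close> and
  \<open>7\<close>.\<close>

definition prism_vertex :: "int \<Rightarrow> nat \<times> nat \<times> nat" where
  "prism_vertex x = (if x = 0 then (0,0,0) else if x = 1 then (1,0,0) else if x = 2 then (0,0,1)
     else if x = 3 then (1,0,1) else if x = 4 then (0,1,0) else if x = 5 then (1,1,0) else (1,1,1))"

text \<open>A relative Ganea cube is the identity on the span, so its vertical edges there have the
  values of degenerate edges.\<close>

lemma relative_ganea_hom_edges:
  assumes c: "relative_ganea_at X p c"
  shows "rspecial X (c 1 [(0,0,0),(1,0,0)]) \<longleftrightarrow> rspecial X (c 1 [(1,0,0),(1,0,0)])"
    "rspecial X (c 1 [(0,0,1),(1,0,1)]) \<longleftrightarrow> rspecial X (c 1 [(1,0,1),(1,0,1)])"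
    "rspecial X (c 1 [(0,1,0),(1,1,0)]) \<longleftrightarrow> rspecial X (c 1 [(1,1,0),(1,1,0)])"
    "p 1 [(0,1),(1,1)] = c 1 [(1,0,1),(1,1,1)]" "p 1 [(1,0),(1,1)] = c 1 [(1,1,0),(1,1,1)]"
proof -
  have R5: "reindex ({..1} \<times> Span) id c = reindex ({..1} \<times> Span) (\<lambda>(i, v). (1, v)) c"
    and R4: "reindex Cosp (\<lambda>v. (1, v)) c = p" using c unfolding relative_ganea_at_def by auto
  have "c 1 [(0,v),(1,v)] = c 1 [(1,v),(1,v)]" if "v \<in> Span" for v
    using sset_map_eqD[OF R5[unfolded reindex_def], of "[(0,v),(1,v)]" 1] that
    by (cases v) (auto simp: in_nerve)
  then show "rspecial X (c 1 [(0,0,0),(1,0,0)]) \<longleftrightarrow> rspecial X (c 1 [(1,0,0),(1,0,0)])"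
    "rspecial X (c 1 [(0,0,1),(1,0,1)]) \<longleftrightarrow> rspecial X (c 1 [(1,0,1),(1,0,1)])"
    "rspecial X (c 1 [(0,1,0),(1,1,0)]) \<longleftrightarrow> rspecial X (c 1 [(1,1,0),(1,1,0)])" by simp_all
  show "p 1 [(0,1),(1,1)] = c 1 [(1,0,1),(1,1,1)]" "p 1 [(1,0),(1,1)] = c 1 [(1,1,0),(1,1,1)]"
    unfolding R4[symmetric] reindex_def by (simp_all add: in_nerve)
qed

lemma dmap_ganea:
  assumes "c \<in> sset_hom (nerve Cube) X"
  shows "dmap X (fam [[4,5,7,9],[4,6,7,9]]) (cone_of c ganea_vertex)"
    "dmap X (fam (map ((#) 0) prism)) (cone_of c prism_vertex)"
  by (rule dmap_cone_fam[OF assms]; simp add: ganea_vertex_def prism_vertex_def)+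

text \<open>The square with corner \<open>B\<close> whose span lies in the top face of
  \<open>c\<close> is connected to the pullback square by degenerate edges only, so it is cartesian
  as well.\<close>

lemma relative_ganea_limit:
  assumes X: "quasicategory X" and c: "relative_ganea_at X p c"
  shows "lim_cone X (fam [[5,9],[6,9]]) 4 (cone_of c ganea_vertex)"
    "rspecial X (c 1 [(0,0,1),(1,0,1)])" "rspecial X (c 1 [(0,1,0),(1,1,0)])"
proof -
  have ch: "c \<in> sset_hom (nerve Cube) X" and R3: "pullback_square X (reindex Sq (\<lambda>v. (1, v)) c)"
    using c unfolding relative_ganea_at_def by auto
  let ?f = "cone_of c prism_vertex"
  note f = dmap_ganea(2)[OF ch]
  have v: "prism_vertex 0 = (0,0,0)" "prism_vertex 1 = (1,0,0)" "prism_vertex 2 = (0,0,1)" "prism_vertex 3 = (1,0,1)"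
    "prism_vertex 4 = (0,1,0)" "prism_vertex 5 = (1,1,0)" "prism_vertex 6 = (1,1,1)" "prism_vertex 7 = (1,1,1)"
    by (simp_all add: prism_vertex_def)
  have sp: "rspecial X (c 1 [prism_vertex j, prism_vertex j])" if "infam (map ((#) 0) prism) [j]" for j
    using rspecial_degenerate_edge[OF X f that] by (simp add: cone_of_def)
  have "infam (map ((#) 0) prism) [1]" "infam (map ((#) 0) prism) [3]" "infam (map ((#) 0) prism) [5]" "infam (map ((#) 0) prism) [7]"
    by code_simp+
  then have s: "rspecial X (c 1 [(1,0,0),(1,0,0)])" "rspecial X (c 1 [(1,0,1),(1,0,1)])" "rspecial X (c 1 [(1,1,0),(1,1,0)])"
    "rspecial X (c 1 [(1,1,1),(1,1,1)])"
    using sp v by metis+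
  note e = relative_ganea_hom_edges[OF c]
  show s1: "rspecial X (c 1 [(0,0,1),(1,0,1)])" "rspecial X (c 1 [(0,1,0),(1,1,0)])" using s e by simp_all
  have "reindex Sq (\<lambda>v. (1, v)) c = sq_of ?f 1 3 5 7"
    by (rule sq_of_cone_of[symmetric]) (auto simp: in_Sq sq_label_def prism_vertex_def)
  moreover have "dmap X (fam [[1,3,7],[1,5,7]]) ?f" by (rule dmap_sub[OF f]; code_simp)
  ultimately have l: "lim_cone X (fam [[3,7],[5,7]]) 1 ?f"
    using pullback_iff[of 1 3 5 7 X ?f] R3 by simp
  have "lim_cone X (fam [[2,6],[4,6]]) 0 ?f"
    by (rule limit_along_equivalence[OF X f _ _ _ _ l]) (use s s1 e v in \<open>simp_all add: cone_of_def\<close>)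
  moreover have "dmap X (fam [[0,2,6],[0,4,6]]) ?f" by (rule dmap_sub[OF f]; code_simp)
  ultimately have "pullback_square X (sq_of ?f 0 2 4 6)" using pullback_iff[of 0 2 4 6 X ?f] by simp
  also have "sq_of ?f 0 2 4 6 = reindex Sq (\<lambda>v. prism_vertex (sq_label 0 2 4 6 v)) c"
    by (rule sq_of_cone_of) simp
  also have "\<dots> = sq_of (cone_of c ganea_vertex) 4 5 6 9"
    by (rule sq_of_cone_of[symmetric]) (auto simp: in_Sq sq_label_def prism_vertex_def ganea_vertex_def)
  finally show "lim_cone X (fam [[5,9],[6,9]]) 4 (cone_of c ganea_vertex)"
    using pullback_iff[of 4 5 6 9 X "cone_of c ganea_vertex"] dmap_sub[OF dmap_ganea(1)[OF ch], of "[[4,5,9],[4,6,9]]"]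
    by (simp add: sub_ok_def infam_def)
qed

text \<open>The maximal chains of the cube on \<open>0\<close> to \<open>7\<close> followed by
  \<open>9\<close>, and the chains that leave the top face through \<open>8\<close>.\<close>

definition full_chains :: "int list list" where
  "full_chains = [[0,1,3,7,9],[0,1,3,8,9],[0,2,3,7,9],[0,2,3,8,9],[0,1,5,7,9],[0,2,6,7,9],[0,4,5,7,9],[0,4,6,7,9]]"

text \<open>The data at hand: the square \<open>4, 5, 6, 7\<close> mapping to \<open>9\<close>,
  three fiber squares that share the edge \<open>8 -> 9\<close>, and the product span on
  \<open>0, 1, 2\<close>.\<close>

definition base_chains :: "int list list" where
  "base_chains = [[4,5,7,9],[4,6,7,9],[3,7,9],[3,8,9],[1,5,9],[1,8,9],[2,6,9],[2,8,9],[0,1],[0,2]]"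

text \<open>
  The labels \<open>0, 1, 2, 3\<close> stand for \<open>F\<^sub>X \<times> F\<^sub>Y, F\<^sub>X, F\<^sub>Y, F\<^sub>X\<^sub>,\<^sub>Y\<close>, the labels \<open>4, 5, 6, 7\<close> for
  \<open>X \<times>\<^sub>B Y, X, Y, X \<star>\<^sub>B Y\<close>, and \<open>8, 9\<close> for the zero object and \<open>B\<close>.
\<close>

lemma extend_base_chains:
  assumes X: "quasicategory X" and f: "dmap X (fam base_chains) f" and t: "terminal X (f [8])"
    and l: "lim_cone X (fam [[7,9],[8,9]]) 3 f" "lim_cone X (fam [[5,9],[6,9]]) 4 f"
  shows "\<exists>g. dmap X (fam full_chains) g \<and> agree (fam base_chains) g f"
proof -
  have ss: "simplicial_set X" using X unfolding quasicategory_def by blast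
  note tr = fext_trans
  let ?B = base_chains
  have 1: "fext X ?B f ?B [[4,5,7,9],[4,6,7,9],[3,7,9],[3,8,9],[1,5,7,9],[1,8,9],[2,6,9],[2,8,9],[0,1],[0,2]]"
    unfolding base_chains_def by (rule fext_toggle[OF X, where v = 5]; code_simp)
  have 2: "fext X ?B f [[4,5,7,9],[4,6,7,9],[3,7,9],[3,8,9],[1,5,7,9],[1,8,9],[2,6,9],[2,8,9],[0,1],[0,2]]
      [[4,5,7,9],[4,6,7,9],[3,7,9],[3,8,9],[1,5,7,9],[1,8,9],[2,6,7,9],[2,8,9],[0,1],[0,2]]"
    unfolding base_chains_def by (rule fext_toggle[OF X, where v = 6]; code_simp)
  \<comment> \<open>The limit property at \<open>3\<close> yields the maps \<open>1 -> 3\<close> and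
    \<open>2 -> 3\<close> between the fibers.\<close>
  have 3: "fext X ?B f [[4,5,7,9],[4,6,7,9],[3,7,9],[3,8,9],[1,5,7,9],[1,8,9],[2,6,7,9],[2,8,9],[0,1],[0,2]]
      [[4,5,7,9],[4,6,7,9],[1,5,7,9],[2,6,7,9],[1,3,7,9],[1,3,8,9],[2,3,7,9],[2,3,8,9],[0,1],[0,2]]"
    unfolding base_chains_def by (rule fext_lim[where b = 3 and f = f, OF _ _ _ _ _ l(1)]; code_simp)
  have 4: "fext X ?B f [[4,5,7,9],[4,6,7,9],[1,5,7,9],[2,6,7,9],[1,3,7,9],[1,3,8,9],[2,3,7,9],[2,3,8,9],[0,1],[0,2]]
      [[4,5,7,9],[4,6,7,9],[1,5,7,9],[2,6,7,9],[1,3,7,9],[1,3,8,9],[2,3,7,9],[2,3,8,9],[0,1,8],[0,2,8]]"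
    unfolding base_chains_def by (rule fext_terminal[OF ss, where v = 8 and f = f, OF _ _ _ _ _ t]; code_simp)
  have 5: "fext X ?B f [[4,5,7,9],[4,6,7,9],[1,5,7,9],[2,6,7,9],[1,3,7,9],[1,3,8,9],[2,3,7,9],[2,3,8,9],[0,1,8],[0,2,8]]
      [[4,5,7,9],[4,6,7,9],[1,5,7,9],[2,6,7,9],[1,3,7,9],[1,3,8,9],[2,3,7,9],[2,3,8,9],[0,1,8,9],[0,2,8,9]]"
    unfolding base_chains_def by (rule fext_toggle[OF X, where v = 8]; code_simp)
  have 6: "fext X ?B f [[4,5,7,9],[4,6,7,9],[1,5,7,9],[2,6,7,9],[1,3,7,9],[1,3,8,9],[2,3,7,9],[2,3,8,9],[0,1,8,9],[0,2,8,9]]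
      [[4,5,7,9],[4,6,7,9],[1,5,7,9],[2,6,7,9],[1,3,7,9],[1,3,8,9],[2,3,7,9],[2,3,8,9],[0,1,8,9],[0,2,8,9],[0,1,5,9]]"
    unfolding base_chains_def by (rule fext_toggle[OF X, where v = 1]; code_simp)
  have 7: "fext X ?B f [[4,5,7,9],[4,6,7,9],[1,5,7,9],[2,6,7,9],[1,3,7,9],[1,3,8,9],[2,3,7,9],[2,3,8,9],[0,1,8,9],[0,2,8,9],[0,1,5,9]]
      [[4,5,7,9],[4,6,7,9],[1,5,7,9],[2,6,7,9],[1,3,7,9],[1,3,8,9],[2,3,7,9],[2,3,8,9],[0,1,8,9],[0,2,8,9],[0,1,5,9],[0,2,6,9]]"
    unfolding base_chains_def by (rule fext_toggle[OF X, where v = 2]; code_simp)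
  \<comment> \<open>The limit property at \<open>4\<close> yields the map \<open>0 -> 4\<close> from
    the product of the fibers to the pullback.\<close>
  have 8: "fext X ?B f [[4,5,7,9],[4,6,7,9],[1,5,7,9],[2,6,7,9],[1,3,7,9],[1,3,8,9],[2,3,7,9],[2,3,8,9],[0,1,8,9],[0,2,8,9],[0,1,5,9],[0,2,6,9]]
      [[4,5,7,9],[4,6,7,9],[1,5,7,9],[2,6,7,9],[1,3,7,9],[1,3,8,9],[2,3,7,9],[2,3,8,9],[0,1,8,9],[0,2,8,9],[0,1,5,9],[0,2,6,9],[0,4,5,9],[0,4,6,9]]"
    unfolding base_chains_def by (rule fext_lim[where b = 4 and f = f, OF _ _ _ _ _ l(2)]; code_simp)
  have 9: "fext X ?B f [[4,5,7,9],[4,6,7,9],[1,5,7,9],[2,6,7,9],[1,3,7,9],[1,3,8,9],[2,3,7,9],[2,3,8,9],[0,1,8,9],[0,2,8,9],[0,1,5,9],[0,2,6,9],[0,4,5,9],[0,4,6,9]]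
      [[1,5,7,9],[2,6,7,9],[1,3,7,9],[1,3,8,9],[2,3,7,9],[2,3,8,9],[0,1,8,9],[0,2,8,9],[0,1,5,9],[0,2,6,9],[0,4,5,7,9],[0,4,6,7,9]]"
    unfolding base_chains_def by (rule fext_toggle[OF X, where v = 4]; code_simp)
  have 10: "fext X ?B f [[1,5,7,9],[2,6,7,9],[1,3,7,9],[1,3,8,9],[2,3,7,9],[2,3,8,9],[0,1,8,9],[0,2,8,9],[0,1,5,9],[0,2,6,9],[0,4,5,7,9],[0,4,6,7,9]]
      [[2,6,7,9],[1,3,7,9],[1,3,8,9],[2,3,7,9],[2,3,8,9],[0,1,8,9],[0,2,8,9],[0,1,5,7,9],[0,2,6,9],[0,4,5,7,9],[0,4,6,7,9]]"
    unfolding base_chains_def by (rule fext_toggle[OF X, where v = 5]; code_simp)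
  have 11: "fext X ?B f [[2,6,7,9],[1,3,7,9],[1,3,8,9],[2,3,7,9],[2,3,8,9],[0,1,8,9],[0,2,8,9],[0,1,5,7,9],[0,2,6,9],[0,4,5,7,9],[0,4,6,7,9]]
      [[1,3,7,9],[1,3,8,9],[2,3,7,9],[2,3,8,9],[0,1,8,9],[0,2,8,9],[0,1,5,7,9],[0,2,6,7,9],[0,4,5,7,9],[0,4,6,7,9]]"
    unfolding base_chains_def by (rule fext_toggle[OF X, where v = 6]; code_simp)
  \<comment> \<open>The limit property at \<open>3\<close>, applied once more, fills the square
    \<open>0, 1, 2, 3\<close>, the future top face, along with the rest of the diagram.\<close>
  have 12: "fext X ?B f [[1,3,7,9],[1,3,8,9],[2,3,7,9],[2,3,8,9],[0,1,8,9],[0,2,8,9],[0,1,5,7,9],[0,2,6,7,9],[0,4,5,7,9],[0,4,6,7,9]] full_chains"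
    unfolding base_chains_def full_chains_def by (rule fext_lim[where b = 3 and f = f, OF _ _ _ _ _ l(1)]; code_simp)
  show ?thesis
    by (rule fextE[OF tr[OF 1 tr[OF 2 tr[OF 3 tr[OF 4 tr[OF 5 tr[OF 6 tr[OF 7 tr[OF 8 tr[OF 9 tr[OF 10 tr[OF 11 12]]]]]]]]]]] f])
qed

text \<open>The product of the fibers is the fiber of the pullback over \<open>B\<close>: a map to
  \<open>4\<close> that is trivial over \<open>9\<close> has components in \<open>5\<close> and
  \<open>6\<close>, these lift to the fibers \<open>1\<close> and \<open>2\<close>, and the lifts
  combine to a map to \<open>0\<close>.\<close>

lemma limit_of_product:
  assumes X: "quasicategory X" and f: "dmap X (fam full_chains) f" and t: "terminal X (f [8])"
    and l: "lim_cone X (fam [[5,9],[8,9]]) 1 f" "lim_cone X (fam [[6,9],[8,9]]) 2 f"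
      "lim_cone X (fam [[5,9],[6,9]]) 4 f" "lim_cone X (fam [[1],[2]]) 0 f"
  shows "lim_cone X (fam [[4,9],[8,9]]) 0 f"
proof -
  let ?V = "[[1,5,9],[1,8,9],[2,6,9],[2,8,9],[4,5,9],[4,6,9]]"
  show ?thesis
  proof (rule lim_cone_by_jext[where vs = ?V])
    show "dmap X (joinc (Pow {0}) (fam ?V)) f"
      unfolding joinc_fam_eq by (rule dmap_sub[OF f]) (unfold full_chains_def, code_simp)
    fix \<sigma> assume b: "jbase \<sigma> {0} ?V"
    note tr = jext_trans[OF b]
    have ss: "simplicial_set X" using X unfolding quasicategory_def by blast
    have 1: "jext X \<sigma> {0} ?V f [[4,9],[8,9]] [] [[4,5,9],[4,6,9],[8,9]] []"
      by (rule jext_toggle[OF X b, where v = 4]; code_simp)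
    have 2: "jext X \<sigma> {0} ?V f [[4,5,9],[4,6,9],[8,9]] [] [[4,5,9],[4,6,9],[1,5,9],[1,8,9]] []"
      by (rule jext_lim[OF b _ _ _ _ _ l(1)]; code_simp)
    have 3: "jext X \<sigma> {0} ?V f [[4,5,9],[4,6,9],[1,5,9],[1,8,9]] [] ?V []"
      by (rule jext_lim[OF b _ _ _ _ _ l(2)]; code_simp)
    have 4: "jext X \<sigma> {0} ?V f ?V [] ?V [[1],[2]]"
      by (rule jext_lim0[OF b _ _ l(4)]; code_simp)
    have 5: "jext X \<sigma> {0} ?V f ?V [[1],[2]] ?V [[1,8],[2,8]]"
      by (rule jext_terminal[OF ss b, where v = 8 and f = f, OF _ _ _ _ _ t]; code_simp)
    have 6: "jext X \<sigma> {0} ?V f ?V [[1,8],[2,8]] ?V [[1,8,9],[2,8,9]]"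
      by (rule jext_toggle[OF X b, where v = 8]; code_simp)
    have 7: "jext X \<sigma> {0} ?V f ?V [[1,8,9],[2,8,9]] ?V [[1,8,9],[2,8,9],[1,5,9]]"
      by (rule jext_toggle[OF X b, where v = 1]; code_simp)
    have 8: "jext X \<sigma> {0} ?V f ?V [[1,8,9],[2,8,9],[1,5,9]] ?V [[1,8,9],[2,8,9],[1,5,9],[2,6,9]]"
      by (rule jext_toggle[OF X b, where v = 2]; code_simp)
    \<comment> \<open>The pullback property at \<open>4\<close> matches the map to \<open>4\<close>
      obtained through \<open>0\<close> with the given one.\<close>
    have 9: "jext X \<sigma> {0} ?V f ?V [[1,8,9],[2,8,9],[1,5,9],[2,6,9]] ?V ?V"
      by (rule jext_lim[OF b _ _ _ _ _ l(3)]; code_simp)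
    show "jext X \<sigma> {0} ?V f [[4,9],[8,9]] [] ?V ?V"
      by (rule tr[OF 1 tr[OF 2 tr[OF 3 tr[OF 4 tr[OF 5 tr[OF 6 tr[OF 7 tr[OF 8 9]]]]]]]])
  qed (code_simp | simp)+
qed

lemma lim_agree:
  assumes "lim_cone X (fam as) b f" "agree (fam cs) g f" "\<forall>a\<in>set as. infam cs (b # a)"
  shows "lim_cone X (fam as) b g"
  using lim_cone_agree[OF assms(1)] agree_subset[OF assms(2) joinc_fam[OF assms(3)]] by blast

theorem join_of_fibers:
  assumes X: "quasicategory X" and ax: "mather_cube_axiom X"
    and FX: "is_fiber X (p 1 [(0,1), (1,1)]) F_X" and FY: "is_fiber X (p 1 [(1,0), (1,1)]) F_Y"
    and can: "is_canonical_morphism X p h" and FXY: "is_fiber X h F_XY" and J: "is_join_object X F_X F_Y J"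
  shows "equivalent_objects X F_XY J"
proof -
  have ss: "simplicial_set X" using X unfolding quasicategory_def by blast
  obtain c where c: "relative_ganea_at X p c" and h: "h = c 1 [(0,1,1), (1,1,1)]"
    using can unfolding is_canonical_morphism_def by blast
  have ch: "c \<in> sset_hom (nerve Cube) X" and cpo: "pushout_square X (reindex Sq (\<lambda>v. (0, v)) c)"
    using c unfolding relative_ganea_at_def by auto
  obtain S_X where SX: "fiber_square X S_X" "S_X 1 [(0,1),(1,1)] = p 1 [(0,1),(1,1)]" "S_X 0 [(0,0)] = F_X"
    using FX unfolding is_fiber_def by blast
  obtain S_Y where SY: "fiber_square X S_Y" "S_Y 1 [(0,1),(1,1)] = p 1 [(1,0),(1,1)]" "S_Y 0 [(0,0)] = F_Y"
    using FY unfolding is_fiber_def by blast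
  obtain E where E: "fiber_square X E" "E 1 [(0,1),(1,1)] = h" "E 0 [(0,0)] = F_XY"
    using FXY unfolding is_fiber_def by blast
  obtain D where D: "pushout_square X D" "is_limit_at X {(0,1),(1,0)} (0,0) D"
    "D 0 [(0,1)] = F_X" "D 0 [(1,0)] = F_Y" "D 0 [(1,1)] = J"
    using J unfolding is_join_object_def by blast
  have Eh: "E \<in> sset_hom (nerve Sq) X" and Ep: "pullback_square X E" and Ez: "zero_object X (E 0 [(1,0)])"
    using E(1) unfolding fiber_square_def pullback_square_def by auto
  have Dh: "D \<in> sset_hom (nerve Sq) X" using D(1) unfolding pushout_square_def by blast
  have act_sq: "act X n \<alpha> (S n xs) = S m (comp_op xs \<alpha>)"
    if "S \<in> sset_hom (nerve P) X" "xs \<in> simplices (nerve P) n" "\<alpha> \<in> simplices (Delta n) m" for S n xs \<alpha> m and P :: "'q::order set"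
    using sset_homD(3)[OF that(1,3,2)] by simp
  have D01: "[0] \<in> simplices (Delta 1) 0" "[1] \<in> simplices (Delta 1) 0" "[0,1] \<in> simplices (Delta 2) 1"
    "[1,2] \<in> simplices (Delta 2) 1" "[0,2] \<in> simplices (Delta 2) 1" by (simp_all add: in_Delta)

  note H = dmap_ganea(1)[OF ch] and G = relative_ganea_limit[OF X c] and pe = relative_ganea_hom_edges(4,5)[OF c]
  let ?H = "cone_of c ganea_vertex" and ?E = "cone_of E (sq_vertex 3 7 8)" and ?D = "cone_of D (sq_vertex 0 1 2)"
  \<comment> \<open>The edge from zero to \<open>B\<close> in the fiber square of
    \<open>F_XY\<close>; the squares of \<open>F_X\<close> and \<open>F_Y\<close> are moved to
    it.\<close>
  define e where "e = E 1 [(1,0),(1,1)]"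
  have sqn: "[(1,0),(1,1)] \<in> simplices (nerve Sq) 1" "[(0,1),(1,1)] \<in> simplices (nerve Sq) 1" by (simp_all add: in_nerve)
  have E11: "E 0 [(1,1)] = c 0 [(1,1,1)]"
    using act_sq[OF Eh sqn(2) D01(2)] act_sq[OF ch, of "[(0,1,1),(1,1,1)]" 1 "[1]" 0] D01 E(2) h by (simp add: in_nerve)
  have e: "e \<in> simplices X 1" "act X 1 [0] e = E 0 [(1,0)]" "act X 1 [1] e = c 0 [(1,1,1)]"
    unfolding e_def using sset_homD(1)[OF Eh sqn(1)] act_sq[OF Eh sqn(1) D01(1)] act_sq[OF Eh sqn(1) D01(2)] E11 by simp_all

  \<comment> \<open>The given fibers are those of edges in the bottom face of \<open>c\<close>,
    whereas the relative join lies in the top face. The triangle \<open>?t\<close> compares the two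
    edges to \<open>B\<close>; its first edge is a vertical edge over the span and so
    special.\<close>
  have fib: "\<exists>g. dmap X (fam [[0,1,3],[0,2,3]]) g \<and> lim_cone X (fam [[1,3],[2,3]]) 0 g \<and>
      g [1,3] = c 1 [(0,v),(1,1,1)] \<and> g [2,3] = e \<and> g [0] = S 0 [(0,0)]"
    if S: "fiber_square X S" "S 1 [(0,1),(1,1)] = c 1 [(1,v),(1,1,1)]" and v: "v = (0,1) \<or> v = (1,0)"
      and sp: "rspecial X (c 1 [(0,v),(1,v)])" for S v
  proof -
    let ?t = "c 2 [(0,v),(1,v),(1,1,1)]"
    have tn: "[(0,v),(1,v),(1,1,1)] \<in> simplices (nerve Cube) 2" using v by (auto simp: in_nerve)
    have Sh: "S \<in> sset_hom (nerve Sq) X" using S unfolding fiber_square_def pullback_square_def by auto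
    have a: "act X 2 [0,1] ?t = c 1 [(0,v),(1,v)]" "act X 2 [1,2] ?t = c 1 [(1,v),(1,1,1)]" "act X 2 [0,2] ?t = c 1 [(0,v),(1,1,1)]"
      using act_sq[OF ch tn D01(3)] act_sq[OF ch tn D01(4)] act_sq[OF ch tn D01(5)] by (simp_all add: numeral_2_eq_2)
    have "[(1,v),(1,1,1)] \<in> simplices (nerve Cube) 1" using v by (auto simp: in_nerve)
    then have "c 0 [(1,1,1)] = S 0 [(1,1)]"
      using act_sq[OF Sh sqn(2) D01(2)] act_sq[OF ch _ D01(2)] S(2) by fastforce
    then show ?thesis
      using fiber_along_homotopy[OF X S(1) sset_homD(1)[OF ch tn] _ _ Ez e(1,2)] e(3) a S(2) sp by simp
  qed
  obtain gX where gX: "dmap X (fam [[0,1,3],[0,2,3]]) gX" "lim_cone X (fam [[1,3],[2,3]]) 0 gX"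
      "gX [1,3] = c 1 [(0,0,1),(1,1,1)]" "gX [2,3] = e" "gX [0] = F_X"
    using fib[OF SX(1), of "(0,1)"] SX pe G by auto
  obtain gY where gY: "dmap X (fam [[0,1,3],[0,2,3]]) gY" "lim_cone X (fam [[1,3],[2,3]]) 0 gY"
      "gY [1,3] = c 1 [(0,1,0),(1,1,1)]" "gY [2,3] = e" "gY [0] = F_Y"
    using fib[OF SY(1), of "(1,0)"] SY pe G by auto

  let ?rX = "relabel [(1,0),(5,1),(8,2),(9,3)]" and ?rY = "relabel [(2,0),(6,1),(8,2),(9,3)]"
  have rX: "?rX 1 = 0" "?rX 5 = 1" "?rX 8 = 2" "?rX 9 = 3" and rY: "?rY 2 = 0" "?rY 6 = 1" "?rY 8 = 2" "?rY 9 = 3"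
    by (simp_all add: relabel_def)
  have dE: "dmap X (fam [[3,7,9],[3,8,9]]) ?E" by (rule dmap_cone_fam[OF Eh]) (simp add: sq_vertex_def)
  have dX: "dmap X (fam [[1,5,9],[1,8,9]]) (\<lambda>xs. gX (map ?rX xs))" by (rule dmap_relabel[OF gX(1)]; code_simp)
  have dY: "dmap X (fam [[2,6,9],[2,8,9]]) (\<lambda>xs. gY (map ?rY xs))" by (rule dmap_relabel[OF gY(1)]; code_simp)
  have dD: "dmap X (fam [[0,1],[0,2]]) ?D" by (rule dmap_cone_fam[OF Dh]) (simp add: sq_vertex_def)

  \<comment> \<open>The pieces are glued along \<open>7 -> 9\<close>, then \<open>5 -> 9\<close> and
    \<open>8 -> 9\<close>, then \<open>6 -> 9\<close> and \<open>8 -> 9\<close>, and finally at the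
    vertices \<open>1\<close> and \<open>2\<close>; they agree there by the choice of
    \<open>gX\<close>, \<open>gY\<close> and \<open>e\<close>.\<close>
  let ?k0 = "[[4,5,7,9],[4,6,7,9]]"
  have "glue_ok ?k0 [[3,7,9],[3,8,9]] [[7,9]]" by code_simp
  moreover have "\<forall>l\<in>set [[7,9]]. l = [] \<or> ?H l = ?E l"
    using E(2) h by (simp add: cone_of_def ganea_vertex_def sq_vertex_def)
  ultimately obtain k1 where k1: "dmap X (fam (?k0 @ [[3,7,9],[3,8,9]])) k1" "agree (fam ?k0) k1 ?H" "agree (fam [[3,7,9],[3,8,9]]) k1 ?E"
    using glue_fam[OF H dE] by blast
  let ?k1 = "[[4,5,7,9],[4,6,7,9],[3,7,9],[3,8,9]]"
  have k1d: "dmap X (fam ?k1) k1" using k1(1) by simp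
  have "glue_ok ?k1 [[1,5,9],[1,8,9]] [[5,9],[8,9]]" by code_simp
  moreover have "k1 [5,9] = ?H [5,9]" by (rule agree_fam[OF k1(2)]; code_simp)
  moreover have k189: "k1 [8,9] = ?E [8,9]" by (rule agree_fam[OF k1(3)]; code_simp)
  ultimately obtain k2 where k2: "dmap X (fam (?k1 @ [[1,5,9],[1,8,9]])) k2" "agree (fam ?k1) k2 k1"
      "agree (fam [[1,5,9],[1,8,9]]) k2 (\<lambda>xs. gX (map ?rX xs))"
    using glue_fam[OF k1d dX, of "[[5,9],[8,9]]"] rX gX(3,4)
    by (auto simp: cone_of_def ganea_vertex_def sq_vertex_def e_def)
  let ?k2 = "[[4,5,7,9],[4,6,7,9],[3,7,9],[3,8,9],[1,5,9],[1,8,9]]"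
  have k2d: "dmap X (fam ?k2) k2" using k2(1) by simp
  have "glue_ok ?k2 [[2,6,9],[2,8,9]] [[6,9],[8,9]]" by code_simp
  moreover have "k2 [6,9] = k1 [6,9]" "k2 [8,9] = k1 [8,9]" by (rule agree_fam[OF k2(2)]; code_simp)+
  moreover have "k1 [6,9] = ?H [6,9]" by (rule agree_fam[OF k1(2)]; code_simp)
  ultimately obtain k3 where k3: "dmap X (fam (?k2 @ [[2,6,9],[2,8,9]])) k3" "agree (fam ?k2) k3 k2"
      "agree (fam [[2,6,9],[2,8,9]]) k3 (\<lambda>xs. gY (map ?rY xs))"
    using glue_fam[OF k2d dY, of "[[6,9],[8,9]]"] rY gY(3,4) k189
    by (auto simp: cone_of_def ganea_vertex_def sq_vertex_def e_def)
  let ?k3 = "[[4,5,7,9],[4,6,7,9],[3,7,9],[3,8,9],[1,5,9],[1,8,9],[2,6,9],[2,8,9]]"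
  have k3d: "dmap X (fam ?k3) k3" using k3(1) by simp
  have "glue_ok ?k3 [[0,1],[0,2]] [[1],[2]]" by code_simp
  moreover have "k3 [1] = k2 [1]" by (rule agree_fam[OF k3(2)]; code_simp)
  moreover have "k2 [1] = gX (map ?rX [1])" by (rule agree_fam[OF k2(3)]; code_simp)
  moreover have "k3 [2] = gY (map ?rY [2])" by (rule agree_fam[OF k3(3)]; code_simp)
  ultimately obtain k where k: "dmap X (fam (?k3 @ [[0,1],[0,2]])) k" "agree (fam ?k3) k k3" "agree (fam [[0,1],[0,2]]) k ?D"
    using glue_fam[OF k3d dD, of "[[1],[2]]"] rX rY gX(5) gY(5) D(3,4)
    by (auto simp: cone_of_def sq_vertex_def)
  have kd: "dmap X (fam base_chains) k" using k(1) unfolding base_chains_def by simp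
  have k3a: "agree (fam ?k2) k k2" by (rule agree_trans[OF agree_sub[OF k(2)] k3(2)]; code_simp)
  have k2a: "agree (fam ?k1) k k1" by (rule agree_trans[OF agree_sub[OF k3a] k2(2)]; code_simp)
  have aH: "agree (fam ?k0) k ?H" by (rule agree_trans[OF agree_sub[OF k2a] k1(2)]; code_simp)
  have aE: "agree (fam [[3,7,9],[3,8,9]]) k ?E" by (rule agree_trans[OF agree_sub[OF k2a] k1(3)]; code_simp)
  have aX: "agree (fam [[1,5,9],[1,8,9]]) k (\<lambda>xs. gX (map ?rX xs))" by (rule agree_trans[OF agree_sub[OF k3a] k2(3)]; code_simp)
  have aY: "agree (fam [[2,6,9],[2,8,9]]) k (\<lambda>xs. gY (map ?rY xs))" by (rule agree_trans[OF agree_sub[OF k(2)] k3(3)]; code_simp)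

  have "k [8] = ?E [8]" by (rule agree_fam[OF aE]; code_simp)
  then have t8: "terminal X (k [8])" using Ez by (simp add: cone_of_def sq_vertex_def zero_object_def)
  have "sq_of ?E 3 7 8 9 = reindex Sq id E" by (rule sq_of_cone_of) (auto simp: in_Sq sq_label_def sq_vertex_def)
  then have "lim_cone X (fam [[7,9],[8,9]]) 3 ?E" using pullback_iff[of 3 7 8 9 X ?E] dE Ep reindex_id[OF Eh] by simp
  then have L3: "lim_cone X (fam [[7,9],[8,9]]) 3 k" by (rule lim_agree[OF _ aE]) code_simp
  have L4: "lim_cone X (fam [[5,9],[6,9]]) 4 k" by (rule lim_agree[OF G(1) aH]) code_simp
  have "lim_cone X (fam [[5,9],[8,9]]) 1 (\<lambda>xs. gX (map ?rX xs))"
    using lim_relabel[OF gX(1), where b = 1 and x = 5 and y = 8 and w = 9 and r = ?rX] gX(2) rX by simp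
  then have L1: "lim_cone X (fam [[5,9],[8,9]]) 1 k" by (rule lim_agree[OF _ aX]) code_simp
  have "lim_cone X (fam [[6,9],[8,9]]) 2 (\<lambda>xs. gY (map ?rY xs))"
    using lim_relabel[OF gY(1), where b = 2 and x = 6 and y = 8 and w = 9 and r = ?rY] gY(2) rY by simp
  then have L2: "lim_cone X (fam [[6,9],[8,9]]) 2 k" by (rule lim_agree[OF _ aY]) code_simp
  have "lim_cone X (fam [[1],[2]]) 0 ?D"
    using is_limit_at_imp_lim_cone[OF chain_enum_two D(2)] unfolding fun_upd_sq_vertex .
  then have L0: "lim_cone X (fam [[1],[2]]) 0 k" by (rule lim_agree[OF _ k(3)]) code_simp

  obtain m where m: "dmap X (fam full_chains) m" "agree (fam base_chains) m k"
    using extend_base_chains[OF X kd t8 L3 L4] by blast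
  have "m [8] = k [8]" by (rule agree_fam[OF m(2)]) (unfold base_chains_def, code_simp+)
  then have T: "terminal X (m [8])" using t8 by simp
  have S9: "rspecial X (m [9, 9])" by (rule rspecial_degenerate_edge[OF X m(1)]) (unfold full_chains_def, code_simp)
  have M1: "lim_cone X (fam [[5,9],[8,9]]) 1 m" by (rule lim_agree[OF L1 m(2)]) (unfold base_chains_def, code_simp)
  have M2: "lim_cone X (fam [[6,9],[8,9]]) 2 m" by (rule lim_agree[OF L2 m(2)]) (unfold base_chains_def, code_simp)
  have M3: "lim_cone X (fam [[7,9],[8,9]]) 3 m" by (rule lim_agree[OF L3 m(2)]) (unfold base_chains_def, code_simp)
  have M4: "lim_cone X (fam [[5,9],[6,9]]) 4 m" by (rule lim_agree[OF L4 m(2)]) (unfold base_chains_def, code_simp)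
  have M5: "lim_cone X (fam [[1],[2]]) 0 m" by (rule lim_agree[OF L0 m(2)]) (unfold base_chains_def, code_simp)
  have M0: "lim_cone X (fam [[4,9],[8,9]]) 0 m" by (rule limit_of_product[OF X m(1) T M1 M2 M4 M5])
  \<comment> \<open>All fiber squares share \<open>8\<close> and \<open>9\<close>, so the critical
    edge of the pasting is the degenerate edge at \<open>9\<close>.\<close>
  note pf = pullback_of_fibers[OF X m(1), where z = 8 and z' = 8 and w = 9 and w' = 9, OF _ _ _ _ _ _ _ _ _ _ _ _ _ _ S9 T T]
  have P1: "pullback_square X (sq_of m 0 1 4 5)"
    by (rule pf[OF _ _ _ _ _ _ _ _ _ _ _ _ _ _ M0 M1]) (unfold full_chains_def, code_simp+)
  have P2: "pullback_square X (sq_of m 0 2 4 6)"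
    by (rule pf[OF _ _ _ _ _ _ _ _ _ _ _ _ _ _ M0 M2]) (unfold full_chains_def, code_simp+)
  have P3: "pullback_square X (sq_of m 1 3 5 7)"
    by (rule pf[OF _ _ _ _ _ _ _ _ _ _ _ _ _ _ M1 M3]) (unfold full_chains_def, code_simp+)
  have P4: "pullback_square X (sq_of m 2 3 6 7)"
    by (rule pf[OF _ _ _ _ _ _ _ _ _ _ _ _ _ _ M2 M3]) (unfold full_chains_def, code_simp+)

  define W where "W = cube_of m"
  have mc: "dmap X (fam cube_chains) m" by (rule dmap_sub[OF m(1)]) (unfold full_chains_def, code_simp)
  have Wh: "W \<in> sset_hom (nerve Cube) X" unfolding W_def by (rule cube_of_hom[OF mc])
  have aHm: "agree (fam ?k0) m ?H"
    by (rule agree_trans[OF agree_sub[OF m(2)] aH]) (unfold base_chains_def, code_simp)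
  have aDm: "agree (fam [[0,1],[0,2]]) m ?D"
    by (rule agree_trans[OF agree_sub[OF m(2)] k(3)]) (unfold base_chains_def, code_simp)
  have bot: "bottom_face W = reindex Sq (\<lambda>v. (0, v)) c"
  proof -
    have "bottom_face W = sq_of m 4 5 6 7"
      unfolding bottom_face_def W_def by (subst face_cube_of) (auto simp: mono_on_def cube_label_def)
    also have "\<dots> = sq_of ?H 4 5 6 7" by (rule sq_of_cong[OF agree_sub[OF aHm]]) code_simp+
    also have "\<dots> = reindex Sq (\<lambda>v. (0, v)) c"
      by (rule sq_of_cone_of) (auto simp: in_Sq sq_label_def ganea_vertex_def)
    finally show ?thesis .
  qed
  have top: "top_face W = sq_of m 0 1 2 3"
    unfolding top_face_def W_def by (subst face_cube_of) (auto simp: mono_on_def cube_label_def)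
  have side: "reindex Sq (\<lambda>(a, b). (a, 0, b)) W = sq_of m 0 1 4 5" "reindex Sq (\<lambda>(a, b). (a, 1, b)) W = sq_of m 2 3 6 7"
    "reindex Sq (\<lambda>(a, b). (a, b, 0)) W = sq_of m 0 2 4 6" "reindex Sq (\<lambda>(a, b). (a, b, 1)) W = sq_of m 1 3 5 7"
    unfolding W_def by (subst face_cube_of; auto simp: mono_on_def cube_label_def)+
  have "upright_mather_cube X W"
    unfolding upright_mather_cube_def
  proof (intro conjI allI impI Wh)
    show "pushout_square X (bottom_face W)" unfolding bot by (rule cpo)
    fix i :: nat assume "i \<le> 1"
    then have "i = 0 \<or> i = 1" by auto
    then show "pullback_square X (reindex Sq (\<lambda>(a, b). (a, i, b)) W)" "pullback_square X (reindex Sq (\<lambda>(a, b). (a, b, i)) W)"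
      using side P1 P2 P3 P4 by auto
  qed
  moreover have rot: "rotate_cube 0 W = W"
    unfolding rotate_cube_def using reindex_id[OF Wh] by (simp add: id_def)
  ultimately have "pushout_square X (top_face (rotate_cube 0 W))"
    using ax Wh unfolding mather_cube_axiom_def by (metis zero_less_numeral)
  then have po: "is_colimit_at X Span (1,1) (sq_of m 0 1 2 3)" unfolding rot top pushout_square_def by blast
  have poD: "is_colimit_at X Span (1,1) D" using D(1) unfolding pushout_square_def by blast
  \<comment> \<open>The top face restricts on the span to the product span of \<open>D\<close>, so
    both squares are pushouts of the same diagram.\<close>
  have "sset_map (nerve Span) (sq_of m 0 1 2 3) n xs = sset_map (nerve Span) D n xs" for n xs
  proof (cases "xs \<in> simplices (nerve Span) n")
    case True
    then have xs: "sorted_wrt (\<le>) xs" "set xs \<subseteq> Span" "length xs = Suc n" by (auto simp: in_nerve)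
    then have xq: "xs \<in> simplices (nerve Sq) n" by (auto simp: in_nerve)
    let ?l = "map (sq_label 0 1 2 3) xs"
    have "\<not> ((0,1) \<in> set xs \<and> (1,0) \<in> set xs)" using comparable[OF xs(1), of "(0,1)" "(1,0)"] by auto
    then have "set xs \<subseteq> {(0,0),(0,1)} \<or> set xs \<subseteq> {(0,0),(1,0)}" using xs(2) by blast
    then have "set ?l \<in> fam [[0,1],[0,2]]" by (auto simp: fam_def sq_label_def image_subset_iff)
    moreover have "sorted ?l" by (rule sq_label_chain(1)[OF _ _ _ _ xq]) auto
    moreover have "?l \<noteq> []" using xs(3) by auto
    ultimately have "m ?l = ?D ?l" using aDm unfolding agree_def by blast
    also have "map (sq_vertex 0 1 2) ?l = xs"
      unfolding map_map by (rule map_idI) (use xs(2) in \<open>auto simp: sq_label_def sq_vertex_def\<close>)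
    then have "?D ?l = D n xs" using cone_of_eval[of ?l n D "sq_vertex 0 1 2"] xs(3) by simp
    finally show ?thesis using True xq by (simp add: sq_of_def)
  qed (simp add: sset_map_out)
  then have eq: "sset_map (nerve Span) (sq_of m 0 1 2 3) = sset_map (nerve Span) D" by blast
  have v11: "[(1,1)] \<in> simplices (nerve Sq) 0" by (simp add: in_nerve)
  have "sq_of m 0 1 2 3 0 [(1,1)] = m [3]" using v11 by (simp add: sq_of_def sq_label_def)
  also have "m [3] = k [3]" by (rule agree_fam[OF m(2)]) (unfold base_chains_def, code_simp+)
  also have "k [3] = ?E [3]" by (rule agree_fam[OF aE]; code_simp)
  also have "\<dots> = F_XY" using E(3) by (simp add: cone_of_def sq_vertex_def)
  finally have "sq_of m 0 1 2 3 0 [(1,1)] = F_XY" .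
  then show ?thesis using pushout_unique[OF ss po poD eq] D(5) by simp
qed

section \<open>Functors between diagram categories\<close>

lemma prod_simplices [simp]: "simplices (sset_prod X Y) n = simplices X n \<times> simplices Y n"
  by (simp add: sset_prod_def)

lemma prod_act [simp]: "act (sset_prod X Y) n \<alpha> (x, y) = (act X n \<alpha> x, act Y n \<alpha> y)"
  by (simp add: sset_prod_def)

lemma fun_simplices [simp]: "simplices (fun_sset K X) n = sset_hom (sset_prod (Delta n) K) X"
  by (simp add: fun_sset_def)

lemma fun_act:
  "length \<alpha> = Suc k \<Longrightarrow> act (fun_sset K X) n \<alpha> f = sset_map (sset_prod (Delta k) K) (\<lambda>m (\<beta>, x). f m (comp_op \<alpha> \<beta>, x))"
  by (simp add: fun_sset_def)

lemma fun_act_eval: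
  "length \<alpha> = Suc k \<Longrightarrow> \<beta> \<in> simplices (Delta k) m \<Longrightarrow> x \<in> simplices K m \<Longrightarrow>
   act (fun_sset K X) n \<alpha> f m (\<beta>, x) = f m (comp_op \<alpha> \<beta>, x)"
  by (simp add: fun_act)

lemma sset_map_eqI:
  assumes "\<And>m x. x \<in> simplices S m \<Longrightarrow> f m x = g m x" shows "sset_map S f = sset_map S g"
  using assms by (intro ext) (simp add: sset_map_def restrict_def)

lemma Delta_comp_op:
  assumes "\<gamma> \<in> simplices (Delta k) l" "length \<beta> = Suc k"
  shows "comp_op (comp_op \<alpha> \<beta>) \<gamma> = comp_op \<alpha> (comp_op \<beta> \<gamma>)"
  by (rule comp_op_comp_op) (use assms in \<open>auto simp: in_Delta\<close>)

lemma fun_act_act: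
  assumes "\<alpha> \<in> simplices (Delta n) m" "\<beta> \<in> simplices (Delta m) k"
  shows "act (fun_sset K X) m \<beta> (act (fun_sset K X) n \<alpha> f) = act (fun_sset K X) n (comp_op \<alpha> \<beta>) f"
proof -
  have l: "length \<alpha> = Suc m" "length \<beta> = Suc k" "length (comp_op \<alpha> \<beta>) = Suc k" using assms by (auto simp: in_Delta)
  show ?thesis
    unfolding fun_act[OF l(2)] fun_act[OF l(3)]
  proof (rule sset_map_eqI, clarify)
    fix i \<gamma> x assume "(\<gamma>, x) \<in> simplices (sset_prod (Delta k) K) i"
    then have g: "\<gamma> \<in> simplices (Delta k) i" "x \<in> simplices K i" by auto
    then show "act (fun_sset K X) n \<alpha> f i (comp_op \<beta> \<gamma>, x) = f i (comp_op (comp_op \<alpha> \<beta>) \<gamma>, x)"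
      using fun_act_eval[OF l(1) comp_op_Delta[OF assms(2) g(1)] g(2)] Delta_comp_op[OF g(1) l(2)] by metis
  qed
qed

lemma simplicial_setD:
  "simplicial_set K \<Longrightarrow> \<alpha> \<in> simplices (Delta n) m \<Longrightarrow> x \<in> simplices K n \<Longrightarrow> act K n \<alpha> x \<in> simplices K m"
  by (rule sset_act(1))

lemma fun_act_in:
  assumes K: "simplicial_set K" and f: "f \<in> simplices (fun_sset K X) n" and al: "\<alpha> \<in> simplices (Delta n) m"
  shows "act (fun_sset K X) n \<alpha> f \<in> simplices (fun_sset K X) m"
proof -
  have l: "length \<alpha> = Suc m" using al by (auto simp: in_Delta)
  have fh: "f \<in> sset_hom (sset_prod (Delta n) K) X" using f by simp
  show ?thesis
    unfolding fun_simplices fun_act[OF l]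
  proof (rule sset_mapI, clarify)
    fix k \<beta> x assume "(\<beta>, x) \<in> simplices (sset_prod (Delta m) K) k"
    then have b: "\<beta> \<in> simplices (Delta m) k" "x \<in> simplices K k" by auto
    show "f k (comp_op \<alpha> \<beta>, x) \<in> simplices X k"
      by (rule sset_homD(1)[OF fh]) (use comp_op_Delta[OF al b(1)] b in simp)
  next
    fix k i \<gamma> z assume g: "\<gamma> \<in> simplices (Delta k) i" and z: "z \<in> simplices (sset_prod (Delta m) K) k"
    obtain \<beta> x where zz: "z = (\<beta>, x)" "\<beta> \<in> simplices (Delta m) k" "x \<in> simplices K k" using z by auto
    have lb: "length \<beta> = Suc k" using zz by (auto simp: in_Delta)
    have p: "(comp_op \<alpha> \<beta>, x) \<in> simplices (sset_prod (Delta n) K) k" using comp_op_Delta[OF al zz(2)] zz by simp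
    have "f i (act (sset_prod (Delta n) K) k \<gamma> (comp_op \<alpha> \<beta>, x)) = act X k \<gamma> (f k (comp_op \<alpha> \<beta>, x))"
      by (rule sset_homD(3)[OF fh g p])
    then show "act (sset_prod (Delta m) K) k \<gamma> z \<in> simplices (sset_prod (Delta m) K) i \<and>
      (case act (sset_prod (Delta m) K) k \<gamma> z of (\<beta>, x) \<Rightarrow> f i (comp_op \<alpha> \<beta>, x)) =
      act X k \<gamma> (case z of (\<beta>, x) \<Rightarrow> f k (comp_op \<alpha> \<beta>, x))"
      using zz Delta_comp_op[OF g lb, of \<alpha>] comp_op_Delta[OF zz(2) g] simplicial_setD[OF K g zz(3)]
      by (simp del: map_map)
  qed
qed

lemma id_Delta: "id_op n \<in> simplices (Delta n) n"
  by (auto simp: in_Delta simp del: upt_Suc)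

lemma id_comp_op: "\<alpha> \<in> simplices (Delta n) m \<Longrightarrow> comp_op (id_op n) \<alpha> = \<alpha>"
  by (intro map_idI) (auto simp: in_Delta simp del: upt_Suc)

lemma nerve_comp_op: "\<alpha> \<in> simplices (Delta n) m \<Longrightarrow> x \<in> simplices (nerve A) n \<Longrightarrow> comp_op x \<alpha> \<in> simplices (nerve A) m"
  using simplicial_setD[OF simplicial_set_nerve, of \<alpha> n m x A] by simp

text \<open>Evaluation at the generic simplex \<open>id_op m\<close> uncurries a functor from
  \<open>Z\<close> to diagrams into a simplicial map on the product of \<open>Z\<close> and the
  nerve of \<open>P\<close>.\<close>

lemma eval_functor:
  assumes G: "G \<in> sset_hom Z (Diag P C)" and z: "\<zeta> \<in> simplices Z m" and x: "x \<in> simplices (nerve P) m"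
  shows "G m \<zeta> m (id_op m, x) \<in> simplices C m"
    and "\<gamma> \<in> simplices (Delta m) k \<Longrightarrow>
      G k (act Z m \<gamma> \<zeta>) k (id_op k, comp_op x \<gamma>) = act C m \<gamma> (G m \<zeta> m (id_op m, x))"
    and "\<gamma> \<in> simplices (Delta m) k \<Longrightarrow> y \<in> simplices (nerve P) k \<Longrightarrow>
      G k (act Z m \<gamma> \<zeta>) k (id_op k, y) = G m \<zeta> k (\<gamma>, y)"
proof -
  have h: "G m \<zeta> \<in> sset_hom (sset_prod (Delta m) (nerve P)) C" using sset_homD(1)[OF G z] by simp
  have p: "(id_op m, x) \<in> simplices (sset_prod (Delta m) (nerve P)) m" using id_Delta x by simp
  show "G m \<zeta> m (id_op m, x) \<in> simplices C m" by (rule sset_homD(1)[OF h p])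
  assume g: "\<gamma> \<in> simplices (Delta m) k"
  then have l: "length \<gamma> = Suc k" by (simp add: in_Delta)
  show 1: "G k (act Z m \<gamma> \<zeta>) k (id_op k, y) = G m \<zeta> k (\<gamma>, y)" if y: "y \<in> simplices (nerve P) k" for y
    using sset_homD(3)[OF G g z] fun_act_eval[OF l id_Delta y] comp_op_id[OF l] by metis
  show "G k (act Z m \<gamma> \<zeta>) k (id_op k, comp_op x \<gamma>) = act C m \<gamma> (G m \<zeta> m (id_op m, x))"
    using 1[OF nerve_comp_op[OF g x]] sset_homD(3)[OF h g p] id_comp_op[OF g] by simp
qed

lemma map_fst_snd_nerve:
  assumes "z \<in> simplices (nerve (P \<times> Q)) m"
  shows "map fst z \<in> simplices (nerve P) m" "map snd z \<in> simplices (nerve Q) m"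
  by (rule nerve_map[OF assms]; auto simp: mono_on_def less_eq_prod_def)+

lemma trans_to_functor_in:
  fixes Q :: "'q::order set"
  assumes g: "g \<in> sset_hom (sset_prod (Delta 1) (Diag A C)) (Diag Q C)" and p: "p \<in> simplices (Diag A C) n"
  shows "trans_to_functor (Diag A C) Q g n p \<in> simplices (Diag ({..1} \<times> Q) C) n"
  unfolding trans_to_functor_def fun_simplices
proof (rule sset_mapI, clarify)
  fix m \<alpha> and z :: "(nat \<times> 'q) list"
  assume "(\<alpha>, z) \<in> simplices (sset_prod (Delta n) (nerve ({..1} \<times> Q))) m"
  then have a: "\<alpha> \<in> simplices (Delta n) m" "z \<in> simplices (nerve ({..1} \<times> Q)) m" by auto
  note f = map_fst_snd_nerve[OF a(2)]
  have "(map fst z, act (Diag A C) n \<alpha> p) \<in> simplices (sset_prod (Delta 1) (Diag A C)) m"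
    using f fun_act_in[OF simplicial_set_nerve p a(1)] by simp
  from eval_functor(1)[OF g this f(2)]
  show "g m (map fst z, act (Diag A C) n \<alpha> p) m (id_op m, map snd z) \<in> simplices C m" .
next
  fix m k \<gamma> and w :: "nat list \<times> (nat \<times> 'q) list"
  assume ga: "\<gamma> \<in> simplices (Delta m) k" and w: "w \<in> simplices (sset_prod (Delta n) (nerve ({..1} \<times> Q))) m"
  obtain \<alpha> and z :: "(nat \<times> 'q) list" where a: "w = (\<alpha>, z)" "\<alpha> \<in> simplices (Delta n) m" "z \<in> simplices (nerve ({..1} \<times> Q)) m" using w by auto
  note f = map_fst_snd_nerve[OF a(3)]
  have q: "(map fst z, act (Diag A C) n \<alpha> p) \<in> simplices (sset_prod (Delta 1) (Diag A C)) m"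
    using f fun_act_in[OF simplicial_set_nerve p a(2)] by simp
  have s: "set \<gamma> \<subseteq> {..<length z}" using ga a(3) by (auto simp: in_Delta in_nerve)
  have "g k (comp_op (map fst z) \<gamma>, act (Diag A C) n (comp_op \<alpha> \<gamma>) p) k (id_op k, comp_op (map snd z) \<gamma>)
    = act C m \<gamma> (g m (map fst z, act (Diag A C) n \<alpha> p) m (id_op m, map snd z))"
    using eval_functor(2)[OF g q f(2) ga] fun_act_act[OF a(2) ga, of "nerve A" C p] by (simp del: map_map)
  then show "act (sset_prod (Delta n) (nerve ({..1} \<times> Q))) m \<gamma> w \<in> simplices (sset_prod (Delta n) (nerve ({..1} \<times> Q))) k \<and>
    (case act (sset_prod (Delta n) (nerve ({..1} \<times> Q))) m \<gamma> w of
      (\<alpha>, z) \<Rightarrow> g k (map fst z, act (Diag A C) n \<alpha> p) k (id_op k, map snd z)) =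
    act C m \<gamma> (case w of (\<alpha>, z) \<Rightarrow> g m (map fst z, act (Diag A C) n \<alpha> p) m (id_op m, map snd z))"
    using a comp_op_Delta[OF a(2) ga] nerve_comp_op[OF ga a(3)] map_comp_op[OF s, of fst] map_comp_op[OF s, of snd]
    by (simp del: map_map)
qed

lemma trans_to_functor_act:
  fixes Q :: "'q::order set"
  assumes al: "\<alpha> \<in> simplices (Delta n) m"
  shows "trans_to_functor (Diag A C) Q g m (act (Diag A C) n \<alpha> p) = act (Diag ({..1} \<times> Q) C) n \<alpha> (trans_to_functor (Diag A C) Q g n p)"
proof -
  have l: "length \<alpha> = Suc m" using al by (simp add: in_Delta)
  show ?thesis
    unfolding fun_act[OF l, of "nerve ({..1} \<times> Q)"] trans_to_functor_def[of _ _ _ m]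
  proof (rule sset_map_eqI, clarify)
    fix k \<beta> and z :: "(nat \<times> 'q) list"
    assume "(\<beta>, z) \<in> simplices (sset_prod (Delta m) (nerve ({..1} \<times> Q))) k"
    then have b: "\<beta> \<in> simplices (Delta m) k" "z \<in> simplices (nerve ({..1} \<times> Q)) k" by auto
    show "g k (map fst z, act (Diag A C) m \<beta> (act (Diag A C) n \<alpha> p)) k (id_op k, map snd z) =
      trans_to_functor (Diag A C) Q g n p k (comp_op \<alpha> \<beta>, z)"
      using fun_act_act[OF al b(1), of "nerve A" C p] comp_op_Delta[OF al b(1)] b(2) by (simp add: trans_to_functor_def)
  qed
qed

section \<open>Currying of diagrams\<close>

lemma zip_nerve:
  assumes "x \<in> simplices (nerve P) k" "y \<in> simplices (nerve Q) k"
  shows "zip x y \<in> simplices (nerve (P \<times> Q)) k"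
proof -
  have "length x = Suc k" "length y = Suc k" "sorted_wrt (\<le>) x" "sorted_wrt (\<le>) y" "set x \<subseteq> P" "set y \<subseteq> Q"
    using assms by (auto simp: in_nerve)
  then show ?thesis
    unfolding in_nerve sorted_wrt_iff_nth_less by (auto simp: less_eq_prod_def dest: set_zip_leftD set_zip_rightD)
qed

lemma zip_comp_op: "set \<gamma> \<subseteq> {..<length x} \<Longrightarrow> length x = length y \<Longrightarrow> zip (comp_op x \<gamma>) (comp_op y \<gamma>) = comp_op (zip x y) \<gamma>"
  by (auto simp: zip_map_map zip_same_conv_map subset_iff)

lemma curry_diag_eval:
  assumes "\<alpha> \<in> simplices (Delta n) m" "y \<in> simplices (nerve Q) m" "\<beta> \<in> simplices (Delta m) k" "x \<in> simplices (nerve P) k"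
  shows "curry_diag P Q n c m (\<alpha>, y) k (\<beta>, x) = c k (comp_op \<alpha> \<beta>, zip x (comp_op y \<beta>))"
  using assms by (simp add: curry_diag_def)

lemma curry_diag_in:
  assumes c: "c \<in> simplices (Diag (P \<times> Q) C) n"
  shows "curry_diag P Q n c \<in> sset_hom (sset_prod (Delta n) (nerve Q)) (Diag P C)"
proof -
  have ch: "c \<in> sset_hom (sset_prod (Delta n) (nerve (P \<times> Q))) C" using c by simp
  show ?thesis
    unfolding curry_diag_def
  proof (rule sset_mapI, clarify)
    fix m \<alpha> y assume "(\<alpha>, y) \<in> simplices (sset_prod (Delta n) (nerve Q)) m"
    then have a: "\<alpha> \<in> simplices (Delta n) m" "y \<in> simplices (nerve Q) m" by auto
    show "sset_map (sset_prod (Delta m) (nerve P)) (\<lambda>k (\<beta>, x). c k (comp_op \<alpha> \<beta>, zip x (comp_op y \<beta>))) \<in> simplices (Diag P C) m"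
      unfolding fun_simplices
    proof (rule sset_mapI, clarify)
      fix k \<beta> x assume "(\<beta>, x) \<in> simplices (sset_prod (Delta m) (nerve P)) k"
      then have b: "\<beta> \<in> simplices (Delta m) k" "x \<in> simplices (nerve P) k" by auto
      show "c k (comp_op \<alpha> \<beta>, zip x (comp_op y \<beta>)) \<in> simplices C k"
        by (rule sset_homD(1)[OF ch]) (use comp_op_Delta[OF a(1) b(1)] zip_nerve[OF b(2) nerve_comp_op[OF b(1) a(2)]] in simp)
    next
      fix k l \<gamma> w assume g: "\<gamma> \<in> simplices (Delta k) l" and w: "w \<in> simplices (sset_prod (Delta m) (nerve P)) k"
      obtain \<beta> x where b: "w = (\<beta>, x)" "\<beta> \<in> simplices (Delta m) k" "x \<in> simplices (nerve P) k" using w by auto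
      have lb: "length \<beta> = Suc k" "length x = Suc k" using b by (auto simp: in_Delta in_nerve)
      have "(comp_op \<alpha> \<beta>, zip x (comp_op y \<beta>)) \<in> simplices (sset_prod (Delta n) (nerve (P \<times> Q))) k"
        using comp_op_Delta[OF a(1) b(2)] zip_nerve[OF b(3) nerve_comp_op[OF b(2) a(2)]] by simp
      from sset_homD(3)[OF ch g this]
      have "c l (comp_op (comp_op \<alpha> \<beta>) \<gamma>, comp_op (zip x (comp_op y \<beta>)) \<gamma>) = act C k \<gamma> (c k (comp_op \<alpha> \<beta>, zip x (comp_op y \<beta>)))"
        by (simp del: map_map)
      moreover have "comp_op (zip x (comp_op y \<beta>)) \<gamma> = zip (comp_op x \<gamma>) (comp_op (comp_op y \<beta>) \<gamma>)"
        by (rule zip_comp_op[symmetric]) (use g lb in \<open>auto simp: in_Delta\<close>)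
      ultimately show "act (sset_prod (Delta m) (nerve P)) k \<gamma> w \<in> simplices (sset_prod (Delta m) (nerve P)) l \<and>
        (case act (sset_prod (Delta m) (nerve P)) k \<gamma> w of (\<beta>, x) \<Rightarrow> c l (comp_op \<alpha> \<beta>, zip x (comp_op y \<beta>))) =
        act C k \<gamma> (case w of (\<beta>, x) \<Rightarrow> c k (comp_op \<alpha> \<beta>, zip x (comp_op y \<beta>)))"
        using b comp_op_Delta[OF b(2) g] nerve_comp_op[OF g b(3)] Delta_comp_op[OF g lb(1), of \<alpha>] Delta_comp_op[OF g lb(1), of y]
        by (simp del: map_map)
    qed
  next
    fix m k \<delta> w assume d: "\<delta> \<in> simplices (Delta m) k" and w: "w \<in> simplices (sset_prod (Delta n) (nerve Q)) m"
    obtain \<alpha> y where a: "w = (\<alpha>, y)" "\<alpha> \<in> simplices (Delta n) m" "y \<in> simplices (nerve Q) m" using w by auto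
    have ld: "length \<delta> = Suc k" using d by (simp add: in_Delta)
    have "sset_map (sset_prod (Delta k) (nerve P)) (\<lambda>i (\<beta>, x). c i (comp_op (comp_op \<alpha> \<delta>) \<beta>, zip x (comp_op (comp_op y \<delta>) \<beta>)))
      = act (Diag P C) m \<delta> (sset_map (sset_prod (Delta m) (nerve P)) (\<lambda>i (\<beta>, x). c i (comp_op \<alpha> \<beta>, zip x (comp_op y \<beta>))))"
      unfolding fun_act[OF ld]
    proof (rule sset_map_eqI, clarify)
      fix i \<beta> x assume "(\<beta>, x) \<in> simplices (sset_prod (Delta k) (nerve P)) i"
      then have b: "\<beta> \<in> simplices (Delta k) i" "x \<in> simplices (nerve P) i" by auto
      show "c i (comp_op (comp_op \<alpha> \<delta>) \<beta>, zip x (comp_op (comp_op y \<delta>) \<beta>)) =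
        sset_map (sset_prod (Delta m) (nerve P)) (\<lambda>i (\<beta>, x). c i (comp_op \<alpha> \<beta>, zip x (comp_op y \<beta>))) i (comp_op \<delta> \<beta>, x)"
        using b comp_op_Delta[OF d b(1)] unfolding Delta_comp_op[OF b(1) ld] by (simp del: map_map)
    qed
    then show "act (sset_prod (Delta n) (nerve Q)) m \<delta> w \<in> simplices (sset_prod (Delta n) (nerve Q)) k \<and>
      (case act (sset_prod (Delta n) (nerve Q)) m \<delta> w of (\<alpha>, y) \<Rightarrow>
         sset_map (sset_prod (Delta k) (nerve P)) (\<lambda>i (\<beta>, x). c i (comp_op \<alpha> \<beta>, zip x (comp_op y \<beta>)))) =
      act (Diag P C) m \<delta> (case w of (\<alpha>, y) \<Rightarrow>
         sset_map (sset_prod (Delta m) (nerve P)) (\<lambda>i (\<beta>, x). c i (comp_op \<alpha> \<beta>, zip x (comp_op y \<beta>))))"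
      using a comp_op_Delta[OF a(2) d] nerve_comp_op[OF d a(3)] by (simp del: map_map)
  qed
qed

lemma curry_diag_act:
  assumes al: "\<alpha> \<in> simplices (Delta n) m" and b: "\<beta> \<in> simplices (Delta m) k" "y \<in> simplices (nerve Q) k"
  shows "curry_diag P Q m (act (Diag (P \<times> Q) C) n \<alpha> c) k (\<beta>, y) = curry_diag P Q n c k (comp_op \<alpha> \<beta>, y)"
proof -
  have l: "length \<alpha> = Suc m" "length \<beta> = Suc k" using al b by (auto simp: in_Delta)
  have "sset_map (sset_prod (Delta k) (nerve P)) (\<lambda>i (\<gamma>, x). act (Diag (P \<times> Q) C) n \<alpha> c i (comp_op \<beta> \<gamma>, zip x (comp_op y \<gamma>)))
    = sset_map (sset_prod (Delta k) (nerve P)) (\<lambda>i (\<gamma>, x). c i (comp_op (comp_op \<alpha> \<beta>) \<gamma>, zip x (comp_op y \<gamma>)))"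
  proof (rule sset_map_eqI, clarify)
    fix i \<gamma> x assume "(\<gamma>, x) \<in> simplices (sset_prod (Delta k) (nerve P)) i"
    then have g: "\<gamma> \<in> simplices (Delta k) i" "x \<in> simplices (nerve P) i" by auto
    show "act (Diag (P \<times> Q) C) n \<alpha> c i (comp_op \<beta> \<gamma>, zip x (comp_op y \<gamma>)) = c i (comp_op (comp_op \<alpha> \<beta>) \<gamma>, zip x (comp_op y \<gamma>))"
      using fun_act_eval[OF l(1) comp_op_Delta[OF b(1) g(1)] zip_nerve[OF g(2) nerve_comp_op[OF g(1) b(2)]]]
      unfolding Delta_comp_op[OF g(1) l(2)] .
  qed
  then show ?thesis using b comp_op_Delta[OF al b(1)] by (simp add: curry_diag_def del: map_map)
qed

lemma comp_in:
  assumes f: "f \<in> sset_hom S T" and g: "g \<in> sset_hom T U"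
    and S: "\<And>n m \<alpha> x. \<alpha> \<in> simplices (Delta n) m \<Longrightarrow> x \<in> simplices S n \<Longrightarrow> act S n \<alpha> x \<in> simplices S m"
  shows "sset_map S (\<lambda>m x. g m (f m x)) \<in> sset_hom S U"
proof (rule sset_mapI)
  show "x \<in> simplices S n \<Longrightarrow> g n (f n x) \<in> simplices U n" for n x
    using sset_homD(1)[OF g] sset_homD(1)[OF f] by blast
  show "\<alpha> \<in> simplices (Delta n) m \<Longrightarrow> x \<in> simplices S n \<Longrightarrow>
      act S n \<alpha> x \<in> simplices S m \<and> g m (f m (act S n \<alpha> x)) = act U n \<alpha> (g n (f n x))" for n m \<alpha> x
    using S sset_homD(3)[OF f] sset_homD(3)[OF g] sset_homD(1)[OF f] by metis
qed

lemma prod_act_in: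
  assumes "simplicial_set X" "simplicial_set Y" "\<alpha> \<in> simplices (Delta n) m" "z \<in> simplices (sset_prod X Y) n"
  shows "act (sset_prod X Y) n \<alpha> z \<in> simplices (sset_prod X Y) m"
  using assms(4) simplicial_setD[OF assms(1,3)] simplicial_setD[OF assms(2,3)] by (cases z) auto

lemma uncurry_diag_in:
  fixes P :: "'p::order set" and Q :: "'q::order set"
  assumes G: "G \<in> sset_hom (sset_prod (Delta n) (nerve Q)) (Diag P C)"
  shows "uncurry_diag P Q n G \<in> simplices (Diag (P \<times> Q) C) n"
  unfolding uncurry_diag_def fun_simplices
proof (rule sset_mapI, clarify)
  fix m \<alpha> and z :: "('p \<times> 'q) list"
  assume "(\<alpha>, z) \<in> simplices (sset_prod (Delta n) (nerve (P \<times> Q))) m"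
  then have a: "\<alpha> \<in> simplices (Delta n) m" "z \<in> simplices (nerve (P \<times> Q)) m" by auto
  note f = map_fst_snd_nerve[OF a(2)]
  have "(\<alpha>, map snd z) \<in> simplices (sset_prod (Delta n) (nerve Q)) m" using f a by simp
  from eval_functor(1)[OF G this f(1)]
  show "G m (\<alpha>, map snd z) m (id_op m, map fst z) \<in> simplices C m" .
next
  fix m k \<gamma> and w :: "nat list \<times> ('p \<times> 'q) list"
  assume ga: "\<gamma> \<in> simplices (Delta m) k" and w: "w \<in> simplices (sset_prod (Delta n) (nerve (P \<times> Q))) m"
  obtain \<alpha> and z :: "('p \<times> 'q) list" where a: "w = (\<alpha>, z)" "\<alpha> \<in> simplices (Delta n) m" "z \<in> simplices (nerve (P \<times> Q)) m" using w by auto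
  note f = map_fst_snd_nerve[OF a(3)]
  have q: "(\<alpha>, map snd z) \<in> simplices (sset_prod (Delta n) (nerve Q)) m" using f a by simp
  have s: "set \<gamma> \<subseteq> {..<length z}" using ga a(3) by (auto simp: in_Delta in_nerve)
  have "G k (comp_op \<alpha> \<gamma>, comp_op (map snd z) \<gamma>) k (id_op k, comp_op (map fst z) \<gamma>)
    = act C m \<gamma> (G m (\<alpha>, map snd z) m (id_op m, map fst z))"
    using eval_functor(2)[OF G q f(1) ga] by (simp del: map_map)
  then show "act (sset_prod (Delta n) (nerve (P \<times> Q))) m \<gamma> w \<in> simplices (sset_prod (Delta n) (nerve (P \<times> Q))) k \<and>
    (case act (sset_prod (Delta n) (nerve (P \<times> Q))) m \<gamma> w of
      (\<alpha>, z) \<Rightarrow> G k (\<alpha>, map snd z) k (id_op k, map fst z)) =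
    act C m \<gamma> (case w of (\<alpha>, z) \<Rightarrow> G m (\<alpha>, map snd z) m (id_op m, map fst z))"
    using a comp_op_Delta[OF a(2) ga] nerve_comp_op[OF ga a(3)] map_comp_op[OF s, of fst] map_comp_op[OF s, of snd]
    by (simp del: map_map)
qed

lemma pull_in:
  assumes f: "f \<in> simplices (Diag B C) n" and u: "\<And>v. v \<in> A \<Longrightarrow> u v \<in> B" "mono_on A u"
  shows "pull A u n f \<in> simplices (Diag A C) n"
proof -
  have fh: "f \<in> sset_hom (sset_prod (Delta n) (nerve B)) C" using f by simp
  show ?thesis
    unfolding pull_def fun_simplices
  proof (rule sset_mapI, clarify)
    fix m \<alpha> x assume "(\<alpha>, x) \<in> simplices (sset_prod (Delta n) (nerve A)) m"
    then show "f m (\<alpha>, map u x) \<in> simplices C m"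
      using sset_homD(1)[OF fh, of "(\<alpha>, map u x)"] nerve_map[OF _ u] by simp
  next
    fix m k \<gamma> w assume ga: "\<gamma> \<in> simplices (Delta m) k" and w: "w \<in> simplices (sset_prod (Delta n) (nerve A)) m"
    obtain \<alpha> x where a: "w = (\<alpha>, x)" "\<alpha> \<in> simplices (Delta n) m" "x \<in> simplices (nerve A) m" using w by auto
    have "(\<alpha>, map u x) \<in> simplices (sset_prod (Delta n) (nerve B)) m" using a nerve_map[OF a(3) u] by simp
    from sset_homD(3)[OF fh ga this]
    have "f k (comp_op \<alpha> \<gamma>, comp_op (map u x) \<gamma>) = act C m \<gamma> (f m (\<alpha>, map u x))" by (simp del: map_map)
    moreover have "map u (comp_op x \<gamma>) = comp_op (map u x) \<gamma>"
      by (rule map_comp_op) (use ga a(3) in \<open>auto simp: in_Delta in_nerve\<close>)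
    ultimately show "act (sset_prod (Delta n) (nerve A)) m \<gamma> w \<in> simplices (sset_prod (Delta n) (nerve A)) k \<and>
      (case act (sset_prod (Delta n) (nerve A)) m \<gamma> w of (\<alpha>, x) \<Rightarrow> f k (\<alpha>, map u x)) =
      act C m \<gamma> (case w of (\<alpha>, x) \<Rightarrow> f m (\<alpha>, map u x))"
      using a comp_op_Delta[OF a(2) ga] nerve_comp_op[OF ga a(3)] by (simp del: map_map)
  qed
qed

text \<open>In \<open>Sq \<times> Sq\<close> the first factor runs through a fiber square, whose
  edge from \<open>(0,0)\<close> to \<open>(0,1)\<close> is the fiber inclusion; the cube consists
  of these edges.\<close>

abbreviation edge_vertex :: "nat \<times> 'v \<Rightarrow> (nat \<times> nat) \<times> 'v" where
  "edge_vertex \<equiv> (\<lambda>(a, v). ((0, a), v))"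

lemma edge_vertex_mono: "mono_on A edge_vertex"
  by (auto simp: mono_on_def less_eq_prod_def)

lemma replace_in:
  assumes \<Phi>: "\<Phi> \<in> sset_hom (Diag {..1::nat} C) (Diag Sq C)" and c: "c \<in> simplices (Diag ({..1} \<times> Sq) C) n"
  shows "sset_map (sset_prod (Delta n) (nerve Sq)) (\<lambda>m z. \<Phi> m (curry_diag {..1} Sq n c m z))
      \<in> sset_hom (sset_prod (Delta n) (nerve Sq)) (Diag Sq C)"
    and "replace_by_fiber_inclusion \<Phi> n c \<in> simplices (Diag Cube C) n"
proof -
  show 1: "sset_map (sset_prod (Delta n) (nerve Sq)) (\<lambda>m z. \<Phi> m (curry_diag {..1} Sq n c m z))
      \<in> sset_hom (sset_prod (Delta n) (nerve Sq)) (Diag Sq C)"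
    by (rule comp_in[OF curry_diag_in[OF c] \<Phi> prod_act_in[OF simplicial_set_nerve simplicial_set_nerve]])
  show "replace_by_fiber_inclusion \<Phi> n c \<in> simplices (Diag Cube C) n"
    unfolding replace_by_fiber_inclusion_def
    by (rule pull_in[OF uncurry_diag_in[OF 1] _ edge_vertex_mono]) auto
qed

lemma replace_eval:
  assumes "\<beta> \<in> simplices (Delta n) m" "z \<in> simplices (nerve Cube) m"
  shows "replace_by_fiber_inclusion \<Phi> n c m (\<beta>, z) =
    \<Phi> m (curry_diag {..1} Sq n c m (\<beta>, map snd z)) m (id_op m, map (\<lambda>(a, v). (0, a)) z)"
proof -
  have z: "map edge_vertex z \<in> simplices (nerve (Sq \<times> Sq)) m"
    by (rule nerve_map[OF assms(2) _ edge_vertex_mono]) auto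
  have "map snd z \<in> simplices (nerve Sq) m" by (rule map_fst_snd_nerve(2)[OF assms(2)])
  moreover have "map snd (map edge_vertex z) = map snd z" "map fst (map edge_vertex z) = map (\<lambda>(a, v). (0, a)) z" by auto
  ultimately show ?thesis
    using assms z unfolding replace_by_fiber_inclusion_def pull_def uncurry_diag_def by (simp del: map_map)
qed

lemma replace_act:
  assumes al: "\<alpha> \<in> simplices (Delta n) m"
  shows "replace_by_fiber_inclusion \<Phi> m (act (Diag ({..1} \<times> Sq) C) n \<alpha> c) =
    act (Diag Cube C) n \<alpha> (replace_by_fiber_inclusion \<Phi> n c)"
proof -
  have l: "length \<alpha> = Suc m" using al by (simp add: in_Delta)
  have e: "replace_by_fiber_inclusion \<Phi> m d = sset_map (sset_prod (Delta m) (nerve Cube)) (replace_by_fiber_inclusion \<Phi> m d)" for d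
    unfolding replace_by_fiber_inclusion_def pull_def by (rule sset_map_eqI) simp
  show ?thesis
    unfolding fun_act[OF l, of "nerve Cube" C n "replace_by_fiber_inclusion \<Phi> n c"]
  proof (subst e, rule sset_map_eqI)
    fix k and w :: "nat list \<times> (nat \<times> nat \<times> nat) list"
    assume "w \<in> simplices (sset_prod (Delta m) (nerve Cube)) k"
    then obtain \<beta> z where b: "w = (\<beta>, z)" "\<beta> \<in> simplices (Delta m) k" "z \<in> simplices (nerve Cube) k" by auto
    have "replace_by_fiber_inclusion \<Phi> m (act (Diag ({..1} \<times> Sq) C) n \<alpha> c) k (\<beta>, z) =
      replace_by_fiber_inclusion \<Phi> n c k (comp_op \<alpha> \<beta>, z)"
      unfolding replace_eval[OF b(2,3)] replace_eval[OF comp_op_Delta[OF al b(2)] b(3)]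
        curry_diag_act[OF al b(2) map_fst_snd_nerve(2)[OF b(3)]] by (rule refl)
    then show "replace_by_fiber_inclusion \<Phi> m (act (Diag ({..1} \<times> Sq) C) n \<alpha> c) k w =
      (case w of (\<beta>, x) \<Rightarrow> replace_by_fiber_inclusion \<Phi> n c k (comp_op \<alpha> \<beta>, x))"
      unfolding b(1) by simp
  qed
qed

lemma nerve_const: "v \<in> A \<Longrightarrow> replicate (Suc m) v \<in> simplices (nerve A) m"
  by (auto simp: in_nerve sorted_wrt_iff_nth_less simp del: replicate_Suc)

lemma comp_op_replicate: "\<beta> \<in> simplices (Delta m) k \<Longrightarrow> comp_op (replicate (Suc m) v) \<beta> = replicate (Suc k) v"
  by (intro nth_equalityI) (auto simp: in_Delta nth_replicate all_set_conv_all_nth subset_iff less_Suc_eq_le simp del: replicate_Suc)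

text \<open>Compares the two ways of evaluating a vertex of the diagram category on an
  \<open>m\<close>-simplex: at a constant operator, and at the generic simplex after a
  degeneracy.\<close>

lemma underlying_act:
  assumes f: "f \<in> simplices (Diag A C) 0" and x: "x \<in> simplices (nerve A) m"
  shows "act (Diag A C) 0 (replicate (Suc m) 0) f m (id_op m, x) = underlying (nerve A) f m x"
proof -
  have l: "length (replicate (Suc m) (0::nat)) = Suc m" by simp
  show ?thesis
    unfolding fun_act_eval[OF l id_Delta x] comp_op_replicate[OF id_Delta] underlying_def using x by simp
qed

theorem Xi_rel_mather:
  assumes X: "quasicategory C" and Xi: "is_Xi_rel C \<Xi>"
  shows "\<Xi> \<in> sset_hom (Diag Cosp C) (full_sub (Diag Cube C) {D. mather_cube C (underlying (nerve Cube) D)})"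
proof -
  let ?S = "Diag Cosp C"
  obtain P Q \<kappa> g \<Phi> where rg: "relative_ganea C P Q \<kappa>" and gg: "Gan_rel_nat C P Q \<kappa> g" and ff: "fiber_functor C \<Phi>"
    and Xi_eq: "\<Xi> = sset_map ?S (\<lambda>n p. replace_by_fiber_inclusion \<Phi> n (trans_to_functor ?S Sq g n p))"
    using Xi unfolding is_Xi_rel_def by blast
  have ss: "simplicial_set C" using X unfolding quasicategory_def by blast
  have gh: "g \<in> sset_hom (sset_prod (Delta 1) ?S) (Diag Sq C)" using gg unfolding Gan_rel_nat_def by simp
  have Ph: "P \<in> sset_hom ?S (Diag Sq C)" and Qh: "Q \<in> sset_hom (Diag Span C) (Diag Sq C)"
    using rg unfolding relative_ganea_def pullback_functor_def pushout_functor_def by auto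
  have Phi: "\<Phi> \<in> sset_hom (Diag {..1::nat} C) (Diag Sq C)" using ff unfolding fiber_functor_def by blast
  have Phi_pull: "pull {..1} (\<lambda>i. (i, 1)) n (\<Phi> n f) = f" if "f \<in> simplices (Diag {..1} C) n" for n f
    using ff that unfolding fiber_functor_def by blast
  have Phi_fib: "fiber_square C (underlying (nerve Sq) (\<Phi> 0 f))" if "f \<in> simplices (Diag {..1} C) 0" for f
    using ff that unfolding fiber_functor_def by blast
  have Tin: "trans_to_functor ?S Sq g n p \<in> simplices (Diag ({..1} \<times> Sq) C) n" if "p \<in> simplices ?S n" for n p
    by (rule trans_to_functor_in[OF gh that])
  have act_S: "act ?S n \<alpha> p \<in> simplices ?S m" if "\<alpha> \<in> simplices (Delta n) m" "p \<in> simplices ?S n" for n m \<alpha> p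
    by (rule fun_act_in[OF simplicial_set_nerve that(2,1)])
  have Xin: "\<Xi> n p \<in> simplices (Diag Cube C) n" if "p \<in> simplices ?S n" for n p
    using replace_in(2)[OF Phi Tin[OF that]] that unfolding Xi_eq by simp
  have Xact: "\<Xi> m (act ?S n \<alpha> p) = act (Diag Cube C) n \<alpha> (\<Xi> n p)"
    if "\<alpha> \<in> simplices (Delta n) m" "p \<in> simplices ?S n" for n m \<alpha> p
    using act_S[OF that] that(2) trans_to_functor_act[OF that(1), of Cosp C Sq g p] replace_act[OF that(1), of \<Phi> C]
    unfolding Xi_eq by simp
  have Xm: "mather_cube C (underlying (nerve Cube) (\<Xi> 0 p))" if p: "p \<in> simplices ?S 0" for p
  proof -
    define c where "c = trans_to_functor ?S Sq g 0 p"
    have c: "c \<in> simplices (Diag ({..1} \<times> Sq) C) 0" unfolding c_def by (rule Tin[OF p])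
    let ?cu = "curry_diag {..1::nat} Sq 0 c"
    \<comment> \<open>The unique \<open>m\<close>-simplex of the point; evaluations on
      \<open>m\<close>-simplices take place at the corresponding degeneracy of
      \<open>p\<close>.\<close>
    define z0 where "z0 m = replicate (Suc m) (0::nat)" for m
    have z0: "z0 m \<in> simplices (Delta 0) m" "length (z0 m) = Suc m" for m
      using nerve_const[of 0 "{..0::nat}" m] by (simp_all add: z0_def del: replicate_Suc)
    have z0c: "comp_op (z0 m) \<beta> = z0 k" if "\<beta> \<in> simplices (Delta m) k" for m k \<beta>
      unfolding z0_def by (rule comp_op_replicate[OF that])
    define G where "G = sset_map (sset_prod (Delta 0) (nerve Sq)) (\<lambda>m z. \<Phi> m (?cu m z))"
    have G: "G \<in> sset_hom (sset_prod (Delta 0) (nerve Sq)) (Diag Sq C)" unfolding G_def by (rule replace_in(1)[OF Phi c])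
    \<comment> \<open>The whole diagram on \<open>Sq \<times> Sq\<close>, with one fiber square for
      each vertex of the square of edges \<open>Z -> B\<close>. The cube keeps only the fiber
      inclusions, but pasting also requires the zero objects and \<open>B\<close>.\<close>
    define U where "U = sset_map (nerve (Sq \<times> Sq)) (\<lambda>m w. G m (z0 m, map snd w) m (id_op m, map fst w))"
    have Uh: "U \<in> sset_hom (nerve (Sq \<times> Sq)) C"
      unfolding U_def
    proof (rule sset_mapI)
      fix m and w :: "((nat \<times> nat) \<times> nat \<times> nat) list" assume w: "w \<in> simplices (nerve (Sq \<times> Sq)) m"
      note f = map_fst_snd_nerve[OF w]
      have q: "(z0 m, map snd w) \<in> simplices (sset_prod (Delta 0) (nerve Sq)) m" using f z0 by simp
      show "G m (z0 m, map snd w) m (id_op m, map fst w) \<in> simplices C m" by (rule eval_functor(1)[OF G q f(1)])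
      fix k \<gamma> assume ga: "\<gamma> \<in> simplices (Delta m) k"
      have s: "set \<gamma> \<subseteq> {..<length w}" using ga w by (auto simp: in_Delta in_nerve)
      show "act (nerve (Sq \<times> Sq)) m \<gamma> w \<in> simplices (nerve (Sq \<times> Sq)) k \<and>
        G k (z0 k, map snd (act (nerve (Sq \<times> Sq)) m \<gamma> w)) k (id_op k, map fst (act (nerve (Sq \<times> Sq)) m \<gamma> w)) =
        act C m \<gamma> (G m (z0 m, map snd w) m (id_op m, map fst w))"
        using eval_functor(2)[OF G q f(1) ga] nerve_comp_op[OF ga w] z0c[OF ga] map_comp_op[OF s, of fst] map_comp_op[OF s, of snd]
        by (simp del: map_map)
    qed
    have Ueval: "U m w = \<Phi> m (?cu m (z0 m, map snd w)) m (id_op m, map fst w)" if "w \<in> simplices (nerve (Sq \<times> Sq)) m" for m w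
      using that map_fst_snd_nerve[OF that] z0 unfolding U_def G_def by simp
    have cuin: "?cu m (z0 m, y) \<in> simplices (Diag {..1} C) m" if "y \<in> simplices (nerve Sq) m" for m y
      by (rule sset_homD(1)[OF curry_diag_in[OF c]]) (use that z0 in simp)
    have XU: "underlying (nerve Cube) (\<Xi> 0 p) = reindex Cube edge_vertex U"
      unfolding underlying_def reindex_def
    proof (rule sset_map_eqI)
      fix m and w :: "(nat \<times> nat \<times> nat) list" assume w: "w \<in> simplices (nerve Cube) m"
      have ew: "map edge_vertex w \<in> simplices (nerve (Sq \<times> Sq)) m"
        by (rule nerve_map[OF w _ edge_vertex_mono]) auto
      have "\<Xi> 0 p = replace_by_fiber_inclusion \<Phi> 0 c" using p unfolding Xi_eq c_def by simp
      then have "\<Xi> 0 p m (z0 m, w) = \<Phi> m (?cu m (z0 m, map snd w)) m (id_op m, map (\<lambda>(a, v). (0, a)) w)"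
        using replace_eval[OF z0(1) w] by simp
      also have "map (\<lambda>(a, v). (0, a)) w = map fst (map edge_vertex w)" by auto
      also have "map snd w = map snd (map edge_vertex w)" by auto
      finally show "\<Xi> 0 p m (replicate (Suc m) 0, w) = U m (map edge_vertex w)"
        unfolding Ueval[OF ew] z0_def .
    qed
    have Uv: "reindex Sq (\<lambda>s. (s, v)) U = underlying (nerve Sq) (\<Phi> 0 (?cu 0 ([0], [v])))" "?cu 0 ([0], [v]) \<in> simplices (Diag {..1} C) 0"
      if v: "v \<in> Sq" for v
    proof -
      have v0: "[v] \<in> simplices (nerve Sq) 0" using v by (auto simp: in_nerve)
      show f: "?cu 0 ([0], [v]) \<in> simplices (Diag {..1} C) 0" using cuin[OF v0] by (simp add: z0_def)
      show "reindex Sq (\<lambda>s. (s, v)) U = underlying (nerve Sq) (\<Phi> 0 (?cu 0 ([0], [v])))"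
        unfolding reindex_def underlying_def
      proof (rule sset_map_eqI)
        fix m and x :: "(nat \<times> nat) list" assume x: "x \<in> simplices (nerve Sq) m"
        have w: "map (\<lambda>s. (s, v)) x \<in> simplices (nerve (Sq \<times> Sq)) m"
          by (rule nerve_map[OF x]) (use v in \<open>auto simp: mono_on_def less_eq_prod_def\<close>)
        have sx: "map snd (map (\<lambda>s. (s, v)) x) = replicate (Suc m) v" using x by (simp add: in_nerve map_replicate_const comp_def)
        have fx: "map fst (map (\<lambda>s. (s, v)) x) = x" by (simp add: comp_def)
        have q: "([0], [v]) \<in> simplices (sset_prod (Delta 0) (nerve Sq)) 0" using v0 by (simp add: in_nerve)
        have "comp_op [0] (z0 m) = z0 m" "comp_op [v] (z0 m) = replicate (Suc m) v"
          unfolding z0_def by (simp_all add: map_replicate_const del: replicate_Suc)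
        then have "?cu m (z0 m, replicate (Suc m) v) = act (Diag {..1} C) 0 (z0 m) (?cu 0 ([0], [v]))"
          using sset_homD(3)[OF curry_diag_in[OF c] z0(1)[of m] q] by (simp only: prod_act act_nerve)
        then have "U m (map (\<lambda>s. (s, v)) x) = act (Diag Sq C) 0 (z0 m) (\<Phi> 0 (?cu 0 ([0], [v]))) m (id_op m, x)"
          unfolding Ueval[OF w] sx fx using sset_homD(3)[OF Phi z0(1) f] by simp
        also have "\<dots> = underlying (nerve Sq) (\<Phi> 0 (?cu 0 ([0], [v]))) m x"
          unfolding z0_def by (rule underlying_act[OF sset_homD(1)[OF Phi f] x])
        finally show "U m (map (\<lambda>s. (s, v)) x) = \<Phi> 0 (?cu 0 ([0], [v])) m (replicate (Suc m) 0, x)"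
          using x by (simp add: underlying_def)
      qed
    qed
    have fibU: "fiber_square C (reindex Sq (\<lambda>s. (s, v)) U)" if "v \<in> Sq" for v
      unfolding Uv(1)[OF that] by (rule Phi_fib[OF Uv(2)[OF that]])
    \<comment> \<open>Fiber squares extend the edges from which they are built, so \<open>U\<close>
      over the edge from \<open>(0,1)\<close> to \<open>(1,1)\<close> is the transformation
      \<open>g\<close>.\<close>
    have U1: "U m (zip (map (\<lambda>i. (i, 1)) is) vs) = g m (is, act ?S 0 (z0 m) p) m (id_op m, vs)"
      if i: "is \<in> simplices (Delta 1) m" and vs: "vs \<in> simplices (nerve Sq) m" for m "is" vs
    proof -
      have i1: "is \<in> simplices (nerve {..1}) m" using i .
      have li: "length (map (\<lambda>i. (i, 1::nat)) is) = length vs" using i vs by (simp add: in_nerve)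
      have i1: "map (\<lambda>i. (i, 1)) is \<in> simplices (nerve Sq) m"
        by (rule nerve_map[OF i]) (auto simp: mono_on_def)
      have w: "zip (map (\<lambda>i. (i, 1)) is) vs \<in> simplices (nerve (Sq \<times> Sq)) m" by (rule zip_nerve[OF i1 vs])
      let ?f = "?cu m (z0 m, vs)"
      note f = cuin[OF vs]
      have "U m (zip (map (\<lambda>i. (i, 1)) is) vs) = \<Phi> m ?f m (id_op m, map (\<lambda>i. (i, 1)) is)"
        unfolding Ueval[OF w] map_snd_zip[OF li] map_fst_zip[OF li] ..
      also have "\<dots> = pull {..1} (\<lambda>i. (i, 1)) m (\<Phi> m ?f) m (id_op m, is)"
        unfolding pull_def using i id_Delta[of m] by (simp del: upt_Suc)
      also have "\<dots> = ?f m (id_op m, is)" unfolding Phi_pull[OF f] ..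
      also have "\<dots> = c m (comp_op (z0 m) (id_op m), zip is (comp_op vs (id_op m)))"
        by (rule curry_diag_eval[OF z0(1) vs id_Delta i])
      also have "\<dots> = c m (z0 m, zip is vs)"
        using comp_op_id[OF z0(2)] comp_op_id[of vs m] vs by (simp add: in_nerve del: upt_Suc)
      also have "\<dots> = g m (is, act ?S 0 (z0 m) p) m (id_op m, vs)"
        using zip_nerve[OF i vs] z0 li by (simp add: c_def trans_to_functor_def del: upt_Suc)
      finally show ?thesis .
    qed
    have "nat_trans_composite ?S (Diag Sq C) (\<lambda>m (\<beta>, p). colim_unit C m (\<beta>, F_rel C P Q m p))
       (\<lambda>m (\<beta>, p). const_diag Sq C m (Gan_rel C \<kappa> m (\<beta>, p))) g"
      using gg unfolding Gan_rel_nat_def by (rule conjunct2)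
    then obtain \<theta> where th0: "\<forall>m. \<forall>\<beta>\<in>simplices (Delta 1) m. \<forall>x\<in>simplices ?S m.
       \<theta> m (\<beta>, x) = colim_unit C m (\<beta>, F_rel C P Q m x) \<and> \<theta> m (map Suc \<beta>, x) = const_diag Sq C m (Gan_rel C \<kappa> m (\<beta>, x)) \<and>
       \<theta> m (map ((*) 2) \<beta>, x) = g m (\<beta>, x)"
      unfolding nat_trans_composite_def prod.case by (rule bexE)
    then have th: "\<theta> m (\<beta>, x) = colim_unit C m (\<beta>, F_rel C P Q m x) \<and> \<theta> m (map Suc \<beta>, x) = const_diag Sq C m (Gan_rel C \<kappa> m (\<beta>, x)) \<and>
       \<theta> m (map ((*) 2) \<beta>, x) = g m (\<beta>, x)"
      if "\<beta> \<in> simplices (Delta 1) m" "x \<in> simplices ?S m" for m \<beta> x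
      using that by blast
    have pS: "act ?S 0 (z0 m) p \<in> simplices ?S m" for m by (rule act_S[OF z0(1) p])
    define w1 where "w1 m = Gan_rel C \<kappa> m (replicate (Suc m) 1, act ?S 0 (z0 m) p)" for m
    have r1: "replicate (Suc m) 1 \<in> simplices (Delta 1) m" "replicate (Suc m) 0 \<in> simplices (Delta 1) m" for m
      using nerve_const[of "1::nat" "{..1}" m] nerve_const[of "0::nat" "{..1}" m] by (simp_all del: replicate_Suc)
    \<comment> \<open>Vertex \<open>1\<close> of \<open>g\<close> is the last vertex of the
      composite \<theta>, where the value is a constant square and hence independent of
      \<open>vs\<close>.\<close>
    have g1: "g m (replicate (Suc m) 1, act ?S 0 (z0 m) p) m (id_op m, vs) = act C m (id_op m) (w1 m)"
      if vs: "vs \<in> simplices (nerve Sq) m" for m vs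
    proof -
      have t: "\<theta> m (map Suc (replicate (Suc m) 1), act ?S 0 (z0 m) p) = const_diag Sq C m (w1 m)"
        "g m (replicate (Suc m) 1, act ?S 0 (z0 m) p) = \<theta> m (map ((*) 2) (replicate (Suc m) 1), act ?S 0 (z0 m) p)"
        using th[OF r1(1) pS, of m] unfolding w1_def by (elim conjE; simp only:)+
      \<comment> \<open>Doubling and successor agree at \<open>1\<close>: the composite edge and the
        second edge of a 2-simplex end in the same vertex.\<close>
      have "map ((*) 2) (replicate (Suc m) (1::nat)) = map Suc (replicate (Suc m) 1)"
        by (simp add: numeral_2_eq_2)
      then have "g m (replicate (Suc m) 1, act ?S 0 (z0 m) p) = const_diag Sq C m (w1 m)"
        using t by (simp only:)
      then show ?thesis using vs id_Delta[of m] by (simp add: const_diag_def del: upt_Suc)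
    qed
    have Be: "U 1 [((1,1),u), ((1,1),v)] = act C 1 (id_op 1) (w1 1)" if "[u,v] \<in> simplices (nerve Sq) 1" for u v
      using U1[OF r1(1) that] g1[OF that] by simp
    \<comment> \<open>The copies of \<open>B\<close> in the different fiber squares are thus
      connected by degenerate edges, which are special.\<close>
    have Bdeg: "rspecial C (U 1 [((1,1),u), ((1,1),v)])" if uv: "[u,v] \<in> simplices (nerve Sq) 1" for u v
    proof -
      have u: "u \<in> Sq" using uv by (auto simp: in_nerve)
      have uu: "[u,u] \<in> simplices (nerve Sq) 1" using u by (auto simp: in_nerve)
      have u0: "[((1,1),u)] \<in> simplices (nerve (Sq \<times> Sq)) 0" using u by (auto simp: in_nerve)
      have z: "[0,0] \<in> simplices (Delta 0) 1" by (simp add: in_nerve)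
      have "U 1 [((1,1),u), ((1,1),v)] = U 1 [((1,1),u), ((1,1),u)]" using Be[OF uv] Be[OF uu] by simp
      also have "\<dots> = act C 0 [0,0] (U 0 [((1,1),u)])" using sset_homD(3)[OF Uh z u0] by simp
      finally show ?thesis using rspecial_degenerate[OF X sset_homD(1)[OF Uh u0]] by simp
    qed
    define D where "D = reindex Cube edge_vertex U"
    have face: "reindex Sq h D = reindex Sq (\<lambda>s. edge_vertex (h s)) U" if h: "\<And>s. s \<in> Sq \<Longrightarrow> h s \<in> Cube" "mono_on Sq h" for h
      unfolding D_def reindex_def
    proof (rule sset_map_eqI)
      fix m and x :: "(nat \<times> nat) list" assume x: "x \<in> simplices (nerve Sq) m"
      show "sset_map (nerve Cube) (\<lambda>m xs. U m (map edge_vertex xs)) m (map h x) = U m (map (\<lambda>s. edge_vertex (h s)) x)"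
        using nerve_map[OF x h] by (simp add: comp_def)
    qed
    have Dh: "D \<in> sset_hom (nerve Cube) C"
      unfolding D_def reindex_def
    proof (rule sset_mapI)
      fix m and w :: "(nat \<times> nat \<times> nat) list" assume w: "w \<in> simplices (nerve Cube) m"
      have ew: "map edge_vertex w \<in> simplices (nerve (Sq \<times> Sq)) m"
        by (rule nerve_map[OF w _ edge_vertex_mono]) auto
      show "U m (map edge_vertex w) \<in> simplices C m" by (rule sset_homD(1)[OF Uh ew])
      fix k \<gamma> assume ga: "\<gamma> \<in> simplices (Delta m) k"
      have s: "set \<gamma> \<subseteq> {..<length w}" using ga w by (auto simp: in_Delta in_nerve)
      show "act (nerve Cube) m \<gamma> w \<in> simplices (nerve Cube) k \<and>
        U k (map edge_vertex (act (nerve Cube) m \<gamma> w)) = act C m \<gamma> (U m (map edge_vertex w))"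
        using sset_homD(3)[OF Uh ga ew] nerve_comp_op[OF ga w] map_comp_op[OF s, of edge_vertex] by (simp del: map_map)
    qed
    \<comment> \<open>The bottom face of the cube is vertex \<open>0\<close> of \<open>g\<close>,
      the source of the unit, and hence the pushout square itself.\<close>
    have bot: "bottom_face D = underlying (nerve Sq) (Q 0 (pullback_span C P 0 p))"
    proof -
      have Pp: "P 0 p \<in> simplices (Diag Sq C) 0" by (rule sset_homD(1)[OF Ph p])
      have span: "pullback_span C P m q = pull Span id m (P m q)" if "q \<in> simplices ?S m" for m q
        using that by (simp add: pullback_span_def)
      have spin: "pullback_span C P m q \<in> simplices (Diag Span C) m" if "q \<in> simplices ?S m" for m q
        unfolding span[OF that] by (rule pull_in[OF sset_homD(1)[OF Ph that]]) (auto simp: mono_on_def)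
      have spact: "pullback_span C P m (act ?S 0 (z0 m) p) = act (Diag Span C) 0 (z0 m) (pullback_span C P 0 p)" for m
      proof -
        have "pull Span id m (act (Diag Sq C) 0 (z0 m) (P 0 p)) = act (Diag Span C) 0 (z0 m) (pull Span id 0 (P 0 p))"
          unfolding fun_act[OF z0(2), of "nerve Span"] unfolding pull_def
        proof (rule sset_map_eqI, clarify)
          fix k \<beta> and x :: "(nat \<times> nat) list" assume "(\<beta>, x) \<in> simplices (sset_prod (Delta m) (nerve Span)) k"
          then have b: "\<beta> \<in> simplices (Delta m) k" "x \<in> simplices (nerve Span) k" by auto
          have x: "x \<in> simplices (nerve Sq) k" using b(2) by (auto simp: in_nerve)
          show "act (Diag Sq C) 0 (z0 m) (P 0 p) k (\<beta>, map id x) =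
            sset_map (sset_prod (Delta 0) (nerve Span)) (\<lambda>m (\<alpha>, x). P 0 p m (\<alpha>, map id x)) k (comp_op (z0 m) \<beta>, x)"
            using fun_act_eval[OF z0(2) b(1) x, of C 0 "P 0 p"] b comp_op_Delta[OF z0(1) b(1)] by simp
        qed
        then show ?thesis unfolding span[OF p] span[OF pS] sset_homD(3)[OF Ph z0(1) p] .
      qed
      let ?s = "pullback_span C P 0 p"
      note s = spin[OF p]
      have Fin: "F_rel C P Q m q \<in> simplices (Diag Sq C) m" if "q \<in> simplices ?S m" for m q
        using sset_homD(1)[OF Qh spin[OF that]] that by (simp add: F_rel_def)
      show ?thesis
        unfolding bottom_face_def
      proof (subst face)
        show "reindex Sq (\<lambda>s. edge_vertex (1, s)) U = underlying (nerve Sq) (Q 0 ?s)"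
          unfolding reindex_def underlying_def
        proof (rule sset_map_eqI)
          fix m and x :: "(nat \<times> nat) list" assume x: "x \<in> simplices (nerve Sq) m"
          have lx: "length x = Suc m" using x by (simp add: in_nerve)
          have "map (\<lambda>s. edge_vertex (1, s)) x = zip (map (\<lambda>i. (i, 1)) (replicate (Suc m) 0)) x"
            using lx by (intro nth_equalityI) (auto simp: nth_Cons' simp del: replicate_Suc)
          then have "U m (map (\<lambda>s. edge_vertex (1, s)) x) = g m (replicate (Suc m) 0, act ?S 0 (z0 m) p) m (id_op m, x)"
            using U1[OF r1(2) x] by simp
          also have "g m (replicate (Suc m) 0, act ?S 0 (z0 m) p) = colim_unit C m (replicate (Suc m) 0, F_rel C P Q m (act ?S 0 (z0 m) p))"
          proof -
            have t: "\<theta> m (replicate (Suc m) 0, act ?S 0 (z0 m) p) = colim_unit C m (replicate (Suc m) 0, F_rel C P Q m (act ?S 0 (z0 m) p))"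
              "g m (replicate (Suc m) 0, act ?S 0 (z0 m) p) = \<theta> m (map ((*) 2) (replicate (Suc m) 0), act ?S 0 (z0 m) p)"
              using th[OF r1(2) pS, of m] by (elim conjE; simp only:)+
            have "map ((*) 2) (replicate (Suc m) (0::nat)) = replicate (Suc m) 0" by simp
            then show ?thesis using t by (simp only:)
          qed
          also have "colim_unit C m (replicate (Suc m) 0, F_rel C P Q m (act ?S 0 (z0 m) p)) m (id_op m, x)
            = F_rel C P Q m (act ?S 0 (z0 m) p) m (id_op m, map2 (\<lambda>i v. if i = 1 then (1,1) else v) (comp_op (replicate (Suc m) (0::nat)) (id_op m)) x)"
            unfolding colim_unit_def using r1(2)[of m] Fin[OF pS] id_Delta[of m] x by (simp del: replicate_Suc upt_Suc One_nat_def)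
          \<comment> \<open>At vertex \<open>0\<close> the unit never takes the branch that moves a
            vertex to \<open>(1,1)\<close>.\<close>
          also have "map2 (\<lambda>i v. if i = 1 then (1,1) else v) (comp_op (replicate (Suc m) (0::nat)) (id_op m)) x = x"
            unfolding comp_op_replicate[OF id_Delta] using lx
            by (intro nth_equalityI) (auto simp: nth_Cons' simp del: replicate_Suc)
          also have "F_rel C P Q m (act ?S 0 (z0 m) p) = act (Diag Sq C) 0 (z0 m) (Q 0 ?s)"
            using pS[of m] spact sset_homD(3)[OF Qh z0(1) s] by (simp add: F_rel_def)
          also have "act (Diag Sq C) 0 (z0 m) (Q 0 ?s) m (id_op m, x) = underlying (nerve Sq) (Q 0 ?s) m x"
            unfolding z0_def by (rule underlying_act[OF sset_homD(1)[OF Qh s] x])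
          finally show "U m (map (\<lambda>s. edge_vertex (1, s)) x) = Q 0 ?s m (replicate (Suc m) 0, x)"
            using x by (simp add: underlying_def)
        qed
      qed (auto simp: mono_on_def)
    qed
    have po: "pushout_square C (bottom_face D)"
    proof -
      have "pull Span id 0 (P 0 p) \<in> simplices (Diag Span C) 0"
        by (rule pull_in[OF sset_homD(1)[OF Ph p]]) (auto simp: mono_on_def)
      moreover have "pullback_span C P 0 p = pull Span id 0 (P 0 p)" using p by (simp add: pullback_span_def)
      ultimately have "pullback_span C P 0 p \<in> simplices (Diag Span C) 0" by (simp only:)
      then show ?thesis
        using rg unfolding bot relative_ganea_def pushout_functor_def by blast
    qed
    \<comment> \<open>A side face compares the fiber inclusions at \<open>u\<close> and
      \<open>v\<close>. The labels put the fiber square at \<open>u\<close> on the even and the one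
      at \<open>v\<close> on the odd vertices of the prism, with the degenerate edge at
      \<open>B\<close> as \<open>6 -> 7\<close>.\<close>
    have side: "pullback_square C (reindex Sq (\<lambda>(a, b). ((0, a), if b = 0 then u else v)) U)"
      if uv: "u \<le> v" "u \<in> Sq" "v \<in> Sq" for u v
    proof -
      define lab :: "int \<Rightarrow> (nat \<times> nat) \<times> nat \<times> nat" where "lab x = (if x = 0 then ((0,0),u) else if x = 1 then ((0,0),v) else if x = 2 then ((0,1),u)
        else if x = 3 then ((0,1),v) else if x = 4 then ((1,0),u) else if x = 5 then ((1,0),v)
        else if x = 6 then ((1,1),u) else ((1,1),v))" for x
      let ?f = "cone_of U lab"
      have d: "dmap C (fam (map ((#) 0) prism)) ?f"
        by (rule dmap_cone_fam[OF Uh]) (use uv in \<open>simp add: lab_def\<close>)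
      have f1: "sq_of ?f 0 2 4 6 = reindex Sq (\<lambda>s. (s, u)) U"
        by (rule sq_of_cone_of) (auto simp: in_Sq sq_label_def lab_def)
      have f2: "sq_of ?f 1 3 5 7 = reindex Sq (\<lambda>s. (s, v)) U"
        by (rule sq_of_cone_of) (auto simp: in_Sq sq_label_def lab_def)
      have f3: "sq_of ?f 0 1 2 3 = reindex Sq (\<lambda>(a, b). ((0, a), if b = 0 then u else v)) U"
        by (rule sq_of_cone_of) (auto simp: in_Sq sq_label_def lab_def)
      have p1: "pullback_square C (sq_of ?f 0 2 4 6)" "zero_object C (?f [4])"
        using fibU[OF uv(2)] unfolding f1 fiber_square_def by (simp_all add: reindex_def in_nerve cone_of_def lab_def)
      have p2: "pullback_square C (sq_of ?f 1 3 5 7)" "zero_object C (?f [5])"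
        using fibU[OF uv(3)] unfolding f2 fiber_square_def by (simp_all add: reindex_def in_nerve cone_of_def lab_def)
      have d1: "dmap C (fam [[0,2,6],[0,4,6]]) ?f" "dmap C (fam [[1,3,7],[1,5,7]]) ?f"
        by (rule dmap_sub[OF d]; code_simp)+
      have l1: "lim_cone C (fam [[2,6],[4,6]]) 0 ?f" using pullback_iff[of 0 2 4 6 C ?f] d1 p1 by simp
      have l2: "lim_cone C (fam [[3,7],[5,7]]) 1 ?f" using pullback_iff[of 1 3 5 7 C ?f] d1 p2 by simp
      have "[u,v] \<in> simplices (nerve Sq) 1" using uv by (auto simp: in_nerve)
      then have sp: "rspecial C (?f [6,7])" using Bdeg by (simp add: cone_of_def lab_def)
      have te: "terminal C (?f [4])" "terminal C (?f [5])" using p1 p2 unfolding zero_object_def by auto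
      have "pullback_square C (sq_of ?f 0 1 2 3)"
        by (rule pullback_of_fibers[OF X d _ _ _ _ _ _ _ _ _ _ _ _ _ _ sp te l1 l2]; code_simp)
      then show ?thesis unfolding f3 .
    qed
    have "upright_mather_cube C D"
      unfolding upright_mather_cube_def
    proof (intro conjI allI impI Dh po)
      fix i :: nat assume i: "i \<le> 1"
      have "reindex Sq (\<lambda>(a, b). (a, i, b)) D = reindex Sq (\<lambda>(a, b). ((0, a), if b = 0 then (i,0) else (i,1))) U"
      proof (subst face)
        show "reindex Sq (\<lambda>s. edge_vertex (case s of (a, b) \<Rightarrow> (a, i, b))) U = reindex Sq (\<lambda>(a, b). ((0, a), if b = 0 then (i,0) else (i,1))) U"
          unfolding reindex_def
        proof (rule sset_map_eqI)
          fix m and x :: "(nat \<times> nat) list" assume "x \<in> simplices (nerve Sq) m"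
          then have "map (\<lambda>s. edge_vertex (case s of (a, b) \<Rightarrow> (a, i, b))) x = map (\<lambda>(a, b). ((0, a), if b = 0 then (i,0) else (i,1))) x"
            by (auto simp: in_nerve)
          then show "U m (map (\<lambda>s. edge_vertex (case s of (a, b) \<Rightarrow> (a, i, b))) x) = U m (map (\<lambda>(a, b). ((0, a), if b = 0 then (i,0) else (i,1))) x)"
            by (rule arg_cong)
        qed
      qed (use i in \<open>auto simp: mono_on_def\<close>)
      then show "pullback_square C (reindex Sq (\<lambda>(a, b). (a, i, b)) D)" using side[of "(i,0)" "(i,1)"] i by simp
      have "reindex Sq (\<lambda>(a, b). (a, b, i)) D = reindex Sq (\<lambda>(a, b). ((0, a), if b = 0 then (0,i) else (1,i))) U"
      proof (subst face)
        show "reindex Sq (\<lambda>s. edge_vertex (case s of (a, b) \<Rightarrow> (a, b, i))) U = reindex Sq (\<lambda>(a, b). ((0, a), if b = 0 then (0,i) else (1,i))) U"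
          unfolding reindex_def
        proof (rule sset_map_eqI)
          fix m and x :: "(nat \<times> nat) list" assume "x \<in> simplices (nerve Sq) m"
          then have "map (\<lambda>s. edge_vertex (case s of (a, b) \<Rightarrow> (a, b, i))) x = map (\<lambda>(a, b). ((0, a), if b = 0 then (0,i) else (1,i))) x"
            by (auto simp: in_nerve)
          then show "U m (map (\<lambda>s. edge_vertex (case s of (a, b) \<Rightarrow> (a, b, i))) x) = U m (map (\<lambda>(a, b). ((0, a), if b = 0 then (0,i) else (1,i))) x)"
            by (rule arg_cong)
        qed
      qed (use i in \<open>auto simp: mono_on_def\<close>)
      then show "pullback_square C (reindex Sq (\<lambda>(a, b). (a, b, i)) D)" using side[of "(0,i)" "(1,i)"] i by simp
    qed
    \<comment> \<open>The fiber inclusions already run in the vertical direction, so the trivial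
      rotation works.\<close>
    moreover have "rotate_cube 0 D = D" unfolding rotate_cube_def using reindex_id[OF Dh] by (simp add: id_def)
    ultimately have "upright_mather_cube C (rotate_cube 0 D)" by simp
    then have "mather_cube C D" unfolding mather_cube_def using Dh by (intro conjI exI[of _ 0]) auto
    then show ?thesis unfolding XU D_def .
  qed
  \<comment> \<open>Membership in the full subcategory is tested on vertices, and \<Xi> commutes
    with taking vertices.\<close>
  have Xfull: "\<Xi> n p \<in> simplices (full_sub (Diag Cube C) {D. mather_cube C (underlying (nerve Cube) D)}) n" if p: "p \<in> simplices ?S n" for n p
  proof -
    have "mather_cube C (underlying (nerve Cube) (act (Diag Cube C) n [i] (\<Xi> n p)))" if i: "i \<le> n" for i
    proof -
      have d: "[i] \<in> simplices (Delta n) 0" using i by (simp add: in_Delta)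
      show ?thesis using Xm[OF act_S[OF d p]] Xact[OF d p] by simp
    qed
    then show ?thesis using Xin[OF p] unfolding full_sub_def by simp
  qed
  show ?thesis
  proof (rule sset_homI[OF Xfull])
    show "x \<notin> simplices ?S n \<Longrightarrow> \<Xi> n x = undefined" for n x unfolding Xi_eq by (simp add: sset_map_out)
    show "\<alpha> \<in> simplices (Delta n) m \<Longrightarrow> x \<in> simplices ?S n \<Longrightarrow> \<Xi> m (act ?S n \<alpha> x) =
      act (full_sub (Diag Cube C) {D. mather_cube C (underlying (nerve Cube) D)}) n \<alpha> (\<Xi> n x)" for n m \<alpha> x
      using Xact unfolding full_sub_def by simp
  qed
qed

text \<open>The functor, the fibers, the canonical morphism and the join are determined only up to
  choices, so both claims are asserted for every choice.\<close>

theorem theoremA17: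
  fixes C :: "'a sset"
  assumes "quasicategory C" and "pointed C"
    and "has_finite_limits C" and "has_finite_colimits C"
  shows "(\<forall>\<Xi>. is_Xi_rel C \<Xi> \<longrightarrow>
            \<Xi> \<in> sset_hom (Diag Cosp C)
                   (full_sub (Diag Cube C) {D. mather_cube C (underlying (nerve Cube) D)}))
       \<and> (mather_cube_axiom C \<longrightarrow>
            (\<forall>p\<in>sset_hom (nerve Cosp) C. \<forall>h F_X F_Y F_XY J.
               is_fiber C (p 1 [(0,1), (1,1)]) F_X \<and>
               is_fiber C (p 1 [(1,0), (1,1)]) F_Y \<and>
               is_canonical_morphism C p h \<and> is_fiber C h F_XY \<and>
               is_join_object C F_X F_Y J \<longrightarrow>
               equivalent_objects C F_XY J))"
  using Xi_rel_mather[OF assms(1)] join_of_fibers[OF assms(1)] by blast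

end
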